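(* Let $b$ be a prime, let $s,d,\alpha,m\in\mathbb N$ (positive integers), let $0\le t\le m$ be an integer, and put $N=b^m$, $\rho=\min(\alpha,d)$. There is a constant $C_{b,s,\alpha,d}>0$, depending only on $b,s,\alpha,d$, such that the following holds. Let $P=\{z_0,\ldots,z_{N-1}\}\subset[0,1)^{ds}$ be a digital $(t,m,ds)$-net in base $b$, and let $$\widehat I_N(f)=\frac1N\sum_{n=0}^{N-1}f\bigl(\mathcal D_d(\Pi(z_n))\bigr)$$ be its order-$d$ nested-uniformly scrambled and interlaced estimator. Then, for every $f\in\mathcal H_{s,\alpha}$, $$\left(\mathbb E|\widehat I_N(f)-I(f)|^2\right)^{1/2}\le C_{b,s,\alpha,d}^{1/2}\,\|f\|_{\mathcal H_{s,\alpha}}\,b^{-(\rho+1/2)(m-t)}(m-t+2)^{(ds-1)/2}.$$ Moreover, for a family of such nets with fixed $b,s,d,\alpha,t$ (and $m\to\infty$), the root mean square error $\operatorname{RMSE}=\left(\mathbb E|\widehat I_N(f)-I(f)|^2\right)^{1/2}$ satisfies $$\operatorname{RMSE}=O\!\left(N^{-\rho-1/2}(\log N)^{(ds-1)/2}\right)=O\!\left(N^{-\rho-1/2+\varepsilon}\right)$$ for every $\varepsilon>0$. In particular, if $d\ge\alpha$, then $\operatorname{RMSE}=O(N^{-\alpha-1/2+\varepsilon})$ for every $\varepsilon>0$.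
   Context: Base-$b$ expansions of points in $[0,1)$ are chosen to be the ones not eventually equal to $b-1$. Digital net: let $\mathbb F_b$ be the field with $b$ elements, identified with $\{0,\ldots,b-1\}$, and let $C_1,\ldots,C_{ds}\in\mathbb F_b^{m\times m}$. For $0\le n<b^m$ with base-$b$ digit vector $\vec n=(n_0,\ldots,n_{m-1})^\top$, let $(z_{n,j,1},\ldots,z_{n,j,m})^\top=C_j\vec n$, $z_{n,j}=\sum_{a=1}^m z_{n,j,a}b^{-a}$, and $z_n=(z_{n,1},\ldots,z_{n,ds})$. The point set $\{z_0,\ldots,z_{b^m-1}\}$ is a digital $(t,m,ds)$-net in base $b$ if for all integers $c_1,\ldots,c_{ds}\ge0$ with $c_1+\cdots+c_{ds}=m-t$, the system consisting of the first $c_j$ rows of $C_j$, $j=1,\ldots,ds$, is linearly independent over $\mathbb F_b$. Nested uniform (Owen) scrambling $\Pi$: for each coordinate $j\in\{1,\ldots,ds\}$ and each finite digit string $(a_1,\ldots,a_r)$, $r\ge0$, there is a uniformly distributed random permutation $\pi_{j;a_1,\ldots,a_r}$ of $\{0,\ldots,b-1\}$; all of these permutations are mutually independent. If $z_j=\sum_{a\ge1}z_{j,a}b^{-a}$, the $j$-th coordinate of $\Pi(z)$ has digits $\pi_{j;z_{j,1},\ldots,z_{j,r-1}}(z_{j,r})$, $r\ge1$. The same random permutations are applied to all points of $P$. Digit interlacing $\mathcal D_d:[0,1)^{ds}\to[0,1)^s$: with $z_j=\sum_{a\ge1}z_{j,a}b^{-a}$, $$\mathcal D_d(z)_i=\sum_{a=1}^\infty\sum_{r=1}^d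 z_{(i-1)d+r,a}\,b^{-r-(a-1)d},\qquad 1\le i\le s.$$ Sobolev space: for $u\subseteq\{1,\ldots,s\}$ let $f_u(x_u)=\int_{[0,1]^{s-|u|}}f(x)\,\mathrm dx_{-u}$ (integrating out the variables not in $u$), and $I(f)=\int_{[0,1]^s}f(x)\,\mathrm dx$. For smooth $f$ on $[0,1]^s$, $$\|f\|_{\mathcal H_{s,\alpha}}^2=|I(f)|^2+\sum_{\emptyset\ne u\subseteq\{1,\ldots,s\}}\ \sum_{\boldsymbol\nu_u\in\{1,\ldots,\alpha\}^u}\int_{[0,1]^{|u|}}|\partial^{\boldsymbol\nu_u}f_u(x_u)|^2\,\mathrm dx_u.$$ $\mathcal H_{s,\alpha}$ is the completion of the smooth functions in this norm; since $\|f\|_{L_2}\le\|f\|_{\mathcal H_{s,\alpha}}$, it is embedded in $L_2([0,1]^s)$. Expectations are over the randomness of $\Pi$. In the $O$-statements $f\in\mathcal H_{s,\alpha}$ is fixed. *)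

theory Defs
  imports
    "HOL-Probability.Probability"
    "HOL-Combinatorics.Permutations"
    "HOL-Computational_Algebra.Primes"
    "HOL-Library.Landau_Symbols"
begin

text \<open>
  Points of $[0,1]^I$, for a finite set $I$ of coordinates, are extensional functions
  \<^typ>\<open>nat \<Rightarrow> real\<close>; the coordinates of $[0,1]^s$ are numbered from 1 to $s$.
\<close>

definition cube :: "nat set \<Rightarrow> (nat \<Rightarrow> real) set" where
  "cube I = (\<Pi>\<^sub>E i\<in>I. {0..1})"

definition cube_measure :: "nat set \<Rightarrow> (nat \<Rightarrow> real) measure" where
  "cube_measure I = (\<Pi>\<^sub>M i\<in>I. restrict_space lborel {0..1})"


section \<open>Digital nets\<close>

text \<open>
  \<^term>\<open>A j a k\<close> is the entry in row $a \in \{1,\ldots,m\}$ and column $k \in \{0,\ldots,m-1\}$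
  of the $j$-th generating matrix. The field with $b$ elements is $\{0,\ldots,b-1\}$ with
  arithmetic modulo the prime $b$.
\<close>

definition generating_matrices ::
    "nat \<Rightarrow> nat \<Rightarrow> nat \<Rightarrow> (nat \<Rightarrow> nat \<Rightarrow> nat \<Rightarrow> nat) \<Rightarrow> bool" where
  "generating_matrices b m n A \<longleftrightarrow> (\<forall>j\<in>{1..n}. \<forall>a\<in>{1..m}. \<forall>k<m. A j a k < b)"

definition net_digit ::
    "nat \<Rightarrow> nat \<Rightarrow> (nat \<Rightarrow> nat \<Rightarrow> nat \<Rightarrow> nat) \<Rightarrow> nat \<Rightarrow> nat \<Rightarrow> nat \<Rightarrow> nat" where
  "net_digit b m A n j a = (\<Sum>k<m. A j a k * (n div b ^ k mod b)) mod b"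

definition net_point ::
    "nat \<Rightarrow> nat \<Rightarrow> (nat \<Rightarrow> nat \<Rightarrow> nat \<Rightarrow> nat) \<Rightarrow> nat \<Rightarrow> (nat \<Rightarrow> real)" where
  "net_point b m A n = (\<lambda>j. \<Sum>a=1..m. real (net_digit b m A n j a) / real b ^ a)"

text \<open>
  Linear independence over the field with $b$ elements of the family consisting of the first
  \<^term>\<open>c j\<close> rows of the $j$-th matrix, for $j = 1,\ldots,n$.
\<close>

definition rows_independent ::
    "nat \<Rightarrow> nat \<Rightarrow> nat \<Rightarrow> (nat \<Rightarrow> nat \<Rightarrow> nat \<Rightarrow> nat) \<Rightarrow> (nat \<Rightarrow> nat) \<Rightarrow> bool" where
  "rows_independent b m n A c \<longleftrightarrow>
     (\<forall>l :: nat \<Rightarrow> nat \<Rightarrow> nat.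
        (\<forall>k<m. (\<Sum>j=1..n. \<Sum>a=1..c j. l j a * A j a k) mod b = 0) \<longrightarrow>
        (\<forall>j\<in>{1..n}. \<forall>a\<in>{1..c j}. l j a mod b = 0))"

definition digital_net ::
    "nat \<Rightarrow> nat \<Rightarrow> nat \<Rightarrow> nat \<Rightarrow> (nat \<Rightarrow> nat \<Rightarrow> nat \<Rightarrow> nat) \<Rightarrow> bool" where
  "digital_net b t m n A \<longleftrightarrow>
     generating_matrices b m n A \<and>
     (\<forall>c :: nat \<Rightarrow> nat. (\<Sum>j=1..n. c j) = m - t \<longrightarrow> rows_independent b m n A c)"


section \<open>Scrambling and interlacing\<close>

text \<open>
  The $a$-th digit ($a \ge 1$) of $x \in [0,1)$ in the base-$b$ expansion that is not eventually
  equal to $b-1$.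
\<close>

definition base_digit :: "nat \<Rightarrow> real \<Rightarrow> nat \<Rightarrow> nat" where
  "base_digit b x a = nat (\<lfloor>x * real b ^ a\<rfloor> mod int b)"

text \<open>
  Independent uniformly distributed permutations of $\{0,\ldots,b-1\}$, one for each coordinate
  $j \in \{1,\ldots,n\}$ and each finite digit string.
\<close>

definition scrambling_measure ::
    "nat \<Rightarrow> nat \<Rightarrow> (nat \<times> nat list \<Rightarrow> nat \<Rightarrow> nat) measure" where
  "scrambling_measure b n =
     (\<Pi>\<^sub>M (j, as) \<in> {1..n} \<times> lists {..<b}. uniform_count_measure {p. p permutes {..<b}})"

text \<open>
  The scrambled digits may be eventually equal to $b-1$, but for a given point this happens
  with probability 0.
\<close>

definition scramble ::
    "nat \<Rightarrow> (nat \<times> nat list \<Rightarrow> nat \<Rightarrow> nat) \<Rightarrow> (nat \<Rightarrow> real) \<Rightarrow> (nat \<Rightarrow> real)" where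
  "scramble b \<pi> z = (\<lambda>j. \<Sum>r.
     real (\<pi> (j, map (base_digit b (z j)) [1..<Suc r]) (base_digit b (z j) (Suc r)))
       / real b ^ Suc r)"

text \<open>The outer summation index is shifted so that it starts at 0.\<close>

definition interlace :: "nat \<Rightarrow> nat \<Rightarrow> nat \<Rightarrow> (nat \<Rightarrow> real) \<Rightarrow> (nat \<Rightarrow> real)" where
  "interlace b d s z = (\<lambda>i\<in>{1..s}. \<Sum>a. \<Sum>r=1..d.
     real (base_digit b (z ((i - 1) * d + r)) (Suc a)) / real b ^ (r + a * d))"


section \<open>The estimator and its error\<close>

text \<open>
  The scalar type ranges over the classes \<^class>\<open>real_normed_field\<close> and
  \<^class>\<open>euclidean_space\<close>, so that integrands may be real- or complex-valued.
\<close>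

definition cube_integral ::
    "nat \<Rightarrow> ((nat \<Rightarrow> real) \<Rightarrow> 'k::{real_normed_field,euclidean_space}) \<Rightarrow> 'k" where
  "cube_integral s f = (\<integral>x. f x \<partial>cube_measure {1..s})"

definition estimator ::
    "nat \<Rightarrow> nat \<Rightarrow> nat \<Rightarrow> nat \<Rightarrow> (nat \<Rightarrow> nat \<Rightarrow> nat \<Rightarrow> nat) \<Rightarrow>
     ((nat \<Rightarrow> real) \<Rightarrow> 'k::{real_normed_field,euclidean_space}) \<Rightarrow>
     (nat \<times> nat list \<Rightarrow> nat \<Rightarrow> nat) \<Rightarrow> 'k" where
  "estimator b s d m A f \<pi> =
     (\<Sum>n<b ^ m. f (interlace b d s (scramble b \<pi> (net_point b m A n)))) /\<^sub>R real (b ^ m)"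

definition squared_error ::
    "nat \<Rightarrow> nat \<Rightarrow> nat \<Rightarrow> nat \<Rightarrow> (nat \<Rightarrow> nat \<Rightarrow> nat \<Rightarrow> nat) \<Rightarrow>
     ((nat \<Rightarrow> real) \<Rightarrow> 'k::{real_normed_field,euclidean_space}) \<Rightarrow>
     (nat \<times> nat list \<Rightarrow> nat \<Rightarrow> nat) \<Rightarrow> real" where
  "squared_error b s d m A f \<pi> = (norm (estimator b s d m A f \<pi> - cube_integral s f))\<^sup>2"

definition rmse ::
    "nat \<Rightarrow> nat \<Rightarrow> nat \<Rightarrow> nat \<Rightarrow> (nat \<Rightarrow> nat \<Rightarrow> nat \<Rightarrow> nat) \<Rightarrow>
     ((nat \<Rightarrow> real) \<Rightarrow> 'k::{real_normed_field,euclidean_space}) \<Rightarrow> real" where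
  "rmse b s d m A f =
     sqrt (\<integral>\<pi>. squared_error b s d m A f \<pi> \<partial>scrambling_measure b (d * s))"


section \<open>The Sobolev space\<close>

text \<open>Derivatives are one-sided at the boundary of the cube.\<close>

definition partial_deriv ::
    "nat \<Rightarrow> ((nat \<Rightarrow> real) \<Rightarrow> 'k::{real_normed_field,euclidean_space}) \<Rightarrow>
     ((nat \<Rightarrow> real) \<Rightarrow> 'k)" where
  "partial_deriv i f = (\<lambda>x. vector_derivative (\<lambda>t. f (x(i := t))) (at (x i) within {0..1}))"

definition smooth_on_cube ::
    "nat \<Rightarrow> ((nat \<Rightarrow> real) \<Rightarrow> 'k::{real_normed_field,euclidean_space}) \<Rightarrow> bool" where
  "smooth_on_cube s f \<longleftrightarrow>
     (\<forall>is \<in> lists {1..s}. let g = foldr partial_deriv is f in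
        continuous_on (cube {1..s}) g \<and>
        (\<forall>i\<in>{1..s}. \<forall>x\<in>cube {1..s}.
           (\<lambda>t. g (x(i := t))) differentiable (at (x i) within {0..1})))"

definition mixed_deriv ::
    "nat set \<Rightarrow> (nat \<Rightarrow> nat) \<Rightarrow> ((nat \<Rightarrow> real) \<Rightarrow> 'k::{real_normed_field,euclidean_space}) \<Rightarrow>
     ((nat \<Rightarrow> real) \<Rightarrow> 'k)" where
  "mixed_deriv u \<nu> f = foldr (\<lambda>i. partial_deriv i ^^ \<nu> i) (sorted_list_of_set u) f"

text \<open>The function $f_u$ of $x_u \in [0,1]^u$.\<close>

definition marginal ::
    "nat \<Rightarrow> nat set \<Rightarrow> ((nat \<Rightarrow> real) \<Rightarrow> 'k::{real_normed_field,euclidean_space}) \<Rightarrow>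
     ((nat \<Rightarrow> real) \<Rightarrow> 'k)" where
  "marginal s u f =
     (\<lambda>x. \<integral>y. f (merge u ({1..s} - u) (x, y)) \<partial>cube_measure ({1..s} - u))"

definition smooth_sobolev_norm ::
    "nat \<Rightarrow> nat \<Rightarrow> ((nat \<Rightarrow> real) \<Rightarrow> 'k::{real_normed_field,euclidean_space}) \<Rightarrow> real" where
  "smooth_sobolev_norm s \<alpha> f = sqrt (
     (norm (cube_integral s f))\<^sup>2 +
     (\<Sum>u \<in> Pow {1..s} - {{}}. \<Sum>\<nu> \<in> (\<Pi>\<^sub>E i\<in>u. {1..\<alpha>}).
        \<integral>x. (norm (mixed_deriv u \<nu> (marginal s u f) x))\<^sup>2 \<partial>cube_measure u))"

definition square_integrable ::
    "nat \<Rightarrow> ((nat \<Rightarrow> real) \<Rightarrow> 'k::{real_normed_field,euclidean_space}) \<Rightarrow> bool" where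
  "square_integrable s f \<longleftrightarrow>
     f \<in> borel_measurable (cube_measure {1..s}) \<and>
     integrable (cube_measure {1..s}) (\<lambda>x. (norm (f x))\<^sup>2)"

text \<open>
  An element of the completion is represented by a sequence \<^term>\<open>F\<close> of smooth functions that is
  Cauchy in the Sobolev norm. Since that norm dominates the $L_2$ norm, the sequence converges in
  $L_2$, and the element is identified with the limit \<^term>\<open>f\<close>, an $L_2$ function determined up
  to a null set.
\<close>

definition represents ::
    "nat \<Rightarrow> nat \<Rightarrow> (nat \<Rightarrow> (nat \<Rightarrow> real) \<Rightarrow> 'k::{real_normed_field,euclidean_space}) \<Rightarrow>
     ((nat \<Rightarrow> real) \<Rightarrow> 'k) \<Rightarrow> bool" where
  "represents s \<alpha> F f \<longleftrightarrow>
     (\<forall>k. smooth_on_cube s (F k)) \<and>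
     (\<forall>e>0. \<exists>K. \<forall>k\<ge>K. \<forall>l\<ge>K. smooth_sobolev_norm s \<alpha> (\<lambda>x. F k x - F l x) < e) \<and>
     square_integrable s f \<and>
     (\<lambda>k. \<integral>x. (norm (F k x - f x))\<^sup>2 \<partial>cube_measure {1..s}) \<longlonglongrightarrow> 0"

definition sobolev_space ::
    "nat \<Rightarrow> nat \<Rightarrow> ((nat \<Rightarrow> real) \<Rightarrow> 'k::{real_normed_field,euclidean_space}) set" where
  "sobolev_space s \<alpha> = {f. \<exists>F. represents s \<alpha> F f}"

text \<open>
  The norm of the completion. The choice of \<^term>\<open>F\<close> does not matter: the completion embeds
  injectively into $L_2$ (weak derivatives are unique), so all sequences representing \<^term>\<open>f\<close>
  are equivalent and their norms have the same limit.
\<close>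

definition sobolev_norm ::
    "nat \<Rightarrow> nat \<Rightarrow> ((nat \<Rightarrow> real) \<Rightarrow> 'k::{real_normed_field,euclidean_space}) \<Rightarrow> real" where
  "sobolev_norm s \<alpha> f =
     lim (\<lambda>k. smooth_sobolev_norm s \<alpha> ((SOME F. represents s \<alpha> F f) k))"

end

theory Submission
  imports Defs "HOL-Number_Theory.Cong"
begin

text \<open>
  For a smooth integrand $f$, replace the scrambled and interlaced points by the grid points
  determined by their first $L$ digits per coordinate, so that $f$ becomes a function of finitely
  many digits. Its ANOVA decomposition over sets $v$ of digits is orthogonal under scrambling. Let
  $l_j$ be the largest position of a digit of coordinate $j$ in $v$, and $M=m-t$. The net property
  makes the contribution of $v$ to the error vanish if $\sum_j l_j\le M$, and bounds its variance by
  a multiple of $b^{-M}$ times the mean square of the component otherwise.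

  The components with given levels $l$ are estimated together: their sum of mean squares is at most
  the mean square of $f$ with some digits averaged out and others replaced by their deviations from
  the average. A change of the digit at position $l_j$ of coordinate $j$ moves one variable by about
  $b^{-d l_j}$, so the $\alpha$ largest levels of each block of $d$ coordinates yield mixed
  derivatives of a marginal of $f$ and a factor of order $b^{-2\rho\sum_j l_j}$. Summing over $l$
  with $\sum_j l_j>M$ gives the bound, first as $L\to\infty$ for smooth $f$, and then by density,
  since the points are uniformly distributed and the error is thus continuous in the $L_2$ norm.
\<close>

section \<open>ANOVA decomposition over finitely many digits\<close>

text \<open>Components are indexed by sets of digits, not by Walsh functions: nested scrambling acts
  on a digit through the digits preceding it, which is why the levels of v decide, and a deviation
  in a digit is directly a difference of the integrand. Exponentially many v share the same levels,
  so components are not bounded one by one; Parseval is applied once to a function that contains all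
  of them. The differences have steps of very different sizes, but all are multiples of the finest
  mesh. Splitting them into differences with the mesh as step gives expressions uniformly close to
  derivatives at translates of grid points, and avoids kernels for divided differences. The number
  of admissible levels grows with L, so the estimate for large L must be uniform in the levels; it
  is, because the threshold depends only on the set of variables and the orders of differentiation,
  of which there are finitely many. Selecting min(\<alpha>, d) of at most d levels in a block keeps
  the fraction \<rho>/d of their sum, and each level counts d digits of the interlaced variable;
  this is where the exponent \<rho> comes from.\<close>

definition avg :: "nat \<Rightarrow> 'q \<Rightarrow> (('q \<Rightarrow> nat) \<Rightarrow> 'v::real_vector) \<Rightarrow> ('q \<Rightarrow> nat) \<Rightarrow> 'v" where
  "avg b q h \<xi> = (\<Sum>c<b. h (\<xi>(q := c))) /\<^sub>R real b"

definition dev :: "nat \<Rightarrow> 'q \<Rightarrow> (('q \<Rightarrow> nat) \<Rightarrow> 'v::real_vector) \<Rightarrow> ('q \<Rightarrow> nat) \<Rightarrow> 'v" where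
  "dev b q h \<xi> = h \<xi> - avg b q h \<xi>"

text \<open>A product of commuting projections, I - A_q for q in v and A_q for the other listed q,
  where A_q averages over digit q. The list only fixes an order of composition.\<close>

definition anova :: "nat \<Rightarrow> 'q set \<Rightarrow> 'q list \<Rightarrow> (('q \<Rightarrow> nat) \<Rightarrow> 'v::real_vector) \<Rightarrow> ('q \<Rightarrow> nat) \<Rightarrow> 'v" where
  "anova b v qs = foldr (\<lambda>q. if q \<in> v then dev b q else avg b q) qs"

text \<open>Functions take total assignments as arguments, so that the infinite array of scrambled
  digits can be inserted without restricting it; dependence on finitely many digits is kept as a
  separate property.\<close>

definition depends_on :: "'q set \<Rightarrow> (('q \<Rightarrow> nat) \<Rightarrow> 'v) \<Rightarrow> bool" where
  "depends_on Q h \<longleftrightarrow> (\<forall>\<xi> \<xi>'. (\<forall>q\<in>Q. \<xi> q = \<xi>' q) \<longrightarrow> h \<xi> = h \<xi>')"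

abbreviation arrays :: "nat \<Rightarrow> 'q set \<Rightarrow> ('q \<Rightarrow> nat) set" where
  "arrays b Q \<equiv> PiE Q (\<lambda>_. {..<b})"

definition array_mean :: "nat \<Rightarrow> 'q set \<Rightarrow> (('q \<Rightarrow> nat) \<Rightarrow> 'v::real_vector) \<Rightarrow> 'v" where
  "array_mean b Q h = (\<Sum>\<xi>\<in>arrays b Q. h \<xi>) /\<^sub>R real (b ^ card Q)"

lemma dev_eq: "dev b q h = (\<lambda>\<xi>. h \<xi> - avg b q h \<xi>)"
  by (simp add: dev_def fun_eq_iff)

lemma avg_commute: "avg b p (avg b q h) = avg b q (avg b p h)"
proof (cases "p = q")
  case False
  then show ?thesis
    by (auto simp: avg_def fun_eq_iff scaleR_sum_right fun_upd_twist[of p q] intro: sum.swap)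
qed auto

lemma avg_update [simp]: "avg b q h (\<xi>(q := c)) = avg b q h \<xi>"
  by (simp add: avg_def)

lemma avg_const: "0 < b \<Longrightarrow> (\<And>c. h (\<xi>(q := c)) = h \<xi>) \<Longrightarrow> avg b q h \<xi> = h \<xi>"
  by (simp add: avg_def sum_constant_scaleR)

lemma avg_idem: "0 < b \<Longrightarrow> avg b q (avg b q h) = avg b q h"
  by (auto simp: fun_eq_iff intro!: avg_const)

lemma avg_diff: "avg b q (\<lambda>\<xi>. g \<xi> - h \<xi>) = (\<lambda>\<xi>. avg b q g \<xi> - avg b q h \<xi>)"
  by (simp add: avg_def fun_eq_iff sum_subtractf scaleR_diff_right)

lemma avg_dev: "0 < b \<Longrightarrow> avg b q (dev b q h) = (\<lambda>_. 0)"
  by (simp add: dev_eq avg_diff avg_idem)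

lemma dev_idem: "0 < b \<Longrightarrow> dev b q (dev b q h) = dev b q h"
  by (simp add: dev_def[of b q "dev b q h"] avg_dev fun_eq_iff)

lemma avg_dev_commute: "avg b p (dev b q h) = dev b q (avg b p h)"
  by (simp add: dev_eq avg_diff avg_commute[of b p q])

lemma dev_commute: "dev b p (dev b q h) = dev b q (dev b p h)"
  by (simp add: dev_eq avg_diff avg_commute[of b p q] algebra_simps)

lemma anova_Nil [simp]: "anova b v [] h = h"
  by (simp add: anova_def)

lemma anova_Cons: "anova b v (q # qs) h = (if q \<in> v then dev b q else avg b q) (anova b v qs h)"
  by (simp add: anova_def)

lemma anova_avg: "anova b v qs (avg b q h) = avg b q (anova b v qs h)"
  by (induction qs) (auto simp: anova_Cons avg_dev_commute avg_commute[of b q])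

lemma anova_dev: "anova b v qs (dev b q h) = dev b q (anova b v qs h)"
  by (induction qs) (auto simp: anova_Cons avg_dev_commute dev_commute[of b q])

text \<open>The projection \<open>dev b q\<close> is already a factor when q is in v; all factors
  commute and it is idempotent, so a second copy is absorbed. This lets many components share one
  modified function.\<close>

lemma anova_dev_eq:
  assumes "0 < b" "q \<in> v" "q \<in> set qs"
  shows "anova b v qs (dev b q h) = anova b v qs h"
  using assms(3)
proof (induction qs)
  case (Cons p qs)
  then show ?case
    using assms(1,2)
    by (cases "q = p") (auto simp: anova_Cons, auto simp: anova_dev dev_idem)
qed auto

lemma anova_avg_eq:
  assumes "0 < b" "q \<notin> v" "q \<in> set qs"
  shows "anova b v qs (avg b q h) = anova b v qs h"
  using assms(3)
proof (induction qs)
  case (Cons p qs)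
  then show ?case
    using assms(1,2)
    by (cases "q = p") (auto simp: anova_Cons, auto simp: anova_avg avg_idem)
qed auto

lemma avg_anova_eq_0:
  assumes "0 < b" "q \<in> v" "q \<in> set qs"
  shows "avg b q (anova b v qs h) = (\<lambda>_. 0)"
  using anova_dev_eq[OF assms, of h] avg_dev[OF assms(1), of q "anova b v qs h"]
  by (simp add: anova_dev)

lemma anova_update:
  assumes "0 < b" "q \<notin> v" "q \<in> set qs"
  shows "anova b v qs h (\<xi>(q := c)) = anova b v qs h \<xi>"
  by (metis anova_avg anova_avg_eq[OF assms] avg_update)

lemma anova_cong: "(\<And>q. q \<in> set qs \<Longrightarrow> q \<in> v \<longleftrightarrow> q \<in> w) \<Longrightarrow> anova b v qs h = anova b w qs h"
  by (induction qs) (auto simp: anova_Cons)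

text \<open>Expansion of the identity, written as the product over q of A_q + (I - A_q); the subset
  v chooses a summand in each factor.\<close>

lemma sum_anova:
  assumes "distinct qs"
  shows "(\<Sum>v\<in>Pow (set qs). anova b v qs h \<xi>) = h \<xi>"
  using assms
proof (induction qs arbitrary: h \<xi>)
  case (Cons q qs)
  let ?P = "Pow (set qs)"
  have disj: "?P \<inter> insert q ` ?P = {}" and inj: "inj_on (insert q) ?P"
    using Cons.prems by (auto simp: inj_on_def)
  have 1: "anova b v (q # qs) h = avg b q (anova b v qs h)" if "v \<in> ?P" for v
    using that Cons.prems by (auto simp: anova_Cons)
  have 2: "anova b (insert q v) (q # qs) h = dev b q (anova b v qs h)" if "v \<in> ?P" for v
    using that Cons.prems by (auto simp: anova_Cons intro!: arg_cong[where f = "dev b q"] anova_cong)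
  have "(\<Sum>v\<in>Pow (set (q # qs)). anova b v (q # qs) h \<xi>) =
      (\<Sum>v\<in>?P. anova b v (q # qs) h \<xi>) + (\<Sum>v\<in>?P. anova b (insert q v) (q # qs) h \<xi>)"
    using disj inj by (simp add: Pow_insert sum.union_disjoint sum.reindex)
  also have "\<dots> = (\<Sum>v\<in>?P. anova b v qs h \<xi>)"
    by (simp add: 1 2 dev_def flip: sum.distrib)
  finally show ?case
    using Cons by simp
qed simp

lemma depends_onD: "depends_on Q h \<Longrightarrow> (\<And>q. q \<in> Q \<Longrightarrow> \<xi> q = \<xi>' q) \<Longrightarrow> h \<xi> = h \<xi>'"
  by (auto simp: depends_on_def)

lemma depends_on_avg: "depends_on Q h \<Longrightarrow> depends_on Q (avg b q h)"
  unfolding depends_on_def avg_def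
  by (intro allI impI arg_cong[where f = "\<lambda>x. x /\<^sub>R real b"] sum.cong) auto

lemma depends_on_dev: "depends_on Q h \<Longrightarrow> depends_on Q (dev b q h)"
  using depends_on_avg[of Q h b q] unfolding dev_eq depends_on_def by metis

lemma depends_on_anova: "depends_on Q h \<Longrightarrow> depends_on Q (anova b v qs h)"
  by (induction qs) (auto simp: anova_Cons depends_on_avg depends_on_dev)

lemma depends_on_remove:
  assumes "depends_on Q h" "\<And>\<xi> c. h (\<xi>(q := c)) = h \<xi>"
  shows "depends_on (Q - {q}) (h :: ('q \<Rightarrow> nat) \<Rightarrow> 'v)"
  unfolding depends_on_def
proof (intro allI impI)
  fix \<xi> \<xi>' :: "'q \<Rightarrow> nat" assume *: "\<forall>q\<in>Q - {q}. \<xi> q = \<xi>' q"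
  have "h \<xi> = h (\<xi>(q := \<xi>' q))"
    by (simp add: assms(2))
  also have "\<dots> = h \<xi>'"
    by (rule depends_onD[OF assms(1)]) (use * in auto)
  finally show "h \<xi> = h \<xi>'" .
qed

lemma depends_on_diff:
  assumes "finite R" "depends_on Q h" "\<forall>q\<in>R. \<forall>\<xi> c. h (\<xi>(q := c)) = h \<xi>"
  shows "depends_on (Q - R) h"
  using assms(1,3)
proof (induction R rule: finite_induct)
  case empty
  show ?case
    using assms(2) by (simp only: Diff_empty)
next
  case (insert q R)
  from insert.prems have 3: "\<And>\<xi> c. h (\<xi>(q := c)) = h \<xi>" and 1: "\<forall>q\<in>R. \<forall>\<xi> c. h (\<xi>(q := c)) = h \<xi>"
    by blast+
  show ?case
    by (subst Diff_insert) (rule depends_on_remove[OF insert.IH[OF 1] 3])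
qed

text \<open>The factors A_q with q outside v remove the dependence on q, and
  \<open>depends_on_diff\<close> deletes these digits from the support one at a time.\<close>

lemma depends_on_anova_support:
  assumes "0 < b" "depends_on (set qs) h" "v \<subseteq> set qs"
  shows "depends_on v (anova b v qs h)"
proof -
  let ?g = "anova b v qs h"
  have "\<forall>q\<in>set qs - v. \<forall>\<xi> c. ?g (\<xi>(q := c)) = ?g \<xi>"
  proof (intro ballI allI)
    fix q \<xi> c assume "q \<in> set qs - v"
    then have "q \<notin> v" "q \<in> set qs" by simp_all
    then show "?g (\<xi>(q := c)) = ?g \<xi>" by (rule anova_update[OF assms(1)])
  qed
  then have "depends_on (set qs - (set qs - v)) ?g"
    by (rule depends_on_diff[OF finite_Diff[OF finite_set] depends_on_anova[OF assms(2)]])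
  moreover have "set qs - (set qs - v) = v"
    using assms(3) by blast
  ultimately show ?thesis
    by (simp only:)
qed

section \<open>Means over all digit arrays\<close>

lemma bij_betw_add_mod: "0 < b \<Longrightarrow> bij_betw (\<lambda>x. (x + c) mod b) {..<b} {..<(b::nat)}"
proof -
  assume "0 < b"
  have "inj_on (\<lambda>x. (x + c) mod b) {..<b}"
  proof (rule inj_onI)
    fix x y assume "x \<in> {..<b}" "y \<in> {..<b}" "(x + c) mod b = (y + c) mod b"
    then have "x mod b = y mod b"
      using cong_add_rcancel_nat[of x c y b] by (simp add: cong_def)
    then show "x = y"
      using \<open>x \<in> {..<b}\<close> \<open>y \<in> {..<b}\<close> by simp
  qed
  moreover have "(\<lambda>x. (x + c) mod b) ` {..<b} \<subseteq> {..<b}"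
    using \<open>0 < b\<close> by auto
  ultimately show ?thesis
    by (simp add: bij_betw_def endo_inj_surj)
qed

text \<open>The sum over all values of the digit is reindexed by its cyclic shifts. In this form the
  average can be realised by shifts that preserve the mean over arrays, or the scrambling
  measure.\<close>

lemma avg_shift:
  assumes "\<xi> q < b"
  shows "avg b q h \<xi> = (\<Sum>c<b. h (\<xi>(q := (\<xi> q + c) mod b))) /\<^sub>R real b"
proof -
  have "bij_betw (\<lambda>c. (\<xi> q + c) mod b) {..<b} {..<b}"
    using bij_betw_add_mod[of b "\<xi> q"] assms by (simp add: add.commute)
  from sum.reindex_bij_betw[OF this, of "\<lambda>c. h (\<xi>(q := c))"] show ?thesis
    by (simp add: avg_def)
qed

lemma array_mean_shift:
  assumes "finite Q" "q \<in> Q" "0 < b"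
  shows "array_mean b Q (\<lambda>\<xi>. h (\<xi>(q := (\<xi> q + c) mod b))) = array_mean b Q h"
proof -
  let ?F = "\<lambda>\<xi>. \<xi>(q := (\<xi> q + c) mod b)"
  have "inj_on ?F (arrays b Q)"
  proof (rule inj_onI)
    fix x y assume *: "x \<in> arrays b Q" "y \<in> arrays b Q" "?F x = ?F y"
    then have "x p = y p" if "p \<noteq> q" for p
      using that by (metis fun_upd_other)
    moreover have "x q = y q"
    proof (rule inj_onD[OF bij_betw_imp_inj_on[OF bij_betw_add_mod[OF assms(3), of c]]])
      show "(x q + c) mod b = (y q + c) mod b"
        using fun_cong[OF *(3), of q] by simp
    qed (use * assms in \<open>auto simp: PiE_iff\<close>)
    ultimately show "x = y"
      by (intro ext) metis
  qed
  moreover have "?F ` arrays b Q \<subseteq> arrays b Q"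
    using assms by (auto simp: PiE_iff extensional_def)
  ultimately have "bij_betw ?F (arrays b Q) (arrays b Q)"
    by (simp add: bij_betw_def endo_inj_surj finite_PiE assms)
  from sum.reindex_bij_betw[OF this, of h] show ?thesis
    by (simp add: array_mean_def)
qed

lemma array_mean_sum: "array_mean b Q (\<lambda>\<xi>. \<Sum>i\<in>I. h i \<xi>) = (\<Sum>i\<in>I. array_mean b Q (h i))"
  by (simp add: array_mean_def sum.swap[of _ I] scaleR_sum_right)

lemma array_mean_scaleR: "array_mean b Q (\<lambda>\<xi>. c *\<^sub>R h \<xi>) = c *\<^sub>R array_mean b Q h"
  by (simp add: array_mean_def mult.commute flip: scaleR_sum_right)

text \<open>Each cyclic shift of digit q permutes the arrays, so all b terms of the average have the
  same mean.\<close>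

lemma array_mean_avg:
  fixes h :: "('q \<Rightarrow> nat) \<Rightarrow> 'v::real_vector"
  assumes "finite Q" "q \<in> Q" "0 < b"
  shows "array_mean b Q (avg b q h) = array_mean b Q h"
proof -
  have "array_mean b Q (avg b q h) =
      array_mean b Q (\<lambda>\<xi>. (\<Sum>c<b. h (\<xi>(q := (\<xi> q + c) mod b))) /\<^sub>R real b)"
    using assms(2) unfolding array_mean_def
    by (intro arg_cong[where f = "\<lambda>x. x /\<^sub>R _"] sum.cong avg_shift) (auto simp: PiE_iff)
  also have "\<dots> = (\<Sum>c<b. array_mean b Q (\<lambda>\<xi>. h (\<xi>(q := (\<xi> q + c) mod b)))) /\<^sub>R real b"
    by (simp only: array_mean_scaleR array_mean_sum)
  also have "\<dots> = array_mean b Q h"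
    using assms by (simp add: array_mean_shift sum_constant_scaleR)
  finally show ?thesis .
qed

lemma array_mean_add: "array_mean b Q (\<lambda>\<xi>. g \<xi> + h \<xi>) = array_mean b Q g + array_mean b Q h"
  by (simp add: array_mean_def sum.distrib scaleR_add_right)

lemma array_mean_cmul: "array_mean b Q (\<lambda>\<xi>. c * h \<xi>) = c * array_mean b Q (h :: _ \<Rightarrow> real)"
  by (simp add: array_mean_def sum_distrib_left mult.assoc mult.left_commute[of c])

lemma array_mean_mono:
  fixes g h :: "_ \<Rightarrow> real"
  shows "(\<And>\<xi>. \<xi> \<in> arrays b Q \<Longrightarrow> g \<xi> \<le> h \<xi>) \<Longrightarrow> array_mean b Q g \<le> array_mean b Q h"
  by (auto simp: array_mean_def intro!: divide_right_mono mult_left_mono sum_mono)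

lemma array_mean_nonneg:
  fixes h :: "_ \<Rightarrow> real"
  shows "(\<And>\<xi>. \<xi> \<in> arrays b Q \<Longrightarrow> 0 \<le> h \<xi>) \<Longrightarrow> 0 \<le> array_mean b Q h"
  by (auto simp: array_mean_def intro!: mult_nonneg_nonneg sum_nonneg)

lemma array_mean_const: "finite Q \<Longrightarrow> 0 < b \<Longrightarrow> array_mean b Q (\<lambda>_. x) = x"
  by (simp add: array_mean_def card_PiE scaleR_conv_of_real sum_constant_scaleR)

text \<open>\<open>avg b q g\<close> is constant in digit q, so averaging the inner product over q
  meets only the deviation, whose average vanishes; the two parts are orthogonal.\<close>

lemma array_mean_pythagoras:
  fixes g :: "('q \<Rightarrow> nat) \<Rightarrow> 'v::real_inner"
  assumes "finite Q" "q \<in> Q" "0 < b"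
  shows "array_mean b Q (\<lambda>\<xi>. (norm (g \<xi>))\<^sup>2) =
    array_mean b Q (\<lambda>\<xi>. (norm (avg b q g \<xi>))\<^sup>2) + array_mean b Q (\<lambda>\<xi>. (norm (dev b q g \<xi>))\<^sup>2)"
proof -
  have "array_mean b Q (\<lambda>\<xi>. avg b q g \<xi> \<bullet> dev b q g \<xi>) =
      array_mean b Q (avg b q (\<lambda>\<xi>. avg b q g \<xi> \<bullet> dev b q g \<xi>))"
    using array_mean_avg[OF assms] by metis
  also have "avg b q (\<lambda>\<xi>. avg b q g \<xi> \<bullet> dev b q g \<xi>) = (\<lambda>\<xi>. avg b q g \<xi> \<bullet> avg b q (dev b q g) \<xi>)"
    by (simp add: avg_def[of b q "\<lambda>\<xi>. avg b q g \<xi> \<bullet> dev b q g \<xi>"] avg_def[of b q "dev b q g"]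
        inner_sum_right fun_eq_iff)
  also have "\<dots> = (\<lambda>_. 0)"
    using avg_dev[OF assms(3), of q g] by simp
  finally have 0: "array_mean b Q (\<lambda>\<xi>. avg b q g \<xi> \<bullet> dev b q g \<xi>) = 0"
    by (simp add: array_mean_def)
  have "(norm (g \<xi>))\<^sup>2 = ((norm (avg b q g \<xi>))\<^sup>2 + (norm (dev b q g \<xi>))\<^sup>2)
      + 2 * (avg b q g \<xi> \<bullet> dev b q g \<xi>)" for \<xi>
    by (simp add: dev_def power2_norm_eq_inner algebra_simps inner_commute)
  then have "array_mean b Q (\<lambda>\<xi>. (norm (g \<xi>))\<^sup>2) = array_mean b Q (\<lambda>\<xi>. (norm (avg b q g \<xi>))\<^sup>2)
      + array_mean b Q (\<lambda>\<xi>. (norm (dev b q g \<xi>))\<^sup>2) + 2 * array_mean b Q (\<lambda>\<xi>. avg b q g \<xi> \<bullet> dev b q g \<xi>)"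
    by (simp only: array_mean_add array_mean_cmul)
  with 0 show ?thesis by simp
qed

text \<open>Each further digit splits every component into its average and its deviation, and
  Pythagoras preserves the total.\<close>

lemma parseval_anova:
  fixes h :: "('q \<Rightarrow> nat) \<Rightarrow> 'v::real_inner"
  assumes "finite Q" "0 < b" "distinct qs" "set qs \<subseteq> Q"
  shows "(\<Sum>v\<in>Pow (set qs). array_mean b Q (\<lambda>\<xi>. (norm (anova b v qs h \<xi>))\<^sup>2)) =
    array_mean b Q (\<lambda>\<xi>. (norm (h \<xi>))\<^sup>2)"
  using assms(3,4)
proof (induction qs)
  case (Cons q qs)
  let ?P = "Pow (set qs)" and ?M = "\<lambda>g. array_mean b Q (\<lambda>\<xi>. (norm (g \<xi>))\<^sup>2)"
  have disj: "?P \<inter> insert q ` ?P = {}" and inj: "inj_on (insert q) ?P"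
    using Cons.prems by (auto simp: inj_on_def)
  have 1: "anova b v (q # qs) h = avg b q (anova b v qs h)" if "v \<in> ?P" for v
    using that Cons.prems by (auto simp: anova_Cons)
  have 2: "anova b (insert q v) (q # qs) h = dev b q (anova b v qs h)" if "v \<in> ?P" for v
    using that Cons.prems by (auto simp: anova_Cons intro!: arg_cong[where f = "dev b q"] anova_cong)
  have "(\<Sum>v\<in>Pow (set (q # qs)). ?M (anova b v (q # qs) h)) =
      (\<Sum>v\<in>?P. ?M (anova b v (q # qs) h)) + (\<Sum>v\<in>?P. ?M (anova b (insert q v) (q # qs) h))"
    using disj inj by (simp add: Pow_insert sum.union_disjoint sum.reindex)
  also have "\<dots> = (\<Sum>v\<in>?P. ?M (anova b v qs h))"
  proof -
    have q: "q \<in> Q" using Cons.prems by simp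
    have "?M (anova b v (q # qs) h) + ?M (anova b (insert q v) (q # qs) h) = ?M (anova b v qs h)"
      if "v \<in> ?P" for v
      unfolding 1[OF that] 2[OF that] using array_mean_pythagoras[OF assms(1) q assms(2), of "anova b v qs h"] by simp
    then show ?thesis
      unfolding sum.distrib[symmetric] by (rule sum.cong[OF refl])
  qed
  finally show ?case
    using Cons by simp
qed simp

text \<open>Averaging over some digits is the same as resampling them from a full random array.
  Taken over all digits this identifies the constant component; taken over all digits of some
  variables it yields a discrete marginal.\<close>

lemma avgs_eq_array_mean:
  fixes h :: "('q \<Rightarrow> nat) \<Rightarrow> 'v::real_vector"
  assumes "finite Q" "0 < b" "distinct zs" "set zs \<subseteq> Q"
  shows "foldr (avg b) zs h \<xi> = array_mean b Q (\<lambda>\<zeta>. h (\<lambda>q. if q \<in> set zs then \<zeta> q else \<xi> q))"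
  using assms(3,4)
proof (induction zs arbitrary: \<xi>)
  case Nil
  then show ?case using assms by (simp add: array_mean_const)
next
  case (Cons z zs)
  let ?g = "\<lambda>\<zeta>. h (\<lambda>q. if q \<in> set (z # zs) then \<zeta> q else \<xi> q)"
  have "foldr (avg b) (z # zs) h \<xi> =
      (\<Sum>c<b. array_mean b Q (\<lambda>\<zeta>. h (\<lambda>q. if q \<in> set zs then \<zeta> q else (\<xi>(z := c)) q))) /\<^sub>R real b"
  proof -
    have "foldr (avg b) zs h \<xi>' = array_mean b Q (\<lambda>\<zeta>. h (\<lambda>q. if q \<in> set zs then \<zeta> q else \<xi>' q))" for \<xi>'
      by (rule Cons.IH) (use Cons.prems in auto)
    then show ?thesis
      by (simp only: foldr.simps o_apply avg_def[of b z "foldr (avg b) zs h"])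
  qed
  also have "\<dots> = array_mean b Q (avg b z ?g)"
  proof -
    have eq: "(\<lambda>q. if q \<in> set zs then \<zeta> q else (\<xi>(z := c)) q) =
        (\<lambda>q. if q \<in> set (z # zs) then (\<zeta>(z := c)) q else \<xi> q)" for \<zeta> :: "'q \<Rightarrow> nat" and c
      using Cons.prems by auto
    show ?thesis
      unfolding eq avg_def by (simp only: array_mean_scaleR array_mean_sum)
  qed
  also have "\<dots> = array_mean b Q ?g"
    using Cons.prems assms by (intro array_mean_avg) auto
  finally show ?case .
qed

lemma anova_devs_avgs_eq:
  fixes h :: "('q \<Rightarrow> nat) \<Rightarrow> 'v::real_vector"
  assumes "0 < b" "set ss \<subseteq> v" "set zs \<inter> v = {}" "set ss \<subseteq> set qs" "set zs \<subseteq> set qs"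
  shows "anova b v qs (foldr (dev b) ss (foldr (avg b) zs h)) = anova b v qs h"
proof -
  have "anova b v qs (foldr (avg b) zs h) = anova b v qs h"
    using assms(3,5) by (induction zs) (auto simp: anova_avg_eq[OF assms(1)])
  moreover have "anova b v qs (foldr (dev b) ss g) = anova b v qs g" for g :: "('q \<Rightarrow> nat) \<Rightarrow> 'v"
    using assms(2,4) by (induction ss) (auto simp: anova_dev_eq[OF assms(1)])
  ultimately show ?thesis by simp
qed

text \<open>All these components are unchanged when h is replaced by the function with the digits
  \<open>ss\<close> deviated and the digits \<open>zs\<close> averaged out. Parseval for that
  function bounds them together, whatever their number.\<close>

lemma sum_anova_le:
  fixes h :: "('q \<Rightarrow> nat) \<Rightarrow> 'v::real_inner"
  assumes "0 < b" "distinct qs" "set ss \<subseteq> set qs" "set zs \<subseteq> set qs"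
    and V: "V \<subseteq> {v. v \<subseteq> set qs \<and> set ss \<subseteq> v \<and> set zs \<inter> v = {}}"
  shows "(\<Sum>v\<in>V. array_mean b (set qs) (\<lambda>\<xi>. (norm (anova b v qs h \<xi>))\<^sup>2)) \<le>
    array_mean b (set qs) (\<lambda>\<xi>. (norm (foldr (dev b) ss (foldr (avg b) zs h) \<xi>))\<^sup>2)"
proof -
  let ?g = "foldr (dev b) ss (foldr (avg b) zs h)"
  have "(\<Sum>v\<in>V. array_mean b (set qs) (\<lambda>\<xi>. (norm (anova b v qs h \<xi>))\<^sup>2)) =
      (\<Sum>v\<in>V. array_mean b (set qs) (\<lambda>\<xi>. (norm (anova b v qs ?g \<xi>))\<^sup>2))"
    using assms by (intro sum.cong refl) (subst anova_devs_avgs_eq, auto)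
  also have "\<dots> \<le> (\<Sum>v\<in>Pow (set qs). array_mean b (set qs) (\<lambda>\<xi>. (norm (anova b v qs ?g \<xi>))\<^sup>2))"
    using V by (intro sum_mono2) (auto intro: array_mean_nonneg)
  also have "\<dots> = array_mean b (set qs) (\<lambda>\<xi>. (norm (?g \<xi>))\<^sup>2)"
    using assms by (intro parseval_anova) auto
  finally show ?thesis .
qed

section \<open>Deviations bounded by jumps between two values of a digit\<close>

definition jump :: "'q \<times> nat \<times> nat \<Rightarrow> (('q \<Rightarrow> nat) \<Rightarrow> 'v::real_vector) \<Rightarrow> ('q \<Rightarrow> nat) \<Rightarrow> 'v" where
  "jump = (\<lambda>(q, c, c') h \<xi>. h (\<xi>(q := c')) - h (\<xi>(q := c)))"

lemma jump_avg: "p \<noteq> q \<Longrightarrow> jump (q, c, c') (avg b p h) = avg b p (jump (q, c, c') h)"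
  by (auto simp: jump_def avg_def fun_eq_iff sum_subtractf fun_upd_twist[of p q] scaleR_diff_right)

lemma jump_dev: "p \<noteq> q \<Longrightarrow> jump (q, c, c') (dev b p h) = dev b p (jump (q, c, c') h)"
  using jump_avg[of p q c c' b h] by (auto simp: jump_def dev_def fun_eq_iff algebra_simps)

text \<open>A deviation is the mean over c of the differences between the present value and the
  value at digit c; Cauchy-Schwarz and a second average over the present digit leave a mean over
  pairs of values. Equal values contribute nothing and the order of a pair only affects the sign, so
  increasing pairs suffice.\<close>

lemma array_mean_dev_le:
  fixes g :: "('q \<Rightarrow> nat) \<Rightarrow> 'v::real_inner"
  assumes "finite Q" "q \<in> Q" "0 < b" "0 \<le> K"
    and K: "\<And>c c'. c < c' \<Longrightarrow> c' < b \<Longrightarrow> array_mean b Q (\<lambda>\<xi>. (norm (jump (q, c, c') g \<xi>))\<^sup>2) \<le> K"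
  shows "array_mean b Q (\<lambda>\<xi>. (norm (dev b q g \<xi>))\<^sup>2) \<le> K"
proof -
  have K': "array_mean b Q (\<lambda>\<xi>. (norm (g (\<xi>(q := c')) - g (\<xi>(q := c))))\<^sup>2) \<le> K" if "c < b" "c' < b" for c c'
  proof (cases c c' rule: linorder_cases)
    case less
    then show ?thesis using K[of c c'] that by (simp add: jump_def)
  next
    case equal
    then show ?thesis using assms by (simp add: array_mean_const)
  next
    case greater
    then show ?thesis using K[of c' c] that by (simp add: jump_def norm_minus_commute)
  qed
  have "(norm (dev b q g \<xi>))\<^sup>2 \<le> (\<Sum>c<b. (norm (g \<xi> - g (\<xi>(q := c))))\<^sup>2) / real b" for \<xi>
  proof -
    have "dev b q g \<xi> = (\<Sum>c<b. g \<xi> - g (\<xi>(q := c))) /\<^sub>R real b"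
      using assms(3) by (simp add: dev_def avg_def sum_subtractf sum_constant_scaleR scaleR_diff_right)
    then have "norm (dev b q g \<xi>) \<le> (\<Sum>c<b. norm (g \<xi> - g (\<xi>(q := c)))) / real b"
      by (simp add: divide_inverse_commute mult_left_mono norm_sum)
    then have "(norm (dev b q g \<xi>))\<^sup>2 \<le> ((\<Sum>c<b. norm (g \<xi> - g (\<xi>(q := c)))) / real b)\<^sup>2"
      by (intro power_mono) auto
    also have "\<dots> \<le> (real b * (\<Sum>c<b. (norm (g \<xi> - g (\<xi>(q := c))))\<^sup>2)) / (real b)\<^sup>2"
      using sum_squared_le_sum_of_squares[of "\<lambda>c. norm (g \<xi> - g (\<xi>(q := c)))" "{..<b}"]
      by (auto simp: power_divide mult.commute[of "real b"] intro!: divide_right_mono)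
    also have "\<dots> = (\<Sum>c<b. (norm (g \<xi> - g (\<xi>(q := c))))\<^sup>2) / real b"
      using assms(3) by (simp add: power2_eq_square)
    finally show ?thesis .
  qed
  then have "(norm (dev b q g \<xi>))\<^sup>2 \<le> (1 / real b) * (\<Sum>c<b. (norm (g \<xi> - g (\<xi>(q := c))))\<^sup>2)" for \<xi>
    by (simp only: times_divide_eq_left mult_1)
  then have "array_mean b Q (\<lambda>\<xi>. (norm (dev b q g \<xi>))\<^sup>2) \<le>
      array_mean b Q (\<lambda>\<xi>. (1 / real b) * (\<Sum>c<b. (norm (g \<xi> - g (\<xi>(q := c))))\<^sup>2))"
    by (rule array_mean_mono)
  also have "\<dots> = (1 / real b) * (\<Sum>c<b. array_mean b Q (\<lambda>\<xi>. (norm (g \<xi> - g (\<xi>(q := c))))\<^sup>2))"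
    by (simp only: array_mean_cmul array_mean_sum)
  also have "\<dots> = (1 / real b) * (\<Sum>c<b. (1 / real b) *
      (\<Sum>c'<b. array_mean b Q (\<lambda>\<xi>. (norm (g (\<xi>(q := c')) - g (\<xi>(q := c))))\<^sup>2)))"
  proof -
    have "array_mean b Q (\<lambda>\<xi>. (norm (g \<xi> - g (\<xi>(q := c))))\<^sup>2) = (1 / real b) *
        (\<Sum>c'<b. array_mean b Q (\<lambda>\<xi>. (norm (g (\<xi>(q := c')) - g (\<xi>(q := c))))\<^sup>2))" for c
    proof -
      \<comment> \<open>Averaging over the present digit is free in the mean and makes it one of the
        values c'.\<close>
      have "array_mean b Q (\<lambda>\<xi>. (norm (g \<xi> - g (\<xi>(q := c))))\<^sup>2) =
          array_mean b Q (avg b q (\<lambda>\<xi>. (norm (g \<xi> - g (\<xi>(q := c))))\<^sup>2))"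
        by (rule array_mean_avg[OF assms(1-3), symmetric])
      also have "avg b q (\<lambda>\<xi>. (norm (g \<xi> - g (\<xi>(q := c))))\<^sup>2) =
          (\<lambda>\<xi>. (1 / real b) * (\<Sum>c'<b. (norm (g (\<xi>(q := c')) - g (\<xi>(q := c))))\<^sup>2))"
        by (simp add: avg_def fun_eq_iff divide_inverse_commute)
      finally show ?thesis
        by (simp only: array_mean_cmul array_mean_sum)
    qed
    then show ?thesis by simp
  qed
  also have "\<dots> \<le> (1 / real b) * (\<Sum>c<b. (1 / real b) * (\<Sum>c'<b. K))"
    by (intro mult_left_mono sum_mono K') auto
  also have "\<dots> = K"
    using assms(3) by simp
  finally show ?thesis .
qed

text \<open>The deviations are traded for jumps one at a time. The jump at the outermost deviation
  is moved through the remaining operators, which act on other digits, down to h; this reverses the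
  order and leaves jumps of h itself, followed by averages only.\<close>

lemma array_mean_devs_le:
  fixes h :: "('q \<Rightarrow> nat) \<Rightarrow> 'v::real_inner"
  assumes "finite Q" "0 < b" "0 \<le> K" "distinct ss" "set ss \<subseteq> Q" "set ss \<inter> set zs = {}"
    and K: "\<And>js. map fst js = rev ss \<Longrightarrow> (\<forall>(q, c, c')\<in>set js. c < c' \<and> c' < b) \<Longrightarrow>
      array_mean b Q (\<lambda>\<xi>. (norm (foldr (avg b) zs (foldr jump js h) \<xi>))\<^sup>2) \<le> K"
  shows "array_mean b Q (\<lambda>\<xi>. (norm (foldr (dev b) ss (foldr (avg b) zs h) \<xi>))\<^sup>2) \<le> K"
  using assms(4-) 
proof (induction ss arbitrary: h)
  case Nil
  show ?case using Nil(4)[of "[]"] by simp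
next
  case (Cons q ss)
  let ?g = "foldr (dev b) ss (foldr (avg b) zs h)"
  have "array_mean b Q (\<lambda>\<xi>. (norm (dev b q ?g \<xi>))\<^sup>2) \<le> K"
  proof (rule array_mean_dev_le)
    fix c c' assume c: "c < c'" "c' < b"
    have "jump (q, c, c') ?g = foldr (dev b) ss (jump (q, c, c') (foldr (avg b) zs h))"
    proof -
      have "q \<notin> set ts \<Longrightarrow> jump (q, c, c') (foldr (dev b) ts g) = foldr (dev b) ts (jump (q, c, c') g)" for ts and g :: "('q \<Rightarrow> nat) \<Rightarrow> 'v"
        by (induction ts) (auto simp: jump_dev)
      then show ?thesis using Cons.prems by auto
    qed
    also have "jump (q, c, c') (foldr (avg b) zs h) = foldr (avg b) zs (jump (q, c, c') h)"
    proof -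
      have "q \<notin> set ts \<Longrightarrow> jump (q, c, c') (foldr (avg b) ts h) = foldr (avg b) ts (jump (q, c, c') h)" for ts
        by (induction ts) (auto simp: jump_avg)
      then show ?thesis using Cons.prems by auto
    qed
    finally have eq: "jump (q, c, c') ?g = foldr (dev b) ss (foldr (avg b) zs (jump (q, c, c') h))" .
    show "array_mean b Q (\<lambda>\<xi>. (norm (jump (q, c, c') ?g \<xi>))\<^sup>2) \<le> K"
      unfolding eq
    proof (rule Cons.IH)
      fix js assume "map fst js = rev ss" "\<forall>(q, c, c')\<in>set js. c < c' \<and> c' < b"
      then show "array_mean b Q (\<lambda>\<xi>. (norm (foldr (avg b) zs (foldr jump js (jump (q, c, c') h)) \<xi>))\<^sup>2) \<le> K"
        using Cons.prems(4)[of "js @ [(q, c, c')]"] c by auto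
    qed (use Cons.prems in auto)
  qed (use Cons.prems assms in auto)
  then show ?case by simp
qed

section \<open>Equidistribution of digital nets\<close>

text \<open>The additive character x -> exp(2 pi i x / b) of the integers modulo b.\<close>

definition root_char :: "nat \<Rightarrow> nat \<Rightarrow> complex" where
  "root_char b x = exp (2 * of_real pi * \<i> * of_nat x / of_nat b)"

lemma root_char_add: "root_char b (x + y) = root_char b x * root_char b y"
  by (simp add: root_char_def add_divide_distrib distrib_left flip: exp_add)

lemma root_char_0 [simp]: "root_char b 0 = 1"
  by (simp add: root_char_def)

lemma root_char_sum: "root_char b (\<Sum>i\<in>I. f i) = (\<Prod>i\<in>I. root_char b (f i))"
  by (induction I rule: infinite_finite_induct) (auto simp: root_char_add)

lemma root_char_mult: "root_char b (l * x) = root_char b x ^ l"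
  by (induction l) (auto simp: root_char_add)

lemma root_char_eq_1_iff: "0 < b \<Longrightarrow> root_char b x = 1 \<longleftrightarrow> b dvd x"
  using complex_root_unity_eq_1[of b x] by (simp add: root_char_def)

lemma sum_root_char:
  assumes "0 < b"
  shows "(\<Sum>l<b. root_char b (l * x)) = (if b dvd x then of_nat b else 0)"
proof (cases "b dvd x")
  case True
  then show ?thesis
    using root_char_eq_1_iff[OF assms, of x] by (simp add: root_char_mult)
next
  case False
  have "root_char b x ^ b = 1"
    using root_char_eq_1_iff[OF assms, of "b * x"] by (simp flip: root_char_mult)
  moreover have "root_char b x \<noteq> 1"
    using False root_char_eq_1_iff[OF assms] by simp
  ultimately show ?thesis
    using False by (simp add: root_char_mult sum_gp_strict)
qed

text \<open>As n runs through 0, ..., b^m - 1, its digit vector runs through all vectors in {0, ...,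
  b-1}^m exactly once, so a sum of products over the digits factorises. The induction splits off the
  leading digit.\<close>

lemma sum_prod_digits:
  fixes \<phi> :: "nat \<Rightarrow> nat \<Rightarrow> 'a::comm_semiring_1"
  assumes "0 < b"
  shows "(\<Sum>n<b ^ m. \<Prod>k<m. \<phi> k (n div b ^ k mod b)) = (\<Prod>k<m. \<Sum>x<b. \<phi> k x)"
proof (induction m)
  case (Suc m)
  have split: "(\<Prod>k<Suc m. \<phi> k (n div b ^ k mod b)) = (\<Prod>k<m. \<phi> k (r div b ^ k mod b)) * \<phi> m x"
    if "n = r + x * b ^ m" "r < b ^ m" "x < b" for n r x
  proof -
    have "n div b ^ k mod b = r div b ^ k mod b" if "k < m" for k
    proof -
      obtain e where e: "m = Suc (k + e)" using \<open>k < m\<close> less_imp_Suc_add by blast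
      have "n div b ^ k = r div b ^ k + b * (x * b ^ e)"
        using \<open>n = _\<close> assms div_mult_self2[of "b ^ k" r "b * (x * b ^ e)"]
        by (simp add: e power_add algebra_simps)
      then show ?thesis by simp
    qed
    moreover have "n div b ^ m mod b = x"
      using that assms by simp
    ultimately show ?thesis by simp
  qed
  have "(\<Sum>n<b ^ Suc m. \<Prod>k<Suc m. \<phi> k (n div b ^ k mod b)) =
      (\<Sum>x<b. \<Sum>n\<in>{x * b ^ m..<x * b ^ m + b ^ m}. \<Prod>k<Suc m. \<phi> k (n div b ^ k mod b))"
    using sum.nat_group[of "\<lambda>n. \<Prod>k<Suc m. \<phi> k (n div b ^ k mod b)" "b ^ m" b] by simp
  also have "\<dots> = (\<Sum>x<b. \<Sum>r<b ^ m. \<Prod>k<Suc m. \<phi> k ((r + x * b ^ m) div b ^ k mod b))"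
  proof (rule sum.cong[OF refl])
    fix x
    show "(\<Sum>n\<in>{x * b ^ m..<x * b ^ m + b ^ m}. \<Prod>k<Suc m. \<phi> k (n div b ^ k mod b)) =
        (\<Sum>r<b ^ m. \<Prod>k<Suc m. \<phi> k ((r + x * b ^ m) div b ^ k mod b))"
      by (rule sum.reindex_bij_witness[of _ "\<lambda>r. r + x * b ^ m" "\<lambda>n. n - x * b ^ m"]) auto
  qed
  also have "\<dots> = (\<Sum>x<b. \<Sum>r<b ^ m. (\<Prod>k<m. \<phi> k (r div b ^ k mod b)) * \<phi> m x)"
    by (intro sum.cong refl split) auto
  also have "\<dots> = (\<Prod>k<Suc m. \<Sum>x<b. \<phi> k x)"
    by (simp add: Suc.IH flip: sum_distrib_right sum_distrib_left)
  finally show ?case .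
qed simp

text \<open>A relation among fewer rows becomes one among more rows after padding its coefficients
  with zeros.\<close>

lemma rows_independent_mono:
  assumes "rows_independent b m n A c'" "\<And>j. c j \<le> c' j"
  shows "rows_independent b m n A c"
  unfolding rows_independent_def
proof (intro allI impI ballI)
  fix l j a
  assume *: "\<forall>k<m. (\<Sum>j=1..n. \<Sum>a=1..c j. l j a * A j a k) mod b = 0" and j: "j \<in> {1..n}" "a \<in> {1..c j}"
  define l' where "l' = (\<lambda>j a. if a \<le> c j then l j a else 0)"
  have "(\<Sum>a=1..c' j. l' j a * A j a k) = (\<Sum>a=1..c j. l j a * A j a k)" for j k
  proof (rule sum.mono_neutral_cong_right)
    show "{1..c j} \<subseteq> {1..c' j}"
      using assms(2)[of j] by auto
  qed (auto simp: l'_def)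
  with * have "\<forall>k<m. (\<Sum>j=1..n. \<Sum>a=1..c' j. l' j a * A j a k) mod b = 0"
    by simp
  then have "\<forall>j\<in>{1..n}. \<forall>a\<in>{1..c' j}. l' j a mod b = 0"
    using assms(1) unfolding rows_independent_def by blast
  then have "l' j a mod b = 0"
    using j assms(2)[of j] by force
  then show "l j a mod b = 0"
    using j by (simp add: l'_def)
qed

text \<open>The net condition speaks of systems of exactly m - t rows; a smaller total is filled up
  in coordinate 1, and the surplus rows are then dropped.\<close>

lemma digital_net_rows_independent:
  assumes "digital_net b t m n A" "1 \<le> n" "(\<Sum>j=1..n. c j) \<le> m - t"
  shows "rows_independent b m n A c"
proof -
  define c' where "c' = c(1 := c 1 + (m - t - (\<Sum>j=1..n. c j)))"
  have eq: "{1..n} = insert 1 {2..n}" using assms(2) by auto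
  have "(\<Sum>j=1..n. c' j) = m - t"
  proof -
    have "sum c' {1..n} = c' 1 + sum c' {2..n}" "sum c {1..n} = c 1 + sum c {2..n}"
      unfolding eq by auto
    moreover have "sum c' {2..n} = sum c {2..n}"
      by (simp add: c'_def)
    moreover have "c' 1 = c 1 + (m - t - sum c {1..n})"
      by (simp add: c'_def)
    ultimately show ?thesis
      using assms(3) by linarith
  qed
  then have "rows_independent b m n A c'"
    using assms(1) by (auto simp: digital_net_def)
  then show ?thesis
    by (rule rows_independent_mono) (auto simp: c'_def)
qed

text \<open>Each digit equation is detected by a sum over additive characters. After exchanging the
  sums, a family of coefficients contributes only if the corresponding combination of rows vanishes
  modulo b, and independence leaves only the zero family, which contributes b^m.\<close>

lemma card_net_digits:
  assumes "0 < b" "rows_independent b m n A c"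
    and y: "\<And>j a. y j a < b"
  shows "card {i. i < b ^ m \<and> (\<forall>j\<in>{1..n}. \<forall>a\<in>{1..c j}. net_digit b m A i j a = y j a)} * b ^ (\<Sum>j=1..n. c j) = b ^ m"
proof -
  define K where "K = Sigma {1..n} (\<lambda>j. {1..c j})"
  have "finite K" by (simp add: K_def)
  have cardK: "card K = (\<Sum>j=1..n. c j)" by (simp add: K_def)
  define dig where "dig = (\<lambda>i k. i div b ^ k mod b)"
  define T where "T = (\<lambda>i (j, a). \<Sum>k<m. A j a k * dig i k)"
  \<comment> \<open>\<open>e\<close> is the negative of the wanted digit modulo b, so that the digit
    equation becomes a divisibility.\<close>
  define e where "e = (\<lambda>(j, a). b - y j a)"
  have dvd: "b dvd T i (j, a) + e (j, a) \<longleftrightarrow> net_digit b m A i j a = y j a" for i j a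
  proof -
    have "b dvd T i (j, a) + e (j, a) \<longleftrightarrow> (T i (j, a) + e (j, a)) mod b = (y j a + e (j, a)) mod b"
      using y[of j a] by (simp add: e_def dvd_eq_mod_eq_0)
    also have "\<dots> \<longleftrightarrow> T i (j, a) mod b = y j a mod b"
      using y[of j a] cong_add_rcancel_nat[of "T i (j, a)" "e (j, a)" "y j a" b] by (simp add: cong_def)
    finally show ?thesis
      using y[of j a] by (simp add: T_def net_digit_def dig_def)
  qed
  \<comment> \<open>\<open>v l k\<close> is the coefficient of the k-th digit of the index in the
    combination of rows given by \<open>l\<close>.\<close>
  define v where "v = (\<lambda>l k. \<Sum>q\<in>K. l q * A (fst q) (snd q) k)"
  have inner: "(\<Sum>i<b ^ m. \<Prod>q\<in>K. root_char b (l q * (T i q + e q))) =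
      (if l \<in> PiE K (\<lambda>_. {0}) then of_nat (b ^ m) else 0)" if l: "l \<in> PiE K (\<lambda>_. {..<b})" for l
  proof -
    have "(\<Prod>q\<in>K. root_char b (l q * (T i q + e q))) =
        root_char b (\<Sum>q\<in>K. l q * e q) * (\<Prod>k<m. root_char b (dig i k * v l k))" for i
    proof -
      have "(\<Prod>q\<in>K. root_char b (l q * (T i q + e q))) =
          root_char b (\<Sum>q\<in>K. l q * e q) * root_char b (\<Sum>q\<in>K. l q * T i q)"
        by (simp add: root_char_sum root_char_add distrib_left prod.distrib)
      also have "(\<Sum>q\<in>K. l q * T i q) = (\<Sum>k<m. dig i k * v l k)"
        unfolding T_def v_def sum_distrib_left case_prod_beta'
        by (subst sum.swap) (simp add: mult_ac)
      finally show ?thesis by (simp add: root_char_sum)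
    qed
    then have "(\<Sum>i<b ^ m. \<Prod>q\<in>K. root_char b (l q * (T i q + e q))) =
        root_char b (\<Sum>q\<in>K. l q * e q) * (\<Prod>k<m. \<Sum>x<b. root_char b (x * v l k))"
      using sum_prod_digits[OF assms(1), where m = m and \<phi> = "\<lambda>k x. root_char b (x * v l k)"]
      by (simp add: dig_def flip: sum_distrib_left)
    also have "(\<Prod>k<m. \<Sum>x<b. root_char b (x * v l k)) =
        (if \<forall>k<m. b dvd v l k then of_nat (b ^ m) else 0)"
      by (auto simp: sum_root_char[OF assms(1)] intro!: prod_zero)
    also have "(\<forall>k<m. b dvd v l k) \<longleftrightarrow> l \<in> PiE K (\<lambda>_. {0})"
    proof
      assume dvd: "\<forall>k<m. b dvd v l k"
      have "v l k = (\<Sum>j=1..n. \<Sum>a=1..c j. l (j, a) * A j a k)" for k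
        by (simp add: v_def K_def sum.Sigma case_prod_beta')
      with dvd have "\<forall>j\<in>{1..n}. \<forall>a\<in>{1..c j}. l (j, a) mod b = 0"
        using assms(2)[unfolded rows_independent_def, rule_format, of "\<lambda>j a. l (j, a)"] by auto
      then have "l q = 0" if "q \<in> K" for q
        using that l by (fastforce simp: K_def PiE_iff)
      then show "l \<in> PiE K (\<lambda>_. {0})"
        using l by (intro PiE_I) (auto simp del: PiE_iff dest: PiE_arb)
    qed (simp add: v_def PiE_iff)
    also have "root_char b (\<Sum>q\<in>K. l q * e q) * (if l \<in> PiE K (\<lambda>_. {0}) then of_nat (b ^ m) else 0) =
        (if l \<in> PiE K (\<lambda>_. {0}) then of_nat (b ^ m) else 0)"
      by (simp add: PiE_iff)
    finally show ?thesis .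
  qed
  let ?S = "{i. i < b ^ m \<and> (\<forall>j\<in>{1..n}. \<forall>a\<in>{1..c j}. net_digit b m A i j a = y j a)}"
  \<comment> \<open>A product of character sums is b^|K| if all digit equations hold and 0
    otherwise, hence the weight b^|K| of each counted index.\<close>
  have "of_nat (card ?S * b ^ card K) = (\<Sum>i<b ^ m. (if i \<in> ?S then of_nat (b ^ card K) else 0 :: complex))"
    by (simp add: sum.If_cases Int_def lessThan_def)
  also have "\<dots> = (\<Sum>i<b ^ m. \<Prod>q\<in>K. \<Sum>l<b. root_char b (l * (T i q + e q)))"
  proof (intro sum.cong refl)
    fix i assume "i \<in> {..<b ^ m}"
    then have "i \<in> ?S \<longleftrightarrow> (\<forall>q\<in>K. b dvd T i q + e q)"
      using dvd by (auto simp: K_def)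
    then show "(if i \<in> ?S then of_nat (b ^ card K) else 0) = (\<Prod>q\<in>K. \<Sum>l<b. root_char b (l * (T i q + e q)))"
      using \<open>finite K\<close> by (auto simp: sum_root_char[OF assms(1)] intro!: prod_zero)
  qed
  also have "\<dots> = (\<Sum>l\<in>PiE K (\<lambda>_. {..<b}). \<Sum>i<b ^ m. \<Prod>q\<in>K. root_char b (l q * (T i q + e q)))"
    unfolding prod_sum_PiE[OF \<open>finite K\<close> finite_lessThan] by (rule sum.swap)
  also have "\<dots> = (\<Sum>l\<in>PiE K (\<lambda>_. {..<b}). if l \<in> PiE K (\<lambda>_. {0}) then of_nat (b ^ m) else 0)"
    by (intro sum.cong refl inner)
  also have "\<dots> = (\<Sum>l\<in>PiE K (\<lambda>_. {0::nat}). of_nat (b ^ m))"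
  proof (rule sum.mono_neutral_cong_right)
    show "PiE K (\<lambda>_. {0}) \<subseteq> PiE K (\<lambda>_. {..<b})"
      using assms(1) by (intro PiE_mono) auto
  qed (use \<open>finite K\<close> in \<open>simp_all add: finite_PiE\<close>)
  also have "\<dots> = of_nat (b ^ m)"
    using \<open>finite K\<close> by (simp add: card_PiE)
  finally show ?thesis
    unfolding cardK by (simp only: of_nat_eq_iff)
qed

section \<open>Invariance of the scrambling measure\<close>

text \<open>The identity outside {0, ..., b-1}, as required of a permutation of that set in the
  sense of \<open>permutes\<close>.\<close>

definition cyclic_perm :: "nat \<Rightarrow> nat \<Rightarrow> nat \<Rightarrow> nat" where
  "cyclic_perm b c x = (if x < b then (x + c) mod b else x)"

text \<open>The index of the permutation that nested scrambling applies at digit q: the coordinate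
  together with the unscrambled digits preceding it.\<close>

definition digit_key :: "(nat \<Rightarrow> nat \<Rightarrow> nat) \<Rightarrow> nat \<times> nat \<Rightarrow> nat \<times> nat list" where
  "digit_key z q = (fst q, map (z (fst q)) [1..<snd q])"

definition cyclic_shift :: "nat \<Rightarrow> nat \<Rightarrow> nat \<times> nat list \<Rightarrow> (nat \<times> nat list \<Rightarrow> nat \<Rightarrow> nat) \<Rightarrow> nat \<times> nat list \<Rightarrow> nat \<Rightarrow> nat" where
  "cyclic_shift b c \<kappa> \<pi> = \<pi>(\<kappa> := cyclic_perm b c \<circ> \<pi> \<kappa>)"

definition scrambled :: "(nat \<Rightarrow> nat \<Rightarrow> nat) \<Rightarrow> (nat \<times> nat list \<Rightarrow> nat \<Rightarrow> nat) \<Rightarrow> nat \<times> nat \<Rightarrow> nat" where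
  "scrambled z \<pi> q = \<pi> (digit_key z q) (z (fst q) (snd q))"

text \<open>The length of the digit string reveals the position. Hence permutations acting at
  different places are different, even for two different points, and correlation between points can
  only come from the same place with the same preceding digits.\<close>

lemma digit_key_inj: "1 \<le> snd p \<Longrightarrow> 1 \<le> snd q \<Longrightarrow> digit_key z p = digit_key z' q \<Longrightarrow> p = q"
proof -
  assume *: "1 \<le> snd p" "1 \<le> snd q" "digit_key z p = digit_key z' q"
  then have "length [1..<snd p] = length [1..<snd q]"
    unfolding digit_key_def by (metis length_map prod.inject)
  with * show "p = q"
    by (auto simp: prod_eq_iff digit_key_def)
qed

lemma cyclic_perm_permutes: "0 < b \<Longrightarrow> cyclic_perm b c permutes {..<b}"
proof (rule bij_imp_permutes)
  assume "0 < b"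
  then show "bij_betw (cyclic_perm b c) {..<b} {..<b}"
    using bij_betw_cong[THEN iffD1, OF _ bij_betw_add_mod[of b c]] by (simp add: cyclic_perm_def)
qed (simp add: cyclic_perm_def)

locale scrambling =
  fixes b n :: nat
  assumes b_gt_1: "1 < b"
begin

abbreviation "perms \<equiv> {p. p permutes {..<b}}"
abbreviation "ix \<equiv> {1..n} \<times> lists {..<b}"
abbreviation "U \<equiv> uniform_count_measure perms"
abbreviation "P \<equiv> scrambling_measure b n"

lemma finite_perms: "finite perms" and perms_nonempty: "perms \<noteq> {}"
  using permutes_id[of "{..<b}"] by (auto intro: finite_permutations simp del: permutes_id)

lemma P_eq: "P = PiM ix (\<lambda>_. U)"
  unfolding scrambling_measure_def by (rule arg_cong[where f = "PiM ix"]) auto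

sublocale prod: product_prob_space "\<lambda>_. U" ix
  using prob_space_uniform_count_measure[OF finite_perms perms_nonempty]
  by (simp add: product_prob_space_def product_prob_space_axioms_def product_sigma_finite_def
      prob_space_imp_sigma_finite)

sublocale P: prob_space P
  unfolding P_eq by (rule prod.prob_space_axioms)

lemma space_P: "\<pi> \<in> space P \<Longrightarrow> \<kappa> \<in> ix \<Longrightarrow> \<pi> \<kappa> permutes {..<b}"
  by (auto simp: P_eq space_PiM PiE_iff space_uniform_count_measure)

lemma measurable_perm [measurable]:
  "\<kappa> \<in> ix \<Longrightarrow> (\<lambda>\<pi>. h (\<pi> \<kappa>)) \<in> measurable P (count_space UNIV)"
  unfolding P_eq
  by (rule measurable_compose[OF measurable_component_singleton])
     (auto simp: measurable_def space_uniform_count_measure sets_uniform_count_measure_count_space)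

lemma cyclic_comp_permutes: "p permutes {..<b} \<Longrightarrow> cyclic_perm b c \<circ> p permutes {..<b}"
  using permutes_compose[OF _ cyclic_perm_permutes] b_gt_1 by simp

lemma cyclic_shift_space:
  assumes "\<kappa> \<in> ix" "\<pi> \<in> PiE ix (\<lambda>_. perms)"
  shows "cyclic_shift b c \<kappa> \<pi> \<in> PiE ix (\<lambda>_. perms)"
  using PiE_fun_upd[of "cyclic_perm b c \<circ> \<pi> \<kappa>" "\<lambda>_. perms" \<kappa> \<pi> ix] cyclic_comp_permutes[of "\<pi> \<kappa>"]
    PiE_mem[OF assms(2,1)] assms
  by (simp only: cyclic_shift_def insert_absorb mem_Collect_eq)

lemma measurable_cyclic_shift:
  assumes "\<kappa> \<in> ix"
  shows "(\<lambda>\<pi>. cyclic_shift b c \<kappa> \<pi>) \<in> measurable P P" (is "?T \<in> _")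
  unfolding P_eq
proof (rule measurable_PiM_single'[where f = "\<lambda>i \<pi>. ?T \<pi> i"])
  fix i assume i: "i \<in> ix"
  show "(\<lambda>\<pi>. ?T \<pi> i) \<in> measurable (PiM ix (\<lambda>_. U)) U"
  proof (cases "i = \<kappa>")
    case True
    have "(\<lambda>p. cyclic_perm b c \<circ> p) \<in> measurable U U"
      by (auto simp: measurable_def space_uniform_count_measure sets_uniform_count_measure_count_space
          cyclic_comp_permutes)
    from measurable_compose[OF measurable_component_singleton[OF assms] this] True show ?thesis
      by (simp only: cyclic_shift_def fun_upd_apply if_True simp_thms)
  next
    case False
    then show ?thesis
      using measurable_component_singleton[OF i, of "\<lambda>_. U"] by (simp only: cyclic_shift_def fun_upd_apply if_False)
  qed
next
  show "(\<lambda>\<pi>. ?T \<pi>) \<in> space (PiM ix (\<lambda>_. U)) \<rightarrow> PiE ix (\<lambda>_. space U)"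
    using cyclic_shift_space[OF assms] by (simp only: space_PiM space_uniform_count_measure Pi_I)
qed

text \<open>Left translation in one factor preserves the uniform measure on the permutations, and
  therefore the product measure. By uniqueness of product measures it is enough to compare the
  values on cylinders.\<close>

lemma distr_cyclic_shift:
  assumes "\<kappa> \<in> ix"
  shows "distr P P (\<lambda>\<pi>. cyclic_shift b c \<kappa> \<pi>) = P" (is "distr P P ?T = P")
proof -
  let ?t = "cyclic_perm b c"
  have t: "?t permutes {..<b}" using cyclic_perm_permutes b_gt_1 by simp
  have "distr P P ?T = PiM ix (\<lambda>_. U)"
  proof (rule prod.PiM_eq)
    fix J and F :: "nat \<times> nat list \<Rightarrow> (nat \<Rightarrow> nat) set"
    assume J: "finite J" "J \<subseteq> ix" and F: "\<And>j. j \<in> J \<Longrightarrow> F j \<in> sets U"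
    \<comment> \<open>The pullback of the cylinder: only its side at \<kappa> changes, to a set of
      permutations of the same cardinality.\<close>
    define F' where "F' = F(\<kappa> := {p \<in> perms. ?t \<circ> p \<in> F \<kappa>})"
    have F': "F' j \<in> sets U" if "j \<in> J" for j
      using F[OF that] by (auto simp: F'_def sets_uniform_count_measure_count_space)
    have emb: "\<pi> \<in> prod_emb ix (\<lambda>_. U) J (PiE J G) \<longleftrightarrow> \<pi> \<in> PiE ix (\<lambda>_. perms) \<and> (\<forall>j\<in>J. \<pi> j \<in> G j)"
      for \<pi> G
      by (auto simp: prod_emb_def space_uniform_count_measure restrict_PiE_iff)
    have "?T \<pi> j \<in> F j \<longleftrightarrow> \<pi> j \<in> F' j" if "\<pi> \<in> PiE ix (\<lambda>_. perms)" for \<pi> j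
      using PiE_mem[OF that assms] by (cases "j = \<kappa>") (auto simp: F'_def cyclic_shift_def)
    then have "?T -` prod_emb ix (\<lambda>_. U) J (PiE J F) \<inter> space P = prod_emb ix (\<lambda>_. U) J (PiE J F')"
      unfolding set_eq_iff Int_iff vimage_eq emb
      using cyclic_shift_space[OF assms]
      by (simp only: P_eq space_PiM space_uniform_count_measure) blast
    then have "emeasure (distr P P ?T) (prod_emb ix (\<lambda>_. U) J (PiE J F)) =
        emeasure (PiM ix (\<lambda>_. U)) (prod_emb ix (\<lambda>_. U) J (PiE J F'))"
      using J F by (subst emeasure_distr[OF measurable_cyclic_shift[OF assms]])
        (simp_all add: P_eq sets_PiM_I)
    also have "\<dots> = (\<Prod>j\<in>J. emeasure U (F' j))"
      using J F' by (intro prod.emeasure_PiM_emb) auto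
    also have "\<dots> = (\<Prod>j\<in>J. emeasure U (F j))"
    proof (rule prod.cong[OF refl])
      fix j assume j: "j \<in> J"
      show "emeasure U (F' j) = emeasure U (F j)"
      proof (cases "j = \<kappa>")
        case True
        have sub: "F \<kappa> \<subseteq> perms"
          using F[OF j] True by (auto simp: sets_uniform_count_measure_count_space)
        have "(\<lambda>p. ?t \<circ> p) ` F' \<kappa> = F \<kappa>"
        proof (intro equalityI subsetI)
          fix p assume p: "p \<in> F \<kappa>"
          have "inv ?t \<circ> p permutes {..<b}"
            using permutes_compose[OF _ permutes_inv[OF t]] sub p by auto
          moreover have eq: "?t \<circ> (inv ?t \<circ> p) = p"
            using permutes_inv_o(1)[OF t] by (simp add: o_assoc)
          ultimately show "p \<in> (\<lambda>p. ?t \<circ> p) ` F' \<kappa>"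
            using p by (intro image_eqI[where x = "inv ?t \<circ> p"]) (simp_all add: F'_def)
        qed (auto simp: F'_def)
        moreover have "inj_on (\<lambda>p. ?t \<circ> p) (F' \<kappa>)"
          using permutes_inj[OF t] by (auto simp: inj_on_def fun_eq_iff)
        ultimately have "card (F' \<kappa>) = card (F \<kappa>)"
          by (metis card_image)
        moreover have "F' \<kappa> \<subseteq> perms"
          by (auto simp: F'_def)
        ultimately show ?thesis
          using True sub finite_perms by (simp add: emeasure_uniform_count_measure)
      qed (simp add: F'_def)
    qed
    finally show "emeasure (distr P P ?T) (prod_emb ix (\<lambda>_. U) J (PiE J F)) =
        (\<Prod>j\<in>J. emeasure U (F j))" .
  qed (simp add: P_eq)
  then show ?thesis by (simp only: P_eq)
qed

lemma integral_cyclic_shift: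
  fixes g :: "_ \<Rightarrow> 'v::{banach, second_countable_topology}"
  assumes "\<kappa> \<in> ix" "g \<in> borel_measurable P"
  shows "(\<integral>\<pi>. g (cyclic_shift b c \<kappa> \<pi>) \<partial>P) = (\<integral>\<pi>. g \<pi> \<partial>P)"
  using integral_distr[OF measurable_cyclic_shift[OF assms(1)] assms(2), of c]
    distr_cyclic_shift[OF assms(1), of c] by simp

section \<open>The scrambled digits of a single point\<close>

context
  fixes z :: "nat \<Rightarrow> nat \<Rightarrow> nat"
  assumes z: "\<And>j a. z j a < b"
begin

lemma key_in_ix: "fst q \<in> {1..n} \<Longrightarrow> digit_key z q \<in> ix"
  using z by (auto simp: digit_key_def)

lemma scrambled_less: "\<pi> \<in> space P \<Longrightarrow> fst q \<in> {1..n} \<Longrightarrow> scrambled z \<pi> q < b"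
  using permutes_in_image[OF space_P[OF _ key_in_ix]] z by (auto simp: scrambled_def)

lemma measurable_scrambled [measurable]:
  "fst q \<in> {1..n} \<Longrightarrow> (\<lambda>\<pi>. scrambled z \<pi> q) \<in> measurable P (count_space UNIV)"
  unfolding scrambled_def using measurable_perm[OF key_in_ix] .

lemma scrambled_shift:
  assumes "fst q \<in> {1..n}" "\<pi> \<in> space P"
  shows "scrambled z (cyclic_shift b c \<kappa> \<pi>) q =
    (if digit_key z q = \<kappa> then (scrambled z \<pi> q + c) mod b else scrambled z \<pi> q)"
  using scrambled_less[OF assms(2,1)] by (auto simp: scrambled_def cyclic_perm_def cyclic_shift_def)

text \<open>Measurability and boundedness are read off from this finite combination of indicators,
  since the array of all scrambled digits is not treated as a random variable in its own
  right.\<close>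

lemma scrambled_as_sum:
  fixes g :: "(nat \<times> nat \<Rightarrow> nat) \<Rightarrow> 'v::real_vector"
  assumes "finite Q" "fst ` Q \<subseteq> {1..n}" "depends_on Q g" "\<pi> \<in> space P"
  shows "g (scrambled z \<pi>) =
    (\<Sum>\<xi>\<in>arrays b Q. indicator {\<pi>\<in>space P. \<forall>q\<in>Q. scrambled z \<pi> q = \<xi> q} \<pi> *\<^sub>R g \<xi>)"
proof -
  let ?\<zeta> = "restrict (scrambled z \<pi>) Q"
  have "?\<zeta> \<in> arrays b Q"
    using assms scrambled_less by auto
  then have "(\<Sum>\<xi>\<in>arrays b Q. indicator {\<pi>\<in>space P. \<forall>q\<in>Q. scrambled z \<pi> q = \<xi> q} \<pi> *\<^sub>R g \<xi>) =
      (\<Sum>\<xi>\<in>{?\<zeta>}. g \<xi>)"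
  proof (intro sum.mono_neutral_cong_right ballI)
    fix \<xi> assume \<xi>: "\<xi> \<in> arrays b Q - {?\<zeta>}"
    then obtain q where "\<xi> q \<noteq> ?\<zeta> q" by (metis DiffE ext singletonI)
    moreover have "q \<in> Q"
      using \<xi> calculation by (metis DiffD1 PiE_arb restrict_apply)
    ultimately have "\<not> (\<forall>q\<in>Q. scrambled z \<pi> q = \<xi> q)" by (metis restrict_apply')
    then show "indicator {\<pi>\<in>space P. \<forall>q\<in>Q. scrambled z \<pi> q = \<xi> q} \<pi> *\<^sub>R g \<xi> = 0"
      by simp
  qed (use assms in \<open>simp_all add: finite_PiE\<close>)
  also have "\<dots> = g (scrambled z \<pi>)"
  proof -
    have "g ?\<zeta> = g (scrambled z \<pi>)"
      by (rule depends_onD[OF assms(3)]) simp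
    then show ?thesis by (simp only: sum.insert[OF finite.emptyI] empty_iff simp_thms sum.empty add_0_right)
  qed
  finally show ?thesis by (rule sym)
qed

lemma borel_measurable_scrambled:
  fixes g :: "(nat \<times> nat \<Rightarrow> nat) \<Rightarrow> 'v::{real_normed_vector, second_countable_topology}"
  assumes "finite Q" "fst ` Q \<subseteq> {1..n}" "depends_on Q g"
  shows "(\<lambda>\<pi>. g (scrambled z \<pi>)) \<in> borel_measurable P"
proof -
  have "{\<pi>\<in>space P. \<forall>q\<in>Q. scrambled z \<pi> q = \<xi> q} \<in> sets P" for \<xi>
  proof (rule sets.sets_Collect_finite_All[OF _ assms(1)])
    fix q assume "q \<in> Q"
    then have "fst q \<in> {1..n}" using assms(2) by blast
    have "(\<lambda>\<pi>. scrambled z \<pi> q) -` {\<xi> q} \<inter> space P \<in> sets P"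
      by (rule measurable_sets[OF measurable_scrambled]) (use \<open>fst q \<in> {1..n}\<close> in simp_all)
    moreover have "(\<lambda>\<pi>. scrambled z \<pi> q) -` {\<xi> q} \<inter> space P = {\<pi>\<in>space P. scrambled z \<pi> q = \<xi> q}"
      by blast
    ultimately show "{\<pi>\<in>space P. scrambled z \<pi> q = \<xi> q} \<in> sets P"
      by (simp only:)
  qed
  then have "(\<lambda>\<pi>. \<Sum>\<xi>\<in>arrays b Q. indicator {\<pi>\<in>space P. \<forall>q\<in>Q. scrambled z \<pi> q = \<xi> q} \<pi> *\<^sub>R g \<xi>)
      \<in> borel_measurable P"
    by (intro borel_measurable_sum borel_measurable_scaleR borel_measurable_indicator borel_measurable_const)
  then show ?thesis
    using measurable_cong[where f = "\<lambda>\<pi>. g (scrambled z \<pi>)" and g = "\<lambda>\<pi>. \<Sum>\<xi>\<in>arrays b Q.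
        indicator {\<pi>\<in>space P. \<forall>q\<in>Q. scrambled z \<pi> q = \<xi> q} \<pi> *\<^sub>R g \<xi>" and M = P and M' = borel]
      scrambled_as_sum[OF assms] by blast
qed

lemma bounded_scrambled:
  fixes g :: "(nat \<times> nat \<Rightarrow> nat) \<Rightarrow> 'v::real_normed_vector"
  assumes "finite Q" "fst ` Q \<subseteq> {1..n}" "depends_on Q g" "\<pi> \<in> space P"
  shows "norm (g (scrambled z \<pi>)) \<le> (\<Sum>\<xi>\<in>arrays b Q. norm (g \<xi>))"
proof -
  have "norm (g (scrambled z \<pi>)) \<le>
      (\<Sum>\<xi>\<in>arrays b Q. norm (indicator {\<pi>\<in>space P. \<forall>q\<in>Q. scrambled z \<pi> q = \<xi> q} \<pi> *\<^sub>R g \<xi>))"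
    unfolding scrambled_as_sum[OF assms] by (rule norm_sum)
  also have "\<dots> \<le> (\<Sum>\<xi>\<in>arrays b Q. norm (g \<xi>))"
    by (intro sum_mono) (auto simp: indicator_def)
  finally show ?thesis .
qed

lemma integrable_scrambled:
  fixes g :: "(nat \<times> nat \<Rightarrow> nat) \<Rightarrow> 'v::{banach, second_countable_topology}"
  assumes "finite Q" "fst ` Q \<subseteq> {1..n}" "depends_on Q g"
  shows "integrable P (\<lambda>\<pi>. g (scrambled z \<pi>))"
  by (rule P.integrable_const_bound[where B = "\<Sum>\<xi>\<in>arrays b Q. norm (g \<xi>)"])
     (use borel_measurable_scrambled[OF assms] bounded_scrambled[OF assms] in auto)

text \<open>Positions start at 1, so distinct digits of one point have distinct keys by
  \<open>digit_key_inj\<close>; a shift at the key of q moves digit q and no other.\<close>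

lemma scrambled_shift_array:
  assumes "q \<in> Q" "Q \<subseteq> {1..n} \<times> {1..}" "\<pi> \<in> space P" "depends_on Q g"
  shows "g (scrambled z (cyclic_shift b c (digit_key z q) \<pi>)) = g ((scrambled z \<pi>)(q := (scrambled z \<pi> q + c) mod b))"
proof (rule depends_onD[OF assms(4)])
  fix p assume p: "p \<in> Q"
  have "digit_key z p = digit_key z q \<longleftrightarrow> p = q"
  proof -
    have "1 \<le> snd p" "1 \<le> snd q" using p assms(1,2) by auto
    then show ?thesis using digit_key_inj by blast
  qed
  then show "scrambled z (cyclic_shift b c (digit_key z q) \<pi>) p = ((scrambled z \<pi>)(q := (scrambled z \<pi> q + c) mod b)) p"
    using p assms by (subst scrambled_shift) auto
qed

text \<open>The b cyclic shifts at the key of q preserve the measure, and their mean acts on the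
  digit array as the average over digit q.\<close>

lemma integral_scrambled_avg:
  fixes g :: "(nat \<times> nat \<Rightarrow> nat) \<Rightarrow> 'v::{banach, second_countable_topology}"
  assumes "finite Q" "q \<in> Q" "Q \<subseteq> {1..n} \<times> {1..}" "depends_on Q g"
  shows "(\<integral>\<pi>. avg b q g (scrambled z \<pi>) \<partial>P) = (\<integral>\<pi>. g (scrambled z \<pi>) \<partial>P)"
proof -
  let ?\<kappa> = "digit_key z q"
  have fQ: "fst ` Q \<subseteq> {1..n}" and q: "fst q \<in> {1..n}" using assms by auto
  have int: "integrable P (\<lambda>\<pi>. g (scrambled z \<pi>))"
    by (rule integrable_scrambled[OF assms(1) fQ assms(4)])
  have int': "integrable P (\<lambda>\<pi>. g (scrambled z (cyclic_shift b c ?\<kappa> \<pi>)))" for c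
    using integrable_distr[OF measurable_cyclic_shift[OF key_in_ix[OF q]], of c "\<lambda>\<pi>. g (scrambled z \<pi>)"]
      distr_cyclic_shift[OF key_in_ix[OF q], of c] int by (simp only:)
  have inv: "(\<integral>\<pi>. g (scrambled z (cyclic_shift b c ?\<kappa> \<pi>)) \<partial>P) = (\<integral>\<pi>. g (scrambled z \<pi>) \<partial>P)" for c
    by (rule integral_cyclic_shift[OF key_in_ix[OF q] borel_measurable_integrable[OF int]])
  have "(\<integral>\<pi>. avg b q g (scrambled z \<pi>) \<partial>P) =
      (\<integral>\<pi>. (\<Sum>c<b. g (scrambled z (cyclic_shift b c ?\<kappa> \<pi>))) /\<^sub>R real b \<partial>P)"
  proof (intro Bochner_Integration.integral_cong refl)
    fix \<pi> assume \<pi>: "\<pi> \<in> space P"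
    show "avg b q g (scrambled z \<pi>) = (\<Sum>c<b. g (scrambled z (cyclic_shift b c ?\<kappa> \<pi>))) /\<^sub>R real b"
      unfolding scrambled_shift_array[OF assms(2,3) \<pi> assms(4)]
      by (rule avg_shift) (rule scrambled_less[OF \<pi> q])
  qed
  also have "\<dots> = (\<Sum>c<b. \<integral>\<pi>. g (scrambled z (cyclic_shift b c ?\<kappa> \<pi>)) \<partial>P) /\<^sub>R real b"
    by (subst integral_scaleR_right, subst Bochner_Integration.integral_sum) (rule int', rule refl)
  also have "\<dots> = (\<integral>\<pi>. g (scrambled z \<pi>) \<partial>P)"
    unfolding inv using b_gt_1 by (simp add: sum_constant_scaleR)
  finally show ?thesis .
qed

text \<open>In probabilistic terms: any finitely many scrambled digits of one point are independent
  and uniform. The digits are averaged out successively, until the integrand is constant.\<close>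

lemma integral_scrambled:
  fixes g :: "(nat \<times> nat \<Rightarrow> nat) \<Rightarrow> 'v::{banach, second_countable_topology}"
  assumes "finite Q" "Q \<subseteq> {1..n} \<times> {1..}" "depends_on Q g"
  shows "(\<integral>\<pi>. g (scrambled z \<pi>) \<partial>P) = array_mean b Q g"
proof -
  obtain qs where qs: "set qs = Q" "distinct qs"
    using finite_distinct_list[OF assms(1)] by blast
  have dep: "depends_on Q (foldr (avg b) zs g)" for zs
    by (induction zs) (auto intro: depends_on_avg assms)
  have 1: "(\<integral>\<pi>. foldr (avg b) zs g (scrambled z \<pi>) \<partial>P) = (\<integral>\<pi>. g (scrambled z \<pi>) \<partial>P)" if "set zs \<subseteq> Q" for zs
    using that by (induction zs) (auto simp: integral_scrambled_avg[OF assms(1) _ assms(2) dep])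
  have 2: "foldr (avg b) qs g (scrambled z \<pi>) = array_mean b Q g" for \<pi>
  proof -
    have "g (\<lambda>q. if q \<in> Q then \<zeta> q else scrambled z \<pi> q) = g \<zeta>" for \<zeta>
      by (rule depends_onD[OF assms(3)]) simp
    then show ?thesis
      using avgs_eq_array_mean[OF assms(1) _ qs(2), of b g "scrambled z \<pi>"] qs(1) b_gt_1
      by (simp only: order_refl)
  qed
  show ?thesis
    using 1[of qs] unfolding 2 using qs(1) P.prob_space by simp
qed

end

text \<open>Averaging over the shifts at the key of q in the first point annihilates the first
  factor, provided that the second is unaffected: either it does not read digit q, or at q the
  second point uses a different permutation. Both kinds of orthogonality, between components and
  between points, come from here.\<close>

lemma integral_scrambled_inner_eq_0:
  fixes g h :: "(nat \<times> nat \<Rightarrow> nat) \<Rightarrow> 'v::euclidean_space"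
  assumes z: "\<And>j a. z j a < b" "\<And>j a. z' j a < b"
    and Q: "finite Q" "Q \<subseteq> {1..n} \<times> {1..}" "q \<in> Q" "depends_on Q g" "depends_on Q h"
    and g: "avg b q g = (\<lambda>_. 0)"
    and h: "(\<forall>\<xi> c. h (\<xi>(q := c)) = h \<xi>) \<or>
      digit_key z q \<noteq> digit_key z' q"
  shows "(\<integral>\<pi>. g (scrambled z \<pi>) \<bullet> h (scrambled z' \<pi>) \<partial>P) = 0"
proof -
  let ?\<kappa> = "digit_key z q"
  have fQ: "fst ` Q \<subseteq> {1..n}" and q: "fst q \<in> {1..n}" using Q by auto
  have meas: "(\<lambda>\<pi>. g (scrambled z \<pi>) \<bullet> h (scrambled z' \<pi>)) \<in> borel_measurable P"
    using borel_measurable_scrambled[where z = z, OF z(1) Q(1) fQ Q(4)]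
      borel_measurable_scrambled[where z = z', OF z(2) Q(1) fQ Q(5)] by simp
  have int: "integrable P (\<lambda>\<pi>. g (scrambled z \<pi>) \<bullet> h (scrambled z' \<pi>))"
  proof (rule P.integrable_const_bound)
    show "AE \<pi> in P. norm (g (scrambled z \<pi>) \<bullet> h (scrambled z' \<pi>)) \<le>
        (\<Sum>\<xi>\<in>arrays b Q. norm (g \<xi>)) * (\<Sum>\<xi>\<in>arrays b Q. norm (h \<xi>))"
    proof (rule AE_I2)
      fix \<pi> assume "\<pi> \<in> space P"
      then have "norm (g (scrambled z \<pi>)) * norm (h (scrambled z' \<pi>)) \<le>
          (\<Sum>\<xi>\<in>arrays b Q. norm (g \<xi>)) * (\<Sum>\<xi>\<in>arrays b Q. norm (h \<xi>))"
        using bounded_scrambled[where z = z, OF z(1) Q(1) fQ Q(4)]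
          bounded_scrambled[where z = z', OF z(2) Q(1) fQ Q(5)]
        by (intro mult_mono) (auto intro: sum_nonneg)
      then show "norm (g (scrambled z \<pi>) \<bullet> h (scrambled z' \<pi>)) \<le>
          (\<Sum>\<xi>\<in>arrays b Q. norm (g \<xi>)) * (\<Sum>\<xi>\<in>arrays b Q. norm (h \<xi>))"
        using Cauchy_Schwarz_ineq2 order_trans by (fastforce simp: real_norm_def)
    qed
  qed (fact meas)
  let ?T = "\<lambda>c \<pi>. cyclic_shift b c ?\<kappa> \<pi>"
  have int': "integrable P (\<lambda>\<pi>. g (scrambled z (?T c \<pi>)) \<bullet> h (scrambled z' (?T c \<pi>)))" for c
    using integrable_distr[OF measurable_cyclic_shift[OF key_in_ix[where z = z, OF z(1) q]], of c
        "\<lambda>\<pi>. g (scrambled z \<pi>) \<bullet> h (scrambled z' \<pi>)"]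
      distr_cyclic_shift[OF key_in_ix[where z = z, OF z(1) q], of c] int by (simp only:)
  have h': "h (scrambled z' (?T c \<pi>)) = h (scrambled z' \<pi>)" if \<pi>: "\<pi> \<in> space P" for \<pi> c
  proof (cases "digit_key z q = digit_key z' q")
    case True
    with h have "\<forall>\<xi> c. h (\<xi>(q := c)) = h \<xi>" by blast
    then show ?thesis
      unfolding True by (subst scrambled_shift_array[where z = z', OF z(2) Q(3,2) \<pi> Q(5)]) blast
  next
    case False
    show ?thesis
    proof (rule depends_onD[OF Q(5)])
      fix p assume p: "p \<in> Q"
      have "1 \<le> snd p" "1 \<le> snd q" "fst p \<in> {1..n}" using Q p by auto
      then have "digit_key z' p \<noteq> ?\<kappa>"
        using digit_key_inj[of p q z' z] False by metis
      then show "scrambled z' (?T c \<pi>) p = scrambled z' \<pi> p"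
        using \<open>fst p \<in> {1..n}\<close> \<pi> by (subst scrambled_shift[where z = z', OF z(2)]) simp_all
    qed
  qed
  have "real b * (\<integral>\<pi>. g (scrambled z \<pi>) \<bullet> h (scrambled z' \<pi>) \<partial>P) =
      (\<Sum>c<b. \<integral>\<pi>. g (scrambled z (?T c \<pi>)) \<bullet> h (scrambled z' (?T c \<pi>)) \<partial>P)"
    unfolding integral_cyclic_shift[OF key_in_ix[where z = z, OF z(1) q] meas] by simp
  also have "\<dots> = (\<integral>\<pi>. (\<Sum>c<b. g (scrambled z (?T c \<pi>)) \<bullet> h (scrambled z' (?T c \<pi>))) \<partial>P)"
    by (rule Bochner_Integration.integral_sum[symmetric]) (rule int')
  also have "\<dots> = (\<integral>\<pi>. (real b *\<^sub>R avg b q g (scrambled z \<pi>)) \<bullet> h (scrambled z' \<pi>) \<partial>P)"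
  proof (intro Bochner_Integration.integral_cong refl)
    fix \<pi> assume \<pi>: "\<pi> \<in> space P"
    have "(\<Sum>c<b. g (scrambled z (?T c \<pi>)) \<bullet> h (scrambled z' (?T c \<pi>))) =
        (\<Sum>c<b. g ((scrambled z \<pi>)(q := (scrambled z \<pi> q + c) mod b))) \<bullet> h (scrambled z' \<pi>)"
      unfolding scrambled_shift_array[where z = z, OF z(1) Q(3,2) \<pi> Q(4)] h'[OF \<pi>] inner_sum_left ..
    also have "(\<Sum>c<b. g ((scrambled z \<pi>)(q := (scrambled z \<pi> q + c) mod b))) = real b *\<^sub>R avg b q g (scrambled z \<pi>)"
      using avg_shift[of "scrambled z \<pi>" q b g, OF scrambled_less[where z = z, OF z(1) \<pi> q]] b_gt_1 by simp
    finally show "(\<Sum>c<b. g (scrambled z (?T c \<pi>)) \<bullet> h (scrambled z' (?T c \<pi>))) =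
        (real b *\<^sub>R avg b q g (scrambled z \<pi>)) \<bullet> h (scrambled z' \<pi>)" .
  qed
  also have "\<dots> = 0" by (simp add: g)
  finally show ?thesis using b_gt_1 by simp
qed

end

section \<open>Variance of scrambled nets\<close>

text \<open>The inserted 0 is the level of a coordinate without digits in v.\<close>

definition level :: "(nat \<times> nat) set \<Rightarrow> nat \<Rightarrow> nat" where
  "level v j = Max (insert 0 {a. (j, a) \<in> v})"

lemma depends_on_mono: "v \<subseteq> Q \<Longrightarrow> depends_on v g \<Longrightarrow> depends_on Q g"
  unfolding depends_on_def by (meson subsetD)

lemma finite_level_set: "finite v \<Longrightarrow> finite {a. (j, a) \<in> v}"
  by (rule finite_subset[of _ "snd ` v"]) force+

lemma level_ge: "finite v \<Longrightarrow> (j, a) \<in> v \<Longrightarrow> a \<le> level v j"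
  unfolding level_def by (intro Max_ge) (auto simp: finite_level_set)

lemma level_mem: "finite v \<Longrightarrow> 0 < level v j \<Longrightarrow> (j, level v j) \<in> v"
  using Max_in[of "insert 0 {a. (j, a) \<in> v}"] by (auto simp: level_def finite_level_set)

lemma exists_bounded_fun_sum:
  fixes u :: "nat \<Rightarrow> nat"
  assumes "T \<le> (\<Sum>j=1..n. u j)"
  shows "\<exists>c. (\<forall>j. c j \<le> u j) \<and> (\<Sum>j=1..n. c j) = T"
  using assms
proof (induction n arbitrary: T)
  case 0
  then show ?case by (intro exI[of _ "\<lambda>_. 0"]) auto
next
  case (Suc n)
  define x where "x = min T (u (Suc n))"
  have "T - x \<le> (\<Sum>j=1..n. u j)"
    using Suc.prems by (auto simp: x_def)
  from Suc.IH[OF this] obtain c where c: "\<forall>j. c j \<le> u j" "(\<Sum>j=1..n. c j) = T - x" by blast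
  have "(\<Sum>j=1..n. (c(Suc n := x)) j) = (\<Sum>j=1..n. c j)"
    by (intro sum.cong) auto
  then have "(\<Sum>j=1..Suc n. (c(Suc n := x)) j) = T"
    using c(2) by (simp add: x_def)
  then show ?case
    using c(1) by (intro exI[of _ "c(Suc n := x)"]) (auto simp: x_def)
qed

context scrambling
begin

text \<open>Scrambling as a map of finite arrays. The zeros outside B are harmless when B consists
  of initial segments, since then no digit in B is preceded by one outside.\<close>

definition scramble_array :: "(nat \<times> nat list \<Rightarrow> nat \<Rightarrow> nat) \<Rightarrow> (nat \<times> nat) set \<Rightarrow> (nat \<times> nat \<Rightarrow> nat) \<Rightarrow> nat \<times> nat \<Rightarrow> nat" where
  "scramble_array \<pi> B \<zeta> = restrict (scrambled (\<lambda>j a. if (j, a) \<in> B then \<zeta> (j, a) else 0) \<pi>) B"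

text \<open>Digits are recovered from left to right: once the preceding digits of a coordinate
  agree, both arrays use the same permutation at the next digit, and permutations are injective.
  Finiteness gives surjectivity.\<close>

lemma bij_scramble_array:
  assumes \<pi>: "\<pi> \<in> space P" and B: "B = Sigma {1..n} (\<lambda>j. {1..lv j})"
  shows "bij_betw (scramble_array \<pi> B) (arrays b B) (arrays b B)"
proof -
  have fin: "finite B" by (simp add: B)
  let ?e = "\<lambda>\<zeta> j a. if (j, a) \<in> B then \<zeta> (j, a) else (0::nat)"
  have e: "?e \<zeta> j a < b" if "\<zeta> \<in> arrays b B" for \<zeta> j a
    using that b_gt_1 by (auto simp: PiE_iff)
  have inj: "inj_on (scramble_array \<pi> B) (arrays b B)"
  proof (rule inj_onI)
    fix x y assume x: "x \<in> arrays b B" and y: "y \<in> arrays b B" and eq: "scramble_array \<pi> B x = scramble_array \<pi> B y"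
    have "(j, a) \<in> B \<longrightarrow> x (j, a) = y (j, a)" for j a
    proof (induction a rule: less_induct)
      case (less a)
      show ?case
      proof
        assume ja: "(j, a) \<in> B"
        have "?e x j a' = ?e y j a'" if "a' \<in> {1..<a}" for a'
          using less[of a'] that by auto
        then have key: "digit_key (?e x) (j, a) = digit_key (?e y) (j, a)"
          unfolding digit_key_def fst_conv snd_conv
          by (intro arg_cong2[where f = Pair] refl map_cong) (simp only: set_upt)
        have "scrambled (?e x) \<pi> (j, a) = scrambled (?e y) \<pi> (j, a)"
          using fun_cong[OF eq, of "(j, a)"] ja unfolding scramble_array_def by (simp only: restrict_apply')
        then have eq': "\<pi> (digit_key (?e y) (j, a)) (x (j, a)) = \<pi> (digit_key (?e y) (j, a)) (y (j, a))"
          unfolding scrambled_def key fst_conv snd_conv using ja by (simp only: if_True)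
        have ix: "digit_key (?e y) (j, a) \<in> ix"
        proof (rule key_in_ix)
          show "?e y j a < b" for j a by (rule e[OF y])
          show "fst (j, a) \<in> {1..n}" using ja by (simp add: B)
        qed
        show "x (j, a) = y (j, a)"
          by (rule injD[OF permutes_inj[OF space_P[OF \<pi> ix]] eq'])
      qed
    qed
    then show "x = y"
      by (intro PiE_ext[OF x y]) (metis prod.collapse)
  qed
  moreover have "scramble_array \<pi> B ` arrays b B \<subseteq> arrays b B"
  proof
    fix w assume "w \<in> scramble_array \<pi> B ` arrays b B"
    then obtain \<zeta> where \<zeta>: "\<zeta> \<in> arrays b B" "w = scramble_array \<pi> B \<zeta>" by blast
    have "scrambled (?e \<zeta>) \<pi> q < b" if "q \<in> B" for q
    proof (rule scrambled_less[OF _ \<pi>])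
      show "?e \<zeta> j a < b" for j a by (rule e[OF \<zeta>(1)])
      show "fst q \<in> {1..n}" using that by (auto simp: B)
    qed
    then show "w \<in> arrays b B"
      by (simp add: \<zeta>(2) scramble_array_def)
  qed
  ultimately show ?thesis
    by (simp add: bij_betw_def endo_inj_surj finite_PiE fin)
qed

section \<open>Variance for a function of finitely many digits of a scrambled point set\<close>

context
  fixes m M L :: nat and z :: "nat \<Rightarrow> nat \<Rightarrow> nat \<Rightarrow> nat" and qs :: "(nat \<times> nat) list"
  assumes z: "\<And>i j a. z i j a < b" and Mm: "M \<le> m"
    and net: "\<And>c y. (\<Sum>j=1..n. c j) \<le> M \<Longrightarrow> (\<And>j a. y j a < b) \<Longrightarrow>
      card {i. i < b ^ m \<and> (\<forall>j\<in>{1..n}. \<forall>a\<in>{1..c j}. z i j a = y j a)} * b ^ (\<Sum>j=1..n. c j) = b ^ m"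
    and qs: "set qs = {1..n} \<times> {1..L}" "distinct qs"
begin

abbreviation "Q \<equiv> {1..n} \<times> {1..L}"

text \<open>Among the points, every content of the leading digits up to the levels of v occurs
  equally often, and for a fixed scrambling these contents are merely permuted. The sum is thus a
  multiple of the mean of g over all arrays, which vanishes. It is zero for every scrambling, not
  just on average.\<close>

lemma sum_net_eq_0:
  fixes g :: "(nat \<times> nat \<Rightarrow> nat) \<Rightarrow> 'v::euclidean_space"
  assumes \<pi>: "\<pi> \<in> space P" and v: "v \<subseteq> Q" "q \<in> v" "depends_on v g" "avg b q g = (\<lambda>_. 0)"
    and le: "(\<Sum>j=1..n. level v j) \<le> M"
  shows "(\<Sum>i<b ^ m. g (scrambled (z i) \<pi>)) = 0"
proof -
  \<comment> \<open>The set v need not contain the digits that precede its elements, but scrambling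
    depends on them; \<open>B\<close> adds them.\<close>
  define B where "B = Sigma {1..n} (\<lambda>j. {1..level v j})"
  have fin: "finite B" by (simp add: B_def)
  have finv: "finite v" using v(1) by (rule finite_subset) simp
  have cardB: "card B = (\<Sum>j=1..n. level v j)" by (simp add: B_def)
  have vB: "v \<subseteq> B" using v(1) level_ge[OF finv] by (force simp: B_def)
  define \<zeta> where "\<zeta> i = restrict (\<lambda>(j, a). z i j a) B" for i
  have \<zeta>: "\<zeta> i \<in> arrays b B" for i using z by (auto simp: \<zeta>_def)
  have 1: "g (scrambled (z i) \<pi>) = g (scramble_array \<pi> B (\<zeta> i))" for i
  proof (rule depends_onD[OF v(3)])
    fix p assume "p \<in> v"
    then have p: "p \<in> B" using vB by blast
    then obtain j a where ja: "p = (j, a)" "j \<in> {1..n}" "a \<in> {1..level v j}" by (auto simp: B_def)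
    have "digit_key (\<lambda>j a. if (j, a) \<in> B then \<zeta> i (j, a) else 0) p = digit_key (z i) p"
      using ja by (auto simp: digit_key_def \<zeta>_def B_def)
    then show "scrambled (z i) \<pi> p = scramble_array \<pi> B (\<zeta> i) p"
      using p ja(1) by (simp add: scramble_array_def scrambled_def) (simp add: \<zeta>_def)
  qed
  \<comment> \<open>The net property, in the form that every array on \<open>B\<close> is the
    leading part of the same number of points.\<close>
  have card: "real (card {i. i < b ^ m \<and> \<zeta> i = y}) = real (b ^ m) / real (b ^ card B)" if y: "y \<in> arrays b B" for y
  proof -
    define y' where "y' = (\<lambda>j a. if (j, a) \<in> B then y (j, a) else 0)"
    have "y' j a < b" for j a using y b_gt_1 by (auto simp: y'_def PiE_iff)
    note net[of "level v" y', OF le this]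
    moreover have "\<zeta> i = y \<longleftrightarrow> (\<forall>j\<in>{1..n}. \<forall>a\<in>{1..level v j}. z i j a = y' j a)" for i
    proof
      assume "\<zeta> i = y"
      then show "\<forall>j\<in>{1..n}. \<forall>a\<in>{1..level v j}. z i j a = y' j a"
        by (auto simp: \<zeta>_def y'_def B_def)
    next
      assume "\<forall>j\<in>{1..n}. \<forall>a\<in>{1..level v j}. z i j a = y' j a"
      then show "\<zeta> i = y"
        by (intro PiE_ext[OF \<zeta> y]) (auto simp: \<zeta>_def y'_def B_def)
    qed
    ultimately have "card {i. i < b ^ m \<and> \<zeta> i = y} * b ^ card B = b ^ m"
      unfolding cardB by (simp only:)
    then have "real (card {i. i < b ^ m \<and> \<zeta> i = y}) * real (b ^ card B) = real (b ^ m)"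
      unfolding of_nat_mult[symmetric] by (simp only:)
    then show ?thesis
      using b_gt_1 by (simp add: field_simps)
  qed
  have "(\<Sum>i<b ^ m. g (scrambled (z i) \<pi>)) = (\<Sum>i<b ^ m. g (scramble_array \<pi> B (\<zeta> i)))"
    unfolding 1 ..
  also have "\<dots> = (\<Sum>y\<in>arrays b B. \<Sum>i\<in>{i. i < b ^ m \<and> \<zeta> i = y}. g (scramble_array \<pi> B (\<zeta> i)))"
  proof -
    have "{i \<in> {..<b ^ m}. \<zeta> i = y} = {i. i < b ^ m \<and> \<zeta> i = y}" for y by auto
    moreover have "\<zeta> ` {..<b ^ m} \<subseteq> arrays b B" using \<zeta> by blast
    ultimately show ?thesis
      using sum.group[of "{..<b ^ m}" "arrays b B" \<zeta> "\<lambda>i. g (scramble_array \<pi> B (\<zeta> i))"] fin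
      by (simp add: finite_PiE)
  qed
  also have "\<dots> = (\<Sum>y\<in>arrays b B. (real (b ^ m) / real (b ^ card B)) *\<^sub>R g (scramble_array \<pi> B y))"
  proof (rule sum.cong[OF refl])
    fix y assume y: "y \<in> arrays b B"
    have "(\<Sum>i\<in>{i. i < b ^ m \<and> \<zeta> i = y}. g (scramble_array \<pi> B (\<zeta> i))) =
        (\<Sum>i\<in>{i. i < b ^ m \<and> \<zeta> i = y}. g (scramble_array \<pi> B y))"
      by (rule sum.cong) auto
    also have "\<dots> = (real (b ^ m) / real (b ^ card B)) *\<^sub>R g (scramble_array \<pi> B y)"
      unfolding sum_constant_scaleR card[OF y] ..
    finally show "(\<Sum>i\<in>{i. i < b ^ m \<and> \<zeta> i = y}. g (scramble_array \<pi> B (\<zeta> i))) =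
        (real (b ^ m) / real (b ^ card B)) *\<^sub>R g (scramble_array \<pi> B y)" .
  qed
  also have "\<dots> = (real (b ^ m) / real (b ^ card B)) *\<^sub>R (\<Sum>y\<in>arrays b B. g y)"
    unfolding scaleR_sum_right[symmetric]
    by (subst sum.reindex_bij_betw[OF bij_scramble_array[OF \<pi> B_def], of g]) (rule refl)
  also have "(\<Sum>y\<in>arrays b B. g y) = 0"
  proof -
    have "array_mean b B g = array_mean b B (avg b q g)"
      using array_mean_avg[OF fin, of q b g] vB v(2) b_gt_1 by auto
    also have "\<dots> = 0" unfolding v(4) by (simp add: array_mean_def)
    finally show ?thesis using b_gt_1 by (simp add: array_mean_def)
  qed
  finally show ?thesis by simp
qed

text \<open>Equal keys at the last digit of v in coordinate j force agreement of the first
  \<open>level v j - 1\<close> digits. The digit at the level itself may differ, so up to n of the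
  more than M digits are lost; this is the origin of the factor b^n.\<close>

lemma card_same_keys:
  assumes v: "v \<subseteq> Q" and gt: "M < (\<Sum>j=1..n. level v j)"
  shows "real (card {i'. i' < b ^ m \<and> (\<forall>q\<in>v. digit_key (z i) q = digit_key (z i') q)}) \<le> real b ^ (m + n) / real b ^ M"
proof -
  have finv: "finite v" using v by (rule finite_subset) simp
  have "(\<Sum>j=1..n. level v j) \<le> (\<Sum>j=1..n. (level v j - 1) + 1)"
    by (intro sum_mono) simp
  then have *: "(\<Sum>j=1..n. level v j) \<le> (\<Sum>j=1..n. level v j - 1) + n"
    by (simp only: sum.distrib) simp
  \<comment> \<open>Cutting the number of prescribed digits down to at most M brings it into the
    range of the net property, while at least M - n of them remain.\<close>
  define T where "T = min M (\<Sum>j=1..n. level v j - 1)"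
  obtain c where c: "\<And>j. c j \<le> level v j - 1" "(\<Sum>j=1..n. c j) = T"
    using exists_bounded_fun_sum[of T "\<lambda>j. level v j - 1" n] by (auto simp: T_def)
  have T: "T \<le> M" "M \<le> T + n" using * gt by (auto simp: T_def)
  let ?S = "{i'. i' < b ^ m \<and> (\<forall>j\<in>{1..n}. \<forall>a\<in>{1..c j}. z i' j a = z i j a)}"
  have "{i'. i' < b ^ m \<and> (\<forall>q\<in>v. digit_key (z i) q = digit_key (z i') q)} \<subseteq> ?S"
  proof (intro subsetI, elim CollectE conjE, intro CollectI conjI ballI)
    fix i' j a assume i': "\<forall>q\<in>v. digit_key (z i) q = digit_key (z i') q" and ja: "j \<in> {1..n}" "a \<in> {1..c j}"
    have lt: "a < level v j" using ja c(1)[of j] by auto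
    then have "(j, level v j) \<in> v" by (intro level_mem[OF finv]) auto
    then have "digit_key (z i) (j, level v j) = digit_key (z i') (j, level v j)" using i' by blast
    then show "z i' j a = z i j a" using lt ja by (auto simp: digit_key_def)
  qed
  then have "card {i'. i' < b ^ m \<and> (\<forall>q\<in>v. digit_key (z i) q = digit_key (z i') q)} \<le> card ?S"
    by (intro card_mono) auto
  moreover have "real (card ?S) * real b ^ T = real b ^ m"
  proof -
    have "card ?S * b ^ (\<Sum>j=1..n. c j) = b ^ m"
      by (rule net[of c "z i", OF _ z]) (simp only: c(2) T(1))
    then show ?thesis
      unfolding c(2) of_nat_power[symmetric] of_nat_mult[symmetric] by (simp only:)
  qed
  moreover have "real b ^ M \<le> real b ^ (T + n)"
    using T b_gt_1 by (intro power_increasing) auto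
  ultimately show ?thesis
  proof -
    assume 1: "card {i'. i' < b ^ m \<and> (\<forall>q\<in>v. digit_key (z i) q = digit_key (z i') q)} \<le> card ?S"
      and 2: "real (card ?S) * real b ^ T = real b ^ m" and 3: "real b ^ M \<le> real b ^ (T + n)"
    have "real (card ?S) * real b ^ M \<le> real (card ?S) * real b ^ (T + n)"
      using 3 by (intro mult_left_mono) auto
    also have "\<dots> = real b ^ (m + n)"
      unfolding power_add by (simp add: 2[symmetric])
    finally have "real (card ?S) \<le> real b ^ (m + n) / real b ^ M"
      using b_gt_1 by (simp add: pos_le_divide_eq)
    then show ?thesis using 1 by linarith
  qed
qed

text \<open>Two points whose keys differ at some digit of v are uncorrelated; the covariance of any
  other pair is bounded by the mean square of g. For each point the number of such partners is
  bounded by \<open>card_same_keys\<close>.\<close>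

lemma expectation_norm_sum_le:
  fixes g :: "(nat \<times> nat \<Rightarrow> nat) \<Rightarrow> 'v::euclidean_space"
  assumes v: "v \<subseteq> Q" "depends_on v g" "\<And>q. q \<in> v \<Longrightarrow> avg b q g = (\<lambda>_. 0)"
    and gt: "M < (\<Sum>j=1..n. level v j)"
  shows "(\<integral>\<pi>. (norm (\<Sum>i<b ^ m. g (scrambled (z i) \<pi>)))\<^sup>2 \<partial>P) \<le>
    real b ^ m * (real b ^ (m + n) / real b ^ M) * array_mean b Q (\<lambda>\<xi>. (norm (g \<xi>))\<^sup>2)"
proof -
  let ?E = "array_mean b Q (\<lambda>\<xi>. (norm (g \<xi>))\<^sup>2)"
  have fQ: "fst ` Q \<subseteq> {1..n}" and QQ: "Q \<subseteq> {1..n} \<times> {1..}" and finQ: "finite Q" by auto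
  have dep: "depends_on Q g" by (rule depends_on_mono[OF v(1,2)])
  have dep2: "depends_on Q (\<lambda>\<xi>. (norm (g \<xi>))\<^sup>2)"
    unfolding depends_on_def using depends_onD[OF dep] by metis
  have E: "(\<integral>\<pi>. (norm (g (scrambled (z i) \<pi>)))\<^sup>2 \<partial>P) = ?E" for i
    by (rule integral_scrambled[where z = "z i", OF z finQ QQ dep2])
  have intE: "integrable P (\<lambda>\<pi>. (norm (g (scrambled (z i) \<pi>)))\<^sup>2)" for i
    by (rule integrable_scrambled[where z = "z i", OF z finQ fQ dep2])
  have meas: "(\<lambda>\<pi>. g (scrambled (z i) \<pi>)) \<in> borel_measurable P" for i
    by (rule borel_measurable_scrambled[where z = "z i", OF z finQ fQ dep])
  have bnd: "\<bar>x \<bullet> y\<bar> \<le> ((norm x)\<^sup>2 + (norm y)\<^sup>2) / 2" for x y :: 'v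
  proof -
    have "\<bar>x \<bullet> y\<bar> \<le> norm x * norm y" by (rule Cauchy_Schwarz_ineq2)
    moreover have "0 \<le> (norm x - norm y)\<^sup>2" by simp
    ultimately show ?thesis by (simp add: power2_diff)
  qed
  have intI: "integrable P (\<lambda>\<pi>. g (scrambled (z i) \<pi>) \<bullet> g (scrambled (z i') \<pi>))" for i i'
  proof (rule Bochner_Integration.integrable_bound)
    show "integrable P (\<lambda>\<pi>. ((norm (g (scrambled (z i) \<pi>)))\<^sup>2 + (norm (g (scrambled (z i') \<pi>)))\<^sup>2) / 2)"
      using intE by (intro integrable_divide Bochner_Integration.integrable_add)
    show "AE \<pi> in P. norm (g (scrambled (z i) \<pi>) \<bullet> g (scrambled (z i') \<pi>)) \<le>
        norm (((norm (g (scrambled (z i) \<pi>)))\<^sup>2 + (norm (g (scrambled (z i') \<pi>)))\<^sup>2) / 2)"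
      using bnd by (intro AE_I2) (simp add: power2_eq_square)
  qed (intro borel_measurable_inner meas)
  let ?S = "\<lambda>i. {i'. i' < b ^ m \<and> (\<forall>q\<in>v. digit_key (z i) q = digit_key (z i') q)}"
  have cov: "(\<integral>\<pi>. g (scrambled (z i) \<pi>) \<bullet> g (scrambled (z i') \<pi>) \<partial>P) \<le> (if i' \<in> ?S i then ?E else 0)"
    if "i' < b ^ m" for i i'
  proof (cases "\<forall>q\<in>v. digit_key (z i) q = digit_key (z i') q")
    case True
    have "(\<integral>\<pi>. g (scrambled (z i) \<pi>) \<bullet> g (scrambled (z i') \<pi>) \<partial>P) \<le>
        (\<integral>\<pi>. ((norm (g (scrambled (z i) \<pi>)))\<^sup>2 + (norm (g (scrambled (z i') \<pi>)))\<^sup>2) / 2 \<partial>P)"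
    proof (rule integral_mono[OF intI])
      show "integrable P (\<lambda>\<pi>. ((norm (g (scrambled (z i) \<pi>)))\<^sup>2 + (norm (g (scrambled (z i') \<pi>)))\<^sup>2) / 2)"
        using intE by (intro integrable_divide Bochner_Integration.integrable_add)
      show "g (scrambled (z i) \<pi>) \<bullet> g (scrambled (z i') \<pi>) \<le>
          ((norm (g (scrambled (z i) \<pi>)))\<^sup>2 + (norm (g (scrambled (z i') \<pi>)))\<^sup>2) / 2" for \<pi>
        using bnd[of "g (scrambled (z i) \<pi>)" "g (scrambled (z i') \<pi>)"] by linarith
    qed
    also have "\<dots> = ?E"
      unfolding integral_divide_zero Bochner_Integration.integral_add[OF intE intE] E by simp
    finally show ?thesis using True that by simp
  next
    case False
    then obtain q where q: "q \<in> v" "digit_key (z i) q \<noteq> digit_key (z i') q" by blast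
    have "(\<integral>\<pi>. g (scrambled (z i) \<pi>) \<bullet> g (scrambled (z i') \<pi>) \<partial>P) = 0"
      by (rule integral_scrambled_inner_eq_0[OF z z finQ QQ _ dep dep v(3)[OF q(1)]])
         (use q v(1) in blast)+
    then show ?thesis using False by auto
  qed
  have "(\<integral>\<pi>. (norm (\<Sum>i<b ^ m. g (scrambled (z i) \<pi>)))\<^sup>2 \<partial>P) =
      (\<Sum>i<b ^ m. \<Sum>i'<b ^ m. \<integral>\<pi>. g (scrambled (z i) \<pi>) \<bullet> g (scrambled (z i') \<pi>) \<partial>P)"
    unfolding power2_norm_eq_inner inner_sum_left inner_sum_right
    by (subst Bochner_Integration.integral_sum, intro Bochner_Integration.integrable_sum intI,
        subst Bochner_Integration.integral_sum, rule intI, rule sum.swap)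
  also have "\<dots> \<le> (\<Sum>i<b ^ m. \<Sum>i'<b ^ m. if i' \<in> ?S i then ?E else 0)"
    using cov by (intro sum_mono) auto
  also have "\<dots> = (\<Sum>i<b ^ m. real (card (?S i)) * ?E)"
  proof (rule sum.cong[OF refl])
    fix i
    have "{..<b ^ m} \<inter> {i'. i' \<in> ?S i} = ?S i" by auto
    then show "(\<Sum>i'<b ^ m. if i' \<in> ?S i then ?E else 0) = real (card (?S i)) * ?E"
      by (simp only: sum.If_cases finite_lessThan sum_constant sum.neutral_const add_0_right)
  qed
  also have "\<dots> \<le> (\<Sum>i<b ^ m. real b ^ (m + n) / real b ^ M * ?E)"
    by (intro sum_mono mult_right_mono card_same_keys v(1) gt array_mean_nonneg) auto
  finally show ?thesis by simp
qed

text \<open>Three facts about the components are combined: the empty set gives the exact mean,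
  different sets are orthogonal for any pair of points, and nonempty sets of total level at most M
  contribute zero for each scrambling.\<close>

lemma variance_le:
  fixes h :: "(nat \<times> nat \<Rightarrow> nat) \<Rightarrow> 'v::euclidean_space"
  assumes h: "depends_on Q h"
  shows "(\<integral>\<pi>. (norm ((\<Sum>i<b ^ m. h (scrambled (z i) \<pi>)) /\<^sub>R real (b ^ m) - array_mean b Q h))\<^sup>2 \<partial>P) \<le>
    real b ^ n / real b ^ M *
      (\<Sum>v | v \<subseteq> Q \<and> M < (\<Sum>j=1..n. level v j). array_mean b Q (\<lambda>\<xi>. (norm (anova b v qs h \<xi>))\<^sup>2))"
proof -
  let ?g = "\<lambda>v. anova b v qs h"
  define Y where "Y v \<pi> = (\<Sum>i<b ^ m. ?g v (scrambled (z i) \<pi>))" for v \<pi>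
  have b0: "0 < b" using b_gt_1 by simp
  have fQ: "fst ` Q \<subseteq> {1..n}" and QQ: "Q \<subseteq> {1..n} \<times> {1..}" and finQ: "finite Q" by auto
  have depv: "depends_on v (?g v)" if "v \<subseteq> Q" for v
    using depends_on_anova_support[OF b0, of qs h v] h that unfolding qs(1) by blast
  have depQ: "depends_on Q (?g v)" for v
    by (rule depends_on_anova[OF h])
  have avg0: "avg b q (?g v) = (\<lambda>_. 0)" if "v \<subseteq> Q" "q \<in> v" for v q
    by (rule avg_anova_eq_0[OF b0 that(2)]) (use that qs(1) in auto)
  have mean: "?g {} \<xi> = array_mean b Q h" for \<xi>
  proof -
    have "?g {} \<xi> = foldr (avg b) qs h \<xi>" by (simp add: anova_def)
    also have "\<dots> = array_mean b Q (\<lambda>\<zeta>. h (\<lambda>q. if q \<in> set qs then \<zeta> q else \<xi> q))"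
      using qs b0 by (intro avgs_eq_array_mean) auto
    also have "(\<lambda>\<zeta>. h (\<lambda>q. if q \<in> set qs then \<zeta> q else \<xi> q)) = h"
      by (rule ext, rule depends_onD[OF h]) (use qs(1) in auto)
    finally show ?thesis .
  qed
  define V where "V = Pow Q - {{}}"
  have finV: "finite V" by (simp add: V_def)
  have split: "(\<Sum>i<b ^ m. h (scrambled (z i) \<pi>)) /\<^sub>R real (b ^ m) - array_mean b Q h = (\<Sum>v\<in>V. Y v \<pi>) /\<^sub>R real (b ^ m)" for \<pi>
  proof -
    have "h \<xi> = array_mean b Q h + (\<Sum>v\<in>V. ?g v \<xi>)" for \<xi>
    proof -
      have "h \<xi> = (\<Sum>v\<in>Pow Q. ?g v \<xi>)"
        using sum_anova[OF qs(2), of b h \<xi>] unfolding qs(1) by (rule sym)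
      also have "\<dots> = ?g {} \<xi> + (\<Sum>v\<in>V. ?g v \<xi>)"
        unfolding V_def by (rule sum.remove) auto
      finally show ?thesis unfolding mean .
    qed
    then have "(\<Sum>i<b ^ m. h (scrambled (z i) \<pi>)) =
        (\<Sum>i<b ^ m. array_mean b Q h + (\<Sum>v\<in>V. ?g v (scrambled (z i) \<pi>)))"
      by (intro sum.cong refl)
    also have "\<dots> = real (b ^ m) *\<^sub>R array_mean b Q h + (\<Sum>v\<in>V. Y v \<pi>)"
      unfolding sum.distrib Y_def sum_constant_scaleR card_lessThan by (subst sum.swap) (rule refl)
    finally show ?thesis
      using b0 by (simp add: scaleR_add_right)
  qed
  have meas: "(\<lambda>\<pi>. Y v \<pi>) \<in> borel_measurable P" for v
    unfolding Y_def by (intro borel_measurable_sum borel_measurable_scrambled[where z = "z _", OF z finQ fQ depQ])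
  have inti: "integrable P (\<lambda>\<pi>. Y v \<pi> \<bullet> Y w \<pi>)" for v w
  proof (rule P.integrable_const_bound)
    let ?B = "\<lambda>v. \<Sum>i<b ^ m. \<Sum>\<xi>\<in>arrays b Q. norm (?g v \<xi>)"
    have Yb: "norm (Y v \<pi>) \<le> ?B v" if "\<pi> \<in> space P" for v \<pi>
      unfolding Y_def
      by (rule order_trans[OF norm_sum], intro sum_mono)
         (rule bounded_scrambled[where z = "z _", OF z finQ fQ depQ that])
    show "AE \<pi> in P. norm (Y v \<pi> \<bullet> Y w \<pi>) \<le> ?B v * ?B w"
    proof (rule AE_I2)
      fix \<pi> assume \<pi>: "\<pi> \<in> space P"
      have "norm (Y v \<pi> \<bullet> Y w \<pi>) \<le> norm (Y v \<pi>) * norm (Y w \<pi>)"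
        unfolding real_norm_def by (rule Cauchy_Schwarz_ineq2)
      also have "\<dots> \<le> ?B v * ?B w"
        by (intro mult_mono Yb \<pi> sum_nonneg) auto
      finally show "norm (Y v \<pi> \<bullet> Y w \<pi>) \<le> ?B v * ?B w" .
    qed
  qed (intro borel_measurable_inner meas)
  have orth: "(\<integral>\<pi>. Y v \<pi> \<bullet> Y w \<pi> \<partial>P) = 0" if vw: "v \<subseteq> Q" "w \<subseteq> Q" "v \<noteq> w" for v w
  proof -
    have *: "(\<integral>\<pi>. ?g v (scrambled (z i) \<pi>) \<bullet> ?g w (scrambled (z i') \<pi>) \<partial>P) = 0"
      if q: "q \<in> v" "q \<notin> w" "v \<subseteq> Q" "w \<subseteq> Q" for i i' q v w
    proof (rule integral_scrambled_inner_eq_0[OF z z finQ QQ _ depQ depQ avg0[OF q(3,1)]])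
      show "q \<in> Q" using q by blast
      have "q \<in> set qs" using q qs(1) by blast
      show "(\<forall>\<xi> c. ?g w (\<xi>(q := c)) = ?g w \<xi>) \<or> digit_key (z i) q \<noteq> digit_key (z i') q"
        by (intro disjI1 allI anova_update[OF b0 q(2) \<open>q \<in> set qs\<close>])
    qed
    \<comment> \<open>One of two different sets has a digit that is not in the other, and the
      component of the other does not read it; symmetry of the inner product covers both
      cases.\<close>
    have **: "(\<integral>\<pi>. ?g v (scrambled (z i) \<pi>) \<bullet> ?g w (scrambled (z i') \<pi>) \<partial>P) = 0" for i i'
    proof (cases "\<exists>q\<in>v. q \<notin> w")
      case True
      then show ?thesis using *[of _ v w i i'] vw by blast
    next
      case False
      then obtain q where "q \<in> w" "q \<notin> v" using vw(3) by blast
      then show ?thesis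
        by (subst inner_commute) (rule *[OF _ _ vw(2,1)])
    qed
    have int: "integrable P (\<lambda>\<pi>. ?g v (scrambled (z i) \<pi>) \<bullet> ?g w (scrambled (z i') \<pi>))" for i i'
    proof (rule P.integrable_const_bound)
      show "AE \<pi> in P. norm (?g v (scrambled (z i) \<pi>) \<bullet> ?g w (scrambled (z i') \<pi>)) \<le>
          (\<Sum>\<xi>\<in>arrays b Q. norm (?g v \<xi>)) * (\<Sum>\<xi>\<in>arrays b Q. norm (?g w \<xi>))"
      proof (rule AE_I2)
        fix \<pi> assume \<pi>: "\<pi> \<in> space P"
        have "norm (?g v (scrambled (z i) \<pi>) \<bullet> ?g w (scrambled (z i') \<pi>)) \<le>
            norm (?g v (scrambled (z i) \<pi>)) * norm (?g w (scrambled (z i') \<pi>))"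
          unfolding real_norm_def by (rule Cauchy_Schwarz_ineq2)
        also have "\<dots> \<le> (\<Sum>\<xi>\<in>arrays b Q. norm (?g v \<xi>)) * (\<Sum>\<xi>\<in>arrays b Q. norm (?g w \<xi>))"
          by (intro mult_mono bounded_scrambled[where z = "z _", OF z finQ fQ depQ \<pi>] sum_nonneg) auto
        finally show "norm (?g v (scrambled (z i) \<pi>) \<bullet> ?g w (scrambled (z i') \<pi>)) \<le>
            (\<Sum>\<xi>\<in>arrays b Q. norm (?g v \<xi>)) * (\<Sum>\<xi>\<in>arrays b Q. norm (?g w \<xi>))" .
      qed
    qed (intro borel_measurable_inner borel_measurable_scrambled[where z = "z _", OF z finQ fQ depQ])
    have "(\<integral>\<pi>. Y v \<pi> \<bullet> Y w \<pi> \<partial>P) = (\<Sum>i'<b ^ m. \<Sum>i<b ^ m. \<integral>\<pi>. ?g v (scrambled (z i) \<pi>) \<bullet> ?g w (scrambled (z i') \<pi>) \<partial>P)"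
      unfolding Y_def inner_sum_left inner_sum_right
      by (subst Bochner_Integration.integral_sum, intro Bochner_Integration.integrable_sum int,
          subst Bochner_Integration.integral_sum, rule int, rule refl)
    then show ?thesis by (simp only: ** sum.neutral_const)
  qed
  let ?W = "{v. v \<subseteq> Q \<and> M < (\<Sum>j=1..n. level v j)}"
  have finW: "finite ?W" by (rule finite_subset[of _ "Pow Q"]) auto
  have WV: "?W \<subseteq> V" by (auto simp: V_def level_def)
  have small: "Y v \<pi> = 0" if "v \<in> V - ?W" "\<pi> \<in> space P" for v \<pi>
  proof -
    from that have v: "v \<subseteq> Q" "v \<noteq> {}" "(\<Sum>j=1..n. level v j) \<le> M" by (auto simp: V_def)
    then obtain q where q: "q \<in> v" by blast
    show ?thesis
      unfolding Y_def by (rule sum_net_eq_0[OF that(2) v(1) q depv[OF v(1)] avg0[OF v(1) q] v(3)])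
  qed
  have "(\<integral>\<pi>. (norm ((\<Sum>i<b ^ m. h (scrambled (z i) \<pi>)) /\<^sub>R real (b ^ m) - array_mean b Q h))\<^sup>2 \<partial>P) =
      (\<integral>\<pi>. (1 / (real (b ^ m))\<^sup>2) * (\<Sum>v\<in>?W. \<Sum>w\<in>?W. Y v \<pi> \<bullet> Y w \<pi>) \<partial>P)"
  proof (intro Bochner_Integration.integral_cong refl)
    fix \<pi> assume \<pi>: "\<pi> \<in> space P"
    have "(\<Sum>v\<in>V. Y v \<pi>) = (\<Sum>v\<in>?W. Y v \<pi>)"
      using small \<pi> by (intro sum.mono_neutral_right finV WV) blast
    then have "(norm ((\<Sum>i<b ^ m. h (scrambled (z i) \<pi>)) /\<^sub>R real (b ^ m) - array_mean b Q h))\<^sup>2 =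
        (1 / (real (b ^ m))\<^sup>2) * (norm (\<Sum>v\<in>?W. Y v \<pi>))\<^sup>2"
      unfolding split by (simp add: power_mult_distrib power_divide divide_inverse power_inverse)
    also have "(norm (\<Sum>v\<in>?W. Y v \<pi>))\<^sup>2 = (\<Sum>v\<in>?W. \<Sum>w\<in>?W. Y v \<pi> \<bullet> Y w \<pi>)"
      unfolding power2_norm_eq_inner inner_sum_left inner_sum_right by (rule sum.swap)
    finally show "(norm ((\<Sum>i<b ^ m. h (scrambled (z i) \<pi>)) /\<^sub>R real (b ^ m) - array_mean b Q h))\<^sup>2 =
        (1 / (real (b ^ m))\<^sup>2) * (\<Sum>v\<in>?W. \<Sum>w\<in>?W. Y v \<pi> \<bullet> Y w \<pi>)" .
  qed
  also have "\<dots> = (1 / (real (b ^ m))\<^sup>2) * (\<Sum>v\<in>?W. \<Sum>w\<in>?W. \<integral>\<pi>. Y v \<pi> \<bullet> Y w \<pi> \<partial>P)"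
    by (subst integral_mult_right_zero, subst Bochner_Integration.integral_sum,
        intro Bochner_Integration.integrable_sum inti, subst Bochner_Integration.integral_sum, rule inti, rule refl)
  also have "\<dots> = (1 / (real (b ^ m))\<^sup>2) * (\<Sum>v\<in>?W. \<integral>\<pi>. Y v \<pi> \<bullet> Y v \<pi> \<partial>P)"
  proof -
    have "(\<Sum>w\<in>?W. \<integral>\<pi>. Y v \<pi> \<bullet> Y w \<pi> \<partial>P) = (\<integral>\<pi>. Y v \<pi> \<bullet> Y v \<pi> \<partial>P)" if v: "v \<in> ?W" for v
    proof -
      have "(\<Sum>w\<in>?W. \<integral>\<pi>. Y v \<pi> \<bullet> Y w \<pi> \<partial>P) = (\<Sum>w\<in>{v}. \<integral>\<pi>. Y v \<pi> \<bullet> Y w \<pi> \<partial>P)"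
        using v orth[of v] by (intro sum.mono_neutral_right finW) blast+
      then show ?thesis by simp
    qed
    then show ?thesis by (simp only: cong: sum.cong)
  qed
  also have "\<dots> \<le> (1 / (real (b ^ m))\<^sup>2) * (\<Sum>v\<in>?W. real b ^ m * (real b ^ (m + n) / real b ^ M) * array_mean b Q (\<lambda>\<xi>. (norm (?g v \<xi>))\<^sup>2))"
  proof (intro mult_left_mono sum_mono)
    fix v assume v: "v \<in> ?W"
    then have v': "v \<subseteq> Q" "M < (\<Sum>j=1..n. level v j)" by blast+
    show "(\<integral>\<pi>. Y v \<pi> \<bullet> Y v \<pi> \<partial>P) \<le> real b ^ m * (real b ^ (m + n) / real b ^ M) * array_mean b Q (\<lambda>\<xi>. (norm (?g v \<xi>))\<^sup>2)"
      unfolding power2_norm_eq_inner[symmetric] Y_def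
      by (rule expectation_norm_sum_le[OF v'(1) depv[OF v'(1)] avg0[OF v'(1)] v'(2)])
  qed simp
  also have "\<dots> = (1 / (real (b ^ m))\<^sup>2) * (real b ^ m * (real b ^ (m + n) / real b ^ M)) *
      (\<Sum>v\<in>?W. array_mean b Q (\<lambda>\<xi>. (norm (?g v \<xi>))\<^sup>2))"
    by (simp only: sum_distrib_left mult.assoc)
  also have "(1 / (real (b ^ m))\<^sup>2) * (real b ^ m * (real b ^ (m + n) / real b ^ M)) = real b ^ n / real b ^ M"
    using b0 by (simp add: power_add power2_eq_square field_simps)
  finally show ?thesis .
qed

end

end

section \<open>Digit expansions and grid points\<close>

text \<open>Horner's scheme for the integer with base-b digits d 1, ..., d k, the most significant
  first.\<close>

definition digit_int :: "nat \<Rightarrow> (nat \<Rightarrow> nat) \<Rightarrow> nat \<Rightarrow> nat" where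
  "digit_int b d = rec_nat 0 (\<lambda>k x. b * x + d (Suc k))"

definition digit_sum :: "nat \<Rightarrow> (nat \<Rightarrow> nat) \<Rightarrow> nat \<Rightarrow> real" where
  "digit_sum b d k = (\<Sum>a=1..k. real (d a) / real b ^ a)"

definition digit_value :: "nat \<Rightarrow> (nat \<Rightarrow> nat) \<Rightarrow> real" where
  "digit_value b d = (\<Sum>a. real (d (Suc a)) / real b ^ Suc a)"

lemma digit_int_simps [simp]: "digit_int b d 0 = 0" "digit_int b d (Suc k) = b * digit_int b d k + d (Suc k)"
  by (simp_all add: digit_int_def)

lemma digit_sum_eq: "0 < b \<Longrightarrow> digit_sum b d k = real (digit_int b d k) / real b ^ k"
  by (induction k) (simp_all add: digit_sum_def add_divide_distrib)

lemma digit_int_less: "(\<And>a. d a < b) \<Longrightarrow> digit_int b d k < b ^ k"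
proof (induction k)
  case (Suc k)
  have "b * digit_int b d k + d (Suc k) < b * digit_int b d k + b"
    using Suc.prems by simp
  also have "\<dots> = b * Suc (digit_int b d k)" by simp
  also have "\<dots> \<le> b * b ^ k"
    using Suc.IH[OF Suc.prems] by (intro mult_le_mono2) simp
  finally show ?case by simp
qed simp

lemma digit_int_cong: "(\<And>a. a \<in> {1..k} \<Longrightarrow> d a = e a) \<Longrightarrow> digit_int b d k = digit_int b e k"
  by (induction k) auto

lemma digit_int_inj:
  assumes "\<And>a. a \<in> {1..k} \<Longrightarrow> d a < b" "\<And>a. a \<in> {1..k} \<Longrightarrow> e a < b" "digit_int b d k = digit_int b e k" "a \<in> {1..k}"
  shows "d a = e a"
  using assms
proof (induction k)
  case (Suc k)
  have lt: "d (Suc k) < b" "e (Suc k) < b" using Suc.prems by auto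
  have eq: "b * digit_int b d k + d (Suc k) = b * digit_int b e k + e (Suc k)" using Suc.prems by simp
  have "d (Suc k) = (b * digit_int b d k + d (Suc k)) mod b" using lt by simp
  also have "\<dots> = e (Suc k)" unfolding eq using lt by simp
  finally have 1: "d (Suc k) = e (Suc k)" .
  with eq lt have "digit_int b d k = digit_int b e k" by auto
  with Suc 1 show ?case by (cases "a = Suc k") auto
qed simp

text \<open>These are the right ends of the nested elementary intervals given by the leading digits.
  They do not increase, and they strictly decrease at a digit other than b - 1, which is what
  excludes the second expansion of a b-adic rational.\<close>

lemma digit_sum_step:
  assumes "\<And>a. d a < b"
  shows "digit_sum b d (Suc k) + 1 / real b ^ Suc k \<le> digit_sum b d k + 1 / real b ^ k"
    and "d (Suc k) \<noteq> b - 1 \<Longrightarrow> digit_sum b d (Suc k) + 1 / real b ^ Suc k < digit_sum b d k + 1 / real b ^ k"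
proof -
  have b: "0 < b" using assms[of 0] by simp
  have eq: "digit_sum b d k + 1 / real b ^ k = digit_sum b d k + real b / real b ^ Suc k"
    using b by simp
  have "real (d (Suc k)) + 1 \<le> real b" using assms[of "Suc k"] by linarith
  then have "(real (d (Suc k)) + 1) / real b ^ Suc k \<le> real b / real b ^ Suc k"
    by (intro divide_right_mono) auto
  then show "digit_sum b d (Suc k) + 1 / real b ^ Suc k \<le> digit_sum b d k + 1 / real b ^ k"
    unfolding eq by (simp add: digit_sum_def add_divide_distrib)
  assume "d (Suc k) \<noteq> b - 1"
  then have "real (d (Suc k)) + 1 < real b" using assms[of "Suc k"] by linarith
  then have "(real (d (Suc k)) + 1) / real b ^ Suc k < real b / real b ^ Suc k"
    using b by (intro divide_strict_right_mono) auto
  then show "digit_sum b d (Suc k) + 1 / real b ^ Suc k < digit_sum b d k + 1 / real b ^ k"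
    unfolding eq by (simp add: digit_sum_def add_divide_distrib)
qed

lemma digit_sum_antimono:
  assumes "\<And>a. d a < b" "k \<le> l"
  shows "digit_sum b d l + 1 / real b ^ l \<le> digit_sum b d k + 1 / real b ^ k"
  using lift_Suc_antimono_le[of "\<lambda>k. digit_sum b d k + 1 / real b ^ k" k l] digit_sum_step(1)[OF assms(1)] assms(2)
  by auto

lemma digit_sum_mono: "k \<le> l \<Longrightarrow> digit_sum b d k \<le> digit_sum b d l"
  unfolding digit_sum_def by (intro sum_mono2) auto

text \<open>For x in the elementary interval, the floor of x b^k is the integer with digits d 1,
  ..., d k, and its residue modulo b is the last of them.\<close>

lemma base_digit_eqI:
  assumes "\<And>a. d a < b" "1 \<le> k" "digit_sum b d k \<le> x" "x < digit_sum b d k + 1 / real b ^ k"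
  shows "base_digit b x k = d k"
proof -
  have b: "0 < b" using assms(1)[of 0] by simp
  have "real (digit_int b d k) \<le> x * real b ^ k"
    using assms(3) b by (simp add: digit_sum_eq pos_divide_le_eq)
  moreover have "x * real b ^ k < real (digit_int b d k) + 1"
    using assms(4) b by (simp add: digit_sum_eq flip: add_divide_distrib) (simp add: pos_less_divide_eq)
  ultimately have fl: "\<lfloor>x * real b ^ k\<rfloor> = int (digit_int b d k)"
    by (intro floor_unique) auto
  obtain k' where "k = Suc k'" using assms(2) by (cases k) auto
  then have "digit_int b d k mod b = d k" using assms(1) by simp
  then show ?thesis
    unfolding base_digit_def fl by (metis nat_int zmod_int)
qed

lemma digit_value_props:
  assumes "\<And>a. d a < b" "1 < b"
  shows summable_digits: "summable (\<lambda>a. real (d (Suc a)) / real b ^ Suc a)"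
    and digit_value_ge: "digit_sum b d k \<le> digit_value b d"
    and digit_value_le: "digit_value b d \<le> digit_sum b d k + 1 / real b ^ k"
proof -
  let ?f = "\<lambda>a. real (d (Suc a)) / real b ^ Suc a"
  have S: "(\<Sum>a<k. ?f a) = digit_sum b d k" for k
    unfolding digit_sum_def by (rule sum.reindex_bij_witness[of _ "\<lambda>a. a - 1" Suc]) auto
  have up: "(\<Sum>a<l. ?f a) \<le> digit_sum b d k + 1 / real b ^ k" for k l
  proof (cases "k \<le> l")
    case True
    have "digit_sum b d l \<le> digit_sum b d l + 1 / real b ^ l" by simp
    then show ?thesis using digit_sum_antimono[of d, OF assms(1) True] unfolding S by linarith
  next
    case False
    then have "digit_sum b d l \<le> digit_sum b d k" by (intro digit_sum_mono) simp
    moreover have "0 \<le> 1 / real b ^ k" by simp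
    ultimately show ?thesis unfolding S by linarith
  qed
  show summ: "summable ?f"
    by (rule summableI_nonneg_bounded[where x = "digit_sum b d 0 + 1 / real b ^ 0"]) (simp, rule up)
  show "digit_value b d \<le> digit_sum b d k + 1 / real b ^ k"
    unfolding digit_value_def by (rule suminf_le_const[OF summ up])
  show "digit_sum b d k \<le> digit_value b d"
    unfolding S[symmetric] digit_value_def by (rule sum_le_suminf[OF summ]) auto
qed

lemma digit_value_bounds:
  assumes "\<And>a. d a < b" "1 < b"
  shows "0 \<le> digit_value b d" "digit_value b d \<le> 1"
  using digit_value_ge[of d b 0, OF assms] digit_value_le[of d b 0, OF assms] by (simp_all add: digit_sum_def)

text \<open>A later digit different from b - 1 moves the value away from the right end of its
  elementary interval, so that the interval may be taken half open.\<close>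

lemma base_digit_digit_value:
  assumes "\<And>a. d a < b" "1 < b" "\<And>K. \<exists>a>K. d a \<noteq> b - 1" "1 \<le> k"
  shows "base_digit b (digit_value b d) k = d k"
proof (rule base_digit_eqI[OF assms(1,4)])
  show "digit_sum b d k \<le> digit_value b d" by (rule digit_value_ge[OF assms(1,2)])
  obtain a where a: "k < a" "d a \<noteq> b - 1" using assms(3) by blast
  then obtain a' where a': "a = Suc a'" "k \<le> a'" by (cases a) auto
  have "digit_value b d \<le> digit_sum b d (Suc a') + 1 / real b ^ Suc a'" by (rule digit_value_le[OF assms(1,2)])
  also have "\<dots> < digit_sum b d a' + 1 / real b ^ a'"
    using digit_sum_step(2)[of d b a'] assms(1) a a' by simp
  also have "\<dots> \<le> digit_sum b d k + 1 / real b ^ k" by (rule digit_sum_antimono[OF assms(1) a'(2)])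
  finally show "digit_value b d < digit_sum b d k + 1 / real b ^ k" .
qed

lemma base_digit_less: "0 < b \<Longrightarrow> base_digit b x a < b"
  by (simp add: base_digit_def nat_less_iff)

text \<open>A net point has m digits by construction, and padding them with zeros gives the
  expansion that \<open>base_digit\<close> selects.\<close>

lemma base_digit_net_point:
  assumes "1 < b" "1 \<le> a"
  shows "base_digit b (net_point b m A i j) a = (if a \<le> m then net_digit b m A i j a else 0)"
proof -
  define d where "d a = (if a \<le> m then net_digit b m A i j a else 0)" for a
  have d: "d a < b" for a using assms(1) by (simp add: d_def net_digit_def)
  have np: "net_point b m A i j = digit_sum b d m"
    by (simp add: net_point_def digit_sum_def d_def)
  have "digit_sum b d a = digit_sum b d m" if "m \<le> a"
    unfolding digit_sum_def using that by (intro sum.mono_neutral_right) (auto simp: d_def)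
  then have "digit_sum b d a \<le> net_point b m A i j"
    unfolding np by (cases "a \<le> m") (auto intro: digit_sum_mono)
  moreover have "net_point b m A i j < digit_sum b d a + 1 / real b ^ a"
  proof (cases "m \<le> a")
    case True
    then show ?thesis
      using \<open>m \<le> a \<Longrightarrow> digit_sum b d a = digit_sum b d m\<close> assms(1) unfolding np by simp
  next
    case False
    have "0 < 1 / real b ^ m" using assms(1) by simp
    with False show ?thesis using digit_sum_antimono[of d b a m, OF d] unfolding np by linarith
  qed
  ultimately show ?thesis
    using base_digit_eqI[of d b a, OF d assms(2)] by (simp add: d_def)
qed

text \<open>Digit p of the i-th interlaced variable. With p = (a - 1) d + r and 1 \<le> r \<le> d it
  is digit a of coordinate (i - 1) d + r.\<close>

definition coord_digit :: "nat \<Rightarrow> (nat \<times> nat \<Rightarrow> nat) \<Rightarrow> nat \<Rightarrow> nat \<Rightarrow> nat" where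
  "coord_digit d \<xi> i p = \<xi> ((i - 1) * d + (p - 1) mod d + 1, (p - 1) div d + 1)"

definition array_point :: "nat \<Rightarrow> nat \<Rightarrow> nat \<Rightarrow> (nat \<times> nat \<Rightarrow> nat) \<Rightarrow> nat \<Rightarrow> real" where
  "array_point b d s \<xi> = (\<lambda>i\<in>{1..s}. digit_value b (coord_digit d \<xi> i))"

text \<open>Truncation after d L digits of each variable, which uses exactly the first L digits of
  each of the d s coordinates.\<close>

definition grid_point :: "nat \<Rightarrow> nat \<Rightarrow> nat \<Rightarrow> nat \<Rightarrow> (nat \<times> nat \<Rightarrow> nat) \<Rightarrow> nat \<Rightarrow> real" where
  "grid_point b d s L \<xi> = (\<lambda>i\<in>{1..s}. digit_sum b (coord_digit d \<xi> i) (d * L))"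

text \<open>The double series of the interlacing is the digit series of each variable, summed in
  blocks of d consecutive digits.\<close>

lemma interlace_eq:
  assumes "1 < b" "1 \<le> d"
  shows "interlace b d s x = array_point b d s (\<lambda>(j, a). base_digit b (x j) a)"
proof (rule ext)
  fix i
  show "interlace b d s x i = array_point b d s (\<lambda>(j, a). base_digit b (x j) a) i"
  proof (cases "i \<in> {1..s}")
    case True
    define e where "e = coord_digit d (\<lambda>(j, a). base_digit b (x j) a) i"
    have e: "e p < b" for p using assms(1) by (simp add: e_def coord_digit_def base_digit_less)
    let ?f = "\<lambda>a. real (e (Suc a)) / real b ^ Suc a"
    have "?f sums digit_value b e"
      unfolding digit_value_def by (rule summable_sums, rule summable_digits[OF e assms(1)])
    from sums_group[OF this, of d] assms(2)
    have *: "(\<lambda>n. sum ?f {n * d..<n * d + d}) sums digit_value b e" by simp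
    have "sum ?f {n * d..<n * d + d} =
        (\<Sum>r=1..d. real (base_digit b (x ((i - 1) * d + r)) (Suc n)) / real b ^ (r + n * d))" for n
    proof (rule sum.reindex_bij_witness[of _ "\<lambda>r. n * d + (r - 1)" "\<lambda>a. a - n * d + 1"])
      fix a assume a: "a \<in> {n * d..<n * d + d}"
      define c where "c = a - n * d"
      have c: "a = n * d + c" "c < d" using a by (auto simp: c_def)
      have "(c + n * d) mod d = c" "(c + n * d) div d = n"
        using c(2) assms(2) by simp_all
      then have "a mod d = c" "a div d = n"
        unfolding c(1) by (simp_all only: add.commute)
      then show "real (base_digit b (x ((i - 1) * d + (a - n * d + 1))) (Suc n)) / real b ^ (a - n * d + 1 + n * d) = ?f a"
        by (simp add: e_def coord_digit_def c add_ac)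
    qed auto
    with * have "(\<lambda>n. \<Sum>r=1..d. real (base_digit b (x ((i - 1) * d + r)) (Suc n)) / real b ^ (r + n * d)) sums digit_value b e"
      by simp
    then show ?thesis
      using True by (simp add: interlace_def array_point_def e_def sums_iff)
  next
    case False
    then show ?thesis
      by (simp only: interlace_def array_point_def restrict_apply if_False)
  qed
qed

lemma scramble_eq: "scramble b \<pi> x j = digit_value b (\<lambda>a. \<pi> (j, map (base_digit b (x j)) [1..<a]) (base_digit b (x j) a))"
  by (simp add: scramble_def digit_value_def)

context
  fixes b d s :: nat
  assumes b: "1 < b" and d: "1 \<le> d"
begin

lemma coord_index:
  assumes "i \<in> {1..s}" "p \<in> {1..d * L}"
  shows "((i - 1) * d + (p - 1) mod d + 1, (p - 1) div d + 1) \<in> {1..d * s} \<times> {1..L}"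
proof -
  obtain i' where i': "i = Suc i'" using assms by (cases i) auto
  have "(p - 1) mod d < d" using d by simp
  moreover have "i' * d + d \<le> d * s"
    using assms i' mult_le_mono1[of "Suc i'" s d] by (simp add: mult.commute)
  moreover have "(p - 1) div d < L"
    using assms d by (intro less_mult_imp_div_less) (auto simp: mult.commute)
  ultimately show ?thesis using i' by auto
qed

lemma coord_surj:
  assumes "q \<in> {1..d * s} \<times> {1..L}"
  obtains i p where "i \<in> {1..s}" "p \<in> {1..d * L}" "q = ((i - 1) * d + (p - 1) mod d + 1, (p - 1) div d + 1)"
    "i = (fst q - 1) div d + 1" "p = (snd q - 1) * d + (fst q - 1) mod d + 1"
proof -
  define j a where "j = fst q - 1" and "a = snd q - 1"
  have q: "q = (Suc j, Suc a)" and j: "j < d * s" and a: "a < L" using assms by (auto simp: j_def a_def)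
  have jm: "j mod d < d" using d by simp
  have 1: "j div d < s" using j by (simp add: less_mult_imp_div_less mult.commute)
  have "a * d + j mod d < Suc a * d" using jm by simp
  also have "\<dots> \<le> L * d" using a by (intro mult_le_mono1) simp
  finally have 2: "a * d + j mod d < d * L" by (simp add: mult.commute)
  have 3: "(a * d + j mod d) mod d = j mod d" "(a * d + j mod d) div d = a" using jm by simp_all
  show ?thesis
    using that[of "j div d + 1" "a * d + j mod d + 1"] 1 2 3 by (simp add: q)
qed

lemma coord_digit_less: "(\<And>q. q \<in> {1..d * s} \<times> {1..L} \<Longrightarrow> \<xi> q < b) \<Longrightarrow> i \<in> {1..s} \<Longrightarrow> p \<in> {1..d * L} \<Longrightarrow> coord_digit d \<xi> i p < b"
  unfolding coord_digit_def using coord_index by blast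

lemma depends_on_grid: "depends_on ({1..d * s} \<times> {1..L}) (\<lambda>\<xi>. F (grid_point b d s L \<xi>))"
  unfolding depends_on_def
proof (intro allI impI arg_cong[where f = F])
  fix \<xi> \<xi>' :: "nat \<times> nat \<Rightarrow> nat" assume *: "\<forall>q\<in>{1..d * s} \<times> {1..L}. \<xi> q = \<xi>' q"
  have "coord_digit d \<xi> i p = coord_digit d \<xi>' i p" if "i \<in> {1..s}" "p \<in> {1..d * L}" for i p
    unfolding coord_digit_def using * coord_index[OF that] by blast
  then show "grid_point b d s L \<xi> = grid_point b d s L \<xi>'"
    unfolding grid_point_def digit_sum_def by (intro restrict_ext sum.cong refl) simp
qed

lemma grid_point_int:
  "grid_point b d s L \<xi> = (\<lambda>i\<in>{1..s}. real (digit_int b (coord_digit d \<xi> i) (d * L)) / real (b ^ (d * L)))"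
  unfolding grid_point_def using b by (intro restrict_ext) (simp add: digit_sum_eq)

text \<open>Injective by uniqueness of digits, hence bijective, since both sides have b^(d s L)
  elements.\<close>

lemma bij_betw_grid:
  "bij_betw (\<lambda>\<xi>. \<lambda>i\<in>{1..s}. digit_int b (coord_digit d \<xi> i) (d * L)) (arrays b ({1..d * s} \<times> {1..L}))
     (PiE {1..s} (\<lambda>_. {..<b ^ (d * L)}))" (is "bij_betw ?G ?A ?B")
proof -
  let ?Q = "{1..d * s} \<times> {1..L}"
  have inj: "inj_on ?G ?A"
  proof (rule inj_onI)
    fix x y assume x: "x \<in> ?A" and y: "y \<in> ?A" and eq: "?G x = ?G y"
    show "x = y"
    proof (rule PiE_ext[OF x y])
      fix q assume "q \<in> ?Q"
      then obtain i p where ip: "i \<in> {1..s}" "p \<in> {1..d * L}" "q = ((i - 1) * d + (p - 1) mod d + 1, (p - 1) div d + 1)"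
        by (rule coord_surj)
      have lt: "coord_digit d x i a < b" "coord_digit d y i a < b" if "a \<in> {1..d * L}" for a
        using x y by (auto intro!: coord_digit_less[OF _ ip(1) that] dest: PiE_mem)
      have "digit_int b (coord_digit d x i) (d * L) = digit_int b (coord_digit d y i) (d * L)"
        using fun_cong[OF eq, of i] ip(1) by simp
      from digit_int_inj[OF lt this ip(2)] show "x q = y q"
        by (simp add: coord_digit_def ip(3))
    qed
  qed
  moreover have "?G ` ?A \<subseteq> ?B"
  proof (intro image_subsetI PiE_I)
    fix \<xi> i assume xi: "\<xi> \<in> ?A" and i: "i \<in> {1..s}"
    let ?e = "\<lambda>p. if p \<in> {1..d * L} then coord_digit d \<xi> i p else 0"
    have "coord_digit d \<xi> i p < b" if "p \<in> {1..d * L}" for p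
      using xi by (auto intro!: coord_digit_less[OF _ i that] dest: PiE_mem)
    then have "?e p < b" for p using b by auto
    then have "digit_int b ?e (d * L) < b ^ (d * L)" by (rule digit_int_less)
    also have "digit_int b ?e (d * L) = digit_int b (coord_digit d \<xi> i) (d * L)" by (rule digit_int_cong) simp
    finally show "?G \<xi> i \<in> {..<b ^ (d * L)}" using i by simp
  next
    fix \<xi> i assume "i \<notin> {1..s}"
    then show "?G \<xi> i = undefined" by (simp only: restrict_apply if_False)
  qed
  moreover have "card (?G ` ?A) = card ?B"
    using inj by (simp add: card_image card_PiE power_mult[symmetric] ac_simps)
  moreover have "finite ?B" by (simp add: finite_PiE)
  ultimately show ?thesis
    unfolding bij_betw_def using card_subset_eq by blast
qed

text \<open>Passes from digits to a regular grid with mesh b^(-d L), on which translations make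
  sense.\<close>

lemma array_mean_grid:
  fixes F :: "_ \<Rightarrow> 'v::real_vector"
  shows "array_mean b ({1..d * s} \<times> {1..L}) (\<lambda>\<xi>. F (grid_point b d s L \<xi>)) =
    (\<Sum>k\<in>PiE {1..s} (\<lambda>_. {..<b ^ (d * L)}). F (\<lambda>i\<in>{1..s}. real (k i) / real (b ^ (d * L)))) /\<^sub>R real ((b ^ (d * L)) ^ s)"
proof -
  have "grid_point b d s L \<xi> = (\<lambda>i\<in>{1..s}. real ((\<lambda>i\<in>{1..s}. digit_int b (coord_digit d \<xi> i) (d * L)) i) / real (b ^ (d * L)))" for \<xi>
    unfolding grid_point_int by (intro restrict_ext) simp
  then show ?thesis
    using sum.reindex_bij_betw[OF bij_betw_grid, of "\<lambda>k. F (\<lambda>i\<in>{1..s}. real (k i) / real (b ^ (d * L)))" L]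
    by (simp add: array_mean_def card_cartesian_product power_mult[symmetric] ac_simps)
qed

text \<open>A digit at position p of a variable has weight b^(-p), and each digit of the array
  occurs at exactly one position of exactly one variable.\<close>

lemma grid_point_update:
  assumes "q \<in> {1..d * s} \<times> {1..L}"
  shows "grid_point b d s L (\<xi>(q := c')) = (grid_point b d s L (\<xi>(q := c)))((fst q - 1) div d + 1 :=
    grid_point b d s L (\<xi>(q := c)) ((fst q - 1) div d + 1) +
      (real c' - real c) / real b ^ ((snd q - 1) * d + (fst q - 1) mod d + 1))"
proof -
  obtain i p where ip: "i \<in> {1..s}" "p \<in> {1..d * L}" "q = ((i - 1) * d + (p - 1) mod d + 1, (p - 1) div d + 1)"
    "i = (fst q - 1) div d + 1" "p = (snd q - 1) * d + (fst q - 1) mod d + 1"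
    using coord_surj[OF assms] .
  have upd: "coord_digit d (\<xi>(q := x)) i' p' = (if i' = i \<and> p' = p then x else coord_digit d \<xi> i' p')"
    if "i' \<in> {1..s}" "p' \<in> {1..d * L}" for x i' p'
  proof -
    have "((i' - 1) * d + (p' - 1) mod d + 1, (p' - 1) div d + 1) = q \<longleftrightarrow> i' = i \<and> p' = p"
    proof
      assume *: "((i' - 1) * d + (p' - 1) mod d + 1, (p' - 1) div d + 1) = q"
      have "i = ((i' - 1) * d + (p' - 1) mod d) div d + 1"
        unfolding ip(4) *[symmetric] by simp
      moreover have "p = (p' - 1) div d * d + ((i' - 1) * d + (p' - 1) mod d) mod d + 1"
        unfolding ip(5) *[symmetric] by simp
      moreover have "((i' - 1) * d + (p' - 1) mod d) div d = i' - 1" "((i' - 1) * d + (p' - 1) mod d) mod d = (p' - 1) mod d"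
        using d by simp_all
      moreover have "(p' - 1) div d * d + (p' - 1) mod d = p' - 1" by simp
      ultimately have "i = i' - 1 + 1" "p = p' - 1 + 1" by (simp_all only:)
      then show "i' = i \<and> p' = p" using that by auto
    next
      assume "i' = i \<and> p' = p"
      then show "((i' - 1) * d + (p' - 1) mod d + 1, (p' - 1) div d + 1) = q" by (simp only: ip(3))
    qed
    then show ?thesis by (simp add: coord_digit_def)
  qed
  have other: "digit_sum b (coord_digit d (\<xi>(q := x)) i') (d * L) = digit_sum b (coord_digit d \<xi> i') (d * L)"
    if "i' \<in> {1..s}" "i' \<noteq> i" for i' x
    unfolding digit_sum_def using that upd by (intro sum.cong refl) simp
  have same: "digit_sum b (coord_digit d (\<xi>(q := x)) i) (d * L) =
      real x / real b ^ p + (\<Sum>a\<in>{1..d * L} - {p}. real (coord_digit d \<xi> i a) / real b ^ a)" for x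
  proof -
    have "digit_sum b (coord_digit d (\<xi>(q := x)) i) (d * L) =
        real (coord_digit d (\<xi>(q := x)) i p) / real b ^ p +
        (\<Sum>a\<in>{1..d * L} - {p}. real (coord_digit d (\<xi>(q := x)) i a) / real b ^ a)"
      unfolding digit_sum_def using ip(2) by (intro sum.remove) auto
    also have "(\<Sum>a\<in>{1..d * L} - {p}. real (coord_digit d (\<xi>(q := x)) i a) / real b ^ a) =
        (\<Sum>a\<in>{1..d * L} - {p}. real (coord_digit d \<xi> i a) / real b ^ a)"
      using upd[OF ip(1)] by (intro sum.cong refl) simp
    finally show ?thesis unfolding upd[OF ip(1,2)] by (simp only: refl conj_absorb if_True simp_thms)
  qed
  show ?thesis
    unfolding ip(4)[symmetric] ip(5)[symmetric]
  proof (rule ext)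
    fix i'
    consider "i' \<notin> {1..s}" | "i' \<in> {1..s}" "i' \<noteq> i" | "i' = i" by blast
    then show "grid_point b d s L (\<xi>(q := c')) i' = ((grid_point b d s L (\<xi>(q := c)))(i :=
        grid_point b d s L (\<xi>(q := c)) i + (real c' - real c) / real b ^ p)) i'"
    proof cases
      case 1
      then have "i' \<noteq> i" using ip(1) by blast
      with 1 show ?thesis by (simp only: grid_point_def restrict_apply if_False fun_upd_apply simp_thms)
    next
      case 2
      then show ?thesis by (simp only: grid_point_def restrict_apply if_False if_True fun_upd_apply other simp_thms not_False_eq_True)
    next
      case 3
      have "real c' / real b ^ p = real c / real b ^ p + (real c' - real c) / real b ^ p"
        by (simp add: diff_divide_distrib)
      then show ?thesis
        using 3 ip(1) by (simp only: grid_point_def restrict_apply if_True fun_upd_apply same) simp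
    qed
  qed
qed

end

section \<open>Smooth functions on the cube\<close>

text \<open>Tychonoff's theorem for functions on all natural numbers: outside I an extensional
  function has the fixed value \<open>undefined\<close>, so the remaining factors are
  singletons.\<close>

lemma compact_cube: "compact (cube I)"
proof -
  have "compactin (product_topology (\<lambda>_. euclidean) I) (cube I)"
    unfolding cube_def by (auto simp: compactin_PiE compactin_euclidean_iff)
  have eq: "cube I = PiE UNIV (\<lambda>i. if i \<in> I then {0..1} else {undefined})"
    by (auto simp: cube_def PiE_iff extensional_def split: if_splits)
  have "compactin (product_topology (\<lambda>_. euclidean) UNIV) (PiE UNIV (\<lambda>i. if i \<in> I then {0..1::real} else {undefined}))"
    by (auto simp: compactin_PiE compactin_euclidean_iff)
  then show ?thesis
    unfolding eq by (simp add: euclidean_product_topology compactin_euclidean_iff)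
qed

lemma cube_upd: "x \<in> cube I \<Longrightarrow> i \<in> I \<Longrightarrow> t \<in> {0..1} \<Longrightarrow> x(i := t) \<in> cube I"
  by (auto simp: cube_def PiE_iff extensional_def)

lemma cubeD: "x \<in> cube I \<Longrightarrow> i \<in> I \<Longrightarrow> x i \<in> {0..1}"
  unfolding cube_def by (rule PiE_mem)

text \<open>The metric of the function space is a sum of truncated coordinate distances with weights
  2^(-n), whose total is 2.\<close>

lemma dist_fun_le:
  fixes x y :: "nat \<Rightarrow> real"
  assumes "\<And>i. dist (x i) (y i) \<le> \<delta>"
  shows "dist x y \<le> 2 * \<delta>"
proof -
  let ?f = "\<lambda>n. (1/2::real)^n * min (dist (x (from_nat n)) (y (from_nat n))) 1"
  have geo: "summable (\<lambda>n. (1/2::real)^n)" by simp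
  have 1: "summable ?f"
    by (rule summable_comparison_test'[OF geo, of 0]) simp
  have 2: "?f n \<le> (1/2)^n * \<delta>" for n
    using assms[of "from_nat n"] by (intro mult_left_mono) (auto intro: min.coboundedI1)
  have 3: "summable (\<lambda>n. (1/2::real)^n * \<delta>)" by (rule summable_mult2[OF geo])
  have "suminf ?f \<le> (\<Sum>n. (1/2)^n * \<delta>)" by (rule suminf_le[OF 2 1 3])
  also have "\<dots> = (\<Sum>n. (1/2)^n) * \<delta>" by (rule suminf_mult2[OF geo, symmetric])
  also have "(\<Sum>n. (1/2::real)^n) = 2" using suminf_geometric[of "1/2::real"] by simp
  finally show ?thesis by (simp only: dist_fun_def)
qed

text \<open>Uniform continuity on the compact cube, rephrased in coordinates so that mesh sizes can
  be compared with \<delta> directly.\<close>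

lemma continuous_cube_uniform:
  fixes g :: "(nat \<Rightarrow> real) \<Rightarrow> 'v::metric_space"
  assumes "continuous_on (cube I) g" "0 < \<epsilon>"
  shows "\<exists>\<delta>>0. \<forall>x\<in>cube I. \<forall>y\<in>cube I. (\<forall>i\<in>I. \<bar>x i - y i\<bar> \<le> \<delta>) \<longrightarrow> dist (g x) (g y) < \<epsilon>"
proof -
  have "uniformly_continuous_on (cube I) g" by (rule compact_uniformly_continuous[OF assms(1) compact_cube])
  then have "\<exists>d>0. \<forall>x\<in>cube I. \<forall>y\<in>cube I. dist y x < d \<longrightarrow> dist (g y) (g x) < \<epsilon>"
    unfolding uniformly_continuous_on_def using assms(2) by (elim allE[of _ \<epsilon>] impE)
  then obtain d where d: "0 < d" "\<forall>x\<in>cube I. \<forall>y\<in>cube I. dist y x < d \<longrightarrow> dist (g y) (g x) < \<epsilon>"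
    by (elim exE conjE)
  show ?thesis
  proof (intro exI[of _ "d / 3"] conjI ballI impI)
    fix x y assume xy: "x \<in> cube I" "y \<in> cube I" "\<forall>i\<in>I. \<bar>x i - y i\<bar> \<le> d / 3"
    have "dist (x i) (y i) \<le> d / 3" for i
    proof (cases "i \<in> I")
      case False
      have "x i = undefined" "y i = undefined"
        by (rule PiE_arb[OF xy(1)[unfolded cube_def] False], rule PiE_arb[OF xy(2)[unfolded cube_def] False])
      then show ?thesis using d(1) by simp
    next
      case True
      then show ?thesis using bspec[OF xy(3) True] by (simp only: dist_real_def)
    qed
    from dist_fun_le[of x y, OF this] have "dist x y \<le> 2 * (d / 3)" .
    also have "\<dots> < d" using d(1) by simp
    finally have "dist y x < d" by (simp only: dist_commute)
    then have "dist (g y) (g x) < \<epsilon>"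
      by (rule mp[OF bspec[OF bspec[OF d(2) xy(1)] xy(2)]])
    then show "dist (g x) (g y) < \<epsilon>" by (simp only: dist_commute)
  qed (use d in simp)
qed

lemma continuous_cube_bounded:
  fixes g :: "(nat \<Rightarrow> real) \<Rightarrow> 'v::real_normed_vector"
  assumes "continuous_on (cube I) g"
  obtains B where "\<And>x. x \<in> cube I \<Longrightarrow> norm (g x) \<le> B"
  using compact_imp_bounded[OF compact_continuous_image[OF assms compact_cube]]
  unfolding bounded_iff by auto

section \<open>Measure and integration on the cube\<close>

lemma space_cube_measure: "space (cube_measure I) = cube I"
  by (simp add: cube_measure_def cube_def space_PiM space_restrict_space)

lemma measurable_cube_borel: "(\<lambda>x. x) \<in> borel_measurable (cube_measure I)"
proof (rule measurable_coordinatewise_then_product)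
  fix i show "(\<lambda>x. x i) \<in> borel_measurable (cube_measure I)"
  proof (cases "i \<in> I")
    case True
    have "(\<lambda>x. x i) \<in> measurable (cube_measure I) (restrict_space lborel {0..1})"
      unfolding cube_measure_def by (rule measurable_component_singleton[OF True])
    moreover have "(\<lambda>x. x) \<in> measurable (restrict_space lborel {0..1::real}) borel"
      by (rule measurable_restrict_space1) simp
    ultimately show ?thesis by (rule measurable_compose)
  next
    case False
    then have "x i = undefined" if "x \<in> space (cube_measure I)" for x
      using that unfolding space_cube_measure cube_def by (rule PiE_arb[rotated])
    then show ?thesis by (subst measurable_cong[where g = "\<lambda>_. undefined"]) simp_all
  qed
qed

lemma continuous_cube_measurable:
  fixes g :: "(nat \<Rightarrow> real) \<Rightarrow> 'v::topological_space"
  assumes "continuous_on (cube I) g"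
  shows "g \<in> borel_measurable (cube_measure I)"
proof -
  have "(\<lambda>x. x) \<in> measurable (cube_measure I) (restrict_space borel (cube I))"
    by (rule measurable_restrict_space2[OF _ measurable_cube_borel]) (simp add: space_cube_measure)
  from measurable_compose[OF this borel_measurable_continuous_on_restrict[OF assms]] show ?thesis .
qed

lemma prob_space_cube_measure: "prob_space (cube_measure I)"
  unfolding cube_measure_def
  by (rule prob_space_PiM, rule prob_spaceI) (simp add: emeasure_restrict_space space_restrict_space)

lemma continuous_cube_integrable:
  fixes g :: "(nat \<Rightarrow> real) \<Rightarrow> 'v::{banach, second_countable_topology}"
  assumes "continuous_on (cube I) g"
  shows "integrable (cube_measure I) g"
proof -
  interpret prob_space "cube_measure I" by (rule prob_space_cube_measure)
  obtain B where "\<And>x. x \<in> cube I \<Longrightarrow> norm (g x) \<le> B" using continuous_cube_bounded[OF assms] by blast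
  then show ?thesis
    by (intro integrable_const_bound[where B = B] continuous_cube_measurable assms AE_I2) (simp add: space_cube_measure)
qed

lemma norm_integral_cube_le:
  fixes g :: "(nat \<Rightarrow> real) \<Rightarrow> 'v::{banach, second_countable_topology}"
  assumes "integrable (cube_measure I) g" "\<And>x. x \<in> cube I \<Longrightarrow> norm (g x) \<le> B"
  shows "norm (\<integral>x. g x \<partial>cube_measure I) \<le> B"
proof -
  interpret prob_space "cube_measure I" by (rule prob_space_cube_measure)
  have "norm (\<integral>x. g x \<partial>cube_measure I) \<le> (\<integral>x. norm (g x) \<partial>cube_measure I)" by (rule integral_norm_bound)
  also have "\<dots> \<le> (\<integral>x. B \<partial>cube_measure I)"
    using assms by (intro integral_mono_AE integrable_norm AE_I2) (simp_all add: space_cube_measure)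
  finally show ?thesis by (simp add: prob_space)
qed

section \<open>Derivatives of smooth functions and of their marginals\<close>

lemma smooth_foldr:
  assumes "smooth_on_cube s f" "set js \<subseteq> {1..s}"
  shows "smooth_on_cube s (foldr partial_deriv js f)"
  unfolding smooth_on_cube_def Let_def
proof (rule ballI)
  fix ks assume "ks \<in> lists {1..s}"
  then have "ks @ js \<in> lists {1..s}" using assms(2) by auto
  with assms(1) have H: "continuous_on (cube {1..s}) (foldr partial_deriv (ks @ js) f) \<and>
      (\<forall>i\<in>{1..s}. \<forall>x\<in>cube {1..s}. (\<lambda>t. foldr partial_deriv (ks @ js) f (x(i := t))) differentiable (at (x i) within {0..1}))"
    unfolding smooth_on_cube_def Let_def by (rule bspec)
  show "continuous_on (cube {1..s}) (foldr partial_deriv ks (foldr partial_deriv js f)) \<and>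
      (\<forall>i\<in>{1..s}. \<forall>x\<in>cube {1..s}. (\<lambda>t. foldr partial_deriv ks (foldr partial_deriv js f) (x(i := t))) differentiable (at (x i) within {0..1}))"
    by (rule H[unfolded foldr_append o_apply])
qed

lemma smooth_continuous: "smooth_on_cube s f \<Longrightarrow> continuous_on (cube {1..s}) f"
  unfolding smooth_on_cube_def Let_def by (drule bspec[of _ _ "[]"]) simp_all

lemma smooth_partial: "smooth_on_cube s f \<Longrightarrow> i \<in> {1..s} \<Longrightarrow> smooth_on_cube s (partial_deriv i f)"
  using smooth_foldr[of s f "[i]"] by simp

lemma smooth_has_derivative:
  assumes "smooth_on_cube s f" "i \<in> {1..s}" "x \<in> cube {1..s}" "t \<in> {0..1}"
  shows "((\<lambda>t. f (x(i := t))) has_vector_derivative partial_deriv i f (x(i := t))) (at t within {0..1})"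
proof -
  let ?y = "x(i := t)"
  have y: "?y \<in> cube {1..s}" by (rule cube_upd[OF assms(3,2,4)])
  have H: "continuous_on (cube {1..s}) f \<and>
      (\<forall>i\<in>{1..s}. \<forall>x\<in>cube {1..s}. (\<lambda>t. f (x(i := t))) differentiable (at (x i) within {0..1}))"
    using bspec[OF assms(1)[unfolded smooth_on_cube_def Let_def] lists.Nil] unfolding foldr.simps id_apply .
  have "(\<lambda>\<tau>. f (?y(i := \<tau>))) differentiable (at (?y i) within {0..1})"
    by (rule bspec[OF bspec[OF conjunct2[OF H] assms(2)] y])
  then have "((\<lambda>\<tau>. f (?y(i := \<tau>))) has_vector_derivative vector_derivative (\<lambda>\<tau>. f (?y(i := \<tau>))) (at (?y i) within {0..1})) (at (?y i) within {0..1})"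
    unfolding vector_derivative_works .
  then show ?thesis by (simp only: partial_deriv_def fun_upd_upd fun_upd_same)
qed

text \<open>Nothing is known of f outside the cube, so identities between derivatives cannot be
  obtained from equality of functions; agreement along the segment inside the cube suffices for the
  derivative within [0, 1].\<close>

lemma partial_deriv_eqI:
  fixes f :: "(nat \<Rightarrow> real) \<Rightarrow> 'k::{real_normed_field,euclidean_space}"
  assumes "x i \<in> {0..1}" "((\<lambda>t. g t) has_vector_derivative D) (at (x i) within {0..1})"
    and "\<And>t. t \<in> {0..1} \<Longrightarrow> f (x(i := t)) = g t"
  shows "partial_deriv i f x = D"
proof -
  have "((\<lambda>t. f (x(i := t))) has_vector_derivative D) (at (x i) within {0..1})"
    by (rule has_vector_derivative_transform[OF assms(1) _ assms(2)]) (rule assms(3))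
  then show ?thesis
    unfolding partial_deriv_def using assms(1) by (intro vector_derivative_within_closed_interval) auto
qed

lemma foldr_partial_diff:
  fixes f g :: "(nat \<Rightarrow> real) \<Rightarrow> 'k::{real_normed_field,euclidean_space}"
  assumes "smooth_on_cube s f" "smooth_on_cube s g" "set js \<subseteq> {1..s}" "x \<in> cube {1..s}"
  shows "foldr partial_deriv js (\<lambda>x. f x - g x) x = foldr partial_deriv js f x - foldr partial_deriv js g x"
  using assms(3,4)
proof (induction js arbitrary: x)
  case (Cons i js)
  let ?F = "foldr partial_deriv js f" and ?G = "foldr partial_deriv js g"
  have i: "i \<in> {1..s}" and js: "set js \<subseteq> {1..s}" using Cons.prems(1) by auto
  have xi: "x i \<in> {0..1}" by (rule cubeD[OF Cons.prems(2) i])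
  have F: "((\<lambda>t. ?F (x(i := t))) has_vector_derivative partial_deriv i ?F x) (at (x i) within {0..1})"
    using smooth_has_derivative[OF smooth_foldr[OF assms(1) js] i Cons.prems(2) xi] by (simp only: fun_upd_triv)
  have G: "((\<lambda>t. ?G (x(i := t))) has_vector_derivative partial_deriv i ?G x) (at (x i) within {0..1})"
    using smooth_has_derivative[OF smooth_foldr[OF assms(2) js] i Cons.prems(2) xi] by (simp only: fun_upd_triv)
  have "partial_deriv i (foldr partial_deriv js (\<lambda>x. f x - g x)) x = partial_deriv i ?F x - partial_deriv i ?G x"
  proof (rule partial_deriv_eqI[where x = x and i = i and g = "\<lambda>t. ?F (x(i := t)) - ?G (x(i := t))", OF xi has_vector_derivative_diff[OF F G]])
    fix t :: real assume "t \<in> {0..1}"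
    from Cons.IH[OF js cube_upd[OF Cons.prems(2) i this]]
    show "foldr partial_deriv js (\<lambda>x. f x - g x) (x(i := t)) = ?F (x(i := t)) - ?G (x(i := t))" .
  qed
  then show ?case by (simp only: foldr.simps o_apply)
qed simp

lemma smooth_diff:
  fixes f g :: "(nat \<Rightarrow> real) \<Rightarrow> 'k::{real_normed_field,euclidean_space}"
  assumes "smooth_on_cube s f" "smooth_on_cube s g"
  shows "smooth_on_cube s (\<lambda>x. f x - g x)"
  unfolding smooth_on_cube_def Let_def
proof (intro ballI conjI)
  fix js assume "js \<in> lists {1..s}"
  then have js: "set js \<subseteq> {1..s}" by auto
  let ?F = "foldr partial_deriv js f" and ?G = "foldr partial_deriv js g"
  note eq = foldr_partial_diff[OF assms js]
  have "continuous_on (cube {1..s}) (\<lambda>x. ?F x - ?G x)"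
    by (intro continuous_on_diff smooth_continuous smooth_foldr assms js)
  then show "continuous_on (cube {1..s}) (foldr partial_deriv js (\<lambda>x. f x - g x))"
    by (rule continuous_on_eq) (rule eq[symmetric])
  fix i x assume i: "i \<in> {1..s}" and x: "x \<in> cube {1..s}"
  have xi: "x i \<in> {0..1}" by (rule cubeD[OF x i])
  have "((\<lambda>t. ?F (x(i := t)) - ?G (x(i := t))) has_vector_derivative
      partial_deriv i ?F (x(i := x i)) - partial_deriv i ?G (x(i := x i))) (at (x i) within {0..1})"
    by (intro has_vector_derivative_diff smooth_has_derivative[where s = s] smooth_foldr assms js i x xi)
  then have "((\<lambda>t. foldr partial_deriv js (\<lambda>x. f x - g x) (x(i := t))) has_vector_derivative
      partial_deriv i ?F (x(i := x i)) - partial_deriv i ?G (x(i := x i))) (at (x i) within {0..1})"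
    by (rule has_vector_derivative_transform[OF xi, rotated]) (rule eq[OF cube_upd[OF x i]])
  then show "(\<lambda>t. foldr partial_deriv js (\<lambda>x. f x - g x) (x(i := t))) differentiable (at (x i) within {0..1})"
    unfolding has_vector_derivative_def by (rule differentiableI)
qed

definition mixed_list :: "nat set \<Rightarrow> (nat \<Rightarrow> nat) \<Rightarrow> nat list" where
  "mixed_list u \<nu> = concat (map (\<lambda>i. replicate (\<nu> i) i) (sorted_list_of_set u))"

lemma mixed_deriv_eq: "mixed_deriv u \<nu> f = foldr partial_deriv (mixed_list u \<nu>) f"
proof -
  have eq: "foldr partial_deriv (replicate n i) g = (partial_deriv i ^^ n) g" for n i and g :: "(nat \<Rightarrow> real) \<Rightarrow> 'a"
    by (induction n) auto
  have "foldr (\<lambda>i. partial_deriv i ^^ \<nu> i) is f = foldr partial_deriv (concat (map (\<lambda>i. replicate (\<nu> i) i) is)) f" for "is"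
    by (induction "is") (simp_all add: eq)
  then show ?thesis by (simp only: mixed_deriv_def mixed_list_def)
qed

lemma set_mixed_list: "finite u \<Longrightarrow> set (mixed_list u \<nu>) \<subseteq> u"
  by (auto simp: mixed_list_def)

text \<open>The second argument may range over the full cube rather than over the remaining
  variables, so that all marginals become integrals over one and the same space.\<close>

definition glue :: "nat \<Rightarrow> nat set \<Rightarrow> (nat \<Rightarrow> real) \<Rightarrow> (nat \<Rightarrow> real) \<Rightarrow> nat \<Rightarrow> real" where
  "glue s u x y = (\<lambda>i\<in>{1..s}. if i \<in> u then x i else y i)"

lemma glue_cube: "u \<subseteq> {1..s} \<Longrightarrow> x \<in> cube u \<or> x \<in> cube {1..s} \<Longrightarrow> y \<in> cube {1..s} \<Longrightarrow> glue s u x y \<in> cube {1..s}"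
  by (auto simp: glue_def cube_def PiE_iff)

lemma glue_upd: "u \<subseteq> {1..s} \<Longrightarrow> i \<in> u \<Longrightarrow> glue s u (x(i := t)) y = (glue s u x y)(i := t)"
  by (auto simp: glue_def fun_eq_iff)

lemma restrict_cube_distr:
  assumes "u \<subseteq> {1..s}"
  shows "distr (cube_measure {1..s}) (cube_measure u) (\<lambda>x. restrict x u) = cube_measure u"
    and "(\<lambda>x. restrict x u) \<in> measurable (cube_measure {1..s}) (cube_measure u)"
proof -
  interpret p: prob_space "restrict_space lborel {0..1::real}"
    by (rule prob_spaceI) (simp add: emeasure_restrict_space space_restrict_space)
  interpret product_prob_space "\<lambda>_::nat. restrict_space lborel {0..1::real}" "{1..s}" ..
  show "distr (cube_measure {1..s}) (cube_measure u) (\<lambda>x. restrict x u) = cube_measure u"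
    unfolding cube_measure_def
    by (rule distr_PiM_restrict_finite[OF finite_subset[OF assms] assms]) simp
  show "(\<lambda>x. restrict x u) \<in> measurable (cube_measure {1..s}) (cube_measure u)"
    unfolding cube_measure_def by (rule measurable_restrict_subset[OF assms])
qed

lemma glue_continuous:
  fixes f :: "(nat \<Rightarrow> real) \<Rightarrow> 'v::topological_space"
  assumes "u \<subseteq> {1..s}" "continuous_on (cube {1..s}) f" "x \<in> cube u \<or> x \<in> cube {1..s}"
  shows "continuous_on (cube {1..s}) (\<lambda>y. f (glue s u x y))"
proof (rule continuous_on_compose2[OF assms(2)])
  show "continuous_on (cube {1..s}) (glue s u x)"
  proof (rule continuous_on_coordinatewise_then_product)
    fix i
    have "continuous_on (cube {1..s}) (\<lambda>y::nat \<Rightarrow> real. y i)" by (rule continuous_on_subset[OF continuous_on_product_coordinates subset_UNIV])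
    then show "continuous_on (cube {1..s}) (\<lambda>y. glue s u x y i)"
      unfolding glue_def restrict_apply by (cases "i \<in> {1..s}"; cases "i \<in> u") (simp_all only: if_True if_False simp_thms continuous_on_const)
  qed
  show "glue s u x ` cube {1..s} \<subseteq> cube {1..s}" using glue_cube[OF assms(1,3)] by blast
qed

text \<open>The integration over the variables outside u is extended to the whole cube, as the
  projection maps the uniform measure to the uniform measure. The point x may be given on u or on
  the whole cube; the first is the domain in the norm, the second that of the grid points.\<close>

lemma marginal_eq:
  fixes f :: "(nat \<Rightarrow> real) \<Rightarrow> 'k::{real_normed_field,euclidean_space}"
  assumes "u \<subseteq> {1..s}" "continuous_on (cube {1..s}) f" "x \<in> cube u \<or> x \<in> cube {1..s}"
  shows "marginal s u f x = (\<integral>y. f (glue s u x y) \<partial>cube_measure {1..s})"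
proof -
  let ?Z = "{1..s} - u"
  have Z: "?Z \<subseteq> {1..s}" by blast
  have m: "merge u ?Z (x, y) = glue s u x y" for y
    using assms(1) by (auto simp: merge_def glue_def fun_eq_iff)
  have r: "glue s u x (restrict y ?Z) = glue s u x y" for y
    by (auto simp: glue_def fun_eq_iff)
  have meas: "(\<lambda>y. f (glue s u x y)) \<in> borel_measurable (cube_measure ?Z)"
  proof -
    have "continuous_on (cube ?Z) (\<lambda>y. f (glue s u x y))"
    proof (rule continuous_on_compose2[OF assms(2)])
      show "continuous_on (cube ?Z) (glue s u x)"
      proof (rule continuous_on_coordinatewise_then_product)
        fix i
        have "continuous_on (cube ?Z) (\<lambda>y::nat \<Rightarrow> real. y i)" by (rule continuous_on_subset[OF continuous_on_product_coordinates subset_UNIV])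
        then show "continuous_on (cube ?Z) (\<lambda>y. glue s u x y i)"
          unfolding glue_def restrict_apply by (cases "i \<in> {1..s}"; cases "i \<in> u") (simp_all only: if_True if_False simp_thms continuous_on_const)
      qed
      show "glue s u x ` cube ?Z \<subseteq> cube {1..s}"
        using assms(1,3) by (auto simp: glue_def cube_def PiE_iff)
    qed
    then show ?thesis by (rule continuous_cube_measurable)
  qed
  have "marginal s u f x = (\<integral>y. f (glue s u x y) \<partial>cube_measure ?Z)"
    unfolding marginal_def m ..
  also have "\<dots> = (\<integral>y. f (glue s u x y) \<partial>distr (cube_measure {1..s}) (cube_measure ?Z) (\<lambda>x. restrict x ?Z))"
    unfolding restrict_cube_distr(1)[OF Z] ..
  also have "\<dots> = (\<integral>y. f (glue s u x (restrict y ?Z)) \<partial>cube_measure {1..s})"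
    by (rule integral_distr[OF restrict_cube_distr(2)[OF Z] meas])
  finally show ?thesis unfolding r .
qed

text \<open>Differentiation under the integral sign: by uniform continuity of the derivative, the
  error of linearisation is at most e |t - x_i| for small |t - x_i|, uniformly in the variables
  integrated out.\<close>

lemma partial_deriv_marginal:
  fixes f :: "(nat \<Rightarrow> real) \<Rightarrow> 'k::{real_normed_field,euclidean_space}"
  assumes u: "u \<subseteq> {1..s}" "i \<in> u" and f: "smooth_on_cube s f" and x: "x \<in> cube u"
  shows "((\<lambda>t. marginal s u f (x(i := t))) has_vector_derivative marginal s u (partial_deriv i f) x) (at (x i) within {0..1})"
  unfolding has_vector_derivative_def has_derivative_within_alt
proof (intro conjI allI impI)
  show "bounded_linear (\<lambda>h. h *\<^sub>R marginal s u (partial_deriv i f) x)" by (rule bounded_linear_scaleR_left)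
next
  fix e :: real assume e: "0 < e"
  have i: "i \<in> {1..s}" using u by blast
  let ?f' = "partial_deriv i f"
  have cont: "continuous_on (cube {1..s}) f" by (rule smooth_continuous[OF f])
  have cont': "continuous_on (cube {1..s}) ?f'" by (rule smooth_continuous[OF smooth_partial[OF f i]])
  obtain \<delta> where \<delta>: "0 < \<delta>" "\<And>x y. x \<in> cube {1..s} \<Longrightarrow> y \<in> cube {1..s} \<Longrightarrow> (\<forall>i\<in>{1..s}. \<bar>x i - y i\<bar> \<le> \<delta>) \<Longrightarrow> dist (?f' x) (?f' y) < e"
    using continuous_cube_uniform[OF cont' e] by blast
  show "\<exists>d>0. \<forall>t\<in>{0..1}. norm (t - x i) < d \<longrightarrow>
      norm (marginal s u f (x(i := t)) - marginal s u f (x(i := x i)) - (t - x i) *\<^sub>R marginal s u ?f' x) \<le> e * norm (t - x i)"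
  proof (intro exI[of _ \<delta>] conjI ballI impI \<delta>(1))
    fix t assume t: "t \<in> {0..1::real}" and lt: "norm (t - x i) < \<delta>"
    have xi: "x i \<in> {0..1}" by (rule cubeD[OF x u(2)])
    have xt: "x(i := t) \<in> cube u" by (rule cube_upd[OF x u(2) t])
    define S where "S = closed_segment (x i) t"
    have S: "S \<subseteq> {0..1}" unfolding S_def using xi t by (intro closed_segment_subset) auto
    have pt: "norm (f (glue s u (x(i := t)) y) - f (glue s u x y) - (t - x i) *\<^sub>R ?f' (glue s u x y)) \<le> e * norm (t - x i)"
      if y: "y \<in> cube {1..s}" for y
    proof -
      let ?z = "glue s u x y"
      have z: "?z \<in> cube {1..s}" by (rule glue_cube[OF u(1) disjI1[OF x] y])
      have zi: "?z i = x i" using u i by (simp add: glue_def)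
      have "norm (f (?z(i := t)) - f (?z(i := x i)) - (t - x i) *\<^sub>R ?f' (?z(i := x i))) \<le> norm (t - x i) * e"
      proof (rule vector_differentiable_bound_linearization[where S = S])
        show "((\<lambda>t. f (?z(i := t))) has_vector_derivative ?f' (?z(i := \<tau>))) (at \<tau> within S)" if "\<tau> \<in> S" for \<tau>
          by (rule has_vector_derivative_within_subset[OF smooth_has_derivative[OF f i z] S]) (use that S in blast)
        show "closed_segment (x i) t \<subseteq> S" unfolding S_def by (rule order_refl)
        show "x i \<in> S" unfolding S_def by simp
        show "norm (?f' (?z(i := \<tau>)) - ?f' (?z(i := x i))) \<le> e" if \<tau>: "\<tau> \<in> S" for \<tau>
        proof -
          have "dist (?f' (?z(i := \<tau>))) (?f' (?z(i := x i))) < e"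
          proof (rule \<delta>(2))
            show "?z(i := \<tau>) \<in> cube {1..s}" "?z(i := x i) \<in> cube {1..s}"
              by (rule cube_upd[OF z i], use \<tau> S in blast, rule cube_upd[OF z i xi])
            have "\<bar>\<tau> - x i\<bar> \<le> \<bar>t - x i\<bar>"
              using \<tau> unfolding S_def by (auto simp: closed_segment_eq_real_ivl split: if_splits)
            then show "\<forall>j\<in>{1..s}. \<bar>(?z(i := \<tau>)) j - (?z(i := x i)) j\<bar> \<le> \<delta>"
              using lt \<delta>(1) by simp
          qed
          then show ?thesis by (simp add: dist_norm)
        qed
      qed
      moreover have "?z(i := x i) = ?z" using zi by auto
      ultimately show ?thesis
        unfolding glue_upd[OF u] by (simp only: mult.commute)
    qed
    have int1: "integrable (cube_measure {1..s}) (\<lambda>y. f (glue s u (x(i := t)) y))"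
      by (rule continuous_cube_integrable[OF glue_continuous[OF u(1) cont disjI1[OF xt]]])
    have int2: "integrable (cube_measure {1..s}) (\<lambda>y. f (glue s u x y))"
      by (rule continuous_cube_integrable[OF glue_continuous[OF u(1) cont disjI1[OF x]]])
    have int3: "integrable (cube_measure {1..s}) (\<lambda>y. ?f' (glue s u x y))"
      by (rule continuous_cube_integrable[OF glue_continuous[OF u(1) cont' disjI1[OF x]]])
    have int3': "integrable (cube_measure {1..s}) (\<lambda>y. (t - x i) *\<^sub>R ?f' (glue s u x y))"
      by (rule integrable_scaleR_right) (rule int3)
    have "marginal s u f (x(i := t)) - marginal s u f (x(i := x i)) - (t - x i) *\<^sub>R marginal s u ?f' x =
        (\<integral>y. f (glue s u (x(i := t)) y) - f (glue s u x y) - (t - x i) *\<^sub>R ?f' (glue s u x y) \<partial>cube_measure {1..s})"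
      unfolding fun_upd_triv marginal_eq[OF u(1) cont disjI1[OF xt]] marginal_eq[OF u(1) cont disjI1[OF x]]
        marginal_eq[OF u(1) cont' disjI1[OF x]]
        Bochner_Integration.integral_diff[OF Bochner_Integration.integrable_diff[OF int1 int2] int3']
        Bochner_Integration.integral_diff[OF int1 int2] integral_scaleR_right ..
    also have "norm \<dots> \<le> e * norm (t - x i)"
      by (rule norm_integral_cube_le[OF Bochner_Integration.integrable_diff[OF Bochner_Integration.integrable_diff[OF int1 int2] int3'] pt])
    finally show "norm (marginal s u f (x(i := t)) - marginal s u f (x(i := x i)) - (t - x i) *\<^sub>R marginal s u ?f' x) \<le> e * norm (t - x i)" .
  qed
qed

lemma foldr_partial_marginal:
  fixes f :: "(nat \<Rightarrow> real) \<Rightarrow> 'k::{real_normed_field,euclidean_space}"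
  assumes u: "u \<subseteq> {1..s}" and f: "smooth_on_cube s f" and js: "set js \<subseteq> u" and x: "x \<in> cube u"
  shows "foldr partial_deriv js (marginal s u f) x = marginal s u (foldr partial_deriv js f) x"
  using js x
proof (induction js arbitrary: x)
  case (Cons i js)
  have i: "i \<in> u" and js: "set js \<subseteq> u" using Cons.prems(1) by auto
  have sm: "smooth_on_cube s (foldr partial_deriv js f)" by (rule smooth_foldr[OF f]) (use js u in blast)
  have "partial_deriv i (foldr partial_deriv js (marginal s u f)) x = marginal s u (partial_deriv i (foldr partial_deriv js f)) x"
  proof (rule partial_deriv_eqI[where x = x and i = i and g = "\<lambda>t. marginal s u (foldr partial_deriv js f) (x(i := t))",
        OF cubeD[OF Cons.prems(2) i] partial_deriv_marginal[OF u i sm Cons.prems(2)]])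
    fix t :: real assume "t \<in> {0..1}"
    from Cons.IH[OF js cube_upd[OF Cons.prems(2) i this]]
    show "foldr partial_deriv js (marginal s u f) (x(i := t)) = marginal s u (foldr partial_deriv js f) (x(i := t))" .
  qed
  then show ?case by (simp only: foldr.simps o_apply)
qed simp

section \<open>A scrambled point is uniformly distributed\<close>

text \<open>The mass of $(x,\infty)$ under the uniform distribution on $[0,1]$.\<close>

definition upper_mass :: "real \<Rightarrow> real" where
  "upper_mass x = min 1 (max 0 (1 - x))"

text \<open>For x in [0, 1) exactly V - 1 - floor(x V) grid points lie above x, which differs from
  (1 - x) V by at most 1.\<close>

lemma card_grid_above:
  assumes "0 < V"
  shows "\<bar>real (card {k \<in> {..<V}. x < real k / real V}) / real V - upper_mass x\<bar> \<le> 1 / real V"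
proof -
  let ?S = "{k \<in> {..<V}. x < real k / real V}"
  consider "x < 0" | "0 \<le> x" "x < 1" | "1 \<le> x" by linarith
  then show ?thesis
  proof cases
    case 1
    then have "?S = {..<V}"
      by (auto intro: less_le_trans)
    then show ?thesis using 1 assms by (simp add: upper_mass_def)
  next
    case 2
    define f where "f = nat \<lfloor>x * real V\<rfloor>"
    have f: "real f \<le> x * real V" "x * real V < real f + 1"
      using 2 by (auto simp: f_def)
    have "?S = {f<..<V}"
    proof (intro set_eqI iffI)
      fix k assume "k \<in> ?S"
      then have "k < V" "x * real V < real k" using assms by (auto simp: pos_less_divide_eq)
      then show "k \<in> {f<..<V}" using f by auto
    next
      fix k assume "k \<in> {f<..<V}"
      then have "k < V" "real f + 1 \<le> real k" by auto
      then show "k \<in> ?S" using f assms by (auto simp: pos_less_divide_eq)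
    qed
    moreover have "f < V"
    proof -
      have "x * real V < 1 * real V" using 2 assms by (intro mult_strict_right_mono) auto
      then show ?thesis using f by linarith
    qed
    ultimately have c: "real (card ?S) = real V - real f - 1" by simp
    have um: "upper_mass x = 1 - x" using 2 by (simp add: upper_mass_def)
    have "real (card ?S) / real V - upper_mass x = (x * real V - real f - 1) / real V"
      unfolding c um using assms by (simp add: field_simps)
    also have "\<bar>\<dots>\<bar> \<le> 1 / real V"
      using f assms by (auto simp: abs_le_iff intro!: divide_right_mono)
    finally show ?thesis .
  next
    case 3
    have "?S = {}"
    proof (intro equals0I)
      fix k assume "k \<in> ?S"
      then have "real k / real V < 1" "x < real k / real V" using assms by auto
      with 3 show False by linarith
    qed
    then have c: "card ?S = 0" by (simp only: card.empty)
    show ?thesis using 3 unfolding c by (simp add: upper_mass_def)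
  qed
qed

lemma upper_mass_lipschitz: "\<bar>upper_mass x - upper_mass y\<bar> \<le> \<bar>x - y\<bar>"
  by (auto simp: upper_mass_def min_def max_def)

lemma emeasure_unit_greaterThan: "emeasure lborel ({x<..} \<inter> {0..1}) = ennreal (upper_mass x)"
proof -
  consider "x < 0" | "0 \<le> x" "x < 1" | "1 \<le> x" by linarith
  then show ?thesis
  proof cases
    case 1
    then have "{x<..} \<inter> {0..1} = {0..1}" by auto
    then show ?thesis using 1 by (simp add: upper_mass_def)
  next
    case 2
    then have "{x<..} \<inter> {0..1} = {x<..1}" by auto
    then show ?thesis using 2 by (simp add: upper_mass_def)
  next
    case 3
    then have "{x<..} \<inter> {0..1} = {}" by auto
    then show ?thesis using 3 by (simp add: upper_mass_def)
  qed
qed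

lemma prob_space_unit: "prob_space (restrict_space lborel {0..1::real})"
  by (rule prob_spaceI) (simp add: emeasure_restrict_space space_restrict_space)

locale scrambling_interlaced = scrambling b "d * s" for b d s :: nat +
  assumes d_pos: "1 \<le> d" and s_pos: "1 \<le> s"
begin

context
  fixes z :: "nat \<Rightarrow> nat \<Rightarrow> nat"
  assumes z: "\<And>j a. z j a < b"
begin

text \<open>R given consecutive digits are all b - 1 with probability b^(-R). Letting R grow and
  then combining the countably many starting positions gives the claim.\<close>

lemma AE_not_eventually_max:
  assumes "j \<in> {1..d * s}"
  shows "AE \<pi> in P. \<forall>K. \<exists>a>K. scrambled z \<pi> (j, a) \<noteq> b - 1"
proof -
  have "AE \<pi> in P. \<exists>a>K. scrambled z \<pi> (j, a) \<noteq> b - 1" for K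
  proof -
    let ?A = "\<lambda>R. {\<pi> \<in> space P. \<forall>a\<in>{K<..K + R}. scrambled z \<pi> (j, a) = b - 1}"
    have meas1: "{\<pi> \<in> space P. scrambled z \<pi> (j, a) = c} \<in> sets P" for a c
    proof -
      have "(\<lambda>\<pi>. scrambled z \<pi> (j, a)) -` {c} \<inter> space P \<in> sets P"
        by (rule measurable_sets[OF measurable_scrambled[where z = z, OF z]]) (use assms in simp_all)
      moreover have "(\<lambda>\<pi>. scrambled z \<pi> (j, a)) -` {c} \<inter> space P = {\<pi> \<in> space P. scrambled z \<pi> (j, a) = c}" by blast
      ultimately show ?thesis by (simp only:)
    qed
    have A: "?A R \<in> sets P" for R
      by (intro sets.sets_Collect_finite_All meas1) simp
    have capA: "(\<Inter>R. ?A R) \<in> sets P"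
      by (rule sets.countable_INT) (use A in blast)+
    have pA: "measure P (?A R) = (1 / real b) ^ R" for R
    proof -
      let ?Q = "{j} \<times> {K<..K + R}"
      let ?g = "\<lambda>\<xi>. if \<forall>q\<in>?Q. \<xi> q = b - 1 then 1 else (0::real)"
      have fin: "finite ?Q" by simp
      have QQ: "?Q \<subseteq> {1..d * s} \<times> {1..}" using assms by auto
      have dep: "depends_on ?Q ?g" unfolding depends_on_def by simp
      have "measure P (?A R) = (\<integral>\<pi>. indicator (?A R) \<pi> \<partial>P)"
        unfolding Bochner_Integration.integral_indicator Int_absorb2[OF sets.sets_into_space[OF A[of R]]] ..
      also have "\<dots> = (\<integral>\<pi>. ?g (scrambled z \<pi>) \<partial>P)"
      proof (rule Bochner_Integration.integral_cong[OF refl])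
        fix \<pi> assume "\<pi> \<in> space P"
        then have "\<pi> \<in> ?A R \<longleftrightarrow> (\<forall>q\<in>?Q. scrambled z \<pi> q = b - 1)" by blast
        then show "indicator (?A R) \<pi> = ?g (scrambled z \<pi>)"
          by (simp only: indicator_def of_bool_def)
      qed
      also have "\<dots> = array_mean b ?Q ?g"
        by (rule integral_scrambled[where z = z, OF z fin QQ dep])
      also have "\<dots> = (1 / real b) ^ R"
      proof -
        define w where "w = (\<lambda>q\<in>?Q. b - 1)"
        have w: "w \<in> arrays b ?Q" using b_gt_1 by (simp add: w_def)
        have "(\<Sum>\<xi>\<in>arrays b ?Q. ?g \<xi>) = ?g w + (\<Sum>\<xi>\<in>arrays b ?Q - {w}. ?g \<xi>)"
          by (rule sum.remove[OF _ w]) (simp add: finite_PiE)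
        also have "(\<Sum>\<xi>\<in>arrays b ?Q - {w}. ?g \<xi>) = 0"
        proof (rule sum.neutral, rule ballI)
          fix \<xi> assume x: "\<xi> \<in> arrays b ?Q - {w}"
          have "\<not> (\<forall>q\<in>?Q. \<xi> q = b - 1)"
          proof
            assume "\<forall>q\<in>?Q. \<xi> q = b - 1"
            then have "\<xi> q = w q" if "q \<in> ?Q" for q
              using that by (simp only: w_def restrict_apply if_True)
            then have "\<xi> = w" by (rule PiE_ext[OF DiffD1[OF x] w])
            with x show False by blast
          qed
          then show "?g \<xi> = 0" by (simp only: if_False)
        qed
        also have "?g w = 1" by (simp add: w_def)
        finally have "(\<Sum>\<xi>\<in>arrays b ?Q. ?g \<xi>) = 1" by (simp only: add_0_right)
        then show ?thesis unfolding array_mean_def by (simp add: card_cartesian_product power_inverse divide_inverse)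
      qed
      finally show ?thesis .
    qed
    have dec: "decseq ?A"
      unfolding decseq_def
    proof (intro allI impI)
      fix R R' :: nat assume "R \<le> R'"
      then have "{K<..K + R} \<subseteq> {K<..K + R'}" by auto
      then show "?A R' \<subseteq> ?A R" by blast
    qed
    have "(\<lambda>R. measure P (?A R)) \<longlonglongrightarrow> measure P (\<Inter>R. ?A R)"
      by (rule P.finite_Lim_measure_decseq[OF _ dec]) (use A in blast)
    moreover have "(\<lambda>R. measure P (?A R)) \<longlonglongrightarrow> 0"
      unfolding pA using b_gt_1 by (intro LIMSEQ_power_zero) simp
    ultimately have "measure P (\<Inter>R. ?A R) = 0" by (rule LIMSEQ_unique)
    then have null: "(\<Inter>R. ?A R) \<in> null_sets P"
      by (intro null_setsI capA) (simp only: P.emeasure_eq_measure ennreal_0)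
    show ?thesis
    proof (rule AE_I'[OF null], rule subsetI, rule INT_I)
      fix \<pi> R assume "\<pi> \<in> {\<pi> \<in> space P. \<not> (\<exists>a>K. scrambled z \<pi> (j, a) \<noteq> b - 1)}"
      then show "\<pi> \<in> ?A R" by simp
    qed
  qed
  then show ?thesis by (simp add: AE_all_countable)
qed

end

definition point_map :: "(nat \<Rightarrow> real) \<Rightarrow> (nat \<times> nat list \<Rightarrow> nat \<Rightarrow> nat) \<Rightarrow> nat \<Rightarrow> real" where
  "point_map x \<pi> = interlace b d s (scramble b \<pi> x)"

context
  fixes x :: "nat \<Rightarrow> real" and z
  defines "z \<equiv> \<lambda>j. base_digit b (x j)"
begin

lemma z_less: "z j a < b"
  using b_gt_1 by (simp add: z_def base_digit_less)

lemma scramble_digit_value: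
  "scramble b \<pi> x j = digit_value b (\<lambda>a. scrambled z \<pi> (j, a))"
  by (simp add: scramble_eq scrambled_def digit_key_def z_def)

text \<open>Interlacing reads the digits of the scrambled point as a real number; these are the
  scrambled digits unless the latter are eventually b - 1, which is a null event.\<close>

lemma AE_base_digit_scramble:
  "AE \<pi> in P. \<forall>q\<in>{1..d * s} \<times> {1..}. base_digit b (scramble b \<pi> x (fst q)) (snd q) = scrambled z \<pi> q"
proof -
  have "AE \<pi> in P. \<forall>j\<in>{1..d * s}. \<forall>K. \<exists>a>K. scrambled z \<pi> (j, a) \<noteq> b - 1"
    by (subst AE_finite_all[OF finite_atLeastAtMost], rule ballI, rule AE_not_eventually_max[where z = z, OF z_less])
  then show ?thesis
  proof (rule AE_mp, intro AE_I2 impI ballI)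
    fix \<pi> q assume \<pi>: "\<pi> \<in> space P" and *: "\<forall>j\<in>{1..d * s}. \<forall>K. \<exists>a>K. scrambled z \<pi> (j, a) \<noteq> b - 1"
      and q: "q \<in> {1..d * s} \<times> {1::nat..}"
    have "scrambled z \<pi> (fst q, a) < b" for a
      by (rule scrambled_less[where z = z, OF z_less \<pi>]) (use q in auto)
    moreover have "\<exists>a>K. scrambled z \<pi> (fst q, a) \<noteq> b - 1" for K using * q by auto
    ultimately have "base_digit b (digit_value b (\<lambda>a. scrambled z \<pi> (fst q, a))) (snd q) = scrambled z \<pi> (fst q, snd q)"
      using q by (intro base_digit_digit_value b_gt_1) auto
    then show "base_digit b (scramble b \<pi> x (fst q)) (snd q) = scrambled z \<pi> q"
      by (simp add: scramble_digit_value)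
  qed
qed

text \<open>The leading digits of the point are almost surely those of the grid point, so the point
  lies in the cell whose lower corner is the grid point.\<close>

lemma point_map_between:
  "AE \<pi> in P. \<forall>L. \<forall>i\<in>{1..s}. grid_point b d s L (scrambled z \<pi>) i \<le> point_map x \<pi> i \<and>
    point_map x \<pi> i \<le> grid_point b d s L (scrambled z \<pi>) i + 1 / real b ^ (d * L)"
  using AE_base_digit_scramble
proof (rule AE_mp, intro AE_I2 impI allI ballI)
  fix \<pi> L i assume \<pi>: "\<pi> \<in> space P" and i: "i \<in> {1..s}"
    and *: "\<forall>q\<in>{1..d * s} \<times> {1..}. base_digit b (scramble b \<pi> x (fst q)) (snd q) = scrambled z \<pi> q"
  let ?\<xi> = "\<lambda>(j, a). base_digit b (scramble b \<pi> x j) a"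
  have e: "coord_digit d ?\<xi> i p < b" for p
    using b_gt_1 by (simp add: coord_digit_def base_digit_less)
  have "coord_digit d ?\<xi> i p = coord_digit d (scrambled z \<pi>) i p" if "p \<in> {1..d * L}" for p
    using * coord_index[OF b_gt_1 d_pos i that] unfolding coord_digit_def by fastforce
  then have "digit_sum b (coord_digit d ?\<xi> i) (d * L) = grid_point b d s L (scrambled z \<pi>) i"
    using i by (simp add: grid_point_def digit_sum_def)
  moreover have "point_map x \<pi> i = digit_value b (coord_digit d ?\<xi> i)"
    using i by (simp add: point_map_def interlace_eq[OF b_gt_1 d_pos] array_point_def)
  ultimately show "grid_point b d s L (scrambled z \<pi>) i \<le> point_map x \<pi> i \<and>
    point_map x \<pi> i \<le> grid_point b d s L (scrambled z \<pi>) i + 1 / real b ^ (d * L)"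
    using digit_value_ge[of "coord_digit d ?\<xi> i" b "d * L", OF e b_gt_1]
      digit_value_le[of "coord_digit d ?\<xi> i" b "d * L", OF e b_gt_1] by simp
qed

lemma point_map_cube: "point_map x \<pi> \<in> cube {1..s}"
  unfolding point_map_def interlace_eq[OF b_gt_1 d_pos] array_point_def cube_def
  using b_gt_1 by (intro restrict_PiE_iff[THEN iffD2] ballI)
    (auto intro!: digit_value_bounds simp: coord_digit_def base_digit_less)

lemma point_map_measurable_coord: "i \<in> {1..s} \<Longrightarrow> (\<lambda>\<pi>. point_map x \<pi> i) \<in> borel_measurable P"
proof -
  assume i: "i \<in> {1..s}"
  have sc: "(\<lambda>\<pi>. scramble b \<pi> x j) \<in> borel_measurable P" if "j \<in> {1..d * s}" for j
  proof -
    have "(\<lambda>\<pi>. real (scrambled z \<pi> (j, Suc a)) / real b ^ Suc a) \<in> borel_measurable P" for a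
    proof -
      have "(\<lambda>\<pi>. scrambled z \<pi> (j, Suc a)) \<in> measurable P (count_space UNIV)"
        by (rule measurable_scrambled[where z = z, OF z_less]) (use that in simp)
      moreover have "(\<lambda>k::nat. real k / real b ^ Suc a) \<in> borel_measurable (count_space UNIV)"
        by (simp only: measurable_count_space_eq1) simp
      ultimately show ?thesis by (rule measurable_compose)
    qed
    then show ?thesis
      unfolding scramble_digit_value digit_value_def by (rule borel_measurable_suminf)
  qed
  have "(\<lambda>\<pi>. real (base_digit b (scramble b \<pi> x ((i - 1) * d + r)) (Suc a)) / real b ^ (r + a * d)) \<in> borel_measurable P"
    if "r \<in> {1..d}" for r a
  proof -
    obtain i' where i': "i = Suc i'" using i by (cases i) auto
    have "i' * d + d \<le> d * s"
      using i i' mult_le_mono1[of "Suc i'" s d] by (simp add: mult.commute)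
    then have "(i - 1) * d + r \<in> {1..d * s}" using that i' by auto
    from sc[OF this] have "(\<lambda>\<pi>. \<lfloor>scramble b \<pi> x ((i - 1) * d + r) * real b ^ Suc a\<rfloor>) \<in> measurable P (count_space UNIV)"
      by measurable
    moreover have "(\<lambda>k::int. real (nat (k mod int b)) / real b ^ (r + a * d)) \<in> borel_measurable (count_space UNIV)"
      by (simp only: measurable_count_space_eq1) simp
    ultimately show ?thesis unfolding base_digit_def by (rule measurable_compose)
  qed
  then have "(\<lambda>\<pi>. \<Sum>a. \<Sum>r=1..d. real (base_digit b (scramble b \<pi> x ((i - 1) * d + r)) (Suc a)) / real b ^ (r + a * d))
      \<in> borel_measurable P"
    by (rule borel_measurable_suminf[OF borel_measurable_sum])
  then show ?thesis
    using i by (simp only: point_map_def interlace_def restrict_apply if_True)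
qed

lemma point_map_measurable: "point_map x \<in> measurable P (cube_measure {1..s})"
  unfolding cube_measure_def
proof (rule measurable_PiM_single'[where f = "\<lambda>i \<pi>. point_map x \<pi> i"])
  fix i assume i: "i \<in> {1..s}"
  have "(\<lambda>\<pi>. point_map x \<pi> i) \<in> measurable P lborel"
    using point_map_measurable_coord[OF i] by simp
  moreover have "point_map x \<pi> i \<in> {0..1}" for \<pi>
    using point_map_cube[of \<pi>] i by (auto simp: cube_def PiE_iff)
  ultimately show "(\<lambda>\<pi>. point_map x \<pi> i) \<in> measurable P (restrict_space lborel {0..1})"
    by (intro measurable_restrict_space2) auto
next
  show "(\<lambda>\<pi>. point_map x \<pi>) \<in> space P \<rightarrow> (\<Pi>\<^sub>E i\<in>{1..s}. space (restrict_space lborel {0..1}))"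
    using point_map_cube by (auto simp: cube_def space_restrict_space)
qed

lemma prob_grid_above:
  "(\<integral>\<pi>. (if \<forall>i\<in>{1..s}. y i < grid_point b d s L (scrambled z \<pi>) i then 1 else (0::real)) \<partial>P) =
    (\<Prod>i\<in>{1..s}. real (card {k \<in> {..<b ^ (d * L)}. y i < real k / real (b ^ (d * L))}) / real (b ^ (d * L)))"
proof -
  let ?V = "b ^ (d * L)" and ?Q = "{1..d * s} \<times> {1..L}"
  let ?F = "\<lambda>x. if \<forall>i\<in>{1..s}. y i < x i then 1 else (0::real)"
  have QQ: "?Q \<subseteq> {1..d * s} \<times> {1..}" and fin: "finite ?Q" by auto
  have F: "?F x = (\<Prod>i\<in>{1..s}. if y i < x i then 1 else 0)" for x
    by (auto intro!: prod_zero[symmetric])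
  have "(\<integral>\<pi>. ?F (grid_point b d s L (scrambled z \<pi>)) \<partial>P) = array_mean b ?Q (\<lambda>\<xi>. ?F (grid_point b d s L \<xi>))"
    by (rule integral_scrambled[where z = z, OF z_less fin QQ depends_on_grid[OF b_gt_1 d_pos]])
  also have "\<dots> = (\<Sum>k\<in>PiE {1..s} (\<lambda>_. {..<?V}). ?F (\<lambda>i\<in>{1..s}. real (k i) / real ?V)) /\<^sub>R real (?V ^ s)"
    by (rule array_mean_grid[OF b_gt_1 d_pos])
  also have "(\<Sum>k\<in>PiE {1..s} (\<lambda>_. {..<?V}). ?F (\<lambda>i\<in>{1..s}. real (k i) / real ?V)) =
      (\<Sum>k\<in>PiE {1..s} (\<lambda>_. {..<?V}). \<Prod>i\<in>{1..s}. if y i < real (k i) / real ?V then 1 else 0)"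
    unfolding F by (intro sum.cong prod.cong refl) simp
  also have "\<dots> = (\<Prod>i\<in>{1..s}. \<Sum>k<?V. if y i < real k / real ?V then 1 else 0)"
    by (subst prod_sum_PiE) simp_all
  also have "\<dots> = (\<Prod>i\<in>{1..s}. real (card {k \<in> {..<?V}. y i < real k / real ?V}))"
    by (intro prod.cong refl) (simp add: sum.If_cases Int_def)
  finally have "(\<integral>\<pi>. ?F (grid_point b d s L (scrambled z \<pi>)) \<partial>P) =
      (\<Prod>i\<in>{1..s}. real (card {k \<in> {..<?V}. y i < real k / real ?V})) /\<^sub>R real (?V ^ s)" .
  moreover have "(\<Prod>i\<in>{1..s}. real (card {k \<in> {..<?V}. y i < real k / real ?V}) / real ?V) =
      (\<Prod>i\<in>{1..s}. real (card {k \<in> {..<?V}. y i < real k / real ?V})) / real ?V ^ s"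
    by (simp only: prod_dividef prod_constant card_atLeastAtMost) simp
  ultimately show ?thesis
    by (simp only: real_scaleR_def divide_inverse_commute of_nat_power)
qed

text \<open>The event is enclosed between two events for the grid point, with thresholds y and y
  lowered by one mesh. Both probabilities are products of counts on the grid and tend to the same
  limit.\<close>

lemma prob_point_map_above:
  "measure P {\<pi> \<in> space P. \<forall>i\<in>{1..s}. y i < point_map x \<pi> i} = (\<Prod>i\<in>{1..s}. upper_mass (y i))"
proof -
  let ?A = "{\<pi> \<in> space P. \<forall>i\<in>{1..s}. y i < point_map x \<pi> i}"
  let ?V = "\<lambda>L. b ^ (d * L)"
  let ?N = "\<lambda>y L. \<Prod>i\<in>{1..s}. real (card {k \<in> {..<?V L}. y i < real k / real (?V L)}) / real (?V L)"
  let ?G = "\<lambda>y L \<pi>. if \<forall>i\<in>{1..s}. y i < grid_point b d s L (scrambled z \<pi>) i then 1 else (0::real)"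
  have A: "?A \<in> sets P"
  proof (intro sets.sets_Collect_finite_All)
    fix i assume "i \<in> {1..s}"
    from point_map_measurable_coord[OF this] show "{\<pi> \<in> space P. y i < point_map x \<pi> i} \<in> sets P"
      by (rule borel_measurable_iff_greater[THEN iffD1, rule_format])
  qed simp
  have intG: "integrable P (?G y L)" for y L
  proof -
    have fin: "finite ({1..d * s} \<times> {1..L})" and fQ: "fst ` ({1..d * s} \<times> {1..L}) \<subseteq> {1..d * s}" by auto
    show ?thesis
      by (rule integrable_scrambled[where z = z and g = "\<lambda>\<xi>. if \<forall>i\<in>{1..s}. y i < grid_point b d s L \<xi> i then 1 else 0",
          OF z_less fin fQ depends_on_grid[OF b_gt_1 d_pos, where F = "\<lambda>x. if \<forall>i\<in>{1..s}. y i < x i then 1 else 0"]])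
  qed
  have intA: "integrable P (indicator ?A :: _ \<Rightarrow> real)"
    by (rule P.integrable_const_bound[where B = 1, OF _ borel_measurable_indicator[OF A]])
       (intro AE_I2, simp add: indicator_def)
  have mA: "measure P ?A = (\<integral>\<pi>. indicator ?A \<pi> \<partial>P)"
    unfolding Bochner_Integration.integral_indicator Int_absorb2[OF sets.sets_into_space[OF A]] ..
  have lower: "?N y L \<le> measure P ?A" for L
  proof -
    have "(\<integral>\<pi>. ?G y L \<pi> \<partial>P) \<le> (\<integral>\<pi>. indicator ?A \<pi> \<partial>P)"
    proof (rule integral_mono_AE[OF intG intA])
      show "AE \<pi> in P. ?G y L \<pi> \<le> indicator ?A \<pi>"
        using point_map_between
      proof (rule AE_mp, intro AE_I2 impI)
        fix \<pi> assume \<pi>: "\<pi> \<in> space P" and *: "\<forall>L. \<forall>i\<in>{1..s}. grid_point b d s L (scrambled z \<pi>) i \<le> point_map x \<pi> i \<and>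
          point_map x \<pi> i \<le> grid_point b d s L (scrambled z \<pi>) i + 1 / real b ^ (d * L)"
        show "?G y L \<pi> \<le> indicator ?A \<pi>"
        proof (cases "\<forall>i\<in>{1..s}. y i < grid_point b d s L (scrambled z \<pi>) i")
          case True
          have "y i < point_map x \<pi> i" if i: "i \<in> {1..s}" for i
            by (rule less_le_trans) (use True * i in blast)+
          then have "\<pi> \<in> ?A" using \<pi> by blast
          then have "indicator ?A \<pi> = (1::real)" by (rule indicator_simps(1))
          then show ?thesis by (subst if_P[OF True]) (simp only: order_refl)
        next
          case False
          show ?thesis by (subst if_not_P[OF False]) (rule indicator_pos_le)
        qed
      qed
    qed
    then show ?thesis unfolding mA prob_grid_above .
  qed
  have upper: "measure P ?A \<le> ?N (\<lambda>i. y i - 1 / real (?V L)) L" for L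
  proof -
    have "(\<integral>\<pi>. indicator ?A \<pi> \<partial>P) \<le> (\<integral>\<pi>. ?G (\<lambda>i. y i - 1 / real (?V L)) L \<pi> \<partial>P)"
    proof (rule integral_mono_AE[OF intA intG])
      show "AE \<pi> in P. indicator ?A \<pi> \<le> ?G (\<lambda>i. y i - 1 / real (?V L)) L \<pi>"
        using point_map_between
      proof (rule AE_mp, intro AE_I2 impI)
        fix \<pi> assume *: "\<forall>L. \<forall>i\<in>{1..s}. grid_point b d s L (scrambled z \<pi>) i \<le> point_map x \<pi> i \<and>
          point_map x \<pi> i \<le> grid_point b d s L (scrambled z \<pi>) i + 1 / real b ^ (d * L)"
        show "indicator ?A \<pi> \<le> ?G (\<lambda>i. y i - 1 / real (?V L)) L \<pi>"
        proof (cases "\<pi> \<in> ?A")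
          case True
          have "y i - 1 / real (?V L) < grid_point b d s L (scrambled z \<pi>) i" if i: "i \<in> {1..s}" for i
          proof -
            have "y i < point_map x \<pi> i" using True i by blast
            moreover have "point_map x \<pi> i \<le> grid_point b d s L (scrambled z \<pi>) i + 1 / real b ^ (d * L)" using * i by blast
            ultimately show ?thesis unfolding of_nat_power by linarith
          qed
          then have "?G (\<lambda>i. y i - 1 / real (?V L)) L \<pi> = 1" by (intro if_P ballI)
          then show ?thesis by (simp only: indicator_le_1)
        next
          case False
          then have "indicator ?A \<pi> = (0::real)" by (rule indicator_simps(2))
          then show ?thesis by (simp only: split: if_split) simp
        qed
      qed
    qed
    then show ?thesis unfolding mA prob_grid_above .
  qed
  have V0: "(\<lambda>L. 1 / real (?V L)) \<longlonglongrightarrow> 0"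
  proof -
    have "(\<lambda>L. (1 / real b ^ d) ^ L) \<longlonglongrightarrow> 0"
      using b_gt_1 d_pos by (intro LIMSEQ_power_zero) simp
    then show ?thesis by (simp add: power_mult power_one_over)
  qed
  have lim: "(\<lambda>L. real (card {k \<in> {..<?V L}. w L < real k / real (?V L)}) / real (?V L)) \<longlonglongrightarrow> upper_mass w0"
    if w: "\<And>L. \<bar>w L - w0\<bar> \<le> 1 / real (?V L)" for w w0
  proof (rule LIM_zero_cancel, rule tendsto_0_le[where K = 2, OF V0], rule always_eventually, rule allI)
    fix L
    have "0 < ?V L" using b_gt_1 by simp
    from card_grid_above[OF this, of "w L"] upper_mass_lipschitz[of "w L" w0] w[of L]
    show "norm (real (card {k \<in> {..<?V L}. w L < real k / real (?V L)}) / real (?V L) - upper_mass w0) \<le> norm (1 / real (?V L)) * 2"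
      by (simp add: abs_le_iff) linarith
  qed
  have l1: "?N y \<longlonglongrightarrow> (\<Prod>i\<in>{1..s}. upper_mass (y i))"
    by (intro tendsto_prod lim) simp
  have l2: "(\<lambda>L. ?N (\<lambda>i. y i - 1 / real (?V L)) L) \<longlonglongrightarrow> (\<Prod>i\<in>{1..s}. upper_mass (y i))"
    by (intro tendsto_prod lim) simp
  show ?thesis
    using LIMSEQ_le_const2[OF l1, of "measure P ?A"] LIMSEQ_le_const[OF l2, of "measure P ?A"] lower upper
    by (meson antisym)
qed

text \<open>The probabilities of upper orthants factorise. Half lines generate the Borel sets, so
  the coordinates are independent, and each is uniform; together this determines the law on the
  cube.\<close>

lemma distr_point_map: "distr P (cube_measure {1..s}) (point_map x) = cube_measure {1..s}"
proof -
  let ?I = "{1..s}" and ?X = "\<lambda>i \<pi>. point_map x \<pi> i"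
  \<comment> \<open>The whole line is included to leave some coordinates free; since all coordinates
    are nonnegative it acts like the half line above -1.\<close>
  let ?E = "insert UNIV (range (\<lambda>a::real. {a<..}))"
  have ne: "?I \<noteq> {}" using s_pos by simp
  have um1: "upper_mass (-1) = 1" by (simp add: upper_mass_def)
  have pos: "0 \<le> point_map x \<pi> i" if "i \<in> ?I" for \<pi> i
    using point_map_cube[of \<pi>] that by (auto simp: cube_def PiE_iff)
  have joint: "measure P (\<Inter>j\<in>?I. ?X j -` A j \<inter> space P) = (\<Prod>i\<in>?I. upper_mass (y i))"
    if Ay: "\<And>i. i \<in> ?I \<Longrightarrow> (A i = {y i<..}) \<or> (A i = UNIV \<and> y i = -1)" for A y
  proof -
    have "(\<Inter>j\<in>?I. ?X j -` A j \<inter> space P) = {\<pi> \<in> space P. \<forall>i\<in>?I. y i < point_map x \<pi> i}"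
    proof (intro equalityI subsetI)
      fix \<pi> assume \<pi>: "\<pi> \<in> (\<Inter>j\<in>?I. ?X j -` A j \<inter> space P)"
      have "y i < point_map x \<pi> i" if i: "i \<in> ?I" for i
        using \<pi> i Ay[OF i] pos[OF i, of \<pi>] by auto
      then show "\<pi> \<in> {\<pi> \<in> space P. \<forall>i\<in>?I. y i < point_map x \<pi> i}" using \<pi> ne by blast
    next
      fix \<pi> assume \<pi>: "\<pi> \<in> {\<pi> \<in> space P. \<forall>i\<in>?I. y i < point_map x \<pi> i}"
      show "\<pi> \<in> (\<Inter>j\<in>?I. ?X j -` A j \<inter> space P)"
      proof (rule INT_I)
        fix j assume j: "j \<in> ?I"
        show "\<pi> \<in> ?X j -` A j \<inter> space P"
          using \<pi> j Ay[OF j] by auto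
      qed
    qed
    then show ?thesis by (simp only: prob_point_map_above)
  qed
  have single: "measure P (?X i -` {a<..} \<inter> space P) = upper_mass a" if i: "i \<in> ?I" for i a
  proof -
    let ?A = "\<lambda>j. if j = i then {a<..} else UNIV" and ?y = "\<lambda>j. if j = i then a else -1"
    have "(\<Inter>j\<in>?I. ?X j -` ?A j \<inter> space P) = ?X i -` {a<..} \<inter> space P"
    proof (intro equalityI subsetI)
      fix \<pi> assume "\<pi> \<in> (\<Inter>j\<in>?I. ?X j -` ?A j \<inter> space P)"
      then have "\<pi> \<in> ?X i -` ?A i \<inter> space P" using i by blast
      then show "\<pi> \<in> ?X i -` {a<..} \<inter> space P" by (simp only: if_True simp_thms)
    next
      fix \<pi> assume *: "\<pi> \<in> ?X i -` {a<..} \<inter> space P"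
      show "\<pi> \<in> (\<Inter>j\<in>?I. ?X j -` ?A j \<inter> space P)"
      proof (rule INT_I)
        fix j show "\<pi> \<in> ?X j -` ?A j \<inter> space P"
          using * by (cases "j = i") simp_all
      qed
    qed
    moreover have "(\<Prod>j\<in>?I. upper_mass (?y j)) = upper_mass a"
      using i by (subst prod.remove[of _ i]) (auto simp: um1)
    ultimately show ?thesis using joint[of ?A ?y] by simp
  qed
  have "P.indep_vars (\<lambda>_. borel) ?X ?I"
  proof (subst P.indep_vars_finite[where E = "\<lambda>_. ?E"])
    show "sets borel = sigma_sets (space borel) ?E"
    proof -
      have "sigma_sets UNIV ?E = sigma_sets UNIV (range (\<lambda>a::real. {a<..}))"
      proof (intro equalityI)
        show "sigma_sets UNIV ?E \<subseteq> sigma_sets UNIV (range (\<lambda>a::real. {a<..}))"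
          by (rule sigma_sets_mono) (auto intro: sigma_sets_top)
      qed (auto intro!: sigma_sets_mono')
      then show ?thesis by (simp add: borel_Ioi)
    qed
    show "Int_stable ?E"
    proof (rule Int_stableI)
      fix a c assume "a \<in> ?E" "c \<in> ?E"
      then consider "a = UNIV" | "c = UNIV" | u w where "a = {u<..}" "c = {w<..}" by blast
      then show "a \<inter> c \<in> ?E"
      proof cases
        case 3
        then have "a \<inter> c = {max u w<..}" by auto
        then show ?thesis by blast
      qed (use \<open>a \<in> ?E\<close> \<open>c \<in> ?E\<close> in \<open>simp_all only: Int_UNIV_left Int_UNIV_right\<close>)
    qed
    show "?X i \<in> borel_measurable P" if "i \<in> ?I" for i by (rule point_map_measurable_coord[OF that])
    show "\<forall>A\<in>?I \<rightarrow> ?E. P.prob (\<Inter>j\<in>?I. ?X j -` A j \<inter> space P) = (\<Prod>j\<in>?I. P.prob (?X j -` A j \<inter> space P))"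
    proof
      fix A assume A: "A \<in> ?I \<rightarrow> ?E"
      have "\<exists>y. (A i = {y<..}) \<or> (A i = UNIV \<and> y = -1)" if "i \<in> ?I" for i using A that by blast
      then have "\<forall>i\<in>?I. \<exists>y. (A i = {y<..}) \<or> (A i = UNIV \<and> y = -1)" by blast
      from bchoice[OF this] obtain y where y: "\<And>i. i \<in> ?I \<Longrightarrow> (A i = {y i<..}) \<or> (A i = UNIV \<and> y i = -1)" by blast
      have pj: "P.prob (?X j -` A j \<inter> space P) = upper_mass (y j)" if j: "j \<in> ?I" for j
        using y[OF j]
      proof
        assume "A j = {y j<..}"
        then show ?thesis by (simp only: single[OF j])
      next
        assume "A j = UNIV \<and> y j = -1"
        then show ?thesis by (simp add: um1 P.prob_space)
      qed
      have "P.prob (\<Inter>j\<in>?I. ?X j -` A j \<inter> space P) = (\<Prod>j\<in>?I. upper_mass (y j))"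
        by (rule joint[OF y])
      also have "\<dots> = (\<Prod>j\<in>?I. P.prob (?X j -` A j \<inter> space P))"
        by (rule prod.cong[OF refl]) (rule pj[symmetric])
      finally show "P.prob (\<Inter>j\<in>?I. ?X j -` A j \<inter> space P) = (\<Prod>j\<in>?I. P.prob (?X j -` A j \<inter> space P))" .
    qed
  qed (use ne in auto)
  note indep = this
  have unif: "distr P borel (?X i) = distr (restrict_space lborel {0..1}) borel (\<lambda>x. x)" if i: "i \<in> ?I" for i
  proof (rule measure_eqI_lessThan)
    have m1: "(\<lambda>x. x) \<in> measurable (restrict_space lborel {0..1::real}) borel"
      by (rule measurable_restrict_space1) simp
    show "emeasure (distr P borel (?X i)) {a<..} = emeasure (distr (restrict_space lborel {0..1}) borel (\<lambda>x. x)) {a<..}" for a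
    proof -
      have "emeasure (distr P borel (?X i)) {a<..} = ennreal (upper_mass a)"
        using single[OF i, of a] point_map_measurable_coord[OF i] by (simp add: emeasure_distr P.emeasure_eq_measure)
      moreover have "emeasure (distr (restrict_space lborel {0..1}) borel (\<lambda>x. x)) {a<..} = ennreal (upper_mass a)"
        using emeasure_unit_greaterThan[of a]
        by (simp add: emeasure_distr[OF m1] space_restrict_space emeasure_restrict_space)
      ultimately show ?thesis by simp
    qed
    show "emeasure (distr P borel (?X i)) {a<..} < \<infinity>" for a
      using point_map_measurable_coord[OF i] P.emeasure_finite by (simp add: emeasure_distr less_top[symmetric])
  qed simp_all
  interpret unit: prob_space "restrict_space lborel {0..1::real}" by (rule prob_space_unit)
  interpret cube: product_sigma_finite "\<lambda>_::nat. restrict_space lborel {0..1::real}" ..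
  show ?thesis
    unfolding cube_measure_def
  proof (rule cube.PiM_eqI)
    fix A assume A: "\<And>i. i \<in> ?I \<Longrightarrow> A i \<in> sets (restrict_space lborel {0..1::real})"
    have Ab: "A i \<in> sets borel" "A i \<subseteq> {0..1}" if "i \<in> ?I" for i
      using A[OF that] by (auto simp: sets_restrict_space)
    have pre: "point_map x -` PiE ?I A \<inter> space P = (\<Inter>j\<in>?I. ?X j -` A j \<inter> space P)"
      using ne point_map_cube by (auto simp: PiE_iff cube_def)
    have "emeasure (distr P (PiM ?I (\<lambda>_. restrict_space lborel {0..1})) (point_map x)) (PiE ?I A) =
        emeasure P (\<Inter>j\<in>?I. ?X j -` A j \<inter> space P)"
      by (subst emeasure_distr[OF point_map_measurable[unfolded cube_measure_def] sets_PiM_I_finite[OF finite_atLeastAtMost A]])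
         (simp_all only: pre)
    also have "\<dots> = ennreal (\<Prod>j\<in>?I. P.prob (?X j -` A j \<inter> space P))"
      using P.indep_varsD_finite[OF indep ne _ Ab(1)] by (simp add: P.emeasure_eq_measure)
    also have "\<dots> = (\<Prod>j\<in>?I. ennreal (P.prob (?X j -` A j \<inter> space P)))"
      by (simp add: prod_ennreal)
    also have "\<dots> = (\<Prod>j\<in>?I. emeasure (restrict_space lborel {0..1}) (A j))"
    proof (rule prod.cong[OF refl])
      fix j assume j: "j \<in> ?I"
      have m1: "(\<lambda>x. x) \<in> measurable (restrict_space lborel {0..1::real}) borel"
        by (rule measurable_restrict_space1) simp
      have "ennreal (P.prob (?X j -` A j \<inter> space P)) = emeasure (distr P borel (?X j)) (A j)"
        using point_map_measurable_coord[OF j] Ab[OF j] by (simp add: emeasure_distr P.emeasure_eq_measure)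
      also have "\<dots> = emeasure (restrict_space lborel {0..1}) (A j)"
        unfolding unif[OF j] using Ab[OF j] by (simp add: emeasure_distr[OF m1] space_restrict_space Int_absorb2)
      finally show "ennreal (P.prob (?X j -` A j \<inter> space P)) = emeasure (restrict_space lborel {0..1}) (A j)" .
    qed
    finally show "emeasure (distr P (PiM ?I (\<lambda>_. restrict_space lborel {0..1})) (point_map x)) (PiE ?I A) =
        (\<Prod>j\<in>?I. emeasure (restrict_space lborel {0..1}) (A j))" .
  qed simp_all
qed

end

end

section \<open>Finite differences\<close>

definition sh :: "nat \<Rightarrow> real \<Rightarrow> (nat \<Rightarrow> real) \<Rightarrow> nat \<Rightarrow> real" where
  "sh i t x = x(i := x i + t)"

definition fdiff :: "real \<Rightarrow> nat \<Rightarrow> ((nat \<Rightarrow> real) \<Rightarrow> 'v::real_vector) \<Rightarrow> (nat \<Rightarrow> real) \<Rightarrow> 'v" where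
  "fdiff \<eta> i g x = g (sh i \<eta> x) - g x"

lemma sh_sh: "sh i t (sh j e x) = sh j e (sh i t x)"
  by (auto simp: sh_def fun_eq_iff)

lemma sh_0: "sh i 0 x = x"
  by (simp add: sh_def)

lemma sh_add: "sh i t (sh i e x) = sh i (t + e) x"
  by (simp add: sh_def add_ac)

lemma sh_cube: "x \<in> cube I \<Longrightarrow> i \<in> I \<Longrightarrow> 0 \<le> t \<Longrightarrow> x i + t \<le> 1 \<Longrightarrow> sh i t x \<in> cube I"
  unfolding sh_def by (rule cube_upd) (auto dest: cubeD)

lemma fdiff_commute: "fdiff a i (fdiff c j g) = fdiff c j (fdiff a i g)"
  by (rule ext) (simp add: fdiff_def sh_sh[of i a j c])

text \<open>Differences and a derivative commute. The condition \<open>room\<close> keeps all points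
  at which f is evaluated in the cube, where alone its derivatives are controlled.\<close>

lemma fdiffs_derivative:
  fixes f :: "(nat \<Rightarrow> real) \<Rightarrow> 'k::{real_normed_field,euclidean_space}"
  assumes f: "smooth_on_cube s f" and js: "set js \<subseteq> {1..s}" and i: "i \<in> {1..s}" and y: "y \<in> cube {1..s}"
    and c: "0 \<le> c" "0 \<le> \<eta>"
    and room: "\<And>k. k \<in> {1..s} \<Longrightarrow> y k + (if k = i then c else 0) + real (count_list js k) * \<eta> \<le> 1"
    and t: "t \<in> {0..c}"
  shows "((\<lambda>t. foldr (fdiff \<eta>) js f (sh i t y)) has_vector_derivative
    foldr (fdiff \<eta>) js (partial_deriv i f) (sh i t y)) (at t within {0..c})"
  using js y room
proof (induction js arbitrary: y)
  case Nil
  have yi: "0 \<le> y i" "y i + c \<le> 1"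
    using cubeD[OF Nil(2) i] Nil(3)[OF i] by simp_all
  have sub: "(\<lambda>t. y i + t) ` {0..c} \<subseteq> {0..1}" using yi by auto
  have yt: "y i + t \<in> {0..1}" using t yi by auto
  have 1: "((\<lambda>t. y i + t) has_vector_derivative 1) (at t within {0..c})"
    by (auto intro!: derivative_eq_intros)
  have 2: "((\<lambda>\<tau>. f (y(i := \<tau>))) has_vector_derivative partial_deriv i f (y(i := y i + t))) (at (y i + t) within (\<lambda>t. y i + t) ` {0..c})"
    by (rule has_vector_derivative_within_subset[OF smooth_has_derivative[OF f i Nil(2) yt] sub])
  from vector_diff_chain_within[OF 1 2] show ?case
    by (simp only: sh_def foldr.simps id_apply o_def scaleR_one)
next
  case (Cons j js)
  have j: "j \<in> {1..s}" and js: "set js \<subseteq> {1..s}" using Cons.prems(1) by auto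
  have cnt: "real (count_list (j # js) k) = (if k = j then 1 else 0) + real (count_list js k)" for k by simp
  have nn: "0 \<le> real (count_list js k) * \<eta>" for k using c by simp
  have y': "sh j \<eta> y \<in> cube {1..s}"
  proof (rule sh_cube[OF Cons.prems(2) j c(2)])
    have "y j + (if j = i then c else 0) + (1 + real (count_list js j)) * \<eta> \<le> 1"
      using Cons.prems(3)[OF j] unfolding cnt by simp
    then show "y j + \<eta> \<le> 1" using nn[of j] c(1) by (simp add: distrib_right split: if_splits)
  qed
  have r1: "y k + (if k = i then c else 0) + real (count_list js k) * \<eta> \<le> 1" if "k \<in> {1..s}" for k
  proof -
    have "y k + (if k = i then c else 0) + ((if k = j then 1 else 0) + real (count_list js k)) * \<eta> \<le> 1"
      using Cons.prems(3)[OF that] unfolding cnt .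
    then show ?thesis using c(2) by (simp add: distrib_right split: if_splits)
  qed
  have r2: "sh j \<eta> y k + (if k = i then c else 0) + real (count_list js k) * \<eta> \<le> 1" if "k \<in> {1..s}" for k
  proof -
    have "y k + (if k = i then c else 0) + ((if k = j then 1 else 0) + real (count_list js k)) * \<eta> \<le> 1"
      using Cons.prems(3)[OF that] unfolding cnt .
    then show ?thesis by (simp add: sh_def distrib_right split: if_splits)
  qed
  have eq: "foldr (fdiff \<eta>) (j # js) g (sh i t y) = foldr (fdiff \<eta>) js g (sh i t (sh j \<eta> y)) - foldr (fdiff \<eta>) js g (sh i t y)"
    for g :: "(nat \<Rightarrow> real) \<Rightarrow> 'k" and t
    by (simp only: foldr.simps o_apply fdiff_def sh_sh[of j \<eta> i t])
  show ?case
    unfolding eq by (rule has_vector_derivative_diff[OF Cons.IH[OF js y' r2] Cons.IH[OF js Cons.prems(2) r1]])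
qed

text \<open>By the mean value inequality, a difference with step \<eta> is \<eta> times a derivative
  up to \<eta> times the oscillation of that derivative. Differences are removed from the outside
  while derivatives are applied to f from the inside, hence the reversal of
  \<open>js\<close>.\<close>

lemma fdiffs_approx:
  fixes f :: "(nat \<Rightarrow> real) \<Rightarrow> 'k::{real_normed_field,euclidean_space}"
  assumes "smooth_on_cube s f" "set js \<subseteq> {1..s}" "x \<in> cube {1..s}" and \<eta>: "0 \<le> \<eta>"
    and "\<And>k. k \<in> {1..s} \<Longrightarrow> x k + real (count_list js k) * \<eta> \<le> 1"
    and "\<And>w. w \<in> cube {1..s} \<Longrightarrow> (\<forall>k\<in>{1..s}. x k \<le> w k \<and> w k \<le> x k + real (count_list js k) * \<eta>) \<Longrightarrow>
      norm (foldr partial_deriv (rev js) f w - v) \<le> \<epsilon>"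
  shows "norm (foldr (fdiff \<eta>) js f x - \<eta> ^ length js *\<^sub>R v) \<le> \<eta> ^ length js * \<epsilon>"
  using assms(1-3,5,6)
proof (induction js arbitrary: f x)
  case Nil
  have "norm (f x - v) \<le> \<epsilon>"
    using Nil(5)[OF Nil(3)] by simp
  then show ?case by simp
next
  case (Cons i js)
  have i: "i \<in> {1..s}" and js: "set js \<subseteq> {1..s}" using Cons.prems(2) by auto
  have cnt: "real (count_list (i # js) k) = (if k = i then 1 else 0) + real (count_list js k)" for k by simp
  have nn: "0 \<le> real (count_list js k) * \<eta>" for k using \<eta> by simp
  have room: "x k + (if k = i then \<eta> else 0) + real (count_list js k) * \<eta> \<le> 1" if "k \<in> {1..s}" for k
    using Cons.prems(4)[OF that] unfolding cnt by (simp add: distrib_right split: if_splits)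
  let ?F = "foldr (fdiff \<eta>) js f" and ?n = "length js"
  let ?D = "\<lambda>t. foldr (fdiff \<eta>) js (partial_deriv i f) (sh i t x)"
  have D: "norm (?D t - \<eta> ^ ?n *\<^sub>R v) \<le> \<eta> ^ ?n * \<epsilon>" if t: "t \<in> {0..\<eta>}" for t
  proof (rule Cons.IH[OF smooth_partial[OF Cons.prems(1) i] js])
    have ri: "x i + \<eta> + real (count_list js i) * \<eta> \<le> 1" using room[OF i] by simp
    have "0 \<le> t" "t \<le> \<eta>" using t by auto
    with ri nn[of i] have "x i + t \<le> 1" by linarith
    then show "sh i t x \<in> cube {1..s}"
      by (rule sh_cube[OF Cons.prems(3) i \<open>0 \<le> t\<close>])
    show "sh i t x k + real (count_list js k) * \<eta> \<le> 1" if "k \<in> {1..s}" for k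
      using room[OF that] t by (auto simp: sh_def split: if_splits)
    fix w assume w: "w \<in> cube {1..s}" "\<forall>k\<in>{1..s}. sh i t x k \<le> w k \<and> w k \<le> sh i t x k + real (count_list js k) * \<eta>"
    have "norm (foldr partial_deriv (rev (i # js)) f w - v) \<le> \<epsilon>"
    proof (rule Cons.prems(5)[OF w(1)], rule ballI)
      fix k assume k: "k \<in> {1..s}"
      show "x k \<le> w k \<and> w k \<le> x k + real (count_list (i # js) k) * \<eta>"
        using bspec[OF w(2) k] t unfolding cnt by (auto simp: sh_def distrib_right split: if_splits)
    qed
    then show "norm (foldr partial_deriv (rev js) (partial_deriv i f) w - v) \<le> \<epsilon>"
      by (simp only: rev.simps foldr_append foldr.simps o_apply id_apply)
  qed
  let ?G = "\<lambda>t. ?F (sh i t x) - t *\<^sub>R (\<eta> ^ ?n *\<^sub>R v)"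
  have "norm (?G \<eta> - ?G 0) \<le> (\<eta> ^ ?n * \<epsilon>) * norm (\<eta> - 0)"
  proof (rule differentiable_bound[where S = "{0..\<eta>}" and f' = "\<lambda>t h. h *\<^sub>R (?D t - \<eta> ^ ?n *\<^sub>R v)"])
    fix t assume t: "t \<in> {0..\<eta>}"
    have 1: "((\<lambda>t. ?F (sh i t x)) has_vector_derivative ?D t) (at t within {0..\<eta>})"
      by (rule fdiffs_derivative[OF Cons.prems(1) js i Cons.prems(3) \<eta> \<eta> room t])
    have 2: "((\<lambda>t. t *\<^sub>R (\<eta> ^ ?n *\<^sub>R v)) has_vector_derivative \<eta> ^ ?n *\<^sub>R v) (at t within {0..\<eta>})"
      by (auto intro!: derivative_eq_intros)
    show "(?G has_derivative (\<lambda>h. h *\<^sub>R (?D t - \<eta> ^ ?n *\<^sub>R v))) (at t within {0..\<eta>})"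
      using has_vector_derivative_diff[OF 1 2] unfolding has_vector_derivative_def .
    show "onorm (\<lambda>h. h *\<^sub>R (?D t - \<eta> ^ ?n *\<^sub>R v)) \<le> \<eta> ^ ?n * \<epsilon>"
    proof (rule onorm_le)
      fix h :: real
      have "\<bar>h\<bar> * norm (?D t - \<eta> ^ ?n *\<^sub>R v) \<le> \<bar>h\<bar> * (\<eta> ^ ?n * \<epsilon>)"
        by (rule mult_left_mono[OF D[OF t]]) simp
      then show "norm (h *\<^sub>R (?D t - \<eta> ^ ?n *\<^sub>R v)) \<le> \<eta> ^ ?n * \<epsilon> * norm h"
        by (simp only: norm_scaleR real_norm_def mult.commute)
    qed
  qed (use \<eta> in auto)
  moreover have "?G \<eta> - ?G 0 = foldr (fdiff \<eta>) (i # js) f x - \<eta> ^ length (i # js) *\<^sub>R v"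
    unfolding sh_0 foldr.simps o_apply fdiff_def[of \<eta> i] by (simp add: algebra_simps)
  moreover have "(\<eta> ^ ?n * \<epsilon>) * norm (\<eta> - 0) = \<eta> ^ length (i # js) * \<epsilon>"
    using \<eta> by simp
  ultimately show ?case by (simp only:)
qed

section \<open>Differences with steps that are multiples of the mesh\<close>

fun step_sum :: "real \<Rightarrow> (nat \<times> nat) list \<Rightarrow> ((nat \<Rightarrow> real) \<Rightarrow> real) \<Rightarrow> (nat \<Rightarrow> real) \<Rightarrow> real" where
  "step_sum \<eta> [] \<theta> x = \<theta> x"
| "step_sum \<eta> ((i, k) # ks) \<theta> x = (\<Sum>\<tau><k. step_sum \<eta> ks \<theta> (sh i (real \<tau> * \<eta>) x))"

text \<open>The points at which \<open>step_sum\<close> evaluates its function argument.\<close>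

fun reach :: "real \<Rightarrow> (nat \<times> nat) list \<Rightarrow> (nat \<Rightarrow> real) \<Rightarrow> (nat \<Rightarrow> real) set" where
  "reach \<eta> [] x = {x}"
| "reach \<eta> ((i, k) # ks) x = (\<Union>\<tau><k. reach \<eta> ks (sh i (real \<tau> * \<eta>) x))"

fun step_total :: "(nat \<times> nat) list \<Rightarrow> nat \<Rightarrow> nat" where
  "step_total [] j = 0"
| "step_total ((i, k) # ks) j = (if j = i then k else 0) + step_total ks j"

definition big_diff :: "real \<Rightarrow> (nat \<times> nat) list \<Rightarrow> ((nat \<Rightarrow> real) \<Rightarrow> 'v::real_vector) \<Rightarrow> (nat \<Rightarrow> real) \<Rightarrow> 'v" where
  "big_diff \<eta> ks g = foldr (\<lambda>(i, k). fdiff (real k * \<eta>) i) ks g"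

lemma big_diff_simps [simp]:
  "big_diff \<eta> [] g = g" "big_diff \<eta> ((i, k) # ks) g = fdiff (real k * \<eta>) i (big_diff \<eta> ks g)"
  by (simp_all add: big_diff_def)

lemma fdiff_big_diff: "fdiff \<eta>' i (big_diff \<eta> ks g) = big_diff \<eta> ks (fdiff \<eta>' i g)"
  by (induction ks) (auto simp: fdiff_commute[of \<eta>' i])

lemma fdiff_foldr: "fdiff \<eta> i (foldr (fdiff \<eta>) is g) = foldr (fdiff \<eta>) is (fdiff \<eta> i g)"
proof (induction "is")
  case (Cons j "is")
  show ?case
    by (simp only: foldr.simps o_apply fdiff_commute[of \<eta> i \<eta> j] Cons.IH)
qed simp

lemma fdiff_telescope: "fdiff (real k * \<eta>) i g x = (\<Sum>\<tau><k. fdiff \<eta> i g (sh i (real \<tau> * \<eta>) x))"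
proof (induction k)
  case (Suc k)
  have "sh i (real (Suc k) * \<eta>) x = sh i \<eta> (sh i (real k * \<eta>) x)"
    unfolding sh_add by (simp add: distrib_right)
  then have "fdiff (real (Suc k) * \<eta>) i g x = fdiff (real k * \<eta>) i g x + fdiff \<eta> i g (sh i (real k * \<eta>) x)"
    by (simp only: fdiff_def) simp
  then show ?case by (simp only: Suc.IH sum.lessThan_Suc)
qed (simp add: fdiff_def sh_0)

lemma step_sum_mono:
  "(\<And>z. z \<in> reach \<eta> ks x \<Longrightarrow> \<phi> z \<le> \<theta> z) \<Longrightarrow> step_sum \<eta> ks \<phi> x \<le> step_sum \<eta> ks \<theta> x"
proof (induction \<eta> ks \<phi> x rule: step_sum.induct)
  case (2 \<eta> i k ks \<phi> x)
  show ?case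
    unfolding step_sum.simps
  proof (rule sum_mono)
    fix \<tau> assume "\<tau> \<in> {..<k}"
    then show "step_sum \<eta> ks \<phi> (sh i (real \<tau> * \<eta>) x) \<le> step_sum \<eta> ks \<theta> (sh i (real \<tau> * \<eta>) x)"
    proof (rule "2.IH")
      fix z assume z: "z \<in> reach \<eta> ks (sh i (real \<tau> * \<eta>) x)"
      show "\<phi> z \<le> \<theta> z"
        by (rule "2.prems") (use z \<open>\<tau> \<in> {..<k}\<close> in auto)
    qed
  qed
qed simp

text \<open>The offsets within a step of k units are at most k - 1, so that from every base point
  one unit step per difference remains before the far corner is reached.\<close>

lemma reach_bounds:
  assumes "0 \<le> \<eta>" "z \<in> reach \<eta> ks x"
  shows "x j \<le> z j" "z j + real (count_list (map fst ks) j) * \<eta> \<le> x j + real (step_total ks j) * \<eta>"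
  using assms(2)
proof (induction ks arbitrary: x)
  case (Cons p ks)
  obtain i k where p: "p = (i, k)" by fastforce
  {
    case 1
    then obtain \<tau> where \<tau>: "\<tau> < k" "z \<in> reach \<eta> ks (sh i (real \<tau> * \<eta>) x)" by (auto simp: p)
    have "x j \<le> sh i (real \<tau> * \<eta>) x j" using assms(1) by (simp add: sh_def)
    also have "\<dots> \<le> z j" by (rule Cons.IH(1)[OF \<tau>(2)])
    finally show ?case .
  next
    case 2
    then obtain \<tau> where \<tau>: "\<tau> < k" "z \<in> reach \<eta> ks (sh i (real \<tau> * \<eta>) x)" by (auto simp: p)
    have *: "z j + real (count_list (map fst ks) j) * \<eta> \<le> sh i (real \<tau> * \<eta>) x j + real (step_total ks j) * \<eta>"
      by (rule Cons.IH(2)[OF \<tau>(2)])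
    have "(real \<tau> + 1) * \<eta> \<le> real k * \<eta>"
      using \<tau>(1) assms(1) by (intro mult_right_mono) auto
    with * show ?case
      by (cases "j = i") (auto simp: p sh_def distrib_right)
  }
qed simp_all

text \<open>Telescoping turns a step of k units into k unit differences, and Cauchy-Schwarz bounds
  the square of that sum by k times the sum of squares; successive differences multiply these
  factors.\<close>

lemma norm_big_diff_le:
  fixes g :: "(nat \<Rightarrow> real) \<Rightarrow> 'v::real_normed_vector"
  shows "(norm (big_diff \<eta> ks g x))\<^sup>2 \<le>
    (\<Prod>k\<leftarrow>ks. real (snd k)) * step_sum \<eta> ks (\<lambda>z. (norm (foldr (fdiff \<eta>) (map fst ks) g z))\<^sup>2) x"
proof (induction ks arbitrary: g x)
  case (Cons p ks)
  obtain i k where p: "p = (i, k)" by fastforce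
  let ?u = "\<lambda>z. (norm (foldr (fdiff \<eta>) (map fst (p # ks)) g z))\<^sup>2"
  let ?P = "\<Prod>k\<leftarrow>ks. real (snd k)"
  have u: "(\<lambda>z. (norm (foldr (fdiff \<eta>) (map fst ks) (fdiff \<eta> i g) z))\<^sup>2) = ?u"
    by (simp only: p list.map fst_conv foldr.simps o_apply fdiff_foldr)
  have "big_diff \<eta> (p # ks) g x = (\<Sum>\<tau><k. big_diff \<eta> ks (fdiff \<eta> i g) (sh i (real \<tau> * \<eta>) x))"
    unfolding p big_diff_simps(2) fdiff_telescope[of k \<eta> i "big_diff \<eta> ks g" x] fdiff_big_diff[of \<eta> i \<eta> ks g] ..
  then have "norm (big_diff \<eta> (p # ks) g x) \<le> (\<Sum>\<tau><k. norm (big_diff \<eta> ks (fdiff \<eta> i g) (sh i (real \<tau> * \<eta>) x)))"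
    by (simp only: norm_sum)
  then have "(norm (big_diff \<eta> (p # ks) g x))\<^sup>2 \<le> (\<Sum>\<tau><k. norm (big_diff \<eta> ks (fdiff \<eta> i g) (sh i (real \<tau> * \<eta>) x)))\<^sup>2"
    by (rule power_mono) simp
  also have "\<dots> \<le> (\<Sum>\<tau><k. (norm (big_diff \<eta> ks (fdiff \<eta> i g) (sh i (real \<tau> * \<eta>) x)))\<^sup>2) * card {..<k}"
    by (rule sum_squared_le_sum_of_squares)
  also have "\<dots> \<le> (\<Sum>\<tau><k. ?P * step_sum \<eta> ks ?u (sh i (real \<tau> * \<eta>) x)) * card {..<k}"
    using Cons.IH[of "fdiff \<eta> i g"] unfolding u by (intro mult_right_mono sum_mono) simp_all
  also have "\<dots> = (\<Prod>k\<leftarrow>p # ks. real (snd k)) * step_sum \<eta> (p # ks) ?u x"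
    unfolding p step_sum.simps sum_distrib_left[symmetric] by simp
  finally show ?case .
qed simp

text \<open>A simultaneous translation by integer multiples of the step, to which every sequence of
  shifts in \<open>step_sum\<close> reduces.\<close>

definition shv :: "real \<Rightarrow> (nat \<Rightarrow> nat) \<Rightarrow> (nat \<Rightarrow> real) \<Rightarrow> nat \<Rightarrow> real" where
  "shv \<eta> a x = (\<lambda>i. x i + real (a i) * \<eta>)"

lemma sh_shv: "sh i (real \<tau> * \<eta>) (shv \<eta> a x) = shv \<eta> (a(i := a i + \<tau>)) x"
  by (auto simp: sh_def shv_def fun_eq_iff distrib_right)

lemma shv_0: "shv \<eta> (\<lambda>_. 0) x = x"
  by (simp add: shv_def)

text \<open>A converse to \<open>continuous_cube_uniform\<close>: a convergent sequence converges in
  each coordinate, hence uniformly in the finitely many coordinates of I.\<close>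

lemma continuous_cubeI:
  fixes g :: "(nat \<Rightarrow> real) \<Rightarrow> 'v::metric_space"
  assumes I: "finite I"
    and unif: "\<And>e. 0 < e \<Longrightarrow> \<exists>\<delta>>0. \<forall>x\<in>cube I. \<forall>y\<in>cube I. (\<forall>i\<in>I. \<bar>x i - y i\<bar> \<le> \<delta>) \<longrightarrow> dist (g x) (g y) < e"
  shows "continuous_on (cube I) g"
  unfolding continuous_on_sequentially
proof (intro allI ballI impI)
  fix X :: "nat \<Rightarrow> nat \<Rightarrow> real" and a assume a: "a \<in> cube I" and X: "(\<forall>n. X n \<in> cube I) \<and> X \<longlonglongrightarrow> a"
  have coord: "(\<lambda>n. X n i) \<longlonglongrightarrow> a i" for i
    using continuous_on_tendsto_compose[OF continuous_on_product_coordinates[of i], of X a sequentially] X by simp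
  show "(g \<circ> X) \<longlonglongrightarrow> g a"
  proof (rule tendstoI)
    fix e :: real assume "0 < e"
    from unif[OF this] obtain \<delta> where \<delta>: "0 < \<delta>"
      "\<forall>x\<in>cube I. \<forall>y\<in>cube I. (\<forall>i\<in>I. \<bar>x i - y i\<bar> \<le> \<delta>) \<longrightarrow> dist (g x) (g y) < e" by (elim exE conjE)
    have "\<forall>\<^sub>F n in sequentially. \<bar>X n i - a i\<bar> \<le> \<delta>" for i
      using tendstoD[OF coord \<delta>(1), of i] by eventually_elim (simp add: dist_real_def)
    then have "\<forall>\<^sub>F n in sequentially. \<forall>i\<in>I. \<bar>X n i - a i\<bar> \<le> \<delta>"
      by (intro eventually_ball_finite[OF I] ballI)
    then show "\<forall>\<^sub>F n in sequentially. dist ((g \<circ> X) n) (g a) < e"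
    proof eventually_elim
      case (elim n)
      have "X n \<in> cube I" using X by blast
      from mp[OF bspec[OF bspec[OF \<delta>(2) this] a] elim] show ?case by (simp only: o_apply)
    qed
  qed
qed

lemma marginal_continuous:
  fixes f :: "(nat \<Rightarrow> real) \<Rightarrow> 'k::{real_normed_field,euclidean_space}"
  assumes u: "u \<subseteq> {1..s}" and f: "continuous_on (cube {1..s}) f" and I: "I = u \<or> I = {1..s}"
  shows "continuous_on (cube I) (marginal s u f)"
proof (rule continuous_cubeI)
  show "finite I" using I u finite_subset by blast
  have uI: "u \<subseteq> I" using u I by blast
  fix e :: real assume e: "0 < e"
  then have e2: "0 < e / 2" by simp
  obtain \<delta> where \<delta>: "0 < \<delta>" "\<forall>x\<in>cube {1..s}. \<forall>y\<in>cube {1..s}. (\<forall>i\<in>{1..s}. \<bar>x i - y i\<bar> \<le> \<delta>) \<longrightarrow> dist (f x) (f y) < e / 2"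
    using continuous_cube_uniform[OF f e2] by (elim exE conjE)
  show "\<exists>\<delta>>0. \<forall>x\<in>cube I. \<forall>y\<in>cube I. (\<forall>i\<in>I. \<bar>x i - y i\<bar> \<le> \<delta>) \<longrightarrow> dist (marginal s u f x) (marginal s u f y) < e"
  proof (intro exI[of _ \<delta>] conjI ballI impI \<delta>(1))
    fix x y assume x: "x \<in> cube I" and y: "y \<in> cube I" and xy: "\<forall>i\<in>I. \<bar>x i - y i\<bar> \<le> \<delta>"
    have x': "x \<in> cube u \<or> x \<in> cube {1..s}" and y': "y \<in> cube u \<or> y \<in> cube {1..s}" using x y I by blast+
    have int: "integrable (cube_measure {1..s}) (\<lambda>w. f (glue s u x w))" "integrable (cube_measure {1..s}) (\<lambda>w. f (glue s u y w))"
      by (rule continuous_cube_integrable[OF glue_continuous[OF u f x']],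
          rule continuous_cube_integrable[OF glue_continuous[OF u f y']])
    have "norm (\<integral>w. f (glue s u x w) - f (glue s u y w) \<partial>cube_measure {1..s}) \<le> e / 2"
    proof (rule norm_integral_cube_le[OF Bochner_Integration.integrable_diff[OF int]])
      fix w assume w: "w \<in> cube {1..s}"
      have "\<forall>i\<in>{1..s}. \<bar>glue s u x w i - glue s u y w i\<bar> \<le> \<delta>"
        using xy uI \<delta>(1) by (auto simp: glue_def)
      from mp[OF bspec[OF bspec[OF \<delta>(2) glue_cube[OF u x' w]] glue_cube[OF u y' w]] this]
      show "norm (f (glue s u x w) - f (glue s u y w)) \<le> e / 2" by (simp only: dist_norm less_imp_le)
    qed
    then have "norm (marginal s u f x - marginal s u f y) \<le> e / 2"
      unfolding marginal_eq[OF u f x'] marginal_eq[OF u f y'] Bochner_Integration.integral_diff[OF int] .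
    then show "dist (marginal s u f x) (marginal s u f y) < e" using e by (simp add: dist_norm)
  qed
qed

lemma integral_marginal:
  fixes f :: "(nat \<Rightarrow> real) \<Rightarrow> 'k::{real_normed_field,euclidean_space}"
  assumes u: "u \<subseteq> {1..s}" and f: "continuous_on (cube {1..s}) f"
  shows "(\<integral>x. (norm (marginal s u f x))\<^sup>2 \<partial>cube_measure {1..s}) = (\<integral>x. (norm (marginal s u f x))\<^sup>2 \<partial>cube_measure u)"
proof -
  have r: "marginal s u f (restrict x u) = marginal s u f x" for x
  proof -
    have "merge u ({1..s} - u) (restrict x u, y) = merge u ({1..s} - u) (x, y)" for y
      by (auto simp: merge_def fun_eq_iff)
    then show ?thesis by (simp only: marginal_def)
  qed
  have "continuous_on (cube u) (\<lambda>x. (norm (marginal s u f x))\<^sup>2)"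
    by (intro continuous_intros marginal_continuous[OF u f]) simp
  then have "(\<lambda>x. (norm (marginal s u f x))\<^sup>2) \<in> borel_measurable (cube_measure u)"
    by (rule continuous_cube_measurable)
  from integral_distr[OF restrict_cube_distr(2)[OF u] this] show ?thesis
    unfolding restrict_cube_distr(1)[OF u] r by (rule sym)
qed

section \<open>Jumps of digits as finite differences\<close>

lemma norm_array_mean_le:
  fixes \<phi> :: "('q \<Rightarrow> nat) \<Rightarrow> 'v::real_normed_vector"
  assumes "finite Q" "0 < b" "\<And>\<xi>. \<xi> \<in> arrays b Q \<Longrightarrow> norm (\<phi> \<xi>) \<le> K"
  shows "norm (array_mean b Q \<phi>) \<le> K"
proof -
  have "norm (array_mean b Q \<phi>) \<le> array_mean b Q (\<lambda>\<xi>. norm (\<phi> \<xi>))"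
    unfolding array_mean_def norm_scaleR real_scaleR_def
    by (rule mult_mono) (auto intro: norm_sum sum_nonneg)
  also have "\<dots> \<le> array_mean b Q (\<lambda>_. K)" by (rule array_mean_mono) (rule assms(3))
  finally show ?thesis by (simp only: array_mean_const[OF assms(1,2)])
qed

lemma array_mean_diff: "array_mean b Q (\<lambda>\<xi>. g \<xi> - h \<xi>) = array_mean b Q g - array_mean b Q h"
  by (simp add: array_mean_def sum_subtractf scaleR_diff_right)

text \<open>Fixing a digit conditions on an event of probability 1/b; for a nonnegative function
  this enlarges the mean at most b times.\<close>

lemma array_mean_update_le:
  fixes \<phi> :: "('q \<Rightarrow> nat) \<Rightarrow> real"
  assumes "finite Q" "q \<in> Q" "c < b" and nn: "\<And>\<xi>. 0 \<le> \<phi> \<xi>"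
  shows "array_mean b Q (\<lambda>\<xi>. \<phi> (\<xi>(q := c))) \<le> real b * array_mean b Q \<phi>"
proof -
  have b: "0 < b" using assms(3) by simp
  have "\<phi> (\<xi>(q := c)) \<le> real b * avg b q \<phi> \<xi>" for \<xi>
  proof -
    have "\<phi> (\<xi>(q := c)) \<le> (\<Sum>c<b. \<phi> (\<xi>(q := c)))"
      using assms(3) by (intro member_le_sum nn) auto
    moreover have "real b * avg b q \<phi> \<xi> = (\<Sum>c<b. \<phi> (\<xi>(q := c)))"
      unfolding avg_def real_scaleR_def mult.assoc[symmetric] using b by (simp only: right_inverse of_nat_eq_0_iff mult_1_left neq0_conv)
    ultimately show ?thesis by (simp only:)
  qed
  then have "array_mean b Q (\<lambda>\<xi>. \<phi> (\<xi>(q := c))) \<le> array_mean b Q (\<lambda>\<xi>. real b * avg b q \<phi> \<xi>)"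
    by (rule array_mean_mono)
  also have "\<dots> = real b * array_mean b Q \<phi>"
    unfolding array_mean_cmul by (simp only: array_mean_avg[OF assms(1,2) b])
  finally show ?thesis .
qed

text \<open>Together with \<open>set_high\<close>: the base point of an iterated jump and its far
  corner, with all jumping digits at their lower or all at their upper values.\<close>

definition set_low :: "('q \<times> nat \<times> nat) list \<Rightarrow> ('q \<Rightarrow> nat) \<Rightarrow> 'q \<Rightarrow> nat" where
  "set_low js \<xi> = foldr (\<lambda>(q, c, c') \<xi>. \<xi>(q := c)) js \<xi>"

definition set_high :: "('q \<times> nat \<times> nat) list \<Rightarrow> ('q \<Rightarrow> nat) \<Rightarrow> 'q \<Rightarrow> nat" where
  "set_high js \<xi> = foldr (\<lambda>(q, c, c') \<xi>. \<xi>(q := c')) js \<xi>"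

lemma set_low_simps [simp]: "set_low [] \<xi> = \<xi>" "set_low ((q, c, c') # js) \<xi> = (set_low js \<xi>)(q := c)"
  by (simp_all add: set_low_def)

lemma set_high_simps [simp]: "set_high [] \<xi> = \<xi>" "set_high ((q, c, c') # js) \<xi> = (set_high js \<xi>)(q := c')"
  by (simp_all add: set_high_def)

lemma set_low_update: "q \<notin> fst ` set js \<Longrightarrow> set_low js (\<xi>(q := x)) = (set_low js \<xi>)(q := x)"
  by (induction js) (auto simp: fun_upd_twist)

lemma set_high_update: "q \<notin> fst ` set js \<Longrightarrow> set_high js (\<xi>(q := x)) = (set_high js \<xi>)(q := x)"
  by (induction js) (auto simp: fun_upd_twist)

lemma set_high_less:
  "(\<And>q. q \<in> Q \<Longrightarrow> \<xi> q < b) \<Longrightarrow> (\<forall>(q, c, c')\<in>set js. c < c' \<and> c' < b) \<Longrightarrow> p \<in> Q \<Longrightarrow> set_high js \<xi> p < b"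
  by (induction js) auto

lemma set_low_less:
  "(\<And>q. q \<in> Q \<Longrightarrow> \<xi> q < b) \<Longrightarrow> (\<forall>(q, c, c')\<in>set js. c < c' \<and> c' < b) \<Longrightarrow> p \<in> Q \<Longrightarrow> set_low js \<xi> p < b"
  by (induction js) auto

lemma array_mean_set_low_le:
  fixes \<phi> :: "('q \<Rightarrow> nat) \<Rightarrow> real"
  assumes "finite Q" "fst ` set js \<subseteq> Q" "\<forall>(q, c, c')\<in>set js. c < c' \<and> c' < b" "\<And>\<xi>. 0 \<le> \<phi> \<xi>"
  shows "array_mean b Q (\<lambda>\<xi>. \<phi> (set_low js \<xi>)) \<le> real b ^ length js * array_mean b Q \<phi>"
  using assms(2-)
proof (induction js arbitrary: \<phi>)
  case (Cons j js)
  obtain q c c' where j: "j = (q, c, c')" by (cases j)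
  have q: "q \<in> Q" "c < b" using Cons.prems by (auto simp: j)
  have "array_mean b Q (\<lambda>\<xi>. \<phi> (set_low (j # js) \<xi>)) = array_mean b Q (\<lambda>\<xi>. (\<lambda>\<xi>. \<phi> (\<xi>(q := c))) (set_low js \<xi>))"
    by (simp only: j set_low_simps)
  also have "\<dots> \<le> real b ^ length js * array_mean b Q (\<lambda>\<xi>. \<phi> (\<xi>(q := c)))"
    by (rule Cons.IH) (use Cons.prems in auto)
  also have "\<dots> \<le> real b ^ length js * (real b * array_mean b Q \<phi>)"
    by (intro mult_left_mono array_mean_update_le[OF assms(1) q Cons.prems(3)]) simp
  finally show ?case by (simp only: length_Cons power_Suc2 mult.assoc)
qed simp

lemma avgs_jumps:
  assumes "fst ` set js \<inter> set zs = {}"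
  shows "foldr (avg b) zs (foldr jump js h) = foldr jump js (foldr (avg b) zs h)"
  using assms
proof (induction js)
  case (Cons j js)
  obtain q c c' where j: "j = (q, c, c')" by (cases j)
  have A: "q \<notin> set ts \<Longrightarrow> foldr (avg b) ts (jump (q, c, c') H) = jump (q, c, c') (foldr (avg b) ts H)" for ts H
    by (induction ts) (auto simp: jump_avg)
  have nq: "q \<notin> set zs" using Cons.prems by (auto simp: j)
  have IH: "foldr (avg b) zs (foldr jump js h) = foldr jump js (foldr (avg b) zs h)"
    by (rule Cons.IH) (use Cons.prems in auto)
  show ?case unfolding j foldr.simps o_apply A[OF nq] IH ..
qed simp

text \<open>The sum ranges over as many translates of the points \<open>Xf\<close> as the product of
  the step counts says, and one bound K serves them all.\<close>

lemma array_mean_step_sum_le: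
  fixes Xf :: "('q \<Rightarrow> nat) \<Rightarrow> nat \<Rightarrow> real"
  assumes K: "\<And>a. (\<forall>i. i \<notin> I \<longrightarrow> a i = 0) \<Longrightarrow> array_mean b Q (\<lambda>\<xi>. \<theta> (shv \<eta> a (Xf \<xi>))) \<le> K"
    and ks: "fst ` set ks \<subseteq> I" and a: "\<forall>i. i \<notin> I \<longrightarrow> a i = 0"
  shows "array_mean b Q (\<lambda>\<xi>. step_sum \<eta> ks \<theta> (shv \<eta> a (Xf \<xi>))) \<le> (\<Prod>k\<leftarrow>ks. real (snd k)) * K"
  using ks a
proof (induction ks arbitrary: a)
  case Nil
  then show ?case using K[of a] by simp
next
  case (Cons p ks)
  obtain i k where p: "p = (i, k)" by fastforce
  have i: "i \<in> I" and ks: "fst ` set ks \<subseteq> I" using Cons.prems(1) by (auto simp: p)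
  have "array_mean b Q (\<lambda>\<xi>. step_sum \<eta> (p # ks) \<theta> (shv \<eta> a (Xf \<xi>))) =
      (\<Sum>\<tau><k. array_mean b Q (\<lambda>\<xi>. step_sum \<eta> ks \<theta> (shv \<eta> (a(i := a i + \<tau>)) (Xf \<xi>))))"
    by (simp only: p step_sum.simps sh_shv array_mean_sum)
  also have "\<dots> \<le> (\<Sum>\<tau><k. (\<Prod>k\<leftarrow>ks. real (snd k)) * K)"
  proof (rule sum_mono)
    fix \<tau>
    have a': "\<forall>j. j \<notin> I \<longrightarrow> (a(i := a i + \<tau>)) j = 0" using Cons.prems(2) i by auto
    show "array_mean b Q (\<lambda>\<xi>. step_sum \<eta> ks \<theta> (shv \<eta> (a(i := a i + \<tau>)) (Xf \<xi>))) \<le> (\<Prod>k\<leftarrow>ks. real (snd k)) * K"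
      by (rule Cons.IH[OF ks a'])
  qed
  also have "\<dots> = (\<Prod>k\<leftarrow>p # ks. real (snd k)) * K"
    by (simp add: p)
  finally show ?case .
qed

context scrambling_interlaced
begin

abbreviation digits :: "nat \<Rightarrow> (nat \<times> nat) set" where
  "digits L \<equiv> {1..d * s} \<times> {1..L}"

abbreviation mean :: "nat \<Rightarrow> ((nat \<times> nat \<Rightarrow> nat) \<Rightarrow> 'v::real_vector) \<Rightarrow> 'v" where
  "mean L \<equiv> array_mean b (digits L)"

abbreviation gp :: "nat \<Rightarrow> (nat \<times> nat \<Rightarrow> nat) \<Rightarrow> nat \<Rightarrow> real" where
  "gp \<equiv> grid_point b d s"

abbreviation mesh :: "nat \<Rightarrow> real" where
  "mesh L \<equiv> 1 / real b ^ (d * L)"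

text \<open>\<open>blk\<close> is the interlaced variable to which a digit contributes, and
  \<open>pos\<close> its position in the expansion of that variable; they invert the indexing in
  \<open>coord_digit\<close>.\<close>

definition blk :: "nat \<times> nat \<Rightarrow> nat" where "blk q = (fst q - 1) div d + 1"

definition pos :: "nat \<times> nat \<Rightarrow> nat" where "pos q = (snd q - 1) * d + (fst q - 1) mod d + 1"

text \<open>A jump from c to c' at position p moves the variable by (c' - c) b^(-p), counted here in
  units of b^(-d L).\<close>

definition steps :: "nat \<Rightarrow> ((nat \<times> nat) \<times> nat \<times> nat) list \<Rightarrow> (nat \<times> nat) list" where
  "steps L js = map (\<lambda>(q, c, c'). (blk q, (c' - c) * b ^ (d * L - pos q))) js"

lemma b_pos: "0 < b" using b_gt_1 by simp

lemma blk_pos_range: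
  assumes "q \<in> digits L"
  shows "blk q \<in> {1..s}" "pos q \<in> {1..d * L}"
proof -
  obtain i p where ip: "i \<in> {1..s}" "p \<in> {1..d * L}"
    and eq: "i = (fst q - 1) div d + 1" "p = (snd q - 1) * d + (fst q - 1) mod d + 1"
    by (rule coord_surj[OF b_gt_1 d_pos assms])
  show "blk q \<in> {1..s}" "pos q \<in> {1..d * L}"
    using ip unfolding blk_def pos_def eq .
qed

lemma finite_digits: "finite (digits L)" by simp

lemma grid_sh:
  assumes "q \<in> digits L" "c < c'"
  shows "gp L (\<xi>(q := c')) = sh (blk q) (real ((c' - c) * b ^ (d * L - pos q)) * mesh L) (gp L (\<xi>(q := c)))"
proof -
  have p: "pos q \<le> d * L" using blk_pos_range(2)[OF assms(1)] by simp
  have "real b ^ (d * L) = real b ^ (d * L - pos q) * real b ^ pos q"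
    using p by (simp flip: power_add)
  then have eq: "(real c' - real c) / real b ^ pos q = real ((c' - c) * b ^ (d * L - pos q)) * mesh L"
    using assms(2) b_pos by (simp add: of_nat_diff)
  show ?thesis
    unfolding grid_point_update[OF b_gt_1 d_pos assms(1), of \<xi> c' c] sh_def blk_def[symmetric] pos_def[symmetric] eq ..
qed

lemma jumps_grid:
  assumes "distinct (map fst js)" "fst ` set js \<subseteq> digits L" "\<forall>(q, c, c')\<in>set js. c < c' \<and> c' < b"
  shows "foldr jump js (\<lambda>\<xi>. G (gp L \<xi>)) \<xi> = big_diff (mesh L) (steps L js) G (gp L (set_low js \<xi>))"
  using assms
proof (induction js arbitrary: \<xi>)
  case (Cons j js)
  obtain q c c' where j: "j = (q, c, c')" by (cases j)
  have q: "q \<in> digits L" "c < c'" "q \<notin> fst ` set js" using Cons.prems by (auto simp: j)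
  have IH: "foldr jump js (\<lambda>\<xi>. G (gp L \<xi>)) \<xi>' = big_diff (mesh L) (steps L js) G (gp L (set_low js \<xi>'))" for \<xi>'
    by (rule Cons.IH) (use Cons.prems in auto)
  have st: "steps L (j # js) = (blk q, (c' - c) * b ^ (d * L - pos q)) # steps L js"
    by (simp add: steps_def j)
  have "foldr jump (j # js) (\<lambda>\<xi>. G (gp L \<xi>)) \<xi> =
      foldr jump js (\<lambda>\<xi>. G (gp L \<xi>)) (\<xi>(q := c')) - foldr jump js (\<lambda>\<xi>. G (gp L \<xi>)) (\<xi>(q := c))"
    by (simp only: j foldr.simps o_apply jump_def prod.case)
  also have "\<dots> = big_diff (mesh L) (steps L js) G (gp L ((set_low js \<xi>)(q := c'))) -
      big_diff (mesh L) (steps L js) G (gp L ((set_low js \<xi>)(q := c)))"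
    unfolding IH set_low_update[OF q(3)] ..
  also have "\<dots> = big_diff (mesh L) (steps L (j # js)) G (gp L (set_low (j # js) \<xi>))"
    unfolding st big_diff_simps fdiff_def unfolding j set_low_simps grid_sh[OF q(1,2)] ..
  finally show ?case .
qed (simp add: steps_def)

text \<open>Used to confine the intermediate points of a jump: they stay below the grid point with
  all jumping digits raised, whose coordinates are less than 1.\<close>

lemma grid_total:
  assumes "distinct (map fst js)" "fst ` set js \<subseteq> digits L" "\<forall>(q, c, c')\<in>set js. c < c' \<and> c' < b"
  shows "gp L (set_high js \<xi>) i = gp L (set_low js \<xi>) i + real (step_total (steps L js) i) * mesh L"
  using assms
proof (induction js arbitrary: \<xi>)
  case (Cons j js)
  obtain q c c' where j: "j = (q, c, c')" by (cases j)
  have q: "q \<in> digits L" "c < c'" "q \<notin> fst ` set js" using Cons.prems by (auto simp: j)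
  have st: "steps L (j # js) = (blk q, (c' - c) * b ^ (d * L - pos q)) # steps L js"
    by (simp add: steps_def j)
  have "gp L (set_high (j # js) \<xi>) i =
      sh (blk q) (real ((c' - c) * b ^ (d * L - pos q)) * mesh L) (gp L ((set_high js \<xi>)(q := c))) i"
    unfolding j set_high_simps grid_sh[OF q(1,2)] ..
  also have "\<dots> = gp L ((set_high js \<xi>)(q := c)) i + (if i = blk q then real ((c' - c) * b ^ (d * L - pos q)) * mesh L else 0)"
    unfolding sh_def by (cases "i = blk q") (simp_all only: fun_upd_apply if_True if_False simp_thms add_0_right)
  also have "gp L ((set_high js \<xi>)(q := c)) i = gp L (set_high js (\<xi>(q := c))) i"
    unfolding set_high_update[OF q(3)] ..
  also have "\<dots> = gp L (set_low js (\<xi>(q := c))) i + real (step_total (steps L js) i) * mesh L"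
    by (rule Cons.IH) (use Cons.prems in auto)
  also have "set_low js (\<xi>(q := c)) = set_low (j # js) \<xi>"
    unfolding set_low_update[OF q(3)] j set_low_simps ..
  finally show ?case
    unfolding st step_total.simps by (cases "i = blk q") (simp_all add: distrib_right add_divide_distrib)
qed (simp add: steps_def)

lemma grid_bounds:
  assumes "\<And>q. q \<in> digits L \<Longrightarrow> \<xi> q < b" "i \<in> {1..s}"
  shows "0 \<le> gp L \<xi> i" "gp L \<xi> i < 1"
proof -
  let ?e = "\<lambda>p. if p \<in> {1..d * L} then coord_digit d \<xi> i p else 0"
  have "?e p < b" for p
  proof (cases "p \<in> {1..d * L}")
    case True
    have "coord_digit d \<xi> i p < b"
      by (rule coord_digit_less[OF b_gt_1 d_pos _ assms(2) True]) (rule assms(1))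
    then show ?thesis using True by (simp only: if_True)
  next
    case False
    then show ?thesis using b_pos by (simp only: if_False)
  qed
  then have "digit_int b ?e (d * L) < b ^ (d * L)" by (rule digit_int_less)
  moreover have "digit_int b ?e (d * L) = digit_int b (coord_digit d \<xi> i) (d * L)"
    by (rule digit_int_cong) simp
  ultimately have lt: "digit_int b (coord_digit d \<xi> i) (d * L) < b ^ (d * L)" by simp
  have eq: "gp L \<xi> i = real (digit_int b (coord_digit d \<xi> i) (d * L)) / real (b ^ (d * L))"
    unfolding grid_point_int[OF b_gt_1 d_pos] using assms(2) by (simp only: restrict_apply if_True)
  show "0 \<le> gp L \<xi> i" unfolding eq by simp
  show "gp L \<xi> i < 1" unfolding eq using lt b_pos by (simp add: divide_less_eq)
qed

lemma grid_cube: "(\<And>q. q \<in> digits L \<Longrightarrow> \<xi> q < b) \<Longrightarrow> gp L \<xi> \<in> cube {1..s}"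
  unfolding cube_def
proof (rule PiE_I)
  fix i assume lt: "\<And>q. q \<in> digits L \<Longrightarrow> \<xi> q < b" and i: "i \<in> {1..s}"
  have "0 \<le> gp L \<xi> i" by (rule grid_bounds(1)[OF _ i]) (rule lt)
  moreover have "gp L \<xi> i < 1" by (rule grid_bounds(2)[OF _ i]) (rule lt)
  ultimately show "gp L \<xi> i \<in> {0..1}" by simp
next
  fix i assume "i \<notin> {1..s}"
  then show "gp L \<xi> i = undefined" by (simp only: grid_point_def restrict_apply if_False)
qed

text \<open>A translation by nonnegative multiples of the mesh takes a grid point out of the grid
  only by raising some coordinate to at least 1, and there \<theta> vanishes. The other grid points
  are mapped injectively into the grid.\<close>

lemma mean_translate_le:
  assumes nn: "\<And>x. 0 \<le> \<theta> x" and supp: "\<And>x i. i \<in> {1..s} \<Longrightarrow> 1 \<le> x i \<Longrightarrow> \<theta> x = (0::real)"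
    and a: "\<forall>i. i \<notin> {1..s} \<longrightarrow> a i = 0"
  shows "mean L (\<lambda>\<xi>. \<theta> (shv (mesh L) a (gp L \<xi>))) \<le> mean L (\<lambda>\<xi>. \<theta> (gp L \<xi>))"
proof -
  let ?V = "b ^ (d * L)" and ?I = "{1..s}"
  let ?B = "PiE ?I (\<lambda>_. {..<?V})"
  let ?p = "\<lambda>k. \<lambda>i\<in>?I. real (k i) / real ?V"
  have V: "0 < real ?V" using b_pos by simp
  have fin: "finite ?B" by (simp add: finite_PiE)
  define T where "T k = (\<lambda>i\<in>?I. k i + a i)" for k
  have sh: "shv (mesh L) a (?p k) = ?p (T k)" for k
  proof (rule ext)
    fix i show "shv (mesh L) a (?p k) i = ?p (T k) i"
    proof (cases "i \<in> ?I")
      case True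
      then show ?thesis by (simp add: shv_def T_def add_divide_distrib)
    next
      case False
      then have "a i = 0" using a by blast
      then show ?thesis using False by (simp only: shv_def restrict_apply if_False of_nat_0 mult_zero_left add_0_right)
    qed
  qed
  let ?S = "{k \<in> ?B. T k \<in> ?B}"
  have zero: "\<theta> (?p (T k)) = 0" if "k \<in> ?B - ?S" for k
  proof -
    have "T k \<notin> ?B" using that by blast
    then obtain i where i: "i \<in> ?I" "\<not> T k i < ?V" by (auto simp: T_def PiE_iff)
    have "real ?V \<le> real (T k i)" using i(2) by (simp only: not_less of_nat_le_iff)
    then have "1 \<le> ?p (T k) i" using i(1) V by (simp add: le_divide_eq)
    then show ?thesis by (rule supp[OF i(1)])
  qed
  have inj: "inj_on T ?S"
  proof (rule inj_onI)
    fix k l assume k: "k \<in> ?S" and l: "l \<in> ?S" and eq: "T k = T l"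
    have kB: "k \<in> ?B" and lB: "l \<in> ?B" using k l by blast+
    show "k = l"
    proof (rule PiE_ext[OF kB lB])
      fix i assume "i \<in> ?I"
      with fun_cong[OF eq, of i] show "k i = l i" by (simp add: T_def)
    qed
  qed
  have "(\<Sum>k\<in>?B. \<theta> (?p (T k))) = (\<Sum>k\<in>?S. \<theta> (?p (T k)))"
    by (rule sum.mono_neutral_right[OF fin]) (use zero in blast)+
  also have "\<dots> = (\<Sum>k\<in>T ` ?S. \<theta> (?p k))"
    using sum.reindex[OF inj, of "\<lambda>k. \<theta> (?p k)"] by (simp only: o_def)
  also have "\<dots> \<le> (\<Sum>k\<in>?B. \<theta> (?p k))"
    by (rule sum_mono2[OF fin]) (use nn in blast)+
  finally have "(\<Sum>k\<in>?B. \<theta> (?p (T k))) /\<^sub>R real (?V ^ s) \<le> (\<Sum>k\<in>?B. \<theta> (?p k)) /\<^sub>R real (?V ^ s)"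
    by (rule scaleR_left_mono) simp
  then show ?thesis
    unfolding array_mean_grid[where F = "\<lambda>x. \<theta> (shv (mesh L) a x)" and s = s and L = L, OF b_gt_1 d_pos]
      array_mean_grid[where F = \<theta> and s = s and L = L, OF b_gt_1 d_pos] sh .
qed

text \<open>The digits in \<open>zs\<close> are exactly those of the variables outside u, since
  interlacing assigns whole blocks of d coordinates to a variable.\<close>

lemma grid_mix:
  assumes "set zs = {q \<in> digits L. blk q \<notin> u}"
  shows "gp L (\<lambda>q. if q \<in> set zs then \<zeta> q else \<xi> q) = glue s u (gp L \<xi>) (gp L \<zeta>)"
proof (rule ext)
  fix i
  show "gp L (\<lambda>q. if q \<in> set zs then \<zeta> q else \<xi> q) i = glue s u (gp L \<xi>) (gp L \<zeta>) i"
  proof (cases "i \<in> {1..s}")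
    case True
    have "coord_digit d (\<lambda>q. if q \<in> set zs then \<zeta> q else \<xi> q) i p = (if i \<in> u then coord_digit d \<xi> i p else coord_digit d \<zeta> i p)"
      if p: "p \<in> {1..d * L}" for p
    proof -
      let ?q = "((i - 1) * d + (p - 1) mod d + 1, (p - 1) div d + 1)"
      have q: "?q \<in> digits L" by (rule coord_index[OF b_gt_1 d_pos True p])
      have "((i - 1) * d + (p - 1) mod d) div d = i - 1" using d_pos by simp
      then have "blk ?q = i" using True unfolding blk_def by simp
      then have "?q \<in> set zs \<longleftrightarrow> i \<notin> u" unfolding assms using q \<open>blk ?q = i\<close> by (simp only: mem_Collect_eq simp_thms)
      then show ?thesis unfolding coord_digit_def by (cases "i \<in> u") (simp_all only: if_True if_False simp_thms)
    qed
    then have "digit_sum b (coord_digit d (\<lambda>q. if q \<in> set zs then \<zeta> q else \<xi> q) i) (d * L) =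
        (if i \<in> u then digit_sum b (coord_digit d \<xi> i) (d * L) else digit_sum b (coord_digit d \<zeta> i) (d * L))"
      unfolding digit_sum_def by (cases "i \<in> u") (simp_all only: if_True if_False cong: sum.cong)
    then show ?thesis
      using True by (simp only: grid_point_def glue_def restrict_apply if_True)
  next
    case False
    then show ?thesis by (simp only: grid_point_def glue_def restrict_apply if_False)
  qed
qed

lemma avgs_grid:
  fixes f :: "(nat \<Rightarrow> real) \<Rightarrow> 'v::real_vector"
  assumes "set zs = {q \<in> digits L. blk q \<notin> u}" "distinct zs"
  shows "foldr (avg b) zs (\<lambda>\<xi>. f (gp L \<xi>)) = (\<lambda>\<xi>. mean L (\<lambda>\<zeta>. f (glue s u (gp L \<xi>) (gp L \<zeta>))))"
proof (rule ext)
  fix \<xi>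
  have sub: "set zs \<subseteq> digits L" unfolding assms(1) by blast
  show "foldr (avg b) zs (\<lambda>\<xi>. f (gp L \<xi>)) \<xi> = mean L (\<lambda>\<zeta>. f (glue s u (gp L \<xi>) (gp L \<zeta>)))"
    unfolding avgs_eq_array_mean[OF finite_digits b_pos assms(2) sub] grid_mix[OF assms(1)] ..
qed

text \<open>Convergence of Riemann sums by coupling: for one scrambled point, here the origin, the
  truncation to the grid has the law of a random grid point, the point itself is uniform, and almost
  surely the two are within one mesh of each other in each coordinate.\<close>

lemma mean_grid_approx:
  fixes \<Phi> :: "(nat \<Rightarrow> real) \<Rightarrow> 'v::euclidean_space"
  assumes cont: "continuous_on (cube {1..s}) \<Phi>"
    and md: "\<And>x y. x \<in> cube {1..s} \<Longrightarrow> y \<in> cube {1..s} \<Longrightarrow> (\<forall>i\<in>{1..s}. \<bar>x i - y i\<bar> \<le> mesh L) \<Longrightarrow> norm (\<Phi> x - \<Phi> y) \<le> \<epsilon>"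
  shows "norm (mean L (\<lambda>\<xi>. \<Phi> (gp L \<xi>)) - (\<integral>x. \<Phi> x \<partial>cube_measure {1..s})) \<le> \<epsilon>"
proof -
  define x where "x = (\<lambda>_::nat. 0::real)"
  define z where "z = (\<lambda>j. base_digit b (x j))"
  have zl: "z j a < b" for j a unfolding z_def by (rule base_digit_less[OF b_pos])
  have sub: "digits L \<subseteq> {1..d * s} \<times> {1..}" and fd: "fst ` digits L \<subseteq> {1..d * s}" by auto
  have dep: "depends_on (digits L) (\<lambda>\<xi>. \<Phi> (gp L \<xi>))" by (rule depends_on_grid[OF b_gt_1 d_pos])
  have A: "(\<integral>\<pi>. \<Phi> (gp L (scrambled z \<pi>)) \<partial>P) = mean L (\<lambda>\<xi>. \<Phi> (gp L \<xi>))"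
    by (rule integral_scrambled[where z = z, OF zl finite_digits sub dep])
  have iA: "integrable P (\<lambda>\<pi>. \<Phi> (gp L (scrambled z \<pi>)))"
    by (rule integrable_scrambled[where z = z, OF zl finite_digits fd dep])
  have B: "(\<integral>\<pi>. \<Phi> (point_map x \<pi>) \<partial>P) = (\<integral>x. \<Phi> x \<partial>cube_measure {1..s})"
    using integral_distr[OF point_map_measurable[of x] continuous_cube_measurable[OF cont]]
    unfolding distr_point_map by (rule sym)
  have iB: "integrable P (\<lambda>\<pi>. \<Phi> (point_map x \<pi>))"
    by (rule integrable_distr[OF point_map_measurable[of x]])
       (simp only: distr_point_map continuous_cube_integrable[OF cont])
  have "norm (\<integral>\<pi>. \<Phi> (gp L (scrambled z \<pi>)) - \<Phi> (point_map x \<pi>) \<partial>P) \<le>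
      (\<integral>\<pi>. norm (\<Phi> (gp L (scrambled z \<pi>)) - \<Phi> (point_map x \<pi>)) \<partial>P)"
    by (rule integral_norm_bound)
  also have "\<dots> \<le> (\<integral>\<pi>. \<epsilon> \<partial>P)"
  proof (rule integral_mono_AE)
    show "integrable P (\<lambda>\<pi>. norm (\<Phi> (gp L (scrambled z \<pi>)) - \<Phi> (point_map x \<pi>)))"
      by (intro integrable_norm Bochner_Integration.integrable_diff iA iB)
    show "AE \<pi> in P. norm (\<Phi> (gp L (scrambled z \<pi>)) - \<Phi> (point_map x \<pi>)) \<le> \<epsilon>"
      using point_map_between[of x] unfolding z_def[symmetric]
    proof (rule AE_mp, intro AE_I2 impI)
      fix \<pi> assume \<pi>: "\<pi> \<in> space P"
        and *: "\<forall>L. \<forall>i\<in>{1..s}. gp L (scrambled z \<pi>) i \<le> point_map x \<pi> i \<and> point_map x \<pi> i \<le> gp L (scrambled z \<pi>) i + mesh L"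
      have lt: "scrambled z \<pi> q < b" if "q \<in> digits L" for q
        by (rule scrambled_less[where z = z, OF zl \<pi>]) (use that in auto)
      have gc: "gp L (scrambled z \<pi>) \<in> cube {1..s}" by (rule grid_cube) (rule lt)
      show "norm (\<Phi> (gp L (scrambled z \<pi>)) - \<Phi> (point_map x \<pi>)) \<le> \<epsilon>"
      proof (rule md[OF gc point_map_cube], rule ballI)
        fix i assume "i \<in> {1..s}"
        from bspec[OF spec[OF *, of L] this]
        show "\<bar>gp L (scrambled z \<pi>) i - point_map x \<pi> i\<bar> \<le> mesh L" by linarith
      qed
    qed
  qed simp
  also have "\<dots> = \<epsilon>" by (simp add: P.prob_space)
  finally show ?thesis
    unfolding Bochner_Integration.integral_diff[OF iA iB] A B .
qed

lemma glue_sh: "i \<in> u \<Longrightarrow> u \<subseteq> {1..s} \<Longrightarrow> glue s u (sh i t x) y = sh i t (glue s u x y)"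
  by (auto simp: glue_def sh_def fun_eq_iff)

lemma fdiffs_mean:
  fixes f :: "(nat \<Rightarrow> real) \<Rightarrow> 'v::real_vector"
  assumes "set js \<subseteq> u" "u \<subseteq> {1..s}"
  shows "foldr (fdiff \<eta>) js (\<lambda>x. mean L (\<lambda>\<zeta>. f (glue s u x (gp L \<zeta>)))) x =
    mean L (\<lambda>\<zeta>. foldr (fdiff \<eta>) js f (glue s u x (gp L \<zeta>)))"
  using assms(1)
proof (induction js arbitrary: x)
  case (Cons i js)
  have i: "i \<in> u" and js: "set js \<subseteq> u" using Cons.prems by auto
  show ?case
    unfolding foldr.simps o_apply fdiff_def[of \<eta> i] Cons.IH[OF js] glue_sh[OF i assms(2)] array_mean_diff ..
qed simp

text \<open>Collects the cost of a jump by k units at position p: k^2 from Cauchy-Schwarz and from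
  the number of translates, b from fixing the lower digit, and the square of the mesh from the unit
  difference. Since k times the mesh is at most b^(1 - p), the product is at most b^3 / b^(2
  p).\<close>

lemma prod_steps_le:
  assumes "fst ` set js \<subseteq> digits L" "\<forall>(q, c, c')\<in>set js. c < c' \<and> c' < b"
  shows "(\<Prod>k\<leftarrow>steps L js. real (snd k))\<^sup>2 * real b ^ length js * (mesh L ^ length js)\<^sup>2 \<le>
    (\<Prod>p\<leftarrow>js. real b ^ 3 / real b ^ (2 * pos (fst p)))"
  using assms
proof (induction js)
  case (Cons j js)
  obtain q c c' where j: "j = (q, c, c')" by (cases j)
  have q: "q \<in> digits L" "c < c'" "c' < b" using Cons.prems by (auto simp: j)
  have p: "pos q \<le> d * L" using blk_pos_range(2)[OF q(1)] by simp
  let ?k = "(c' - c) * b ^ (d * L - pos q)"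
  have e: "real b ^ (d * L) = real b ^ (d * L - pos q) * real b ^ pos q"
    using p by (simp flip: power_add)
  have k: "real ?k * mesh L = (real c' - real c) / real b ^ pos q"
    using q b_pos unfolding e by (simp add: of_nat_diff)
  have "(real ?k * mesh L)\<^sup>2 * real b \<le> (real b / real b ^ pos q)\<^sup>2 * real b"
    unfolding k using q by (intro mult_right_mono power_mono divide_right_mono) auto
  also have "\<dots> = real b ^ 3 / real b ^ (2 * pos q)"
    by (simp add: power_divide power_mult[symmetric] mult.commute[of _ 2] eval_nat_numeral power_add mult.assoc)
  finally have le: "(real ?k * mesh L)\<^sup>2 * real b \<le> real b ^ 3 / real b ^ (2 * pos q)" .
  let ?A = "(\<Prod>k\<leftarrow>steps L js. real (snd k))\<^sup>2 * real b ^ length js * (mesh L ^ length js)\<^sup>2"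
  have "(\<Prod>k\<leftarrow>steps L (j # js). real (snd k))\<^sup>2 * real b ^ length (j # js) * (mesh L ^ length (j # js))\<^sup>2 =
      ((real ?k * mesh L)\<^sup>2 * real b) * ?A"
  proof -
    have st: "steps L (j # js) = (blk q, ?k) # steps L js" by (simp add: steps_def j)
    have gen: "(k * P)\<^sup>2 * (B * B') * (\<eta> * E)\<^sup>2 = ((k * \<eta>)\<^sup>2 * B) * (P\<^sup>2 * B' * E\<^sup>2)" for k P B B' \<eta> E :: real
      by (simp add: power2_eq_square mult_ac)
    show ?thesis unfolding st list.map prod_list.Cons snd_conv length_Cons power_Suc by (rule gen)
  qed
  also have "\<dots> \<le> (real b ^ 3 / real b ^ (2 * pos q)) * (\<Prod>p\<leftarrow>js. real b ^ 3 / real b ^ (2 * pos (fst p)))"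
  proof (rule mult_mono[OF le])
    show "?A \<le> (\<Prod>p\<leftarrow>js. real b ^ 3 / real b ^ (2 * pos (fst p)))"
      by (rule Cons.IH) (use Cons.prems in auto)
  qed simp_all
  finally show ?case by (simp add: j)
qed (simp add: steps_def)

lemma mesh_tendsto: "(\<lambda>L. mesh L * c) \<longlonglongrightarrow> 0"
proof -
  have "(\<lambda>L. (1 / real b ^ d) ^ L) \<longlonglongrightarrow> 0"
    using b_gt_1 d_pos by (intro LIMSEQ_power_zero) simp
  from tendsto_mult_left_zero[OF this, of c] show ?thesis by (simp add: power_mult power_one_over)
qed

text \<open>
  Jumps of $\nu$ digits form an iterated difference of the averaged integrand with large steps, hence a sum
  of iterated differences with the mesh as step, and these are close to the mesh to the power $\nu$
  times a mixed derivative of the marginal. The base point has the jumping digits set to their lower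
  values, which costs a factor $b$ for each of them.
\<close>

lemma jump_mean_bound:
  fixes f :: "(nat \<Rightarrow> real) \<Rightarrow> 'k::{real_normed_field,euclidean_space}"
  assumes f: "smooth_on_cube s f" and u: "u \<subseteq> {1..s}" and is_u: "set is \<subseteq> u" and e: "0 < e"
  shows "\<forall>\<^sub>F L in sequentially. \<forall>js zs. distinct (map fst js) \<and> fst ` set js \<subseteq> digits L \<and>
      (\<forall>(q, c, c')\<in>set js. c < c' \<and> c' < b) \<and> map (blk \<circ> fst) js = is \<and>
      set zs = {q \<in> digits L. blk q \<notin> u} \<and> distinct zs \<longrightarrow>
    mean L (\<lambda>\<xi>. (norm (foldr (avg b) zs (foldr jump js (\<lambda>\<xi>. f (gp L \<xi>))) \<xi>))\<^sup>2) \<le>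
      (\<Prod>p\<leftarrow>js. real b ^ 3 / real b ^ (2 * pos (fst p))) *
      ((\<integral>x. (norm (marginal s u (foldr partial_deriv (rev is) f) x))\<^sup>2 \<partial>cube_measure u) + e)"
proof -
  define \<psi> where "\<psi> = foldr partial_deriv (rev is) f"
  let ?\<Psi> = "marginal s u \<psi>" and ?C = "cube {1..s}"
  let ?I = "\<integral>x. (norm (?\<Psi> x))\<^sup>2 \<partial>cube_measure u"
  have is_s: "set is \<subseteq> {1..s}" using is_u u by blast
  have c\<psi>: "continuous_on ?C \<psi>"
    unfolding \<psi>_def by (rule smooth_continuous, rule smooth_foldr[OF f]) (use is_s in simp)
  have c\<Psi>: "continuous_on ?C ?\<Psi>" by (rule marginal_continuous[OF u c\<psi>]) simp
  have c\<Psi>2: "continuous_on ?C (\<lambda>x. (norm (?\<Psi> x))\<^sup>2)" by (intro continuous_intros c\<Psi>)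
  obtain B0 where B0: "\<And>x. x \<in> ?C \<Longrightarrow> norm (?\<Psi> x) \<le> B0" using continuous_cube_bounded[OF c\<Psi>] by blast
  define B where "B = max B0 0"
  have B: "norm (?\<Psi> x) \<le> B" if "x \<in> ?C" for x using B0[OF that] by (simp add: B_def)
  have B_nn: "0 \<le> B" by (simp add: B_def)
  \<comment> \<open>Replacing n by n + 2 \<epsilon> with n \<le> B changes the square by at most (4
    B + 4) \<epsilon>, and a Riemann sum costs one more \<epsilon>; the total must not exceed
    e.\<close>
  define \<epsilon> where "\<epsilon> = min 1 (e / (4 * B + 5))"
  have \<epsilon>: "0 < \<epsilon>" "\<epsilon> \<le> 1" "\<epsilon> * (4 * B + 5) \<le> e"
  proof -
    show "0 < \<epsilon>" "\<epsilon> \<le> 1" using e B_nn by (auto simp: \<epsilon>_def)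
    have "\<epsilon> \<le> e / (4 * B + 5)" by (simp add: \<epsilon>_def)
    then show "\<epsilon> * (4 * B + 5) \<le> e" using B_nn by (simp add: pos_le_divide_eq)
  qed
  obtain \<delta>1 where \<delta>1: "0 < \<delta>1" "\<forall>x\<in>?C. \<forall>y\<in>?C. (\<forall>i\<in>{1..s}. \<bar>x i - y i\<bar> \<le> \<delta>1) \<longrightarrow> dist (\<psi> x) (\<psi> y) < \<epsilon>"
    using continuous_cube_uniform[OF c\<psi> \<epsilon>(1)] by (elim exE conjE)
  obtain \<delta>2 where \<delta>2: "0 < \<delta>2" "\<forall>x\<in>?C. \<forall>y\<in>?C. (\<forall>i\<in>{1..s}. \<bar>x i - y i\<bar> \<le> \<delta>2) \<longrightarrow> dist ((norm (?\<Psi> x))\<^sup>2) ((norm (?\<Psi> y))\<^sup>2) < \<epsilon>"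
    using continuous_cube_uniform[OF c\<Psi>2 \<epsilon>(1)] by (elim exE conjE)
  let ?\<nu> = "length is"
  have "0 < min \<delta>1 \<delta>2" using \<delta>1 \<delta>2 by simp
  \<comment> \<open>The points of an iterated unit difference spread over at most
    \<open>?\<nu>\<close> mesh steps in each coordinate; the additional mesh serves the Riemann
    sums.\<close>
  from tendstoD[OF mesh_tendsto[of "real ?\<nu> + 1"] this] show ?thesis
    unfolding \<psi>_def[symmetric]
  proof eventually_elim
    case (elim L)
    have mesh0: "0 < mesh L" using b_pos by simp
    have "mesh L * (real ?\<nu> + 1) < min \<delta>1 \<delta>2" using elim mesh0 by (simp add: dist_real_def abs_mult)
    moreover have "mesh L * (real ?\<nu> + 1) = mesh L * real ?\<nu> + mesh L" by (simp add: distrib_left)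
    moreover have "0 \<le> mesh L * real ?\<nu>" using mesh0 by simp
    ultimately have small: "mesh L * real ?\<nu> \<le> \<delta>1" "mesh L \<le> \<delta>1" "mesh L \<le> \<delta>2"
      using mesh0 by linarith+
    show ?case
    proof (intro allI impI, elim conjE)
      fix js zs assume js: "distinct (map fst js)" "fst ` set js \<subseteq> digits L" "\<forall>(q, c, c')\<in>set js. c < c' \<and> c' < b"
        and jis: "map (blk \<circ> fst) js = is" and zs: "set zs = {q \<in> digits L. blk q \<notin> u}" "distinct zs"
      define \<eta> where "\<eta> = mesh L"
      have \<eta>: "0 \<le> \<eta>" using mesh0 by (simp add: \<eta>_def)
      \<comment> \<open>The discrete marginal: the digits of all variables outside u are averaged
        out, while the argument x need no longer be a grid point.\<close>
      define G where "G = (\<lambda>x. mean L (\<lambda>\<zeta>. f (glue s u x (gp L \<zeta>))))"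
      define ks where "ks = steps L js"
      have ks_is: "map fst ks = is"
        unfolding ks_def steps_def jis[symmetric] by (simp add: case_prod_beta' o_def)
      have len: "length js = ?\<nu>" unfolding jis[symmetric] by simp
      have fst_ks: "fst ` set ks \<subseteq> {1..s}"
        using is_s unfolding ks_is[symmetric] by simp
      \<comment> \<open>The squared bound for a unit difference at z, cut off outside the half-open
        cube; the cut-off makes \<open>mean_translate_le\<close> applicable.\<close>
      define \<theta> where "\<theta> z = (if z \<in> ?C \<and> (\<forall>i\<in>{1..s}. z i < 1) then (\<eta> ^ ?\<nu>)\<^sup>2 * (norm (?\<Psi> z) + 2 * \<epsilon>)\<^sup>2 else 0)" for z
      have disj: "fst ` set js \<inter> set zs = {}"
      proof -
        have "blk q \<in> u" if "q \<in> fst ` set js" for q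
        proof -
          have "blk q \<in> set is" unfolding jis[symmetric] using that by auto
          then show ?thesis using is_u by blast
        qed
        then show ?thesis unfolding zs(1) by blast
      qed
      have eq: "foldr (avg b) zs (foldr jump js (\<lambda>\<xi>. f (gp L \<xi>))) \<xi> = big_diff \<eta> ks G (gp L (set_low js \<xi>))" for \<xi>
        proof -
        have "foldr (avg b) zs (foldr jump js (\<lambda>\<xi>. f (gp L \<xi>))) = foldr jump js (\<lambda>\<xi>. G (gp L \<xi>))"
          unfolding avgs_jumps[OF disj] avgs_grid[OF zs, where f = f] G_def ..
        then have "foldr (avg b) zs (foldr jump js (\<lambda>\<xi>. f (gp L \<xi>))) \<xi> = foldr jump js (\<lambda>\<xi>. G (gp L \<xi>)) \<xi>"
          by (rule fun_cong)
        also have "\<dots> = big_diff \<eta> ks G (gp L (set_low js \<xi>))"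
          unfolding \<eta>_def ks_def by (rule jumps_grid[OF js])
        finally show ?thesis .
      qed
      \<comment> \<open>One \<epsilon> is the error of the difference against the derivative, the
        other that of the discrete against the exact marginal.\<close>
      have unit: "norm (foldr (fdiff \<eta>) is G z) \<le> \<eta> ^ ?\<nu> * (norm (?\<Psi> z) + 2 * \<epsilon>)"
        if z: "z \<in> ?C" and room: "\<And>k. k \<in> {1..s} \<Longrightarrow> z k + real (count_list is k) * \<eta> \<le> 1" for z
      proof -
        have ap: "norm (foldr (fdiff \<eta>) is f (glue s u z (gp L \<zeta>)) - \<eta> ^ ?\<nu> *\<^sub>R \<psi> (glue s u z (gp L \<zeta>))) \<le> \<eta> ^ ?\<nu> * \<epsilon>"
          if \<zeta>: "\<zeta> \<in> arrays b (digits L)" for \<zeta>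
        proof -
          let ?w = "glue s u z (gp L \<zeta>)"
          have \<zeta>b: "\<zeta> q < b" if "q \<in> digits L" for q using PiE_mem[OF \<zeta> that] by simp
          have gc: "gp L \<zeta> \<in> ?C" by (rule grid_cube) (rule \<zeta>b)
          have w: "?w \<in> ?C" by (rule glue_cube[OF u disjI2[OF z] gc])
          show ?thesis
          proof (rule fdiffs_approx[OF f is_s w \<eta>])
            fix k assume k: "k \<in> {1..s}"
            show "?w k + real (count_list is k) * \<eta> \<le> 1"
            proof (cases "k \<in> u")
              case True
              then show ?thesis using room[OF k] k by (simp add: glue_def)
            next
              case False
              then have "count_list is k = 0" using is_u by (intro count_notin) blast
              then show ?thesis using cubeD[OF w k] by simp
            qed
          next
            fix v assume v: "v \<in> ?C" "\<forall>k\<in>{1..s}. ?w k \<le> v k \<and> v k \<le> ?w k + real (count_list is k) * \<eta>"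
            have "\<forall>k\<in>{1..s}. \<bar>v k - ?w k\<bar> \<le> \<delta>1"
            proof
              fix k assume k: "k \<in> {1..s}"
              have "real (count_list is k) * \<eta> \<le> real ?\<nu> * \<eta>"
                using \<eta> count_le_length[of "is" k] by (intro mult_right_mono) auto
              then have "real (count_list is k) * \<eta> \<le> \<delta>1" using small(1) by (simp only: \<eta>_def mult.commute) 
              then show "\<bar>v k - ?w k\<bar> \<le> \<delta>1" using bspec[OF v(2) k] by linarith
            qed
            from mp[OF bspec[OF bspec[OF \<delta>1(2) v(1)] w] this]
            show "norm (foldr partial_deriv (rev is) f v - \<psi> ?w) \<le> \<epsilon>"
              unfolding \<psi>_def[symmetric] by (simp only: dist_norm less_imp_le)
          qed
        qed
        let ?A = "mean L (\<lambda>\<zeta>. foldr (fdiff \<eta>) is f (glue s u z (gp L \<zeta>)))"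
        let ?M = "mean L (\<lambda>\<zeta>. \<psi> (glue s u z (gp L \<zeta>)))"
        have 1: "norm (?A - \<eta> ^ ?\<nu> *\<^sub>R ?M) \<le> \<eta> ^ ?\<nu> * \<epsilon>"
          unfolding array_mean_scaleR[symmetric] array_mean_diff[symmetric]
          by (rule norm_array_mean_le[OF finite_digits b_pos]) (rule ap)
        have 2: "norm (?M - ?\<Psi> z) \<le> \<epsilon>"
          unfolding marginal_eq[OF u c\<psi> disjI2[OF z]]
        proof (rule mean_grid_approx[OF glue_continuous[OF u c\<psi> disjI2[OF z]]])
          fix x y assume xy: "x \<in> ?C" "y \<in> ?C" "\<forall>i\<in>{1..s}. \<bar>x i - y i\<bar> \<le> mesh L"
          have "\<forall>i\<in>{1..s}. \<bar>glue s u z x i - glue s u z y i\<bar> \<le> \<delta>1"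
          proof
            fix i assume i: "i \<in> {1..s}"
            have "\<bar>x i - y i\<bar> \<le> \<delta>1" using bspec[OF xy(3) i] small(2) by linarith
            then show "\<bar>glue s u z x i - glue s u z y i\<bar> \<le> \<delta>1"
              using i \<delta>1(1) by (cases "i \<in> u") (simp_all add: glue_def)
          qed
          from mp[OF bspec[OF bspec[OF \<delta>1(2) glue_cube[OF u disjI2[OF z] xy(1)]] glue_cube[OF u disjI2[OF z] xy(2)]] this]
          show "norm (\<psi> (glue s u z x) - \<psi> (glue s u z y)) \<le> \<epsilon>" by (simp only: dist_norm less_imp_le)
        qed
        have "foldr (fdiff \<eta>) is G z = ?A"
          unfolding G_def by (rule fdiffs_mean[OF is_u u])
        moreover have "norm ?A \<le> norm (?A - \<eta> ^ ?\<nu> *\<^sub>R ?M) + norm (\<eta> ^ ?\<nu> *\<^sub>R ?M)"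
          using norm_triangle_ineq[of "?A - \<eta> ^ ?\<nu> *\<^sub>R ?M" "\<eta> ^ ?\<nu> *\<^sub>R ?M"] by simp
        moreover have "norm (\<eta> ^ ?\<nu> *\<^sub>R ?M) \<le> \<eta> ^ ?\<nu> * (norm (?\<Psi> z) + \<epsilon>)"
        proof -
          have "norm ?M \<le> norm (?\<Psi> z) + \<epsilon>"
            using 2 norm_triangle_ineq2[of ?M "?\<Psi> z"] by linarith
          then show ?thesis using \<eta> by (simp add: mult_left_mono)
        qed
        ultimately show ?thesis using 1 by (simp add: distrib_left)
      qed
      have pt: "(norm (big_diff \<eta> ks G (gp L (set_low js \<xi>))))\<^sup>2 \<le> (\<Prod>k\<leftarrow>ks. real (snd k)) * step_sum \<eta> ks \<theta> (gp L (set_low js \<xi>))"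
        if \<xi>: "\<xi> \<in> arrays b (digits L)" for \<xi>
      proof -
        let ?x = "gp L (set_low js \<xi>)"
        have \<xi>b: "\<xi> q < b" if "q \<in> digits L" for q using PiE_mem[OF \<xi> that] by simp
        have low: "set_low js \<xi> q < b" if "q \<in> digits L" for q
          by (rule set_low_less[where Q = "digits L", OF \<xi>b js(3) that])
        have high: "set_high js \<xi> q < b" if "q \<in> digits L" for q
          by (rule set_high_less[where Q = "digits L", OF \<xi>b js(3) that])
        \<comment> \<open>All base points are enclosed between the lower and the upper grid point,
          so the cut-off in \<open>\<theta>\<close> does not affect them.\<close>
        have "step_sum \<eta> ks (\<lambda>z. (norm (foldr (fdiff \<eta>) is G z))\<^sup>2) ?x \<le> step_sum \<eta> ks \<theta> ?x"
        proof (rule step_sum_mono)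
          fix z assume z: "z \<in> reach \<eta> ks ?x"
          note r1 = reach_bounds(1)[OF \<eta> z] and r2 = reach_bounds(2)[OF \<eta> z, unfolded ks_is]
          have tot: "?x i + real (step_total ks i) * \<eta> = gp L (set_high js \<xi>) i" for i
            unfolding ks_def \<eta>_def by (rule grid_total[OF js, symmetric])
          have zu: "z i + real (count_list is i) * \<eta> < 1" "0 \<le> z i" if i: "i \<in> {1..s}" for i
          proof -
            have "gp L (set_high js \<xi>) i < 1" by (rule grid_bounds(2)[OF _ i]) (rule high)
            with r2[of i] tot[of i] show "z i + real (count_list is i) * \<eta> < 1" by linarith
            have "0 \<le> ?x i" by (rule grid_bounds(1)[OF _ i]) (rule low)
            with r1[of i] show "0 \<le> z i" by linarith
          qed
          have z1: "z i < 1" if i: "i \<in> {1..s}" for i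
          proof -
            have "0 \<le> real (count_list is i) * \<eta>" using \<eta> by simp
            with zu(1)[OF i] show ?thesis by linarith
          qed
          have zC: "z \<in> ?C"
            unfolding cube_def
          proof (rule PiE_I)
            fix i assume "i \<in> {1..s}"
            from zu(2)[OF this] z1[OF this] show "z i \<in> {0..1}" by simp
          next
            \<comment> \<open>Off the index set both corners have the value
              \<open>undefined\<close>, and the enclosure forces the same value on z.\<close>
            fix i assume i: "i \<notin> {1..s}"
            have nc: "count_list is i = 0" using is_s i by (intro count_notin) blast
            have "gp L (set_high js \<xi>) i = undefined" "?x i = undefined"
              using i by (simp_all only: grid_point_def restrict_apply if_False)
            moreover have "real (count_list is i) * \<eta> = 0" by (simp only: nc of_nat_0 mult_zero_left)
            ultimately show "z i = undefined" using r1[of i] r2[of i] tot[of i] by linarith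
          qed
          have "(norm (foldr (fdiff \<eta>) is G z))\<^sup>2 \<le> (\<eta> ^ ?\<nu> * (norm (?\<Psi> z) + 2 * \<epsilon>))\<^sup>2"
            by (rule power_mono[OF unit[OF zC]]) (use zu(1) in \<open>auto intro: less_imp_le\<close>)
          also have "\<dots> = \<theta> z"
            unfolding \<theta>_def using zC z1 by (simp add: power_mult_distrib)
          finally show "(norm (foldr (fdiff \<eta>) is G z))\<^sup>2 \<le> \<theta> z" .
        qed
        then have "(\<Prod>k\<leftarrow>ks. real (snd k)) * step_sum \<eta> ks (\<lambda>z. (norm (foldr (fdiff \<eta>) is G z))\<^sup>2) ?x \<le>
            (\<Prod>k\<leftarrow>ks. real (snd k)) * step_sum \<eta> ks \<theta> ?x"
          by (rule mult_left_mono) (auto intro!: prod_list_nonneg)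
        with norm_big_diff_le[of \<eta> ks G ?x] show ?thesis unfolding ks_is by linarith
      qed
      have \<theta>_nn: "0 \<le> \<theta> x" for x by (simp add: \<theta>_def)
      have \<theta>_supp: "\<theta> x = 0" if "i \<in> {1..s}" "1 \<le> x i" for x i
      proof -
        have "\<not> (\<forall>i\<in>{1..s}. x i < 1)" using that by (meson not_less)
        then show ?thesis unfolding \<theta>_def by (simp only: simp_thms if_False)
      qed
      let ?K = "real b ^ ?\<nu> * mean L (\<lambda>\<xi>. \<theta> (gp L \<xi>))"
      \<comment> \<open>Setting the jumping digits to their lower values costs b per jump; the
        translation then costs nothing.\<close>
      have tr: "mean L (\<lambda>\<xi>. \<theta> (shv \<eta> a (gp L (set_low js \<xi>)))) \<le> ?K" if a: "\<forall>i. i \<notin> {1..s} \<longrightarrow> a i = 0" for a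
      proof -
        have "mean L (\<lambda>\<xi>. (\<lambda>\<xi>. \<theta> (shv \<eta> a (gp L \<xi>))) (set_low js \<xi>)) \<le> real b ^ length js * mean L (\<lambda>\<xi>. \<theta> (shv \<eta> a (gp L \<xi>)))"
          by (rule array_mean_set_low_le[OF finite_digits js(2,3)]) (rule \<theta>_nn)
        also have "\<dots> \<le> real b ^ length js * mean L (\<lambda>\<xi>. \<theta> (gp L \<xi>))"
          unfolding \<eta>_def by (intro mult_left_mono mean_translate_le \<theta>_nn \<theta>_supp a) simp_all
        finally show ?thesis unfolding len .
      qed
      have st: "mean L (\<lambda>\<xi>. step_sum \<eta> ks \<theta> (gp L (set_low js \<xi>))) \<le> (\<Prod>k\<leftarrow>ks. real (snd k)) * ?K"
        using array_mean_step_sum_le[where Xf = "\<lambda>\<xi>. gp L (set_low js \<xi>)" and I = "{1..s}" and a = "\<lambda>_. 0" and K = ?K and \<theta> = \<theta> and \<eta> = \<eta> and b = b and Q = "digits L", OF tr fst_ks]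
        unfolding shv_0 by blast
      have \<theta>_mean: "mean L (\<lambda>\<xi>. \<theta> (gp L \<xi>)) \<le> (\<eta> ^ ?\<nu>)\<^sup>2 * (?I + e)"
      proof -
        have "\<theta> (gp L \<xi>) \<le> (\<eta> ^ ?\<nu>)\<^sup>2 * ((norm (?\<Psi> (gp L \<xi>)))\<^sup>2 + (4 * B + 4) * \<epsilon>)"
          if \<xi>: "\<xi> \<in> arrays b (digits L)" for \<xi>
        proof -
          let ?n = "norm (?\<Psi> (gp L \<xi>))"
          have gc: "gp L \<xi> \<in> ?C" by (rule grid_cube) (use PiE_mem[OF \<xi>] in simp)
          have "?n * \<epsilon> \<le> B * \<epsilon>" using B[OF gc] \<epsilon>(1) by (intro mult_right_mono) auto
          moreover have "\<epsilon> * \<epsilon> \<le> 1 * \<epsilon>" using \<epsilon>(1,2) by (intro mult_right_mono) auto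
          moreover have "(?n + 2 * \<epsilon>)\<^sup>2 = ?n\<^sup>2 + 4 * (?n * \<epsilon>) + 4 * (\<epsilon> * \<epsilon>)" by (simp add: power2_eq_square algebra_simps)
          ultimately have "(?n + 2 * \<epsilon>)\<^sup>2 \<le> ?n\<^sup>2 + (4 * B + 4) * \<epsilon>" by (simp add: distrib_right)
          then have "(\<eta> ^ ?\<nu>)\<^sup>2 * (?n + 2 * \<epsilon>)\<^sup>2 \<le> (\<eta> ^ ?\<nu>)\<^sup>2 * (?n\<^sup>2 + (4 * B + 4) * \<epsilon>)"
            by (rule mult_left_mono) simp
          moreover have "0 \<le> (\<eta> ^ ?\<nu>)\<^sup>2 * (?n\<^sup>2 + (4 * B + 4) * \<epsilon>)" using B_nn \<epsilon>(1) by simp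
          ultimately show ?thesis by (simp only: \<theta>_def split: if_split) blast
        qed
        then have "mean L (\<lambda>\<xi>. \<theta> (gp L \<xi>)) \<le> mean L (\<lambda>\<xi>. (\<eta> ^ ?\<nu>)\<^sup>2 * ((norm (?\<Psi> (gp L \<xi>)))\<^sup>2 + (4 * B + 4) * \<epsilon>))"
          by (rule array_mean_mono)
        also have "\<dots> = (\<eta> ^ ?\<nu>)\<^sup>2 * (mean L (\<lambda>\<xi>. (norm (?\<Psi> (gp L \<xi>)))\<^sup>2) + (4 * B + 4) * \<epsilon>)"
          by (simp only: array_mean_cmul array_mean_add array_mean_const[OF finite_digits b_pos])
        also have "\<dots> \<le> (\<eta> ^ ?\<nu>)\<^sup>2 * (?I + e)"
        proof (rule mult_left_mono)
          have "norm (mean L (\<lambda>\<xi>. (norm (?\<Psi> (gp L \<xi>)))\<^sup>2) - (\<integral>x. (norm (?\<Psi> x))\<^sup>2 \<partial>cube_measure {1..s})) \<le> \<epsilon>"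
          proof (rule mean_grid_approx[OF c\<Psi>2])
            fix x y assume xy: "x \<in> ?C" "y \<in> ?C" "\<forall>i\<in>{1..s}. \<bar>x i - y i\<bar> \<le> mesh L"
            have "\<forall>i\<in>{1..s}. \<bar>x i - y i\<bar> \<le> \<delta>2"
            proof
              fix i assume i: "i \<in> {1..s}"
              show "\<bar>x i - y i\<bar> \<le> \<delta>2" using bspec[OF xy(3) i] small(3) by linarith
            qed
            from mp[OF bspec[OF bspec[OF \<delta>2(2) xy(1)] xy(2)] this]
            show "norm ((norm (?\<Psi> x))\<^sup>2 - (norm (?\<Psi> y))\<^sup>2) \<le> \<epsilon>" by (simp only: dist_norm less_imp_le)
          qed
          then have "mean L (\<lambda>\<xi>. (norm (?\<Psi> (gp L \<xi>)))\<^sup>2) \<le> ?I + \<epsilon>"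
            unfolding integral_marginal[OF u c\<psi>] real_norm_def by linarith
          moreover have "\<epsilon> + (4 * B + 4) * \<epsilon> = \<epsilon> * (4 * B + 5)" by (simp add: algebra_simps)
          ultimately show "mean L (\<lambda>\<xi>. (norm (?\<Psi> (gp L \<xi>)))\<^sup>2) + (4 * B + 4) * \<epsilon> \<le> ?I + e"
            using \<epsilon>(3) by linarith
        qed simp
        finally show ?thesis .
      qed
      have Ie: "0 \<le> ?I + e" using e by (simp add: add_nonneg_nonneg)
      let ?\<Pi> = "\<Prod>k\<leftarrow>ks. real (snd k)"
      have \<Pi>: "0 \<le> ?\<Pi>" by (auto intro!: prod_list_nonneg)
      have "mean L (\<lambda>\<xi>. (norm (foldr (avg b) zs (foldr jump js (\<lambda>\<xi>. f (gp L \<xi>))) \<xi>))\<^sup>2) \<le>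
          mean L (\<lambda>\<xi>. ?\<Pi> * step_sum \<eta> ks \<theta> (gp L (set_low js \<xi>)))"
        unfolding eq by (rule array_mean_mono) (rule pt)
      also have "\<dots> \<le> ?\<Pi> * (?\<Pi> * ?K)"
        unfolding array_mean_cmul by (rule mult_left_mono[OF st \<Pi>])
      also have "\<dots> \<le> ?\<Pi> * (?\<Pi> * (real b ^ ?\<nu> * ((\<eta> ^ ?\<nu>)\<^sup>2 * (?I + e))))"
        by (intro mult_left_mono \<theta>_mean \<Pi>) simp
      also have "\<dots> = (?\<Pi>\<^sup>2 * real b ^ length js * (mesh L ^ length js)\<^sup>2) * (?I + e)"
        unfolding len \<eta>_def power2_eq_square[of ?\<Pi>] by (simp only: mult.assoc)
      also have "\<dots> \<le> (\<Prod>p\<leftarrow>js. real b ^ 3 / real b ^ (2 * pos (fst p))) * (?I + e)"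
        unfolding ks_def by (rule mult_right_mono[OF prod_steps_le[OF js(2,3)] Ie])
      finally show "mean L (\<lambda>\<xi>. (norm (foldr (avg b) zs (foldr jump js (\<lambda>\<xi>. f (gp L \<xi>))) \<xi>))\<^sup>2) \<le>
          (\<Prod>p\<leftarrow>js. real b ^ 3 / real b ^ (2 * pos (fst p))) * (?I + e)" .
    qed
  qed
qed

end

section \<open>Selecting large digit levels\<close>

text \<open>Discarding a smallest element never lowers the average of l over the set. Repeating this
  until k elements are left gives a J that holds at least the fraction k / |B| of the sum.\<close>

lemma heavy_subset:
  fixes l :: "'a \<Rightarrow> nat"
  assumes "finite B" "k \<le> card B"
  shows "\<exists>J\<subseteq>B. card J = k \<and> k * sum l B \<le> card B * sum l J"
  using assms(2)
proof (induction "card B - k" arbitrary: k)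
  case 0
  then have "k = card B" by simp
  then show ?case by blast
next
  case (Suc n)
  then have "n = card B - Suc k" "Suc k \<le> card B" by simp_all
  from Suc.hyps(1)[OF this] obtain J' where J': "J' \<subseteq> B" "card J' = Suc k" "Suc k * sum l B \<le> card B * sum l J'"
    by blast
  have fin: "finite J'" and ne: "J' \<noteq> {}" using J'(1,2) assms(1) finite_subset by auto
  then have "Min (l ` J') \<in> l ` J'" by (intro Min_in) auto
  then obtain a where a: "a \<in> J'" "l a = Min (l ` J')" by auto
  have "of_nat (card J') * l a \<le> sum l J'" by (rule sum_bounded_below) (simp add: a(2) fin)
  moreover have S: "sum l J' = l a + sum l (J' - {a})" by (rule sum.remove[OF fin a(1)])
  ultimately have le: "k * l a \<le> sum l (J' - {a})" using J'(2) by simp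
  have "Suc k * (k * sum l B) \<le> k * (card B * (l a + sum l (J' - {a})))"
    using mult_le_mono2[OF J'(3), of k] unfolding S by (simp only: mult.left_commute)
  also have "\<dots> = card B * (k * l a + k * sum l (J' - {a}))" by (simp add: algebra_simps)
  also have "\<dots> \<le> card B * (sum l (J' - {a}) + k * sum l (J' - {a}))" using le by simp
  also have "\<dots> = Suc k * (card B * sum l (J' - {a}))" by (simp add: algebra_simps)
  finally have "k * sum l B \<le> card B * sum l (J' - {a})" by (simp only: Suc_mult_le_cancel1)
  moreover have "card (J' - {a}) = k" using a(1) J'(2) fin by simp
  ultimately show ?case using J'(1) by blast
qed

text \<open>That J is nonempty guarantees that each variable with a positive level is differentiated
  at least once, as the norm involves orders between 1 and \<alpha>.\<close>

lemma heavy_subset_min: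
  fixes l :: "'a \<Rightarrow> nat"
  assumes "finite B" "card B \<le> d" "1 \<le> \<alpha>"
  shows "\<exists>J\<subseteq>B. card J \<le> \<alpha> \<and> (B \<noteq> {} \<longrightarrow> J \<noteq> {}) \<and> min \<alpha> d * sum l B \<le> d * sum l J"
proof (cases "card B \<le> \<alpha>")
  case True
  have "min \<alpha> d * sum l B \<le> d * sum l B" by (intro mult_le_mono1) simp
  with True show ?thesis by blast
next
  case False
  then obtain J where J: "J \<subseteq> B" "card J = \<alpha>" "\<alpha> * sum l B \<le> card B * sum l J"
    using heavy_subset[OF assms(1), of \<alpha> l] by auto
  have "min \<alpha> d * sum l B \<le> \<alpha> * sum l B" by (intro mult_le_mono1) simp
  also note J(3)
  also have "card B * sum l J \<le> d * sum l J" using assms(2) by (intro mult_le_mono1)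
  finally have "min \<alpha> d * sum l B \<le> d * sum l J" .
  moreover have "J \<noteq> {}" using J(2) assms(3) by auto
  ultimately show ?thesis using J(1,2) by blast
qed

text \<open>The selected digits are listed variable by variable, so that the list of their variables
  is literally the list of derivatives in \<open>mixed_list\<close>.\<close>

lemma concat_fibers:
  fixes l :: "'a::linorder \<Rightarrow> nat" and g :: "'a \<Rightarrow> 'b"
  assumes "distinct is" "\<And>i. finite (J i)" "\<And>i j. j \<in> J i \<Longrightarrow> g j = i"
  defines "js \<equiv> concat (map (\<lambda>i. sorted_list_of_set (J i)) is)"
  shows "distinct js" "set js = (\<Union>i\<in>set is. J i)" "map g js = concat (map (\<lambda>i. replicate (card (J i)) i) is)"
    "sum_list (map l js) = (\<Sum>i\<in>set is. sum l (J i))"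
proof -
  show s: "set js = (\<Union>i\<in>set is. J i)" using assms(2) by (simp add: js_def)
  have rep: "map g (sorted_list_of_set (J i)) = replicate (card (J i)) i" for i
    by (rule replicate_eqI) (auto simp: assms(2,3))
  show "map g js = concat (map (\<lambda>i. replicate (card (J i)) i) is)"
    by (simp add: js_def map_concat o_def rep)
  have sl: "sum_list (map l (sorted_list_of_set (J i))) = sum l (J i)" for i
    using assms(2) by (simp add: sum_list_distinct_conv_sum_set)
  show "sum_list (map l js) = (\<Sum>i\<in>set is. sum l (J i))"
    unfolding js_def using assms(1) by (induction "is") (simp_all add: sl)
  show "distinct js"
    unfolding js_def using assms(1)
  proof (induction "is")
    case (Cons i "is")
    have "i = k" if "x \<in> J i" "x \<in> J k" for x k using assms(3)[OF that(1)] assms(3)[OF that(2)] by simp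
    then have "J i \<inter> (\<Union>k\<in>set is. J k) = {}" using Cons.prems by auto
    then show ?case using Cons assms(2) by simp
  qed simp
qed

text \<open>
  In each block of $d$ coordinates that are interlaced into one variable, the at most $\alpha$ largest
  levels are kept; these are the digits in which differences are taken. Keeping all or the $\alpha$
  largest of at most $d$ levels retains a fraction $\min(\alpha,d)/d$ of their sum.
\<close>

lemma exists_selection:
  fixes l :: "nat \<Rightarrow> nat"
  assumes d: "1 \<le> d" and \<alpha>: "1 \<le> \<alpha>"
  obtains u \<nu> js where "u \<subseteq> {1..s}" "\<nu> \<in> PiE u (\<lambda>_. {1..\<alpha>})" "distinct js" "set js \<subseteq> {j \<in> {1..d * s}. 0 < l j}"
    "map (\<lambda>j. (j - 1) div d + 1) js = mixed_list u \<nu>"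
    "\<forall>j\<in>{1..d * s}. 0 < l j \<longrightarrow> (j - 1) div d + 1 \<in> u"
    "min \<alpha> d * (\<Sum>j=1..d * s. l j) \<le> d * sum_list (map l js)"
proof -
  define g where "g j = (j - 1) div d + 1" for j
  define S where "S = {j \<in> {1..d * s}. 0 < l j}"
  define u where "u = g ` S"
  define B where "B i = {j \<in> S. g j = i}" for i
  have finS: "finite S" by (simp add: S_def)
  have finB: "finite (B i)" for i using finS by (simp add: B_def)
  have u: "u \<subseteq> {1..s}"
    using d by (auto simp: u_def g_def S_def Suc_le_eq intro!: less_mult_imp_div_less) (simp add: mult.commute)
  have cardB: "card (B i) \<le> d" for i
  proof -
    have "B i \<subseteq> {(i - 1) * d + 1..(i - 1) * d + d}"
    proof
      fix j assume "j \<in> B i"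
      then have j: "1 \<le> j" "(j - 1) div d = i - 1" by (auto simp: B_def S_def g_def)
      have "(j - 1) div d * d \<le> j - 1" "j - 1 < (j - 1) div d * d + d"
        using d dividend_less_div_times[of d "j - 1"] by simp_all
      then have "(i - 1) * d \<le> j - 1" "j - 1 < (i - 1) * d + d" unfolding j(2) by simp_all
      then show "j \<in> {(i - 1) * d + 1..(i - 1) * d + d}" using j(1) unfolding atLeastAtMost_iff by linarith
    qed
    then have "card (B i) \<le> card {(i - 1) * d + 1..(i - 1) * d + d}" by (rule card_mono[rotated]) simp
    then show ?thesis by simp
  qed
  have "\<forall>i. \<exists>J. J \<subseteq> B i \<and> card J \<le> \<alpha> \<and> (B i \<noteq> {} \<longrightarrow> J \<noteq> {}) \<and> min \<alpha> d * sum l (B i) \<le> d * sum l J"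
    using heavy_subset_min[OF finB cardB \<alpha>] by blast
  then obtain J where J: "\<And>i. J i \<subseteq> B i" "\<And>i. card (J i) \<le> \<alpha>" "\<And>i. B i \<noteq> {} \<Longrightarrow> J i \<noteq> {}"
    "\<And>i. min \<alpha> d * sum l (B i) \<le> d * sum l (J i)"
    by (auto dest!: choice)
  have finJ: "finite (J i)" for i using J(1) finB by (rule finite_subset)
  have gJ: "g j = i" if "j \<in> J i" for i j using that J(1)[of i] by (auto simp: B_def)
  define \<nu> where "\<nu> = (\<lambda>i\<in>u. card (J i))"
  define js where "js = concat (map (\<lambda>i. sorted_list_of_set (J i)) (sorted_list_of_set u))"
  have finu: "finite u" using finS by (simp add: u_def)
  note cf0 = concat_fibers[where J = J and g = g, OF distinct_sorted_list_of_set[of u] finJ gJ]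
  have cf: "distinct js" "set js = (\<Union>i\<in>u. J i)" "map g js = concat (map (\<lambda>i. replicate (card (J i)) i) (sorted_list_of_set u))"
    "sum_list (map l js) = (\<Sum>i\<in>u. sum l (J i))"
    using cf0(1-3) cf0(4)[of l] unfolding set_sorted_list_of_set[OF finu] js_def[symmetric] by simp_all
  show ?thesis
  proof
    show "u \<subseteq> {1..s}" by (rule u)
    show "\<nu> \<in> PiE u (\<lambda>_. {1..\<alpha>})"
      unfolding \<nu>_def
    proof (rule restrict_PiE_iff[THEN iffD2], rule ballI)
      fix i assume "i \<in> u"
      then have "B i \<noteq> {}" by (auto simp: u_def B_def)
      then show "card (J i) \<in> {1..\<alpha>}" using J(2,3)[of i] finJ[of i] by (simp add: Suc_le_eq card_gt_0_iff)
    qed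
    show "distinct js" by (rule cf(1)) 
    show "set js \<subseteq> {j \<in> {1..d * s}. 0 < l j}"
      unfolding cf(2) S_def[symmetric] using J(1) unfolding B_def by blast
    have "map (\<lambda>i. replicate (\<nu> i) i) (sorted_list_of_set u) = map (\<lambda>i. replicate (card (J i)) i) (sorted_list_of_set u)"
      using finu by (simp add: \<nu>_def)
    then show "map (\<lambda>j. (j - 1) div d + 1) js = mixed_list u \<nu>"
      unfolding g_def[symmetric] mixed_list_def cf(3) by (simp only:)
    show "\<forall>j\<in>{1..d * s}. 0 < l j \<longrightarrow> (j - 1) div d + 1 \<in> u"
      unfolding u_def S_def g_def by blast
    have "(\<Sum>j=1..d * s. l j) = sum l S"
      unfolding S_def by (rule sum.mono_neutral_right) auto
    also have "\<dots> = (\<Sum>i\<in>u. sum l (B i))"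
      unfolding B_def by (rule sum.group[symmetric]) (auto simp: finS finu u_def)
    finally have "min \<alpha> d * (\<Sum>j=1..d * s. l j) = (\<Sum>i\<in>u. min \<alpha> d * sum l (B i))"
      by (simp only: sum_distrib_left)
    also have "\<dots> \<le> (\<Sum>i\<in>u. d * sum l (J i))" by (intro sum_mono J(4))
    also have "\<dots> = d * sum_list (map l js)" unfolding cf(4) by (simp only: sum_distrib_left)
    finally show "min \<alpha> d * (\<Sum>j=1..d * s. l j) \<le> d * sum_list (map l js)" .
  qed
qed

section \<open>Tails of multivariate geometric series\<close>

text \<open>The last coordinate is determined by the sum and the others, each of which is at most
  k.\<close>

lemma card_sum_eq_le:
  assumes n: "1 \<le> n"
  shows "card {l \<in> PiE {1..n} (\<lambda>_. {..L}). sum l {1..n} = k} \<le> (k + 1) ^ (n - 1)"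
proof -
  let ?S = "{l \<in> PiE {1..n} (\<lambda>_. {..L}). sum l {1..n} = k}" and ?T = "PiE {1..n - 1} (\<lambda>_. {..k})"
  have ins: "{1..n} = insert n {1..n - 1}" using n by auto
  have split: "sum l {1..n} = l n + sum l {1..n - 1}" for l :: "nat \<Rightarrow> nat" unfolding ins using n by simp
  have "card ?S \<le> card ?T"
  proof (rule card_inj_on_le[where f = "\<lambda>l. restrict l {1..n - 1}"])
    show "inj_on (\<lambda>l. restrict l {1..n - 1}) ?S"
    proof (rule inj_onI)
      fix l l' assume l: "l \<in> ?S" and l': "l' \<in> ?S" and eq: "restrict l {1..n - 1} = restrict l' {1..n - 1}"
      have E: "l i = l' i" if "i \<in> {1..n - 1}" for i
        using fun_cong[OF eq, of i] that by (simp only: restrict_apply if_True)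
      then have "sum l {1..n - 1} = sum l' {1..n - 1}" by (rule sum.cong[OF refl])
      moreover have "l n + sum l {1..n - 1} = l' n + sum l' {1..n - 1}"
        unfolding split[symmetric] using l l' by (simp only: mem_Collect_eq)
      ultimately have n': "l n = l' n" by (simp only: add_right_cancel)
      have "l \<in> PiE {1..n} (\<lambda>_. {..L})" "l' \<in> PiE {1..n} (\<lambda>_. {..L})" using l l' by blast+
      then show "l = l'"
      proof (rule PiE_ext)
        fix i assume "i \<in> {1..n}"
        then show "l i = l' i" unfolding ins using E n' by blast
      qed
    qed
    show "(\<lambda>l. restrict l {1..n - 1}) ` ?S \<subseteq> ?T"
    proof (rule image_subsetI)
      fix l assume l: "l \<in> ?S"
      have "l i \<le> k" if i: "i \<in> {1..n - 1}" for i
      proof -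
        have "l i \<le> sum l {1..n}" by (rule member_le_sum) (use i in auto)
        then show ?thesis using l by (simp only: mem_Collect_eq)
      qed
      then show "restrict l {1..n - 1} \<in> ?T" by (simp add: restrict_PiE_iff)
    qed
    show "finite ?T" by (simp add: finite_PiE)
  qed
  also have "\<dots> = (k + 1) ^ (n - 1)" by (simp add: card_PiE)
  finally show ?thesis .
qed

text \<open>From the exponential series, i^p \<le> p! e^i \<le> p! 3^i; the factor x^i \<le> 4^(-i)
  absorbs 3^i.\<close>

lemma power_series_bound:
  fixes x :: real
  assumes "0 \<le> x" "x \<le> 1 / 4"
  shows "real i ^ p * x ^ i \<le> fact p * (3 / 4) ^ i"
proof -
  have "(\<Sum>k\<in>{p}. real i ^ k /\<^sub>R fact k) \<le> (\<Sum>k. real i ^ k /\<^sub>R fact k)"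
    by (rule sum_le_suminf[OF summable_exp_generic]) (auto intro: scaleR_nonneg_nonneg)
  then have "real i ^ p / fact p \<le> exp (real i)" by (simp add: exp_def divide_inverse mult.commute)
  also have "\<dots> = exp 1 ^ i" using exp_of_nat_mult[of i "1::real"] by simp
  also have "\<dots> \<le> 3 ^ i" by (intro power_mono exp_le) simp
  finally have "real i ^ p \<le> fact p * 3 ^ i" by (simp add: divide_le_eq mult.commute)
  moreover have "x ^ i \<le> (1 / 4) ^ i" using assms by (intro power_mono)
  ultimately have "real i ^ p * x ^ i \<le> (fact p * 3 ^ i) * (1 / 4) ^ i"
    using assms by (intro mult_mono) auto
  also have "\<dots> = fact p * (3 / 4) ^ i" by (simp add: power_divide)
  finally show ?thesis .
qed

text \<open>Sorted by the value k of the sum, the count (k + 1)^(n - 1) is split by k + 1 \<le> (M +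
  2)(k - M) for k > M: the first factor is the announced power, the second is beaten by the
  geometric decay. The constant 4 is the sum of (3/4)^i.\<close>

lemma geometric_tail_le:
  fixes x :: real
  assumes n: "1 \<le> n" and x: "0 \<le> x" "x \<le> 1 / 4"
  shows "(\<Sum>l | l \<in> PiE {1..n} (\<lambda>_. {..L}) \<and> M < sum l {1..n}. x ^ sum l {1..n}) \<le>
    4 * fact (n - 1) * real (M + 2) ^ (n - 1) * x ^ M"
proof -
  let ?P = "PiE {1..n} (\<lambda>_. {..L})" and ?p = "n - 1"
  let ?S = "{l. l \<in> ?P \<and> M < sum l {1..n}}"
  have finP: "finite ?P" by (simp add: finite_PiE)
  then have finS: "finite ?S" by simp
  have fink: "finite {l \<in> ?P. sum l {1..n} = k}" for k using finP by simp
  obtain T where T: "\<And>l. l \<in> ?S \<Longrightarrow> sum l {1..n} \<le> T"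
    using finite_imageI[OF finS, of "\<lambda>l. sum l {1..n}"] unfolding finite_nat_set_iff_bounded_le by blast
  have "(\<Sum>l\<in>?S. x ^ sum l {1..n}) = (\<Sum>k\<in>{M<..T}. \<Sum>l | l \<in> ?S \<and> sum l {1..n} = k. x ^ sum l {1..n})"
    by (rule sum.group[symmetric]) (use finS T in auto)
  also have "\<dots> \<le> (\<Sum>k\<in>{M<..T}. real (M + 2) ^ ?p * x ^ M * (fact ?p * (3 / 4) ^ (k - M)))"
  proof (rule sum_mono)
    fix k assume k: "k \<in> {M<..T}"
    have "(\<Sum>l | l \<in> ?S \<and> sum l {1..n} = k. x ^ sum l {1..n}) = real (card {l. l \<in> ?S \<and> sum l {1..n} = k}) * x ^ k"
      by simp
    also have "\<dots> \<le> real ((k + 1) ^ ?p) * x ^ k"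
    proof (rule mult_right_mono)
      have "card {l. l \<in> ?S \<and> sum l {1..n} = k} \<le> card {l \<in> ?P. sum l {1..n} = k}"
        by (rule card_mono[OF fink]) blast
      also have "\<dots> \<le> (k + 1) ^ ?p" by (rule card_sum_eq_le[OF n])
      finally show "real (card {l. l \<in> ?S \<and> sum l {1..n} = k}) \<le> real ((k + 1) ^ ?p)" by (simp only: of_nat_le_iff)
    qed (use x in simp)
    also have "\<dots> \<le> real (((M + 2) * (k - M)) ^ ?p) * x ^ k"
    proof (rule mult_right_mono)
      obtain i where "k = M + Suc i" using k less_imp_Suc_add[of M k] by auto
      then have "k + 1 \<le> (M + 2) * (k - M)" by simp
      then show "real ((k + 1) ^ ?p) \<le> real (((M + 2) * (k - M)) ^ ?p)"
        by (simp only: of_nat_le_iff power_mono)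
    qed (use x in simp)
    also have "x ^ k = x ^ M * x ^ (k - M)" using k by (simp flip: power_add)
    also have "real (((M + 2) * (k - M)) ^ ?p) * (x ^ M * x ^ (k - M)) =
        real (M + 2) ^ ?p * x ^ M * (real (k - M) ^ ?p * x ^ (k - M))"
      by (simp only: of_nat_power of_nat_mult power_mult_distrib mult_ac)
    also have "\<dots> \<le> real (M + 2) ^ ?p * x ^ M * (fact ?p * (3 / 4) ^ (k - M))"
      using x by (intro mult_left_mono power_series_bound) auto
    finally show "(\<Sum>l | l \<in> ?S \<and> sum l {1..n} = k. x ^ sum l {1..n}) \<le> \<dots>" .
  qed
  also have "\<dots> = real (M + 2) ^ ?p * x ^ M * fact ?p * (\<Sum>k\<in>{M<..T}. (3 / 4) ^ (k - M))"
    by (simp only: sum_distrib_left mult.assoc)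
  also have "\<dots> \<le> real (M + 2) ^ ?p * x ^ M * fact ?p * 4"
  proof (rule mult_left_mono)
    have "(\<Sum>k\<in>{M<..T}. (3 / 4 :: real) ^ (k - M)) = (\<Sum>i\<in>(\<lambda>k. k - M) ` {M<..T}. (3 / 4) ^ i)"
      by (rule sum.reindex[symmetric, unfolded o_def]) (auto simp: inj_on_def)
    also have "\<dots> \<le> (\<Sum>i. (3 / 4) ^ i)"
      by (rule sum_le_suminf) auto
    also have "\<dots> = 4" by (subst suminf_geometric) simp_all
    finally show "(\<Sum>k\<in>{M<..T}. (3 / 4 :: real) ^ (k - M)) \<le> 4" .
  qed (use x in simp)
  finally show ?thesis by (simp only: mult_ac)
qed

section \<open>The Sobolev norm of smooth functions\<close>

text \<open>Young's inequality 2 a c \<le> \<delta> a^2 + c^2 / \<delta>. Unlike the triangle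
  inequality it is linear in the squares, so it can be summed and integrated term by term.\<close>

lemma square_add_le:
  fixes x y :: "'v::real_normed_vector"
  assumes "0 < \<delta>"
  shows "(norm (x + y))\<^sup>2 \<le> (1 + \<delta>) * (norm x)\<^sup>2 + (1 + 1 / \<delta>) * (norm y)\<^sup>2"
proof -
  let ?a = "norm x" and ?c = "norm y"
  have "(norm (x + y))\<^sup>2 \<le> (?a + ?c)\<^sup>2" by (intro power_mono norm_triangle_ineq) simp
  also have "(?a + ?c)\<^sup>2 = ?a\<^sup>2 + 2 * (?a * ?c) + ?c\<^sup>2" by (simp add: power2_sum)
  also have "2 * (?a * ?c) \<le> \<delta> * ?a\<^sup>2 + (1 / \<delta>) * ?c\<^sup>2"
  proof -
    have "0 \<le> (sqrt \<delta> * ?a - ?c / sqrt \<delta>)\<^sup>2" by simp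
    also have "\<dots> = \<delta> * ?a\<^sup>2 + (1 / \<delta>) * ?c\<^sup>2 - 2 * (?a * ?c)"
      using assms by (simp add: power2_diff power_mult_distrib power_divide)
    finally show ?thesis by simp
  qed
  finally show ?thesis by (simp add: distrib_right)
qed

text \<open>The right-hand side is minimal for \<delta> = c / a, where it equals (a + c)^2;
  enlarging a and c slightly avoids division by zero. This recovers a triangle inequality for the
  whole Sobolev norm from \<open>square_add_le\<close> applied to each term.\<close>

lemma le_add_if_square_le:
  fixes x a c :: real
  assumes "0 \<le> a" "0 \<le> c" "\<And>\<delta>. 0 < \<delta> \<Longrightarrow> x\<^sup>2 \<le> (1 + \<delta>) * a\<^sup>2 + (1 + 1 / \<delta>) * c\<^sup>2"
  shows "x \<le> a + c"
proof (rule field_le_epsilon)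
  fix e :: real assume e: "0 < e"
  let ?a = "a + e / 2" and ?c = "c + e / 2"
  have pos: "0 < ?a" "0 < ?c" using assms(1,2) e by simp_all
  have "x\<^sup>2 \<le> (1 + ?c / ?a) * a\<^sup>2 + (1 + 1 / (?c / ?a)) * c\<^sup>2"
    by (rule assms(3)) (rule divide_pos_pos[OF pos(2,1)])
  also have "\<dots> \<le> (1 + ?c / ?a) * ?a\<^sup>2 + (1 + 1 / (?c / ?a)) * ?c\<^sup>2"
  proof (rule add_mono; rule mult_left_mono)
    show "a\<^sup>2 \<le> ?a\<^sup>2" "c\<^sup>2 \<le> ?c\<^sup>2" using assms(1,2) e by (intro power_mono; simp)+
    show "0 \<le> 1 + ?c / ?a" "0 \<le> 1 + 1 / (?c / ?a)" using divide_pos_pos[OF pos] divide_pos_pos[OF pos(2,1)] by simp_all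
  qed
  also have "\<dots> = (?a + ?c)\<^sup>2"
  proof -
    have "(1 + c' / a') * a'\<^sup>2 + (1 + 1 / (c' / a')) * c'\<^sup>2 = (a' + c')\<^sup>2" if "0 < a'" "0 < c'" for a' c' :: real
      using that by (simp add: field_simps power2_eq_square)
    from this[OF pos] show ?thesis .
  qed
  finally have "x \<le> ?a + ?c" by (rule power2_le_imp_le) (use pos in simp)
  then show "x \<le> a + c + e" by simp
qed

lemma mixed_deriv_marginal:
  fixes f :: "(nat \<Rightarrow> real) \<Rightarrow> 'k::{real_normed_field,euclidean_space}"
  assumes "u \<subseteq> {1..s}" "smooth_on_cube s f" "x \<in> cube u"
  shows "mixed_deriv u \<nu> (marginal s u f) x = marginal s u (foldr partial_deriv (mixed_list u \<nu>) f) x"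
  unfolding mixed_deriv_eq
  by (rule foldr_partial_marginal[OF assms(1,2) set_mixed_list assms(3)]) (use assms(1) finite_subset in blast)

lemma smooth_mixed:
  assumes "u \<subseteq> {1..s}" "smooth_on_cube s f"
  shows "continuous_on (cube {1..s}) (foldr partial_deriv (mixed_list u \<nu>) f)"
    and "set (mixed_list u \<nu>) \<subseteq> {1..s}"
proof -
  show "set (mixed_list u \<nu>) \<subseteq> {1..s}"
    using set_mixed_list[of u \<nu>] assms(1) finite_subset[OF assms(1)] by blast
  then show "continuous_on (cube {1..s}) (foldr partial_deriv (mixed_list u \<nu>) f)"
    by (intro smooth_continuous smooth_foldr[OF assms(2)])
qed

lemma integral_mixed_deriv:
  fixes f :: "(nat \<Rightarrow> real) \<Rightarrow> 'k::{real_normed_field,euclidean_space}"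
  assumes "u \<subseteq> {1..s}" "smooth_on_cube s f"
  shows "(\<integral>x. (norm (mixed_deriv u \<nu> (marginal s u f) x))\<^sup>2 \<partial>cube_measure u) =
    (\<integral>x. (norm (marginal s u (foldr partial_deriv (mixed_list u \<nu>) f) x))\<^sup>2 \<partial>cube_measure u)"
  by (rule Bochner_Integration.integral_cong[OF refl])
     (simp only: space_cube_measure mixed_deriv_marginal[OF assms])

lemma smooth_sobolev_norm_nonneg: "0 \<le> smooth_sobolev_norm s \<alpha> f"
  unfolding smooth_sobolev_norm_def by (intro real_sqrt_ge_zero add_nonneg_nonneg sum_nonneg) simp_all

lemma smooth_sobolev_norm_square:
  "(smooth_sobolev_norm s \<alpha> f)\<^sup>2 = (norm (cube_integral s f))\<^sup>2 +
     (\<Sum>u \<in> Pow {1..s} - {{}}. \<Sum>\<nu> \<in> PiE u (\<lambda>_. {1..\<alpha>}).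
        \<integral>x. (norm (mixed_deriv u \<nu> (marginal s u f) x))\<^sup>2 \<partial>cube_measure u)"
  unfolding smooth_sobolev_norm_def by (intro real_sqrt_pow2 add_nonneg_nonneg sum_nonneg) simp_all

lemma sobolev_term_le:
  fixes f :: "(nat \<Rightarrow> real) \<Rightarrow> 'k::{real_normed_field,euclidean_space}"
  assumes "u \<subseteq> {1..s}" "u \<noteq> {}" "\<nu> \<in> PiE u (\<lambda>_. {1..\<alpha>})" "smooth_on_cube s f"
  shows "(\<integral>x. (norm (marginal s u (foldr partial_deriv (mixed_list u \<nu>) f) x))\<^sup>2 \<partial>cube_measure u) \<le>
    (smooth_sobolev_norm s \<alpha> f)\<^sup>2"
proof -
  let ?T = "\<lambda>u \<nu>. \<integral>x. (norm (mixed_deriv u \<nu> (marginal s u f) x))\<^sup>2 \<partial>cube_measure u"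
  have fu: "finite u" using assms(1) finite_subset by blast
  have "?T u \<nu> \<le> (\<Sum>\<nu>\<in>PiE u (\<lambda>_. {1..\<alpha>}). ?T u \<nu>)"
    by (rule member_le_sum[OF assms(3)]) (use fu in \<open>auto simp: finite_PiE\<close>)
  also have "\<dots> \<le> (\<Sum>u\<in>Pow {1..s} - {{}}. \<Sum>\<nu>\<in>PiE u (\<lambda>_. {1..\<alpha>}). ?T u \<nu>)"
    by (rule member_le_sum) (use assms(1,2) in \<open>auto intro!: sum_nonneg\<close>)
  also have "\<dots> \<le> (smooth_sobolev_norm s \<alpha> f)\<^sup>2" unfolding smooth_sobolev_norm_square by simp
  finally show ?thesis unfolding integral_mixed_deriv[OF assms(1,4)] .
qed

lemma smooth_sobolev_norm_triangle:
  fixes f g :: "(nat \<Rightarrow> real) \<Rightarrow> 'k::{real_normed_field,euclidean_space}"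
  assumes f: "smooth_on_cube s f" and g: "smooth_on_cube s g"
  shows "smooth_sobolev_norm s \<alpha> f \<le> smooth_sobolev_norm s \<alpha> g + smooth_sobolev_norm s \<alpha> (\<lambda>x. f x - g x)"
proof (rule le_add_if_square_le[OF smooth_sobolev_norm_nonneg smooth_sobolev_norm_nonneg])
  fix \<delta> :: real assume \<delta>: "0 < \<delta>"
  let ?h = "\<lambda>x. f x - g x"
  have h: "smooth_on_cube s ?h" by (rule smooth_diff[OF f g])
  let ?T = "\<lambda>u \<nu> f. \<integral>x. (norm (mixed_deriv u \<nu> (marginal s u f) x))\<^sup>2 \<partial>cube_measure u"
  have I: "(norm (cube_integral s f))\<^sup>2 \<le> (1 + \<delta>) * (norm (cube_integral s g))\<^sup>2 + (1 + 1 / \<delta>) * (norm (cube_integral s ?h))\<^sup>2"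
  proof -
    have "cube_integral s ?h = cube_integral s f - cube_integral s g"
      unfolding cube_integral_def
      by (intro Bochner_Integration.integral_diff continuous_cube_integrable smooth_continuous f g)
    then have "cube_integral s f = cube_integral s g + cube_integral s ?h" by simp
    then show ?thesis using square_add_le[OF \<delta>] by (simp only:)
  qed
  have T: "?T u \<nu> f \<le> (1 + \<delta>) * ?T u \<nu> g + (1 + 1 / \<delta>) * ?T u \<nu> ?h" if u: "u \<subseteq> {1..s}" for u \<nu>
  proof -
    let ?D = "\<lambda>f. marginal s u (foldr partial_deriv (mixed_list u \<nu>) f)"
    have int: "integrable (cube_measure u) (\<lambda>x. (norm (?D f x))\<^sup>2)" if "smooth_on_cube s f" for f :: "(nat \<Rightarrow> real) \<Rightarrow> 'k"
      by (intro continuous_cube_integrable continuous_intros marginal_continuous[OF u smooth_mixed(1)[OF u that]]) simp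
    have add: "?D f x = ?D g x + ?D ?h x" if x: "x \<in> cube u" for x
    proof -
      note x' = disjI1[OF x, of "x \<in> cube {1..s}"]
      have ci: "integrable (cube_measure {1..s}) (\<lambda>y. foldr partial_deriv (mixed_list u \<nu>) f (glue s u x y))"
        if "smooth_on_cube s f" for f :: "(nat \<Rightarrow> real) \<Rightarrow> 'k"
        by (intro continuous_cube_integrable glue_continuous[OF u smooth_mixed(1)[OF u that] x'])
      have "?D ?h x = (\<integral>y. foldr partial_deriv (mixed_list u \<nu>) f (glue s u x y) - foldr partial_deriv (mixed_list u \<nu>) g (glue s u x y) \<partial>cube_measure {1..s})"
        unfolding marginal_eq[OF u smooth_mixed(1)[OF u h] x']
      proof (rule Bochner_Integration.integral_cong[OF refl])
        fix y assume "y \<in> space (cube_measure {1..s})"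
        then have "glue s u x y \<in> cube {1..s}" unfolding space_cube_measure by (rule glue_cube[OF u x'])
        then show "foldr partial_deriv (mixed_list u \<nu>) ?h (glue s u x y) =
            foldr partial_deriv (mixed_list u \<nu>) f (glue s u x y) - foldr partial_deriv (mixed_list u \<nu>) g (glue s u x y)"
          by (rule foldr_partial_diff[OF f g smooth_mixed(2)[OF u f]])
      qed
      also have "\<dots> = ?D f x - ?D g x"
        unfolding marginal_eq[OF u smooth_mixed(1)[OF u f] x'] marginal_eq[OF u smooth_mixed(1)[OF u g] x']
        by (rule Bochner_Integration.integral_diff[OF ci[OF f] ci[OF g]])
      finally show ?thesis by simp
    qed
    have "(\<integral>x. (norm (?D f x))\<^sup>2 \<partial>cube_measure u) \<le>
        (\<integral>x. (1 + \<delta>) * (norm (?D g x))\<^sup>2 + (1 + 1 / \<delta>) * (norm (?D ?h x))\<^sup>2 \<partial>cube_measure u)"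
    proof (rule integral_mono)
      fix x assume "x \<in> space (cube_measure u)"
      then have x: "x \<in> cube u" unfolding space_cube_measure .
      show "(norm (?D f x))\<^sup>2 \<le> (1 + \<delta>) * (norm (?D g x))\<^sup>2 + (1 + 1 / \<delta>) * (norm (?D ?h x))\<^sup>2"
        unfolding add[OF x] by (rule square_add_le[OF \<delta>])
    qed (intro int f g h Bochner_Integration.integrable_add integrable_mult_right)+
    also have "\<dots> = (1 + \<delta>) * (\<integral>x. (norm (?D g x))\<^sup>2 \<partial>cube_measure u) + (1 + 1 / \<delta>) * (\<integral>x. (norm (?D ?h x))\<^sup>2 \<partial>cube_measure u)"
      using int[OF g] int[OF h] by simp
    finally show ?thesis
      unfolding integral_mixed_deriv[OF u f] integral_mixed_deriv[OF u g] integral_mixed_deriv[OF u h] .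
  qed
  have "(\<Sum>u\<in>Pow {1..s} - {{}}. \<Sum>\<nu>\<in>PiE u (\<lambda>_. {1..\<alpha>}). ?T u \<nu> f) \<le>
      (\<Sum>u\<in>Pow {1..s} - {{}}. \<Sum>\<nu>\<in>PiE u (\<lambda>_. {1..\<alpha>}). (1 + \<delta>) * ?T u \<nu> g + (1 + 1 / \<delta>) * ?T u \<nu> ?h)"
    by (intro sum_mono T) blast
  also have "\<dots> = (1 + \<delta>) * (\<Sum>u\<in>Pow {1..s} - {{}}. \<Sum>\<nu>\<in>PiE u (\<lambda>_. {1..\<alpha>}). ?T u \<nu> g) +
      (1 + 1 / \<delta>) * (\<Sum>u\<in>Pow {1..s} - {{}}. \<Sum>\<nu>\<in>PiE u (\<lambda>_. {1..\<alpha>}). ?T u \<nu> ?h)"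
    by (simp only: sum.distrib sum_distrib_left)
  finally show "(smooth_sobolev_norm s \<alpha> f)\<^sup>2 \<le>
      (1 + \<delta>) * (smooth_sobolev_norm s \<alpha> g)\<^sup>2 + (1 + 1 / \<delta>) * (smooth_sobolev_norm s \<alpha> ?h)\<^sup>2"
    unfolding smooth_sobolev_norm_square distrib_left[of "1 + \<delta>"] distrib_left[of "1 + 1 / \<delta>"]
    using I by linarith
qed

section \<open>The variance for smooth integrands\<close>

lemma norm_average_le:
  fixes g :: "nat \<Rightarrow> 'v::real_normed_vector"
  assumes "0 < N" "\<And>i. i < N \<Longrightarrow> norm (g i) \<le> B"
  shows "norm ((\<Sum>i<N. g i) /\<^sub>R real N) \<le> B"
proof -
  have "norm (\<Sum>i<N. g i) \<le> (\<Sum>i<N. B)" by (rule sum_norm_le) (use assms(2) in simp)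
  then have "norm (\<Sum>i<N. g i) \<le> real N * B" by simp
  then show ?thesis using assms(1) by (simp add: divide_inverse_commute[symmetric] pos_divide_le_eq mult.commute)
qed

context scrambling_interlaced
begin

text \<open>Digit l of a coordinate has position p at least d (l - 1) + 1 in its variable, hence 2 d
  l \<le> 2 p + 2 d. The loss of b^(2 d) per digit joins the factor b^3 of
  \<open>jump_mean_bound\<close>.\<close>

lemma prod_pos_le:
  assumes "\<And>j. j \<in> set js \<Longrightarrow> 0 < l j"
  shows "(\<Prod>q\<leftarrow>map (\<lambda>j. (j, l j)) js. real b ^ 3 / real b ^ (2 * pos q)) \<le>
    real b ^ ((3 + 2 * d) * length js) / real b ^ (2 * d * sum_list (map l js))"
  using assms
proof (induction js)
  case (Cons j js)
  have b1: "1 \<le> real b" using b_pos by simp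
  obtain a where a: "l j = Suc a" using Cons.prems[of j] by (auto simp: gr0_conv_Suc)
  have "2 * d * l j \<le> 2 * pos (j, l j) + 2 * d"
    by (simp add: pos_def a algebra_simps)
  then have "real b ^ (2 * d * l j) \<le> real b ^ (2 * pos (j, l j) + 2 * d)" by (rule power_increasing) (rule b1)
  then have "real b ^ (3 + 2 * d) / real b ^ (2 * pos (j, l j) + 2 * d) \<le> real b ^ (3 + 2 * d) / real b ^ (2 * d * l j)"
    using b_pos by (intro divide_left_mono) auto
  moreover have "real b ^ (3 + 2 * d) / real b ^ (2 * pos (j, l j) + 2 * d) = real b ^ 3 / real b ^ (2 * pos (j, l j))"
    using b_pos by (simp add: power_add)
  ultimately have 1: "real b ^ 3 / real b ^ (2 * pos (j, l j)) \<le> real b ^ (3 + 2 * d) / real b ^ (2 * d * l j)" by simp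
  have "(\<Prod>q\<leftarrow>map (\<lambda>j. (j, l j)) (j # js). real b ^ 3 / real b ^ (2 * pos q)) =
      real b ^ 3 / real b ^ (2 * pos (j, l j)) * (\<Prod>q\<leftarrow>map (\<lambda>j. (j, l j)) js. real b ^ 3 / real b ^ (2 * pos q))"
    by simp
  also have "\<dots> \<le> (real b ^ (3 + 2 * d) / real b ^ (2 * d * l j)) *
      (real b ^ ((3 + 2 * d) * length js) / real b ^ (2 * d * sum_list (map l js)))"
  proof (rule mult_mono[OF 1 Cons.IH])
    show "0 \<le> (\<Prod>q\<leftarrow>map (\<lambda>j. (j, l j)) js. real b ^ 3 / real b ^ (2 * pos q))"
      by (rule prod_list_nonneg) auto
  qed (use Cons.prems in simp_all)
  also have "\<dots> = real b ^ ((3 + 2 * d) * length (j # js)) / real b ^ (2 * d * sum_list (map l (j # js)))"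
    by (simp only: times_divide_times_eq power_add[symmetric] length_Cons list.map sum_list.Cons distrib_left mult_Suc_right)
  finally show ?case .
qed simp

text \<open>Every v with levels l contains the digits (j, l j) with l j > 0 and no digit of a
  variable without a positive level. Deviating the selected digits and averaging out the idle
  variables therefore keeps all components to be summed, and \<open>exists_selection\<close> makes
  the resulting product of weights small enough. The threshold for L precedes l, because the number
  of level vectors grows with L.\<close>

lemma level_sum_bound:
  fixes f :: "(nat \<Rightarrow> real) \<Rightarrow> 'k::{real_normed_field,euclidean_space}"
  assumes f: "smooth_on_cube s f" and \<alpha>: "1 \<le> \<alpha>" and e: "0 < e"
  shows "\<forall>\<^sub>F L in sequentially. \<forall>qs l. distinct qs \<and> set qs = digits L \<and> (\<forall>j\<in>{1..d * s}. l j \<le> L) \<and>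
      0 < (\<Sum>j=1..d * s. l j) \<longrightarrow>
    (\<Sum>v | v \<subseteq> digits L \<and> (\<forall>j\<in>{1..d * s}. level v j = l j). mean L (\<lambda>\<xi>. (norm (anova b v qs (\<lambda>\<xi>. f (gp L \<xi>)) \<xi>))\<^sup>2)) \<le>
      real b ^ ((3 + 2 * d) * (d * s)) / real b ^ (2 * min \<alpha> d * (\<Sum>j=1..d * s. l j)) * ((smooth_sobolev_norm s \<alpha> f)\<^sup>2 + e)"
proof -
  define G where "G L u is \<longleftrightarrow> (\<forall>js zs. distinct (map fst js) \<and> fst ` set js \<subseteq> digits L \<and>
      (\<forall>(q, c, c')\<in>set js. c < c' \<and> c' < b) \<and> map (blk \<circ> fst) js = is \<and>
      set zs = {q \<in> digits L. blk q \<notin> u} \<and> distinct zs \<longrightarrow>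
    mean L (\<lambda>\<xi>. (norm (foldr (avg b) zs (foldr jump js (\<lambda>\<xi>. f (gp L \<xi>))) \<xi>))\<^sup>2) \<le>
      (\<Prod>p\<leftarrow>js. real b ^ 3 / real b ^ (2 * pos (fst p))) *
      ((\<integral>x. (norm (marginal s u (foldr partial_deriv (rev is) f) x))\<^sup>2 \<partial>cube_measure u) + e))" for L u "is"
  let ?N = "(smooth_sobolev_norm s \<alpha> f)\<^sup>2"
  \<comment> \<open>Only finitely many pairs of u and \<nu> occur, hence a common threshold; the
    reversal matches the order in which \<open>array_mean_devs_le\<close> produces the
    jumps.\<close>
  have "\<forall>\<^sub>F L in sequentially. \<forall>u\<in>Pow {1..s}. \<forall>\<nu>\<in>PiE u (\<lambda>_. {1..\<alpha>}). G L u (rev (mixed_list u \<nu>))"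
  proof (rule eventually_ball_finite)
    show "\<forall>u\<in>Pow {1..s}. \<forall>\<^sub>F L in sequentially. \<forall>\<nu>\<in>PiE u (\<lambda>_. {1..\<alpha>}). G L u (rev (mixed_list u \<nu>))"
    proof
      fix u assume "u \<in> Pow {1..s}"
      then have u: "u \<subseteq> {1..s}" and fu: "finite u" using finite_subset by auto
      show "\<forall>\<^sub>F L in sequentially. \<forall>\<nu>\<in>PiE u (\<lambda>_. {1..\<alpha>}). G L u (rev (mixed_list u \<nu>))"
      proof (rule eventually_ball_finite)
        show "finite (PiE u (\<lambda>_. {1..\<alpha>}))" using fu by (simp add: finite_PiE)
        show "\<forall>\<nu>\<in>PiE u (\<lambda>_. {1..\<alpha>}). \<forall>\<^sub>F L in sequentially. G L u (rev (mixed_list u \<nu>))"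
        proof
          fix \<nu>
          have "set (rev (mixed_list u \<nu>)) \<subseteq> u" using set_mixed_list[OF fu] by simp
          then show "\<forall>\<^sub>F L in sequentially. G L u (rev (mixed_list u \<nu>))"
            unfolding G_def by (rule jump_mean_bound[OF f u _ e])
        qed
      qed
    qed
  qed simp
  then show ?thesis
  proof eventually_elim
    case (elim L)
    show ?case
    proof (intro allI impI, elim conjE)
      fix qs :: "(nat \<times> nat) list" and l :: "nat \<Rightarrow> nat"
      assume dq: "distinct qs" and sq: "set qs = digits L" and lL: "\<forall>j\<in>{1..d * s}. l j \<le> L"
        and lpos: "0 < (\<Sum>j=1..d * s. l j)"
      let ?h = "\<lambda>\<xi>. f (gp L \<xi>)" and ?K = "real b ^ ((3 + 2 * d) * (d * s)) / real b ^ (2 * min \<alpha> d * (\<Sum>j=1..d * s. l j)) * (?N + e)"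
      obtain u \<nu> Jl where u: "u \<subseteq> {1..s}" and \<nu>: "\<nu> \<in> PiE u (\<lambda>_. {1..\<alpha>})" and dJ: "distinct Jl"
        and sJ: "set Jl \<subseteq> {j \<in> {1..d * s}. 0 < l j}" and mJ: "map (\<lambda>j. (j - 1) div d + 1) Jl = mixed_list u \<nu>"
        and in_u': "\<forall>j\<in>{1..d * s}. 0 < l j \<longrightarrow> (j - 1) div d + 1 \<in> u"
        and heavy: "min \<alpha> d * (\<Sum>j=1..d * s. l j) \<le> d * sum_list (map l Jl)"
        by (rule exists_selection[where l = l and s = s, OF d_pos \<alpha>])
      have in_u: "(j - 1) div d + 1 \<in> u" if "j \<in> {1..d * s}" "0 < l j" for j using in_u' that by blast
      have fu: "finite u" using u finite_subset by blast
      have "\<exists>j\<in>{1..d * s}. 0 < l j"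
      proof (rule ccontr)
        assume "\<not> (\<exists>j\<in>{1..d * s}. 0 < l j)"
        then have "(\<Sum>j=1..d * s. l j) = 0" by (intro sum.neutral ballI) (meson neq0_conv)
        with lpos show False by linarith
      qed
      then have une: "u \<noteq> {}" using in_u by blast
      \<comment> \<open>The selected digits, each at the last position that v reaches in its
        coordinate.\<close>
      define ss where "ss = map (\<lambda>j. (j, l j)) Jl"
      have bss: "map blk ss = mixed_list u \<nu>"
        unfolding mJ[symmetric] ss_def by (simp add: blk_def)
      have dss: "distinct ss" using dJ by (simp add: ss_def distinct_map inj_on_def)
      have ssd: "set ss \<subseteq> digits L" using sJ lL by (auto simp: ss_def)
      obtain zs where zs: "set zs = {q \<in> digits L. blk q \<notin> u}" "distinct zs"
        using finite_distinct_list[of "{q \<in> digits L. blk q \<notin> u}"] finite_digits[of L] by auto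
      have disj: "set ss \<inter> set zs = {}"
      proof -
        have "blk q \<in> u" if "q \<in> set ss" for q
        proof -
          have "blk q \<in> set (map blk ss)" using that by simp
          then show ?thesis unfolding bss using set_mixed_list[OF fu] by blast
        qed
        then show ?thesis unfolding zs(1) by blast
      qed
      let ?V = "{v. v \<subseteq> digits L \<and> (\<forall>j\<in>{1..d * s}. level v j = l j)}"
      have V: "?V \<subseteq> {v. v \<subseteq> set qs \<and> set ss \<subseteq> v \<and> set zs \<inter> v = {}}"
      proof (rule subsetI)
        fix v assume "v \<in> ?V"
        then have v: "v \<subseteq> digits L" "\<And>j. j \<in> {1..d * s} \<Longrightarrow> level v j = l j" by blast+
        have fv: "finite v" using v(1) finite_digits finite_subset by blast
        have "set ss \<subseteq> v"
        proof
          fix q assume "q \<in> set ss"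
          then obtain j where j: "j \<in> set Jl" "q = (j, l j)" unfolding ss_def by auto
          then have "j \<in> {1..d * s}" "0 < l j" using sJ by blast+
          with level_mem[OF fv, of j] v(2)[of j] j(2) show "q \<in> v" by simp
        qed
        moreover have "q \<notin> v" if "q \<in> set zs" for q
        proof
          assume qv: "q \<in> v"
          obtain j a where q: "q = (j, a)" by (cases q)
          have ja: "j \<in> {1..d * s}" "1 \<le> a" using qv v(1) q by auto
          have "a \<le> level v j" using level_ge[OF fv] qv q by blast
          then have "blk q \<in> u" using in_u[OF ja(1)] ja v(2)[OF ja(1)] by (simp add: q blk_def)
          then show False using that unfolding zs(1) by blast
        qed
        ultimately show "v \<in> {v. v \<subseteq> set qs \<and> set ss \<subseteq> v \<and> set zs \<inter> v = {}}"
          using v(1) unfolding sq by blast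
      qed
      have sub: "set ss \<subseteq> set qs" "set zs \<subseteq> set qs" unfolding sq using ssd zs(1) by blast+
      have Ne: "0 \<le> ?N + e" using e by simp
      have K0: "0 \<le> ?K" using Ne by simp
      have "(\<Sum>v\<in>?V. mean L (\<lambda>\<xi>. (norm (anova b v qs ?h \<xi>))\<^sup>2)) \<le>
          mean L (\<lambda>\<xi>. (norm (foldr (dev b) ss (foldr (avg b) zs ?h) \<xi>))\<^sup>2)"
        using sum_anova_le[where h = ?h, OF b_pos dq sub V] unfolding sq .
      also have "\<dots> \<le> ?K"
      proof (rule array_mean_devs_le[where h = ?h, OF finite_digits b_pos K0 dss ssd disj])
        fix js :: "((nat \<times> nat) \<times> nat \<times> nat) list"
        assume js: "map fst js = rev ss" and jc: "\<forall>(q, c, c')\<in>set js. c < c' \<and> c' < b"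
        have fs: "fst ` set js = set ss"
          using arg_cong[OF js, of set] by simp
        have mb: "map (blk \<circ> fst) js = rev (mixed_list u \<nu>)"
          unfolding map_map[symmetric] js rev_map[symmetric] bss ..
        have "G L u (rev (mixed_list u \<nu>))" using elim u \<nu> by blast
        then have "mean L (\<lambda>\<xi>. (norm (foldr (avg b) zs (foldr jump js ?h) \<xi>))\<^sup>2) \<le>
            (\<Prod>p\<leftarrow>js. real b ^ 3 / real b ^ (2 * pos (fst p))) *
            ((\<integral>x. (norm (marginal s u (foldr partial_deriv (rev (rev (mixed_list u \<nu>))) f) x))\<^sup>2 \<partial>cube_measure u) + e)"
          unfolding G_def by (elim allE impE) (use js dss ssd fs jc mb zs in simp_all)
        also have "\<dots> \<le> (\<Prod>p\<leftarrow>js. real b ^ 3 / real b ^ (2 * pos (fst p))) * (?N + e)"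
          unfolding rev_rev_ident
        proof (rule mult_left_mono)
          show "(\<integral>x. (norm (marginal s u (foldr partial_deriv (mixed_list u \<nu>) f) x))\<^sup>2 \<partial>cube_measure u) + e \<le> ?N + e"
            using sobolev_term_le[OF u une \<nu> f] by linarith
          show "0 \<le> (\<Prod>p\<leftarrow>js. real b ^ 3 / real b ^ (2 * pos (fst p)))" by (rule prod_list_nonneg) auto
        qed
        also have "\<dots> \<le> ?K"
        proof (rule mult_right_mono[OF _ Ne])
          let ?w = "\<lambda>q. real b ^ 3 / real b ^ (2 * pos q)"
          have "(\<Prod>p\<leftarrow>js. ?w (fst p)) = prod_list (map ?w (map fst js))" by (simp add: o_def)
          also have "\<dots> = (\<Prod>q\<leftarrow>ss. ?w q)" unfolding js rev_map[symmetric] by (rule prod_list.rev)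
          also have "\<dots> \<le> real b ^ ((3 + 2 * d) * length Jl) / real b ^ (2 * d * sum_list (map l Jl))"
            unfolding ss_def by (rule prod_pos_le) (use sJ in blast)
          also have "\<dots> \<le> real b ^ ((3 + 2 * d) * (d * s)) / real b ^ (2 * min \<alpha> d * (\<Sum>j=1..d * s. l j))"
          proof (rule frac_le)
            have "length Jl = card (set Jl)" using dJ by (simp add: distinct_card)
            also have "\<dots> \<le> card {1..d * s}" using sJ by (intro card_mono) auto
            finally have "length Jl \<le> d * s" by simp
            then show "real b ^ ((3 + 2 * d) * length Jl) \<le> real b ^ ((3 + 2 * d) * (d * s))"
              using b_pos by (intro power_increasing mult_le_mono2) auto
            show "real b ^ (2 * min \<alpha> d * (\<Sum>j=1..d * s. l j)) \<le> real b ^ (2 * d * sum_list (map l Jl))"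
            proof (rule power_increasing)
              show "2 * min \<alpha> d * (\<Sum>j=1..d * s. l j) \<le> 2 * d * sum_list (map l Jl)"
                using mult_le_mono2[OF heavy, of 2] by (simp only: mult.assoc)
            qed (use b_pos in simp)
          qed (use b_pos in simp_all)
          finally show "(\<Prod>p\<leftarrow>js. ?w (fst p)) \<le> real b ^ ((3 + 2 * d) * (d * s)) / real b ^ (2 * min \<alpha> d * (\<Sum>j=1..d * s. l j))" .
        qed
        finally show "mean L (\<lambda>\<xi>. (norm (foldr (avg b) zs (foldr jump js ?h) \<xi>))\<^sup>2) \<le> ?K" .
      qed
      finally show "(\<Sum>v\<in>?V. mean L (\<lambda>\<xi>. (norm (anova b v qs ?h \<xi>))\<^sup>2)) \<le> ?K" .
    qed
  qed
qed

text \<open>The factors stem from pairs of points with common prefixes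
  (\<open>card_same_keys\<close>), from the jumps of at most d s selected digits
  (\<open>prod_pos_le\<close>), and from the tail of the geometric series
  (\<open>geometric_tail_le\<close>).\<close>

definition variance_const :: real where
  "variance_const = real b ^ (d * s) * real b ^ ((3 + 2 * d) * (d * s)) * (4 * fact (d * s - 1))"

text \<open>The mean squares are sorted by levels; with x = b^(-2 min(\<alpha>, d)) their bounds
  form a multivariate geometric series. The bound x \<le> 1/4 holds as b \<ge> 2 and min(\<alpha>,
  d) \<ge> 1.\<close>

lemma grid_variance:
  fixes f :: "(nat \<Rightarrow> real) \<Rightarrow> 'k::{real_normed_field,euclidean_space}"
  assumes f: "smooth_on_cube s f" and \<alpha>: "1 \<le> \<alpha>" and e: "0 < e" and net: "digital_net b t m (d * s) A"
  defines "z \<equiv> \<lambda>i j. base_digit b (net_point b m A i j)"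
  shows "\<forall>\<^sub>F L in sequentially.
    (\<integral>\<pi>. (norm ((\<Sum>i<b ^ m. f (gp L (scrambled (z i) \<pi>))) /\<^sub>R real (b ^ m) - mean L (\<lambda>\<xi>. f (gp L \<xi>))))\<^sup>2 \<partial>P) \<le>
      variance_const * (real (m - t + 2) ^ (d * s - 1) / real b ^ ((2 * min \<alpha> d + 1) * (m - t))) * ((smooth_sobolev_norm s \<alpha> f)\<^sup>2 + e)"
  using level_sum_bound[OF f \<alpha> e]
proof eventually_elim
  case (elim L)
  let ?n = "d * s" and ?M = "m - t" and ?r = "min \<alpha> d" and ?h = "\<lambda>\<xi>. f (gp L \<xi>)"
  let ?N = "(smooth_sobolev_norm s \<alpha> f)\<^sup>2 + e" and ?B = "real b ^ ((3 + 2 * d) * (d * s))"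
  define x where "x = 1 / real b ^ (2 * ?r)"
  have n1: "1 \<le> ?n" using d_pos s_pos by simp
  have Nn: "0 \<le> ?N" using e by simp
  have x: "0 \<le> x" "x \<le> 1 / 4"
  proof -
    show "0 \<le> x" by (simp add: x_def)
    have "(2::real) ^ 2 \<le> real b ^ 2" using b_gt_1 by (intro power_mono) auto
    also have "\<dots> \<le> real b ^ (2 * ?r)" using b_pos d_pos \<alpha> by (intro power_increasing) auto
    finally show "x \<le> 1 / 4" by (simp add: x_def divide_le_eq)
  qed
  obtain qs where sq: "set qs = digits L" and dq: "distinct qs"
    using finite_distinct_list[OF finite_digits[of L]] by blast
  have zl: "z i j a < b" for i j a unfolding z_def by (rule base_digit_less[OF b_pos])
  \<comment> \<open>All prescribed positions are at most m - t, thus at most m, where the digits of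
    the points are those of the matrix-vector products.\<close>
  have cnt: "card {i. i < b ^ m \<and> (\<forall>j\<in>{1..?n}. \<forall>a\<in>{1..c j}. z i j a = y j a)} * b ^ (\<Sum>j=1..?n. c j) = b ^ m"
    if c: "(\<Sum>j=1..?n. c j) \<le> ?M" and y: "\<And>j a. y j a < b" for c y
  proof -
    have "z i j a = net_digit b m A i j a" if j: "j \<in> {1..?n}" and a: "a \<in> {1..c j}" for i j a
    proof -
      have "c j \<le> (\<Sum>j=1..?n. c j)" by (rule member_le_sum[OF j]) simp_all
      then have "a \<le> m" "1 \<le> a" using c a unfolding atLeastAtMost_iff by linarith+
      then show ?thesis unfolding z_def base_digit_net_point[OF b_gt_1 \<open>1 \<le> a\<close>] by simp
    qed
    then have "{i. i < b ^ m \<and> (\<forall>j\<in>{1..?n}. \<forall>a\<in>{1..c j}. z i j a = y j a)} =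
        {i. i < b ^ m \<and> (\<forall>j\<in>{1..?n}. \<forall>a\<in>{1..c j}. net_digit b m A i j a = y j a)}"
      by (intro Collect_cong conj_cong refl ball_cong) simp
    then show ?thesis
      using card_net_digits[where y = y, OF b_pos digital_net_rows_independent[OF net n1 c] y] by (simp only:)
  qed
  let ?Y = "\<lambda>v. mean L (\<lambda>\<xi>. (norm (anova b v qs ?h \<xi>))\<^sup>2)"
  have Y0: "0 \<le> ?Y v" for v by (rule array_mean_nonneg) simp
  let ?W = "{v. v \<subseteq> digits L \<and> ?M < (\<Sum>j=1..?n. level v j)}"
  let ?T = "{l. l \<in> PiE {1..?n} (\<lambda>_. {..L}) \<and> ?M < sum l {1..?n}}"
  let ?g = "\<lambda>v. \<lambda>j\<in>{1..?n}. level v j"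
  have finD: "finite {v. v \<subseteq> digits L \<and> R v}" for R
    by (rule finite_subset[of _ "Pow (digits L)"]) auto
  have "(\<integral>\<pi>. (norm ((\<Sum>i<b ^ m. ?h (scrambled (z i) \<pi>)) /\<^sub>R real (b ^ m) - mean L ?h))\<^sup>2 \<partial>P) \<le>
      real b ^ ?n / real b ^ ?M * (\<Sum>v\<in>?W. ?Y v)"
    by (rule variance_le[where z = z and M = ?M and qs = qs, OF zl diff_le_self cnt sq dq depends_on_grid[OF b_gt_1 d_pos]])
  also have "\<dots> \<le> real b ^ ?n / real b ^ ?M * (?B * ?N * (4 * fact (?n - 1) * real (?M + 2) ^ (?n - 1) * x ^ ?M))"
  proof (rule mult_left_mono)
    have "(\<Sum>v\<in>?W. ?Y v) = (\<Sum>l\<in>?T. \<Sum>v | v \<in> ?W \<and> ?g v = l. ?Y v)"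
    proof (rule sum.group[symmetric])
      show "finite ?W" by (rule finD)
      show "finite ?T" by (rule finite_subset[of _ "PiE {1..?n} (\<lambda>_. {..L})"]) (auto simp: finite_PiE)
      show "?g ` ?W \<subseteq> ?T"
      proof (rule image_subsetI)
        fix v assume v: "v \<in> ?W"
        then have fv: "finite v" using finite_subset[OF _ finite_digits[of L]] by blast
        have "level v j \<le> L" for j
        proof (cases "0 < level v j")
          case True
          then have "(j, level v j) \<in> digits L" using level_mem[OF fv] v by blast
          then show ?thesis by simp
        qed simp
        then have "?g v \<in> PiE {1..?n} (\<lambda>_. {..L})" by (simp add: restrict_PiE_iff)
        moreover have "sum (?g v) {1..?n} = (\<Sum>j=1..?n. level v j)" by (rule sum.cong) simp_all
        ultimately show "?g v \<in> ?T" using v by simp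
      qed
    qed
    also have "\<dots> \<le> (\<Sum>l\<in>?T. ?B * ?N * x ^ sum l {1..?n})"
    proof (rule sum_mono)
      fix l assume l: "l \<in> ?T"
      have lL: "\<forall>j\<in>{1..?n}. l j \<le> L" using l by (auto simp: PiE_iff)
      have lp: "0 < (\<Sum>j=1..?n. l j)" using l by simp
      have "(\<Sum>v | v \<in> ?W \<and> ?g v = l. ?Y v) \<le> (\<Sum>v | v \<subseteq> digits L \<and> (\<forall>j\<in>{1..?n}. level v j = l j). ?Y v)"
      proof (rule sum_mono2)
        show "finite {v. v \<subseteq> digits L \<and> (\<forall>j\<in>{1..?n}. level v j = l j)}" by (rule finD)
        show "{v. v \<in> ?W \<and> ?g v = l} \<subseteq> {v. v \<subseteq> digits L \<and> (\<forall>j\<in>{1..?n}. level v j = l j)}"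
        proof (rule subsetI, rule CollectI, rule conjI)
          fix v assume v: "v \<in> {v. v \<in> ?W \<and> ?g v = l}"
          then show "v \<subseteq> digits L" by blast
          have eq: "?g v = l" using v by blast
          show "\<forall>j\<in>{1..?n}. level v j = l j"
          proof
            fix j assume "j \<in> {1..?n}"
            then show "level v j = l j" using fun_cong[OF eq, of j] by (simp only: restrict_apply if_True)
          qed
        qed
      qed (rule Y0)
      also have "\<dots> \<le> ?B / real b ^ (2 * ?r * sum l {1..?n}) * ?N"
        using elim dq sq lL lp by blast
      also have "\<dots> = ?B * ?N * x ^ sum l {1..?n}"
        by (simp add: x_def power_mult power_divide)
      finally show "(\<Sum>v | v \<in> ?W \<and> ?g v = l. ?Y v) \<le> ?B * ?N * x ^ sum l {1..?n}" .
    qed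
    also have "\<dots> = ?B * ?N * (\<Sum>l\<in>?T. x ^ sum l {1..?n})" by (simp only: sum_distrib_left)
    also have "\<dots> \<le> ?B * ?N * (4 * fact (?n - 1) * real (?M + 2) ^ (?n - 1) * x ^ ?M)"
      by (rule mult_left_mono[OF geometric_tail_le[OF n1 x]]) (use Nn in simp)
    finally show "(\<Sum>v\<in>?W. ?Y v) \<le> ?B * ?N * (4 * fact (?n - 1) * real (?M + 2) ^ (?n - 1) * x ^ ?M)" .
  qed simp
  also have "\<dots> = variance_const * (real (?M + 2) ^ (?n - 1) / real b ^ ((2 * ?r + 1) * ?M)) * ?N"
  proof -
    have xM: "x ^ ?M = 1 / real b ^ (2 * ?r * ?M)" by (simp add: x_def power_mult power_divide)
    have bM: "real b ^ ((2 * ?r + 1) * ?M) = real b ^ ?M * real b ^ (2 * ?r * ?M)"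
      unfolding distrib_right power_add mult_1 by (rule mult.commute)
    show ?thesis unfolding xM bM variance_const_def by (simp only: times_divide_eq_left times_divide_eq_right divide_divide_eq_left mult_1_right mult_ac)
  qed
  finally show ?case .
qed

lemma grid_tendsto_point_map:
  fixes f :: "(nat \<Rightarrow> real) \<Rightarrow> 'v::real_normed_vector"
  assumes cont: "continuous_on (cube {1..s}) f"
  shows "AE \<pi> in P. (\<lambda>L. f (gp L (scrambled (\<lambda>j. base_digit b (x j)) \<pi>))) \<longlonglongrightarrow> f (point_map x \<pi>)"
proof -
  define z where "z = (\<lambda>j. base_digit b (x j))"
  have zl: "z j a < b" for j a unfolding z_def by (rule base_digit_less[OF b_pos])
  show ?thesis
    using point_map_between[of x] unfolding z_def[symmetric]
  proof (rule AE_mp, intro AE_I2 impI)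
    fix \<pi> assume \<pi>: "\<pi> \<in> space P"
      and *: "\<forall>L. \<forall>i\<in>{1..s}. gp L (scrambled z \<pi>) i \<le> point_map x \<pi> i \<and> point_map x \<pi> i \<le> gp L (scrambled z \<pi>) i + mesh L"
    show "(\<lambda>L. f (gp L (scrambled z \<pi>))) \<longlonglongrightarrow> f (point_map x \<pi>)"
    proof (rule tendstoI)
      fix \<epsilon> :: real assume "0 < \<epsilon>"
      from continuous_cube_uniform[OF cont this] obtain \<delta> where \<delta>: "0 < \<delta>"
        "\<forall>x\<in>cube {1..s}. \<forall>y\<in>cube {1..s}. (\<forall>i\<in>{1..s}. \<bar>x i - y i\<bar> \<le> \<delta>) \<longrightarrow> dist (f x) (f y) < \<epsilon>"
        by (elim exE conjE)
      from tendstoD[OF mesh_tendsto[of 1] \<delta>(1)]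
      show "\<forall>\<^sub>F L in sequentially. dist (f (gp L (scrambled z \<pi>))) (f (point_map x \<pi>)) < \<epsilon>"
      proof eventually_elim
        case (elim L)
        have mL: "mesh L < \<delta>" using elim by (simp add: dist_real_def)
        have lt: "scrambled z \<pi> q < b" if "q \<in> digits L" for q
          by (rule scrambled_less[where z = z, OF zl \<pi>]) (use that in auto)
        have gc: "gp L (scrambled z \<pi>) \<in> cube {1..s}" by (rule grid_cube) (rule lt)
        have "\<forall>i\<in>{1..s}. \<bar>gp L (scrambled z \<pi>) i - point_map x \<pi> i\<bar> \<le> \<delta>"
        proof
          fix i assume "i \<in> {1..s}"
          from bspec[OF spec[OF *, of L] this] mL
          show "\<bar>gp L (scrambled z \<pi>) i - point_map x \<pi> i\<bar> \<le> \<delta>" by linarith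
        qed
        with \<delta>(2) gc point_map_cube[of x \<pi>] show ?case by blast
      qed
    qed
  qed
qed

lemma mean_grid_tendsto:
  fixes f :: "(nat \<Rightarrow> real) \<Rightarrow> 'v::euclidean_space"
  assumes cont: "continuous_on (cube {1..s}) f"
  shows "(\<lambda>L. mean L (\<lambda>\<xi>. f (gp L \<xi>))) \<longlonglongrightarrow> (\<integral>x. f x \<partial>cube_measure {1..s})"
proof (rule tendstoI)
  fix \<epsilon> :: real assume \<epsilon>: "0 < \<epsilon>"
  then have "0 < \<epsilon> / 2" by simp
  from continuous_cube_uniform[OF cont this] obtain \<delta> where \<delta>: "0 < \<delta>"
    "\<forall>x\<in>cube {1..s}. \<forall>y\<in>cube {1..s}. (\<forall>i\<in>{1..s}. \<bar>x i - y i\<bar> \<le> \<delta>) \<longrightarrow> dist (f x) (f y) < \<epsilon> / 2"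
    by (elim exE conjE)
  from tendstoD[OF mesh_tendsto[of 1] \<delta>(1)]
  show "\<forall>\<^sub>F L in sequentially. dist (mean L (\<lambda>\<xi>. f (gp L \<xi>))) (\<integral>x. f x \<partial>cube_measure {1..s}) < \<epsilon>"
  proof eventually_elim
    case (elim L)
    have mL: "mesh L < \<delta>" using elim by (simp add: dist_real_def)
    have "norm (mean L (\<lambda>\<xi>. f (gp L \<xi>)) - (\<integral>x. f x \<partial>cube_measure {1..s})) \<le> \<epsilon> / 2"
    proof (rule mean_grid_approx[OF cont])
      fix x y assume xy: "x \<in> cube {1..s}" "y \<in> cube {1..s}" "\<forall>i\<in>{1..s}. \<bar>x i - y i\<bar> \<le> mesh L"
      have "\<forall>i\<in>{1..s}. \<bar>x i - y i\<bar> \<le> \<delta>"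
      proof
        fix i assume i: "i \<in> {1..s}"
        show "\<bar>x i - y i\<bar> \<le> \<delta>" using bspec[OF xy(3) i] mL by linarith
      qed
      with \<delta>(2) xy(1,2) have "dist (f x) (f y) < \<epsilon> / 2" by blast
      then show "norm (f x - f y) \<le> \<epsilon> / 2" by (simp only: dist_norm less_imp_le)
    qed
    then show ?case using \<epsilon> by (simp add: dist_norm)
  qed
qed

lemma estimator_eq: "estimator b s d m A f \<pi> = (\<Sum>i<b ^ m. f (point_map (net_point b m A i) \<pi>)) /\<^sub>R real (b ^ m)"
  by (simp only: estimator_def point_map_def)

text \<open>Dominated convergence as L grows, with f bounded on the cube, transfers the bound from
  the grid to the point set; then the slack e tends to 0.\<close>

theorem smooth_variance:
  fixes f :: "(nat \<Rightarrow> real) \<Rightarrow> 'k::{real_normed_field,euclidean_space}"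
  assumes f: "smooth_on_cube s f" and \<alpha>: "1 \<le> \<alpha>" and net: "digital_net b t m (d * s) A"
  shows "(\<integral>\<pi>. squared_error b s d m A f \<pi> \<partial>P) \<le>
    variance_const * (real (m - t + 2) ^ (d * s - 1) / real b ^ ((2 * min \<alpha> d + 1) * (m - t))) * (smooth_sobolev_norm s \<alpha> f)\<^sup>2"
proof -
  let ?W = "variance_const * (real (m - t + 2) ^ (d * s - 1) / real b ^ ((2 * min \<alpha> d + 1) * (m - t)))"
  let ?N = "(smooth_sobolev_norm s \<alpha> f)\<^sup>2"
  define z where "z = (\<lambda>i j. base_digit b (net_point b m A i j))"
  define E where "E L \<pi> = (norm ((\<Sum>i<b ^ m. f (gp L (scrambled (z i) \<pi>))) /\<^sub>R real (b ^ m) - mean L (\<lambda>\<xi>. f (gp L \<xi>))))\<^sup>2" for L \<pi>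
  have zl: "z i j a < b" for i j a unfolding z_def by (rule base_digit_less[OF b_pos])
  have cont: "continuous_on (cube {1..s}) f" by (rule smooth_continuous[OF f])
  obtain B where B: "\<And>x. x \<in> cube {1..s} \<Longrightarrow> norm (f x) \<le> B" using continuous_cube_bounded[OF cont] by blast
  have N0: "0 < b ^ m" using b_pos by simp
  have meas: "(\<lambda>\<pi>. f (gp L (scrambled (z i) \<pi>))) \<in> borel_measurable P" for L i
    by (rule borel_measurable_integrable, rule integrable_scrambled[where z = "z i" and Q = "digits L", OF zl finite_digits _ depends_on_grid[OF b_gt_1 d_pos]]) auto
  have fm: "f \<in> borel_measurable (cube_measure {1..s})" by (rule continuous_cube_measurable[OF cont])
  have pm: "(\<lambda>\<pi>. f (point_map x \<pi>)) \<in> borel_measurable P" for x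
    by (rule measurable_compose[OF point_map_measurable fm])
  have lim: "(\<lambda>L. \<integral>\<pi>. E L \<pi> \<partial>P) \<longlonglongrightarrow> (\<integral>\<pi>. squared_error b s d m A f \<pi> \<partial>P)"
  proof (rule integral_dominated_convergence)
    show "squared_error b s d m A f \<in> borel_measurable P"
      unfolding squared_error_def[abs_def] estimator_eq
      using pm[measurable] by measurable
    show "E L \<in> borel_measurable P" for L
      unfolding E_def[abs_def]
      using meas[measurable] by measurable
    show "integrable P (\<lambda>_. (B + B)\<^sup>2)" by simp
    have "AE \<pi> in P. \<forall>i\<in>{..<b ^ m}. (\<lambda>L. f (gp L (scrambled (z i) \<pi>))) \<longlonglongrightarrow> f (point_map (net_point b m A i) \<pi>)"
      by (subst AE_finite_all[OF finite_lessThan], rule ballI, unfold z_def, rule grid_tendsto_point_map[OF cont])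
    then show "AE \<pi> in P. (\<lambda>L. E L \<pi>) \<longlonglongrightarrow> squared_error b s d m A f \<pi>"
    proof (rule AE_mp, intro AE_I2 impI)
      fix \<pi> assume "\<forall>i\<in>{..<b ^ m}. (\<lambda>L. f (gp L (scrambled (z i) \<pi>))) \<longlonglongrightarrow> f (point_map (net_point b m A i) \<pi>)"
      then have conv: "(\<lambda>L. f (gp L (scrambled (z i) \<pi>))) \<longlonglongrightarrow> f (point_map (net_point b m A i) \<pi>)" if "i \<in> {..<b ^ m}" for i
        using that by blast
      show "(\<lambda>L. E L \<pi>) \<longlonglongrightarrow> squared_error b s d m A f \<pi>"
        unfolding E_def squared_error_def estimator_eq cube_integral_def
        by (intro tendsto_power tendsto_norm tendsto_diff tendsto_scaleR tendsto_const tendsto_sum conv mean_grid_tendsto[OF cont])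
    qed
    show "AE \<pi> in P. norm (E L \<pi>) \<le> (B + B)\<^sup>2" for L
    proof (rule AE_I2)
      fix \<pi> assume \<pi>: "\<pi> \<in> space P"
      have "norm (f (gp L (scrambled (z i) \<pi>))) \<le> B" for i
      proof (rule B, rule grid_cube)
        fix q assume "q \<in> digits L"
        then show "scrambled (z i) \<pi> q < b"
          by (intro scrambled_less[where z = "z i", OF zl \<pi>]) auto
      qed
      then have 1: "norm ((\<Sum>i<b ^ m. f (gp L (scrambled (z i) \<pi>))) /\<^sub>R real (b ^ m)) \<le> B"
        by (rule norm_average_le[OF N0])
      have 2: "norm (mean L (\<lambda>\<xi>. f (gp L \<xi>))) \<le> B"
      proof (rule norm_array_mean_le[OF finite_digits b_pos])
        fix \<xi> assume \<xi>: "\<xi> \<in> arrays b (digits L)"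
        show "norm (f (gp L \<xi>)) \<le> B"
          by (rule B, rule grid_cube) (use PiE_mem[OF \<xi>] in simp)
      qed
      have "norm ((\<Sum>i<b ^ m. f (gp L (scrambled (z i) \<pi>))) /\<^sub>R real (b ^ m) - mean L (\<lambda>\<xi>. f (gp L \<xi>))) \<le> B + B"
        using norm_triangle_ineq4 1 2 by (rule order_trans[OF _ add_mono])
      then have "E L \<pi> \<le> (B + B)\<^sup>2" unfolding E_def by (rule power_mono) simp
      moreover have "0 \<le> E L \<pi>" by (simp add: E_def)
      ultimately show "norm (E L \<pi>) \<le> (B + B)\<^sup>2" by simp
    qed
  qed
  have bound: "(\<integral>\<pi>. squared_error b s d m A f \<pi> \<partial>P) \<le> ?W * (?N + e)" if e: "0 < e" for e
  proof (rule tendsto_upperbound[OF lim])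
    show "\<forall>\<^sub>F L in sequentially. (\<integral>\<pi>. E L \<pi> \<partial>P) \<le> ?W * (?N + e)"
      unfolding E_def z_def by (rule grid_variance[OF f \<alpha> e net])
  qed simp
  have "((\<lambda>e. ?W * (?N + e)) \<longlongrightarrow> ?W * (?N + 0)) (at_right 0)"
    by (intro tendsto_intros)
  moreover have "\<forall>\<^sub>F e in at_right 0. (\<integral>\<pi>. squared_error b s d m A f \<pi> \<partial>P) \<le> ?W * (?N + e)"
    unfolding eventually_at_right_field using bound by (intro exI[of _ 1]) simp
  ultimately have "(\<integral>\<pi>. squared_error b s d m A f \<pi> \<partial>P) \<le> ?W * (?N + 0)"
    by (rule tendsto_lowerbound) simp
  then show ?thesis by simp
qed

end

section \<open>Integrands in the Sobolev space\<close>

lemma square_integrable_integrable: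
  fixes g :: "(nat \<Rightarrow> real) \<Rightarrow> 'k::{real_normed_field,euclidean_space}"
  assumes "square_integrable s g"
  shows "integrable (cube_measure {1..s}) g"
    and "(norm (cube_integral s g))\<^sup>2 \<le> (\<integral>x. (norm (g x))\<^sup>2 \<partial>cube_measure {1..s})"
proof -
  interpret prob_space "cube_measure {1..s}" by (rule prob_space_cube_measure)
  have g: "g \<in> borel_measurable (cube_measure {1..s})" and g2: "integrable (cube_measure {1..s}) (\<lambda>x. (norm (g x))\<^sup>2)"
    using assms by (simp_all add: square_integrable_def)
  have ng: "integrable (cube_measure {1..s}) (\<lambda>x. norm (g x))"
    by (rule square_integrable_imp_integrable[OF measurable_compose[OF g borel_measurable_norm] g2])
  then show ig: "integrable (cube_measure {1..s}) g" by (rule integrable_norm_cancel[OF _ g])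
  have "(norm (cube_integral s g))\<^sup>2 \<le> (\<integral>x. norm (g x) \<partial>cube_measure {1..s})\<^sup>2"
    unfolding cube_integral_def by (intro power_mono integral_norm_bound) simp
  also have "\<dots> \<le> (\<integral>x. (norm (g x))\<^sup>2 \<partial>cube_measure {1..s})"
    using variance_positive[of "\<lambda>x. norm (g x)"] unfolding variance_eq[OF ng g2] by simp
  finally show "(norm (cube_integral s g))\<^sup>2 \<le> (\<integral>x. (norm (g x))\<^sup>2 \<partial>cube_measure {1..s})" .
qed

lemma square_integrable_diff:
  fixes f g :: "(nat \<Rightarrow> real) \<Rightarrow> 'k::{real_normed_field,euclidean_space}"
  assumes "square_integrable s f" "square_integrable s g"
  shows "square_integrable s (\<lambda>x. f x - g x)"
proof -
  have f: "f \<in> borel_measurable (cube_measure {1..s})" "integrable (cube_measure {1..s}) (\<lambda>x. (norm (f x))\<^sup>2)"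
    and g: "g \<in> borel_measurable (cube_measure {1..s})" "integrable (cube_measure {1..s}) (\<lambda>x. (norm (g x))\<^sup>2)"
    using assms by (simp_all add: square_integrable_def)
  have fg: "(\<lambda>x. f x - g x) \<in> borel_measurable (cube_measure {1..s})" by (rule borel_measurable_diff[OF f(1) g(1)])
  have "integrable (cube_measure {1..s}) (\<lambda>x. (norm (f x - g x))\<^sup>2)"
  proof (rule Bochner_Integration.integrable_bound)
    show "integrable (cube_measure {1..s}) (\<lambda>x. 2 * (norm (f x))\<^sup>2 + 2 * (norm (g x))\<^sup>2)"
      by (intro Bochner_Integration.integrable_add integrable_mult_right f g)
    show "(\<lambda>x. (norm (f x - g x))\<^sup>2) \<in> borel_measurable (cube_measure {1..s})"
      using fg[measurable] by measurable
    show "AE x in cube_measure {1..s}. norm ((norm (f x - g x))\<^sup>2) \<le> norm (2 * (norm (f x))\<^sup>2 + 2 * (norm (g x))\<^sup>2)"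
    proof (rule AE_I2)
      fix x
      show "norm ((norm (f x - g x))\<^sup>2) \<le> norm (2 * (norm (f x))\<^sup>2 + 2 * (norm (g x))\<^sup>2)"
        using square_add_le[of 1 "f x" "- g x"] by simp
    qed
  qed
  with fg show ?thesis by (simp add: square_integrable_def)
qed

lemma smooth_square_integrable:
  fixes f :: "(nat \<Rightarrow> real) \<Rightarrow> 'k::{real_normed_field,euclidean_space}"
  assumes "smooth_on_cube s f"
  shows "square_integrable s f"
  unfolding square_integrable_def
  by (intro conjI continuous_cube_measurable continuous_cube_integrable continuous_intros smooth_continuous[OF assms])

text \<open>The sequence selected in the definition of the norm serves as F. Its norms form a real
  Cauchy sequence by the triangle inequality, so the limit in the definition exists.\<close>

lemma sobolev_norm_tendsto:
  fixes f :: "(nat \<Rightarrow> real) \<Rightarrow> 'k::{real_normed_field,euclidean_space}"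
  assumes "f \<in> sobolev_space s \<alpha>"
  obtains F where "represents s \<alpha> F f" "(\<lambda>k. smooth_sobolev_norm s \<alpha> (F k)) \<longlonglongrightarrow> sobolev_norm s \<alpha> f"
proof -
  define F where "F = (SOME F. represents s \<alpha> F f)"
  have "\<exists>F. represents s \<alpha> F f" using assms by (simp add: sobolev_space_def)
  then have F: "represents s \<alpha> F f" unfolding F_def by (rule someI_ex)
  then have smooth: "\<And>k. smooth_on_cube s (F k)"
    and cau: "\<forall>e>0. \<exists>K. \<forall>k\<ge>K. \<forall>l\<ge>K. smooth_sobolev_norm s \<alpha> (\<lambda>x. F k x - F l x) < e"
    by (simp_all add: represents_def)
  have "Cauchy (\<lambda>k. smooth_sobolev_norm s \<alpha> (F k))"
  proof (rule CauchyI)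
    fix e :: real assume "0 < e"
    with cau obtain K where K: "\<forall>k\<ge>K. \<forall>l\<ge>K. smooth_sobolev_norm s \<alpha> (\<lambda>x. F k x - F l x) < e" by blast
    have "norm (smooth_sobolev_norm s \<alpha> (F k) - smooth_sobolev_norm s \<alpha> (F l)) < e" if "K \<le> k" "K \<le> l" for k l
    proof -
      have "smooth_sobolev_norm s \<alpha> (\<lambda>x. F k x - F l x) < e" "smooth_sobolev_norm s \<alpha> (\<lambda>x. F l x - F k x) < e"
        using K that by blast+
      with smooth_sobolev_norm_triangle[OF smooth smooth, of \<alpha> k l] smooth_sobolev_norm_triangle[OF smooth smooth, of \<alpha> l k]
      show ?thesis unfolding real_norm_def by linarith
    qed
    then show "\<exists>K. \<forall>k\<ge>K. \<forall>l\<ge>K. norm (smooth_sobolev_norm s \<alpha> (F k) - smooth_sobolev_norm s \<alpha> (F l)) < e" by blast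
  qed
  then have "convergent (\<lambda>k. smooth_sobolev_norm s \<alpha> (F k))" by (simp only: real_Cauchy_convergent)
  then have "(\<lambda>k. smooth_sobolev_norm s \<alpha> (F k)) \<longlonglongrightarrow> sobolev_norm s \<alpha> f"
    unfolding sobolev_norm_def F_def[symmetric] by (simp only: convergent_LIMSEQ_iff)
  with F show ?thesis by (rule that)
qed

context scrambling_interlaced
begin

lemma squared_error_measurable:
  fixes g :: "(nat \<Rightarrow> real) \<Rightarrow> 'k::{real_normed_field,euclidean_space}"
  assumes "square_integrable s g"
  shows "squared_error b s d m A g \<in> borel_measurable P"
proof -
  have "(\<lambda>\<pi>. g (point_map x \<pi>)) \<in> borel_measurable P" for x
    by (rule measurable_compose[OF point_map_measurable]) (use assms in \<open>simp add: square_integrable_def\<close>)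
  note this[measurable]
  show ?thesis unfolding squared_error_def[abs_def] estimator_eq by measurable
qed

text \<open>Each single point is uniformly distributed, so the mean square of the estimator is at
  most that of g, whatever the dependence between the points. This crude bound has no rate but
  controls the error of an L2 approximation.\<close>

lemma squared_error_L2:
  fixes g :: "(nat \<Rightarrow> real) \<Rightarrow> 'k::{real_normed_field,euclidean_space}"
  assumes g: "square_integrable s g"
  shows "integrable P (squared_error b s d m A g)"
    and "(\<integral>\<pi>. squared_error b s d m A g \<pi> \<partial>P) \<le> 4 * (\<integral>x. (norm (g x))\<^sup>2 \<partial>cube_measure {1..s})"
proof -
  let ?N = "real (b ^ m)" and ?I = "\<integral>x. (norm (g x))\<^sup>2 \<partial>cube_measure {1..s}"
  let ?p = "\<lambda>i \<pi>. point_map (net_point b m A i) \<pi>"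
  have N0: "0 < ?N" using b_pos by simp
  have gm: "(\<lambda>x. (norm (g x))\<^sup>2) \<in> borel_measurable (cube_measure {1..s})"
    and gi: "integrable (cube_measure {1..s}) (\<lambda>x. (norm (g x))\<^sup>2)"
    using g by (auto simp: square_integrable_def)
  have int: "integrable P (\<lambda>\<pi>. (norm (g (point_map x \<pi>)))\<^sup>2)" for x
    by (rule integrable_distr[OF point_map_measurable[of x]]) (simp only: distr_point_map gi)
  have eq: "(\<integral>\<pi>. (norm (g (point_map x \<pi>)))\<^sup>2 \<partial>P) = ?I" for x
    using integral_distr[OF point_map_measurable[of x] gm] unfolding distr_point_map by (rule sym)
  let ?R = "\<lambda>\<pi>. 2 * (1 / ?N * (\<Sum>i<b ^ m. (norm (g (?p i \<pi>)))\<^sup>2)) + 2 * ?I"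
  have iR: "integrable P ?R"
    by (intro Bochner_Integration.integrable_add integrable_mult_right Bochner_Integration.integrable_sum int P.integrable_const)
  have le: "squared_error b s d m A g \<pi> \<le> ?R \<pi>" for \<pi>
  proof -
    have "(norm (estimator b s d m A g \<pi>))\<^sup>2 \<le> 1 / ?N * (\<Sum>i<b ^ m. (norm (g (?p i \<pi>)))\<^sup>2)"
    proof -
      have "(norm (\<Sum>i<b ^ m. g (?p i \<pi>)))\<^sup>2 \<le> (\<Sum>i<b ^ m. norm (g (?p i \<pi>)) * 1)\<^sup>2"
        using norm_sum[of "\<lambda>i. g (?p i \<pi>)" "{..<b ^ m}"] by (intro power_mono) simp_all
      also have "\<dots> \<le> (\<Sum>i<b ^ m. (norm (g (?p i \<pi>)))\<^sup>2) * (\<Sum>i<b ^ m. 1\<^sup>2)" by (rule Cauchy_Schwarz_ineq_sum)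
      also have "(\<Sum>i<b ^ m. 1\<^sup>2) = ?N" by simp
      finally have le: "(norm (\<Sum>i<b ^ m. g (?p i \<pi>)))\<^sup>2 \<le> (\<Sum>i<b ^ m. (norm (g (?p i \<pi>)))\<^sup>2) * ?N" .
      have "(norm (estimator b s d m A g \<pi>))\<^sup>2 = (norm (\<Sum>i<b ^ m. g (?p i \<pi>)))\<^sup>2 / ?N\<^sup>2"
        unfolding estimator_eq by (simp add: power_mult_distrib divide_inverse power_inverse mult.commute)
      also have "\<dots> \<le> ((\<Sum>i<b ^ m. (norm (g (?p i \<pi>)))\<^sup>2) * ?N) / ?N\<^sup>2" by (rule divide_right_mono[OF le]) simp
      also have "\<dots> = 1 / ?N * (\<Sum>i<b ^ m. (norm (g (?p i \<pi>)))\<^sup>2)" using N0 by (simp add: power2_eq_square)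
      finally show ?thesis .
    qed
    moreover have "(norm (cube_integral s g))\<^sup>2 \<le> ?I" by (rule square_integrable_integrable(2)[OF g])
    moreover have "squared_error b s d m A g \<pi> \<le> 2 * (norm (estimator b s d m A g \<pi>))\<^sup>2 + 2 * (norm (cube_integral s g))\<^sup>2"
      using square_add_le[of 1 "estimator b s d m A g \<pi>" "- cube_integral s g"] unfolding squared_error_def by simp
    ultimately show ?thesis by linarith
  qed
  show int_se: "integrable P (squared_error b s d m A g)"
  proof (rule Bochner_Integration.integrable_bound[OF iR squared_error_measurable[OF g]], rule AE_I2)
    fix \<pi>
    have "0 \<le> squared_error b s d m A g \<pi>" by (simp add: squared_error_def)
    with le[of \<pi>] show "norm (squared_error b s d m A g \<pi>) \<le> norm (?R \<pi>)" unfolding real_norm_def by linarith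
  qed
  have "(\<integral>\<pi>. squared_error b s d m A g \<pi> \<partial>P) \<le> (\<integral>\<pi>. ?R \<pi> \<partial>P)"
    by (rule integral_mono[OF int_se iR le])
  also have "\<dots> = 2 * (1 / ?N * (\<Sum>i<b ^ m. ?I)) + 2 * ?I"
    using int by (simp add: eq P.prob_space)
  also have "\<dots> = 4 * ?I" using N0 by simp
  finally show "(\<integral>\<pi>. squared_error b s d m A g \<pi> \<partial>P) \<le> 4 * ?I" .
qed

lemma squared_error_split_le:
  fixes f g :: "(nat \<Rightarrow> real) \<Rightarrow> 'k::{real_normed_field,euclidean_space}"
  assumes "square_integrable s f" "square_integrable s g" "0 < \<delta>"
  shows "squared_error b s d m A f \<pi> \<le>
    (1 + \<delta>) * squared_error b s d m A g \<pi> + (1 + 1 / \<delta>) * squared_error b s d m A (\<lambda>x. f x - g x) \<pi>"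
proof -
  have "cube_integral s (\<lambda>x. f x - g x) = cube_integral s f - cube_integral s g"
    unfolding cube_integral_def
    by (rule Bochner_Integration.integral_diff[OF square_integrable_integrable(1)[OF assms(1)] square_integrable_integrable(1)[OF assms(2)]])
  moreover have "estimator b s d m A (\<lambda>x. f x - g x) \<pi> = estimator b s d m A f \<pi> - estimator b s d m A g \<pi>"
    by (simp only: estimator_def sum_subtractf scaleR_diff_right)
  ultimately have "estimator b s d m A f \<pi> - cube_integral s f =
      (estimator b s d m A g \<pi> - cube_integral s g) + (estimator b s d m A (\<lambda>x. f x - g x) \<pi> - cube_integral s (\<lambda>x. f x - g x))"
    by simp
  then show ?thesis using square_add_le[OF assms(3)] unfolding squared_error_def by (simp only:)
qed

text \<open>The error of an approximation F_k obeys the bound for smooth functions, and that of f -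
  F_k tends to 0 in mean square. The weights 1 + \<delta> and 1 + 1/\<delta> allow k to tend to
  infinity first and \<delta> to 0 afterwards, so the constant does not grow.\<close>

theorem sobolev_variance:
  fixes f :: "(nat \<Rightarrow> real) \<Rightarrow> 'k::{real_normed_field,euclidean_space}"
  assumes f: "f \<in> sobolev_space s \<alpha>" and \<alpha>: "1 \<le> \<alpha>" and net: "digital_net b t m (d * s) A"
  shows "integrable P (squared_error b s d m A f)"
    and "(\<integral>\<pi>. squared_error b s d m A f \<pi> \<partial>P) \<le>
      variance_const * (real (m - t + 2) ^ (d * s - 1) / real b ^ ((2 * min \<alpha> d + 1) * (m - t))) * (sobolev_norm s \<alpha> f)\<^sup>2"
    and "0 \<le> sobolev_norm s \<alpha> f"
proof -
  let ?W = "variance_const * (real (m - t + 2) ^ (d * s - 1) / real b ^ ((2 * min \<alpha> d + 1) * (m - t)))"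
  obtain F where F: "represents s \<alpha> F f" and lim: "(\<lambda>k. smooth_sobolev_norm s \<alpha> (F k)) \<longlonglongrightarrow> sobolev_norm s \<alpha> f"
    by (rule sobolev_norm_tendsto[OF f])
  have smooth: "smooth_on_cube s (F k)" for k using F by (simp add: represents_def)
  have sf: "square_integrable s f" and L2: "(\<lambda>k. \<integral>x. (norm (F k x - f x))\<^sup>2 \<partial>cube_measure {1..s}) \<longlonglongrightarrow> 0"
    using F by (simp_all add: represents_def)
  have sF: "square_integrable s (F k)" for k by (rule smooth_square_integrable[OF smooth])
  have sD: "square_integrable s (\<lambda>x. f x - F k x)" for k by (rule square_integrable_diff[OF sf sF])
  show int: "integrable P (squared_error b s d m A f)" by (rule squared_error_L2(1)[OF sf])
  show "0 \<le> sobolev_norm s \<alpha> f"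
    by (rule LIMSEQ_le_const[OF lim]) (use smooth_sobolev_norm_nonneg in blast)
  let ?E = "\<integral>\<pi>. squared_error b s d m A f \<pi> \<partial>P"
  have bound: "?E \<le> (1 + \<delta>) * (?W * (sobolev_norm s \<alpha> f)\<^sup>2)" if \<delta>: "0 < \<delta>" for \<delta> :: real
  proof -
    have "(\<lambda>k. (1 + \<delta>) * (?W * (smooth_sobolev_norm s \<alpha> (F k))\<^sup>2) + (1 + 1 / \<delta>) * (4 * (\<integral>x. (norm (F k x - f x))\<^sup>2 \<partial>cube_measure {1..s})))
        \<longlonglongrightarrow> (1 + \<delta>) * (?W * (sobolev_norm s \<alpha> f)\<^sup>2) + (1 + 1 / \<delta>) * (4 * 0)"
      by (intro tendsto_add tendsto_mult tendsto_const tendsto_power lim L2)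
    then have "?E \<le> (1 + \<delta>) * (?W * (sobolev_norm s \<alpha> f)\<^sup>2) + (1 + 1 / \<delta>) * (4 * 0)"
    proof (rule LIMSEQ_le_const, intro exI[of _ 0] allI impI)
      fix k
      have iF: "integrable P (squared_error b s d m A (F k))" and iD: "integrable P (squared_error b s d m A (\<lambda>x. f x - F k x))"
        by (rule squared_error_L2(1)[OF sF], rule squared_error_L2(1)[OF sD])
      have "?E \<le> (\<integral>\<pi>. (1 + \<delta>) * squared_error b s d m A (F k) \<pi> + (1 + 1 / \<delta>) * squared_error b s d m A (\<lambda>x. f x - F k x) \<pi> \<partial>P)"
      proof (rule integral_mono[OF int])
        show "integrable P (\<lambda>\<pi>. (1 + \<delta>) * squared_error b s d m A (F k) \<pi> + (1 + 1 / \<delta>) * squared_error b s d m A (\<lambda>x. f x - F k x) \<pi>)"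
          by (intro Bochner_Integration.integrable_add integrable_mult_right iF iD)
      qed (rule squared_error_split_le[OF sf sF \<delta>])
      also have "\<dots> = (1 + \<delta>) * (\<integral>\<pi>. squared_error b s d m A (F k) \<pi> \<partial>P) + (1 + 1 / \<delta>) * (\<integral>\<pi>. squared_error b s d m A (\<lambda>x. f x - F k x) \<pi> \<partial>P)"
        using iF iD by simp
      also have "\<dots> \<le> (1 + \<delta>) * (?W * (smooth_sobolev_norm s \<alpha> (F k))\<^sup>2) + (1 + 1 / \<delta>) * (4 * (\<integral>x. (norm (F k x - f x))\<^sup>2 \<partial>cube_measure {1..s}))"
      proof (rule add_mono; rule mult_left_mono)
        show "(\<integral>\<pi>. squared_error b s d m A (F k) \<pi> \<partial>P) \<le> ?W * (smooth_sobolev_norm s \<alpha> (F k))\<^sup>2"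
          by (rule smooth_variance[OF smooth \<alpha> net])
        show "(\<integral>\<pi>. squared_error b s d m A (\<lambda>x. f x - F k x) \<pi> \<partial>P) \<le> 4 * (\<integral>x. (norm (F k x - f x))\<^sup>2 \<partial>cube_measure {1..s})"
          using squared_error_L2(2)[OF sD] by (simp only: norm_minus_commute)
      qed (use \<delta> in simp_all)
      finally show "?E \<le> (1 + \<delta>) * (?W * (smooth_sobolev_norm s \<alpha> (F k))\<^sup>2) + (1 + 1 / \<delta>) * (4 * (\<integral>x. (norm (F k x - f x))\<^sup>2 \<partial>cube_measure {1..s}))" .
    qed
    then show ?thesis by simp
  qed
  have "((\<lambda>\<delta>. (1 + \<delta>) * (?W * (sobolev_norm s \<alpha> f)\<^sup>2)) \<longlongrightarrow> (1 + 0) * (?W * (sobolev_norm s \<alpha> f)\<^sup>2)) (at_right 0)"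
    by (intro tendsto_intros)
  moreover have "\<forall>\<^sub>F \<delta> in at_right 0. ?E \<le> (1 + \<delta>) * (?W * (sobolev_norm s \<alpha> f)\<^sup>2)"
    unfolding eventually_at_right_field using bound by (intro exI[of _ 1]) simp
  ultimately have "?E \<le> (1 + 0) * (?W * (sobolev_norm s \<alpha> f)\<^sup>2)"
    by (rule tendsto_lowerbound) simp
  then show "?E \<le> ?W * (sobolev_norm s \<alpha> f)\<^sup>2" by simp
qed

lemma variance_const_pos: "0 < variance_const"
  unfolding variance_const_def using b_pos by simp

theorem rmse_le:
  fixes f :: "(nat \<Rightarrow> real) \<Rightarrow> 'k::{real_normed_field,euclidean_space}"
  assumes f: "f \<in> sobolev_space s \<alpha>" and \<alpha>: "1 \<le> \<alpha>" and net: "digital_net b t m (d * s) A"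
  shows "rmse b s d m A f \<le> variance_const powr (1/2) * sobolev_norm s \<alpha> f *
    real b powr (- (real (min \<alpha> d) + 1/2) * real (m - t)) * real (m - t + 2) powr ((real (d * s) - 1) / 2)"
proof -
  let ?M = "m - t" and ?r = "min \<alpha> d" and ?n = "d * s"
  have "1 \<le> ?n" using d_pos s_pos by simp
  then have n: "real (?n - 1) = real ?n - 1" by (simp add: of_nat_diff)
  have half: "sqrt (x ^ k) = x powr (real k / 2)" if "0 < x" for x :: real and k
  proof -
    have "sqrt (x ^ k) = (x powr real k) powr (1/2)" using that by (simp add: powr_half_sqrt powr_realpow)
    then show ?thesis by (simp add: powr_powr)
  qed
  have "rmse b s d m A f \<le> sqrt (variance_const * (real (?M + 2) ^ (?n - 1) / real b ^ ((2 * ?r + 1) * ?M)) * (sobolev_norm s \<alpha> f)\<^sup>2)"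
    unfolding rmse_def by (rule real_sqrt_le_mono[OF sobolev_variance(2)[OF f \<alpha> net]])
  also have "\<dots> = sqrt variance_const * (sqrt (real (?M + 2) ^ (?n - 1)) / sqrt (real b ^ ((2 * ?r + 1) * ?M))) * sobolev_norm s \<alpha> f"
    using sobolev_variance(3)[OF f \<alpha> net] by (simp add: real_sqrt_mult real_sqrt_divide)
  also have "sqrt (real (?M + 2) ^ (?n - 1)) = real (?M + 2) powr ((real ?n - 1) / 2)"
    unfolding n[symmetric] by (rule half) simp
  also have "sqrt (real b ^ ((2 * ?r + 1) * ?M)) = real b powr ((real ?r + 1/2) * real ?M)"
  proof -
    have e: "real ((2 * ?r + 1) * ?M) / 2 = (real ?r + 1/2) * real ?M" by (simp only: of_nat_mult of_nat_add of_nat_1 of_nat_numeral) (simp add: field_simps)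
    show ?thesis unfolding e[symmetric] by (rule half) (use b_pos in simp)
  qed
  also have "sqrt variance_const = variance_const powr (1/2)" using variance_const_pos by (simp add: powr_half_sqrt)
  finally have *: "rmse b s d m A f \<le> variance_const powr (1/2) *
    (real (?M + 2) powr ((real ?n - 1) / 2) / real b powr ((real ?r + 1/2) * real ?M)) * sobolev_norm s \<alpha> f" .
  have "real b powr (- (real ?r + 1/2) * real ?M) = inverse (real b powr ((real ?r + 1/2) * real ?M))"
    by (simp only: mult_minus_left powr_minus)
  with * show ?thesis by (simp only: divide_inverse mult_ac)
qed

end

section \<open>Asymptotic rates\<close>

lemma ln_powr_le_powr:
  fixes x p \<epsilon> :: real
  assumes "1 \<le> x" "0 \<le> p" "0 < \<epsilon>"
  shows "ln x powr p \<le> (1 / (\<epsilon> / (p + 1))) powr p * x powr \<epsilon>"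
proof -
  \<comment> \<open>The denominator p + 1 makes the exponent well defined for p = 0 as well and
    still gives \<open>?a * p \<le> \<epsilon>\<close>.\<close>
  let ?a = "\<epsilon> / (p + 1)"
  have a: "0 < ?a" using assms by simp
  have "ln x powr p \<le> (x powr ?a / ?a) powr p"
    by (rule powr_mono2[OF assms(2) _ ln_powr_bound[OF assms(1) a]]) (use assms(1) in simp)
  also have "\<dots> = (1 / ?a) powr p * x powr (?a * p)"
    using a assms(1) powr_mult[of "x powr ?a" "1 / ?a" p] by (simp add: powr_powr)
  also have "\<dots> \<le> (1 / ?a) powr p * x powr \<epsilon>"
  proof (intro mult_left_mono powr_mono)
    show "?a * p \<le> \<epsilon>" using assms(2,3) by (simp add: pos_divide_le_eq)
  qed (use assms(1) in simp_all)
  finally show ?thesis .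
qed

text \<open>With t fixed, b^((\<rho> + 1/2) t) is a constant, and m - t + 2 \<le> 3 m = (3 / ln b)
  ln N turns the polynomial factor into a power of the logarithm. The second rate follows as that
  power is dominated by N^\<epsilon>.\<close>

lemma rate_asymptotics:
  fixes R :: "nat \<Rightarrow> real" and m :: "nat \<Rightarrow> nat" and \<rho> p c :: real
  assumes b: "1 < b" and p: "0 \<le> p" and c: "0 \<le> c" and m: "\<And>i. 1 \<le> m i" "\<And>i. t \<le> m i"
    and R: "\<And>i. 0 \<le> R i" "\<And>i. R i \<le> c * real b powr (- (\<rho> + 1/2) * real (m i - t)) * real (m i - t + 2) powr p"
  shows "R \<in> O(\<lambda>i. real (b ^ m i) powr (- \<rho> - 1/2) * ln (real (b ^ m i)) powr p)"
    and "0 < \<epsilon> \<Longrightarrow> R \<in> O(\<lambda>i. real (b ^ m i) powr (- \<rho> - 1/2 + \<epsilon>))"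
proof -
  let ?N = "\<lambda>i. real (b ^ m i)"
  let ?K = "c * real b powr ((\<rho> + 1/2) * real t) * (3 / ln (real b)) powr p"
  have lnb: "0 < ln (real b)" using b by simp
  have N1: "1 \<le> ?N i" for i using b by (simp add: one_le_power)
  have le: "R i \<le> ?K * (?N i powr (- \<rho> - 1/2) * ln (?N i) powr p)" for i
  proof -
    have "- (\<rho> + 1/2) * real (m i - t) = (\<rho> + 1/2) * real t + real (m i) * (- \<rho> - 1/2)"
      using m(2)[of i] by (simp add: of_nat_diff algebra_simps)
    then have "real b powr (- (\<rho> + 1/2) * real (m i - t)) = real b powr ((\<rho> + 1/2) * real t) * real b powr (real (m i) * (- \<rho> - 1/2))"
      by (simp only: powr_add)
    also have "real b powr (real (m i) * (- \<rho> - 1/2)) = ?N i powr (- \<rho> - 1/2)"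
      using b by (simp add: powr_powr[symmetric] powr_realpow)
    finally have 1: "real b powr (- (\<rho> + 1/2) * real (m i - t)) = real b powr ((\<rho> + 1/2) * real t) * ?N i powr (- \<rho> - 1/2)" .
    have lnN: "ln (?N i) = real (m i) * ln (real b)" using b by (simp add: ln_realpow)
    have "real (m i - t + 2) \<le> 3 * real (m i)" using m[of i] by simp
    also have "\<dots> = 3 / ln (real b) * ln (?N i)" unfolding lnN using lnb by simp
    finally have "real (m i - t + 2) powr p \<le> (3 / ln (real b) * ln (?N i)) powr p"
      by (intro powr_mono2[OF p]) simp_all
    also have "\<dots> = (3 / ln (real b)) powr p * ln (?N i) powr p"
      by (rule powr_mult)
    finally have 2: "real (m i - t + 2) powr p \<le> (3 / ln (real b)) powr p * ln (?N i) powr p" .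
    have "R i \<le> c * (real b powr ((\<rho> + 1/2) * real t) * ?N i powr (- \<rho> - 1/2)) * ((3 / ln (real b)) powr p * ln (?N i) powr p)"
      using R(2)[of i] unfolding 1 by (rule order_trans) (intro mult_left_mono[OF 2] mult_nonneg_nonneg c powr_ge_zero)
    then show ?thesis by (simp only: mult_ac)
  qed
  then have "norm (R i) \<le> ?K * norm (?N i powr (- \<rho> - 1/2) * ln (?N i) powr p)" for i
    using R(1)[of i] by simp
  then show "R \<in> O(\<lambda>i. ?N i powr (- \<rho> - 1/2) * ln (?N i) powr p)"
    by (intro bigoI[where c = ?K] always_eventually allI)
  show "R \<in> O(\<lambda>i. ?N i powr (- \<rho> - 1/2 + \<epsilon>))" if \<epsilon>: "0 < \<epsilon>"
  proof (rule bigoI[where c = "?K * (1 / (\<epsilon> / (p + 1))) powr p"], rule always_eventually, rule allI)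
    fix i
    have "R i \<le> ?K * (?N i powr (- \<rho> - 1/2) * ((1 / (\<epsilon> / (p + 1))) powr p * ?N i powr \<epsilon>))"
      using le[of i] by (rule order_trans) (intro mult_left_mono ln_powr_le_powr N1 p \<epsilon> mult_nonneg_nonneg c powr_ge_zero)
    also have "\<dots> = (?K * (1 / (\<epsilon> / (p + 1))) powr p) * ?N i powr (- \<rho> - 1/2 + \<epsilon>)"
      by (simp only: powr_add mult_ac)
    finally show "norm (R i) \<le> (?K * (1 / (\<epsilon> / (p + 1))) powr p) * norm (?N i powr (- \<rho> - 1/2 + \<epsilon>))"
      using R(1)[of i] by simp
  qed
qed

theorem corollary6p3:
  fixes b s d \<alpha> :: nat
  assumes "prime b" and "1 \<le> s" and "1 \<le> d" and "1 \<le> \<alpha>"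
  defines "\<rho> \<equiv> real (min \<alpha> d)"
  shows
    "(\<exists>C>0. \<forall>m t A. \<forall>f :: (nat \<Rightarrow> real) \<Rightarrow> 'k::{real_normed_field,euclidean_space}.
        1 \<le> m \<and> t \<le> m \<and> digital_net b t m (d * s) A \<and> f \<in> sobolev_space s \<alpha> \<longrightarrow>
        integrable (scrambling_measure b (d * s)) (squared_error b s d m A f) \<and>
        rmse b s d m A f \<le>
          C powr (1/2) * sobolev_norm s \<alpha> f * real b powr (- (\<rho> + 1/2) * real (m - t))
            * real (m - t + 2) powr ((real (d * s) - 1) / 2))
     \<and>
     (\<forall>t. \<forall>m :: nat \<Rightarrow> nat. \<forall>A. \<forall>f :: (nat \<Rightarrow> real) \<Rightarrow> 'k.
        f \<in> sobolev_space s \<alpha> \<and> filterlim m at_top sequentially \<and>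
        (\<forall>i. 1 \<le> m i \<and> t \<le> m i \<and> digital_net b t (m i) (d * s) (A i)) \<longrightarrow>
        (let N = (\<lambda>i. real (b ^ m i)); RMSE = (\<lambda>i. rmse b s d (m i) (A i) f) in
           RMSE \<in> O(\<lambda>i. N i powr (- \<rho> - 1/2) * ln (N i) powr ((real (d * s) - 1) / 2)) \<and>
           (\<forall>\<epsilon>>0. RMSE \<in> O(\<lambda>i. N i powr (- \<rho> - 1/2 + \<epsilon>))) \<and>
           (\<alpha> \<le> d \<longrightarrow> (\<forall>\<epsilon>>0. RMSE \<in> O(\<lambda>i. N i powr (- real \<alpha> - 1/2 + \<epsilon>))))))"
proof -
  have b: "1 < b" using assms(1) by (rule prime_gt_1_nat)
  interpret scrambling_interlaced b d s
    by unfold_locales (rule b assms)+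
  show ?thesis
  proof (intro conjI allI impI)
    show "\<exists>C>0. \<forall>m t A. \<forall>f :: (nat \<Rightarrow> real) \<Rightarrow> 'k.
        1 \<le> m \<and> t \<le> m \<and> digital_net b t m (d * s) A \<and> f \<in> sobolev_space s \<alpha> \<longrightarrow>
        integrable (scrambling_measure b (d * s)) (squared_error b s d m A f) \<and>
        rmse b s d m A f \<le>
          C powr (1/2) * sobolev_norm s \<alpha> f * real b powr (- (\<rho> + 1/2) * real (m - t))
            * real (m - t + 2) powr ((real (d * s) - 1) / 2)"
    \<comment> \<open>\<open>variance_const\<close> is built from b, d and s alone, so one constant
      serves all m, t, nets and integrands.\<close>
    proof (intro exI[of _ variance_const] conjI allI impI variance_const_pos; elim conjE)
      fix m t A and f :: "(nat \<Rightarrow> real) \<Rightarrow> 'k"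
      assume net: "digital_net b t m (d * s) A" and f: "f \<in> sobolev_space s \<alpha>"
      show "integrable P (squared_error b s d m A f)" by (rule sobolev_variance(1)[OF f assms(4) net])
      show "rmse b s d m A f \<le> variance_const powr (1/2) * sobolev_norm s \<alpha> f *
          real b powr (- (\<rho> + 1/2) * real (m - t)) * real (m - t + 2) powr ((real (d * s) - 1) / 2)"
        unfolding \<rho>_def by (rule rmse_le[OF f assms(4) net])
    qed
  next
    fix t and m :: "nat \<Rightarrow> nat" and A and f :: "(nat \<Rightarrow> real) \<Rightarrow> 'k"
    assume "f \<in> sobolev_space s \<alpha> \<and> filterlim m at_top sequentially \<and>
        (\<forall>i. 1 \<le> m i \<and> t \<le> m i \<and> digital_net b t (m i) (d * s) (A i))"
    then have f: "f \<in> sobolev_space s \<alpha>" and m: "\<And>i. 1 \<le> m i" "\<And>i. t \<le> m i"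
      and net: "\<And>i. digital_net b t (m i) (d * s) (A i)" by blast+
    let ?R = "\<lambda>i. rmse b s d (m i) (A i) f" and ?c = "variance_const powr (1/2) * sobolev_norm s \<alpha> f"
    have "1 \<le> d * s" using assms(2,3) by simp
    then have "1 \<le> real (d * s)" unfolding of_nat_1[where 'a = real, symmetric] of_nat_le_iff .
    then have p: "0 \<le> (real (d * s) - 1) / 2" by simp
    have c: "0 \<le> ?c" using sobolev_variance(3)[OF f assms(4) net[of 0]] by simp
    have R: "0 \<le> ?R i" for i
      unfolding rmse_def by (intro real_sqrt_ge_zero integral_nonneg) (simp add: squared_error_def)
    have R': "?R i \<le> ?c * real b powr (- (\<rho> + 1/2) * real (m i - t)) * real (m i - t + 2) powr ((real (d * s) - 1) / 2)" for i
      unfolding \<rho>_def by (rule rmse_le[OF f assms(4) net])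
    note as = rate_asymptotics[where R = ?R and m = m and t = t, OF b p c m R R']
    have \<rho>\<alpha>: "\<rho> = real \<alpha>" if "\<alpha> \<le> d" using that by (simp add: \<rho>_def)
    show "let N = (\<lambda>i. real (b ^ m i)); RMSE = ?R in
           RMSE \<in> O(\<lambda>i. N i powr (- \<rho> - 1/2) * ln (N i) powr ((real (d * s) - 1) / 2)) \<and>
           (\<forall>\<epsilon>>0. RMSE \<in> O(\<lambda>i. N i powr (- \<rho> - 1/2 + \<epsilon>))) \<and>
           (\<alpha> \<le> d \<longrightarrow> (\<forall>\<epsilon>>0. RMSE \<in> O(\<lambda>i. N i powr (- real \<alpha> - 1/2 + \<epsilon>))))"
      unfolding Let_def
    proof (intro conjI allI impI)
      show "?R \<in> O(\<lambda>i. real (b ^ m i) powr (- \<rho> - 1/2) * ln (real (b ^ m i)) powr ((real (d * s) - 1) / 2))" by (rule as(1))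
      show "?R \<in> O(\<lambda>i. real (b ^ m i) powr (- \<rho> - 1/2 + \<epsilon>))" if "0 < \<epsilon>" for \<epsilon> by (rule as(2)[OF that])
      show "?R \<in> O(\<lambda>i. real (b ^ m i) powr (- real \<alpha> - 1/2 + \<epsilon>))" if "\<alpha> \<le> d" "0 < \<epsilon>" for \<epsilon>
        using as(2)[OF that(2)] unfolding \<rho>\<alpha>[OF that(1)] .
    qed
  qed
qed

end
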